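(* Let $\alpha\in(1,2)$ and suppose the following three assumptions hold. (1) $A:\mathcal{D}(A)\subset H\to H$ is a self-adjoint operator with $Ae_k=-\lambda_k e_k$ for all $k\geq 1$, where $\{e_k\}_{k\ge1}\subset\mathcal{D}(A)$, $\lambda_k>0$ and $\lambda_k\uparrow\infty$ as $k\uparrow\infty$. (2) There is a constant $p\in[1,\alpha)$ such that $B:H\times\mathscr{P}_p\to H$, and there is $C>0$ such that for all $x,y\in H$ and $\mu,\nu\in\mathscr{P}_p$, $$|B(x,\mu)-B(y,\nu)|\leq C\left[|x-y|+\mathbb{W}_p(\mu,\nu)\right].$$ (3) $\sum_{k=1}^{\infty}\frac{\beta_k^{\alpha}}{\lambda_k}<\infty$. Then for any $H$-valued $\mathcal{F}_0$-measurable initial value $\xi$ with $\mathbb{E}|\xi|^p<\infty$, the equation $$dX_t=AX_t\,dt+B(X_t,\mathscr{L}_{X_t})\,dt+dL_t,\qquad X_0=\xi,$$ has a unique mild solution $\{X_t\}_{t\ge0}$. Furthermore, if $\mathbb{E}|\xi|^m<\infty$ for some $m\in[p,\alpha)$, then for any $T>0$ there exists a constant $C_{T,m}>0$ (not depending on $\xi$) such that $$\sup_{t\in[0,T]}\left(\mathbb{E}|X_t|^m\right)^{1/m}\leq C_{T,m}\left[1+\left(\mathbb{E}|\xi|^m\right)^{1/m}\right].$$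
   Context: $H$ is a Hilbert space with inner product $\langle\cdot,\cdot\rangle$, norm $|\cdot|$ and complete orthonormal basis $\{e_k\}_{k=1}^\infty$. $\mathscr{P}$ is the set of Borel probability measures on $H$; for $p\ge1$, $\mathscr{P}_p=\{\mu\in\mathscr{P}:\mu(|\cdot|^p):=\int_H|x|^p\mu(dx)<\infty\}$, with the Wasserstein distance $\mathbb{W}_p(\mu_1,\mu_2)=\inf_{\pi}\left[\int_{H\times H}|x-y|^p\pi(dx,dy)\right]^{1/p}$, the infimum being over all couplings $\pi$ of $\mu_1,\mu_2$. $\mathscr{L}_{X}$ denotes the law of a random variable $X$. $(\Omega,\mathcal{F},(\mathcal{F}_t)_{t\ge0},\mathbb{P})$ is a filtered probability space. $L_t=\sum_{k=1}^\infty\beta_kL^k_te_k$, $t\geq 0$, is a cylindrical $\alpha$-stable process: $\{\beta_k\}$ is a given sequence of positive numbers and $\{L^k_t\}_{t\ge0}$, $k\ge1$, are independent one-dimensional symmetric $\alpha$-stable processes, adapted to $(\mathcal{F}_t)$, with $\mathbb{E}[e^{iL^k_th}]=e^{-t|h|^\alpha}$ for $h\in\mathbb{R}$, $t\ge 0$. $(e^{tA})_{t\ge0}$ is the strongly continuous semigroup generated by $A$, and $\int_0^te^{(t-s)A}dL_s=\sum_k\beta_k\int_0^te^{-\lambda_k(t-s)}dL^k_s\,e_k$. A mild solution is a predictable $H$-valued process $\{X_t\}_{t\ge0}$ (with $\mathscr{L}_{X_t}\in\mathscr{P}_p$, so that $B(X_t,\mathscr{L}_{X_t})$ is defined) such that: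 (i) $X$ is $(\mathcal{F}_t)$-adapted; (ii) $\mathbb{P}\left(\int_0^t|e^{(t-s)A}B(X_s,\mathscr{L}_{X_s})|ds<\infty\right)=1$ for all $t\ge0$; (iii) for every $t\ge0$, $\mathbb{P}$-a.s., $$X_t=e^{tA}\xi+\int_0^te^{(t-s)A}B(X_s,\mathscr{L}_{X_s})ds+\int_0^te^{(t-s)A}dL_s.$$
   Formalization: Uniqueness and the moment bound are claimed among mild solutions that also satisfy ∫_0^t |B(X_s, L_{X_s})| ds < ∞ a.s. for every t; the solution shown to exist is one of these. With condition (ii) alone both fail, e.g. for λ_k=k², β_k=1, B(x,μ) the backward shift of x. *)

theory Defs
  imports "HOL-Probability.Probability"
begin

section \<open>Hilbert space, operators and semigroups\<close>

definition complete_orthonormal_basis :: "(nat \<Rightarrow> 'h::real_inner) \<Rightarrow> bool" where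
  "complete_orthonormal_basis e \<longleftrightarrow>
     (\<forall>i j. e i \<bullet> e j = (if i = j then 1 else 0)) \<and> closure (span (range e)) = UNIV"

text \<open>An unbounded operator is a pair of a domain \<open>D\<close> and a function \<open>A\<close> whose values outside
  \<open>D\<close> are irrelevant. The last conjunct is equality of the graphs of \<open>A\<close> and of its adjoint:
  \<open>y\<close> lies in the domain of the adjoint with value \<open>z\<close> there iff
  \<open>A x \<bullet> y = x \<bullet> z\<close> for all \<open>x \<in> D\<close>.\<close>

definition self_adjoint_operator :: "'h::real_inner set \<Rightarrow> ('h \<Rightarrow> 'h) \<Rightarrow> bool" where
  "self_adjoint_operator D A \<longleftrightarrow>
     subspace D \<and> closure D = UNIV \<and>
     (\<forall>x\<in>D. \<forall>y\<in>D. A (x + y) = A x + A y) \<and>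
     (\<forall>c. \<forall>x\<in>D. A (c *\<^sub>R x) = c *\<^sub>R A x) \<and>
     (\<forall>y z. (\<forall>x\<in>D. A x \<bullet> y = x \<bullet> z) \<longleftrightarrow> (y \<in> D \<and> A y = z))"

text \<open>Time is modelled by \<open>real\<close> throughout; only the values at \<open>t \<ge> 0\<close> matter.\<close>

definition C0_semigroup :: "(real \<Rightarrow> 'h::real_normed_vector \<Rightarrow> 'h) \<Rightarrow> bool" where
  "C0_semigroup S \<longleftrightarrow>
     (\<forall>t\<ge>0. bounded_linear (S t)) \<and>
     (\<forall>x. S 0 x = x) \<and>
     (\<forall>s\<ge>0. \<forall>t\<ge>0. \<forall>x. S (s + t) x = S s (S t x)) \<and>
     (\<forall>x. ((\<lambda>t. S t x) \<longlongrightarrow> x) (at_right 0))"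

definition generates_C0_semigroup ::
    "'h::real_normed_vector set \<Rightarrow> ('h \<Rightarrow> 'h) \<Rightarrow> (real \<Rightarrow> 'h \<Rightarrow> 'h) \<Rightarrow> bool" where
  "generates_C0_semigroup D A S \<longleftrightarrow>
     C0_semigroup S \<and>
     (\<forall>x y. (x \<in> D \<and> A x = y) \<longleftrightarrow>
            ((\<lambda>h. (1 / h) *\<^sub>R (S h x - x)) \<longlongrightarrow> y) (at_right 0))"

section \<open>Probability measures with finite moments and the Wasserstein distance\<close>

definition law :: "'w measure \<Rightarrow> ('w \<Rightarrow> 'h::topological_space) \<Rightarrow> 'h measure" where
  "law M X = distr M borel X"

definition borel_probs :: "'h::topological_space measure set" where
  "borel_probs = {\<mu>. prob_space \<mu> \<and> sets \<mu> = sets borel}"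

definition moment_probs :: "real \<Rightarrow> 'h::real_normed_vector measure set" where
  "moment_probs p = {\<mu> \<in> borel_probs. (\<integral>\<^sup>+ x. ennreal (norm x powr p) \<partial>\<mu>) < \<infinity>}"

definition couplings ::
    "'h::topological_space measure \<Rightarrow> 'h measure \<Rightarrow> ('h \<times> 'h) measure set" where
  "couplings \<mu> \<nu> =
     {\<pi>. prob_space \<pi> \<and> sets \<pi> = sets (borel \<Otimes>\<^sub>M borel) \<and>
         distr \<pi> borel fst = \<mu> \<and> distr \<pi> borel snd = \<nu>}"

text \<open>The infimum is finite, so that the conversion to a real number loses nothing, whenever
  both arguments have finite \<open>p\<close>-th moments.\<close>

definition wasserstein ::
    "real \<Rightarrow> 'h::real_normed_vector measure \<Rightarrow> 'h measure \<Rightarrow> real" where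
  "wasserstein p \<mu> \<nu> =
     enn2real (INF \<pi>\<in>couplings \<mu> \<nu>. \<integral>\<^sup>+ z. ennreal (norm (fst z - snd z) powr p) \<partial>\<pi>) powr (1 / p)"

section \<open>Filtrations and processes\<close>

definition time_filtration :: "'w measure \<Rightarrow> (real \<Rightarrow> 'w measure) \<Rightarrow> bool" where
  "time_filtration M F \<longleftrightarrow>
     (\<forall>t\<ge>0. subalgebra M (F t)) \<and> (\<forall>s\<ge>0. \<forall>t\<ge>s. sets (F s) \<subseteq> sets (F t))"

definition adapted_process ::
    "(real \<Rightarrow> 'w measure) \<Rightarrow> (real \<Rightarrow> 'w \<Rightarrow> 'h::topological_space) \<Rightarrow> bool" where
  "adapted_process F X \<longleftrightarrow> (\<forall>t\<ge>0. X t \<in> borel_measurable (F t))"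

definition predictable_algebra ::
    "'w measure \<Rightarrow> (real \<Rightarrow> 'w measure) \<Rightarrow> (real \<times> 'w) measure" where
  "predictable_algebra M F =
     sigma ({0..} \<times> space M)
       ({{0} \<times> E | E. E \<in> sets (F 0)} \<union>
        {{s<..t} \<times> E | s t E. 0 \<le> s \<and> s \<le> t \<and> E \<in> sets (F s)})"

definition predictable_process ::
    "'w measure \<Rightarrow> (real \<Rightarrow> 'w measure) \<Rightarrow> (real \<Rightarrow> 'w \<Rightarrow> 'h::topological_space) \<Rightarrow> bool" where
  "predictable_process M F X \<longleftrightarrow>
     (\<lambda>(t, \<omega>). X t \<omega>) \<in> borel_measurable (predictable_algebra M F)"

definition cadlag_path :: "(real \<Rightarrow> real) \<Rightarrow> bool" where
  "cadlag_path f \<longleftrightarrow>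
     (\<forall>t\<ge>0. (f \<longlongrightarrow> f t) (at_right t)) \<and> (\<forall>t>0. \<exists>l. (f \<longlongrightarrow> l) (at_left t))"

text \<open>A one-dimensional Levy process (almost surely cadlag) whose value at time \<open>t\<close> has
  characteristic function \<open>exp (- t \<bar>h\<bar>\<^sup>\<alpha>)\<close>. No independence from the filtration is imposed.\<close>

definition symmetric_stable_process ::
    "'w measure \<Rightarrow> real \<Rightarrow> (real \<Rightarrow> 'w \<Rightarrow> real) \<Rightarrow> bool" where
  "symmetric_stable_process M \<alpha> L \<longleftrightarrow>
     (\<forall>t\<ge>0. L t \<in> borel_measurable M) \<and>
     (AE \<omega> in M. L 0 \<omega> = 0) \<and>
     (AE \<omega> in M. cadlag_path (\<lambda>t. L t \<omega>)) \<and>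
     (\<forall>n (t::nat \<Rightarrow> real). 0 \<le> t 0 \<and> (\<forall>i<n. t i \<le> t (Suc i)) \<longrightarrow>
        prob_space.indep_vars M (\<lambda>_. borel) (\<lambda>i \<omega>. L (t (Suc i)) \<omega> - L (t i) \<omega>) {..<n}) \<and>
     (\<forall>s\<ge>0. \<forall>h\<ge>0. law M (\<lambda>\<omega>. L (s + h) \<omega> - L s \<omega>) = law M (L h)) \<and>
     (\<forall>t\<ge>0. \<forall>h. char (law M (L t)) h = complex_of_real (exp (- t * \<bar>h\<bar> powr \<alpha>)))"

text \<open>Independence of whole processes, i.e. of the random elements
  \<open>\<omega> \<mapsto> (L k t \<omega>)\<^sub>t\<close> of the path space over the time set \<open>{0..}\<close>.\<close>

definition independent_processes ::
    "'w measure \<Rightarrow> (nat \<Rightarrow> real \<Rightarrow> 'w \<Rightarrow> real) \<Rightarrow> bool" where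
  "independent_processes M L \<longleftrightarrow>
     prob_space.indep_vars M (\<lambda>_. Pi\<^sub>M {0..} (\<lambda>_. borel)) (\<lambda>k \<omega>. \<lambda>t\<in>{0..}. L k t \<omega>) UNIV"

section \<open>Stochastic integrals and the stochastic convolution\<close>

text \<open>\<open>I\<close> is a version of the integral of the deterministic function \<open>f\<close> over \<open>[0, t]\<close> against
  \<open>L\<close>: the limit in probability of the left-endpoint sums over partitions
  \<open>0 = \<tau> 0 \<le> \<dots> \<le> \<tau> n = t\<close> as the mesh tends to 0.\<close>

definition has_stochastic_integral ::
    "'w measure \<Rightarrow> (real \<Rightarrow> real) \<Rightarrow> (real \<Rightarrow> 'w \<Rightarrow> real) \<Rightarrow> real \<Rightarrow> ('w \<Rightarrow> real) \<Rightarrow> bool" where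
  "has_stochastic_integral M f L t I \<longleftrightarrow>
     I \<in> borel_measurable M \<and>
     (\<forall>\<epsilon>>0. \<exists>\<delta>>0. \<forall>n (\<tau>::nat \<Rightarrow> real).
        \<tau> 0 = 0 \<and> \<tau> n = t \<and> (\<forall>i<n. \<tau> i \<le> \<tau> (Suc i) \<and> \<tau> (Suc i) - \<tau> i < \<delta>) \<longrightarrow>
        measure M {\<omega> \<in> space M.
          \<bar>(\<Sum>i<n. f (\<tau> i) * (L (\<tau> (Suc i)) \<omega> - L (\<tau> i) \<omega>)) - I \<omega>\<bar> \<ge> \<epsilon>} < \<epsilon>)"

text \<open>\<open>Z\<close> is a version of \<open>\<integral>\<^sub>0\<^sup>t e\<^bsup>(t-s)A\<^esup> dL\<^sub>s =
  \<Sum>\<^sub>k \<beta>\<^sub>k (\<integral>\<^sub>0\<^sup>t e\<^bsup>-\<lambda>\<^sub>k(t-s)\<^esup> dL\<^sup>k\<^sub>s) e\<^sub>k\<close>.\<close>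

definition is_stochastic_convolution ::
    "'w measure \<Rightarrow> (nat \<Rightarrow> 'h::real_normed_vector) \<Rightarrow> (nat \<Rightarrow> real) \<Rightarrow> (nat \<Rightarrow> real) \<Rightarrow>
     (nat \<Rightarrow> real \<Rightarrow> 'w \<Rightarrow> real) \<Rightarrow> real \<Rightarrow> ('w \<Rightarrow> 'h) \<Rightarrow> bool" where
  "is_stochastic_convolution M e lam bet L t Z \<longleftrightarrow>
     (\<exists>I. (\<forall>k. has_stochastic_integral M (\<lambda>s. exp (- lam k * (t - s))) (L k) t (I k)) \<and>
          (AE \<omega> in M. (\<lambda>k. (bet k * I k \<omega>) *\<^sub>R e k) sums Z \<omega>))"

section \<open>Mild solutions\<close>

definition mild_solution ::
    "'w measure \<Rightarrow> (real \<Rightarrow> 'w measure) \<Rightarrow> (nat \<Rightarrow> 'h) \<Rightarrow> (nat \<Rightarrow> real) \<Rightarrow> (nat \<Rightarrow> real) \<Rightarrow>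
     (nat \<Rightarrow> real \<Rightarrow> 'w \<Rightarrow> real) \<Rightarrow> (real \<Rightarrow> 'h \<Rightarrow> 'h) \<Rightarrow> real \<Rightarrow> ('h \<Rightarrow> 'h measure \<Rightarrow> 'h) \<Rightarrow>
     ('w \<Rightarrow> 'h) \<Rightarrow> (real \<Rightarrow> 'w \<Rightarrow> 'h::{real_inner,banach,second_countable_topology}) \<Rightarrow> bool" where
  "mild_solution M F e lam bet L S p B \<xi> X \<longleftrightarrow>
     predictable_process M F X \<and>
     adapted_process F X \<and>
     (\<forall>t\<ge>0. law M (X t) \<in> moment_probs p) \<and>
     (\<forall>t\<ge>0. AE \<omega> in M.
        set_integrable lborel {0..t} (\<lambda>s. S (t - s) (B (X s \<omega>) (law M (X s))))) \<and>
     (\<forall>t\<ge>0. \<exists>Z. is_stochastic_convolution M e lam bet L t Z \<and>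
        (AE \<omega> in M. X t \<omega> =
           S t (\<xi> \<omega>) + (LINT s:{0..t}|lborel. S (t - s) (B (X s \<omega>) (law M (X s)))) + Z \<omega>))"

text \<open>The condition of \<open>mild_solution\<close> on the integrability of the drift, without the smoothing
  factor \<open>S (t - s)\<close>. It holds in particular if the \<open>p\<close>-th moments of \<open>X\<close> are bounded on bounded
  time intervals. Uniqueness fails without a condition of this kind: the smoothing factor lets
  through solutions whose norm explodes as \<open>t\<close> decreases to 0, in the manner of Tychonoff's
  non-unique solutions of the heat equation. Example: \<open>lam k = k\<^sup>2\<close> for \<open>k \<ge> 1\<close> and \<open>B x \<mu> = K x\<close>
  with \<open>K\<close> the backward shift of the basis. For a suitable theta-type series \<open>g\<close>, flat at 0, the
  deterministic function with coordinates \<open>x\<^sub>1 = g\<close>, \<open>x\<^sub>k\<^sub>+\<^sub>1 = x\<^sub>k' + k\<^sup>2 x\<^sub>k\<close>, added to one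
  solution, gives another.\<close>

definition drift_locally_integrable ::
    "'w measure \<Rightarrow> ('h \<Rightarrow> 'h measure \<Rightarrow> 'h) \<Rightarrow>
     (real \<Rightarrow> 'w \<Rightarrow> 'h::{real_inner,banach,second_countable_topology}) \<Rightarrow> bool" where
  "drift_locally_integrable M B X \<longleftrightarrow>
     (\<forall>t\<ge>0. AE \<omega> in M. set_integrable lborel {0..t} (\<lambda>s. B (X s \<omega>) (law M (X s))))"

end

theory Submission
  imports Defs
begin

text \<open>The moments of the stochastic convolution are controlled through Laplace transforms. If \<open>X\<close>
  has characteristic function \<open>exp (- c \<bar>h\<bar>\<^sup>\<alpha>)\<close>, then \<open>1 - E exp (- u X\<^sup>2) \<le> 4 c u powr (\<alpha> / 2)\<close>, a
  bound that adds up over the coordinates and gives all moments of order less than \<open>\<alpha>\<close> of the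
  norm. Hence the convolution is uniformly continuous in \<open>L\<^sup>p\<close> and has a predictable modification.

  Since \<open>\<bar>S t x\<bar> \<le> \<bar>x\<bar>\<close>, Jensen's inequality and the Lipschitz condition bound the
  \<open>p\<close>-th moment of the difference of two drift integrals by a constant times the time integral of
  the \<open>p\<close>-th moment of the difference of the processes. Picard iteration gives existence, and
  Gronwall's inequality gives uniqueness and the moment estimate, once the moments of an arbitrary
  solution are known to be bounded on bounded time intervals. For this the local integrability of the
  drift is used: along one good path it bounds the contribution of the laws to the drift by an
  integrable function of time, after which Gronwall's inequality applies on the events where the
  solution is pathwise bounded.\<close>

text \<open>The hypothesis sums \<open>bet k powr \<alpha> / lam k\<close>, with exponent \<alpha>,
  while only moments of order \<open>m < \<alpha>\<close> are finite. Adding the m-th moments of the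
  coordinates would require the powers of these terms with exponent \<open>m / \<alpha>\<close> to
  be summable, which is more. The Laplace bound is linear in its constant, and moments are taken
  only after the sum over \<open>k\<close>.

  Cadlag coordinates do not make the convolution cadlag in the Hilbert space, so regularity of its
  paths cannot be used; the modulus of continuity in L^p replaces it. The noise and the initial
  value form one process V, and a solution is X = V + drift integral: in differences of solutions V
  cancels, and no stochastic integral is left.

  The obstacle is an arbitrary solution, whose p-th moment is finite at each time without any
  uniformity. Gronwall's inequality needs a finite bound in advance, and truncating X on an event
  does not truncate the law inside B. Comparing the drift at two points under the same law removes
  the Wasserstein term, so the values along one fixed path can stand in for the law.\<close>

section \<open>Convexity inequalities and a Gronwall lemma\<close>

lemma powr_sum_le:
  fixes x y m :: real
  assumes "0 \<le> x" "0 \<le> y" "0 \<le> m"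
  shows "(x + y) powr m \<le> 2 powr m * (x powr m + y powr m)"
proof -
  have "(x + y) powr m \<le> (2 * max x y) powr m"
    using assms by (intro powr_mono2) auto
  also have "\<dots> = 2 powr m * max x y powr m"
    using assms by (simp add: powr_mult)
  also have "max x y powr m \<le> x powr m + y powr m"
    by (auto simp: max_def)
  finally show ?thesis by simp
qed

lemma le_one_plus_powr:
  fixes y m :: real
  assumes "0 \<le> y" "1 \<le> m"
  shows "y \<le> 1 + y powr m"
proof (cases "y \<le> 1")
  case False
  then have "y powr 1 \<le> y powr m" using assms by (intro powr_mono) auto
  with False show ?thesis by simp
qed (simp add: add_increasing2)

text \<open>The graph of \<open>h powr m\<close> lies above its tangent at \<open>y\<close>. The
  proof reads this off Young's inequality with weights \<open>1/m\<close> and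
  \<open>1 - 1/m\<close>.\<close>

lemma powr_tangent_le:
  fixes y h m :: real
  assumes "0 < y" "0 \<le> h" "1 \<le> m"
  shows "m * y powr (m - 1) * h \<le> h powr m + (m - 1) * y powr m"
proof (cases "h = 0")
  case True
  then show ?thesis using assms by simp
next
  case False
  with assms have h: "h > 0" by simp
  have "(h powr m) powr (1/m) * (y powr m) powr (1 - 1/m) \<le> (1/m) * h powr m + (1 - 1/m) * y powr m"
    using assms h by (intro Youngs_inequality_0) (auto simp: field_simps)
  also have "(h powr m) powr (1/m) * (y powr m) powr (1 - 1/m) = h * y powr (m - 1)"
    using assms h by (simp add: powr_powr algebra_simps)
  finally have "m * (h * y powr (m - 1)) \<le> m * ((1/m) * h powr m + (1 - 1/m) * y powr m)"
    using assms by (intro mult_left_mono) auto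
  also have "\<dots> = h powr m + (m - 1) * y powr m"
    using assms by (simp add: field_simps)
  finally show ?thesis by (simp add: algebra_simps)
qed

text \<open>The conclusion is the integral over \<open>N\<close> of the tangent inequality at \<open>y = x / c\<close>.\<close>

lemma nn_integral_powr_Jensen:
  fixes h :: "'a \<Rightarrow> real"
  assumes [measurable]: "h \<in> borel_measurable N"
    and nonneg: "\<And>s. s \<in> space N \<Longrightarrow> 0 \<le> h s"
    and mass: "emeasure N (space N) \<le> ennreal c" and "0 < c" "1 \<le> m" "0 \<le> x"
    and le: "ennreal x \<le> (\<integral>\<^sup>+ s. ennreal (h s) \<partial>N)"
  shows "ennreal (x powr m) \<le> ennreal (c powr (m - 1)) * (\<integral>\<^sup>+ s. ennreal (h s powr m) \<partial>N)"
proof (cases "x = 0 \<or> (\<integral>\<^sup>+ s. ennreal (h s powr m) \<partial>N) = \<infinity>")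
  case True
  then show ?thesis using \<open>0 < c\<close> by (auto simp: ennreal_mult_top)
next
  case False
  \<comment> \<open>Outside the two trivial cases the tangent point is positive and the right side
    is a real number, so that a summand can be cancelled at the end, which \<open>ennreal\<close>
    does not allow.\<close>
  with assms have x: "x > 0" by simp
  from False obtain J where J: "(\<integral>\<^sup>+ s. ennreal (h s powr m) \<partial>N) = ennreal J" "0 \<le> J"
    by (cases "(\<integral>\<^sup>+ s. ennreal (h s powr m) \<partial>N)") auto
  define y where "y = x / c"
  have y: "y > 0" using x \<open>0 < c\<close> by (simp add: y_def)
  have "ennreal (m * y powr (m - 1) * x) = ennreal (m * y powr (m - 1)) * ennreal x"
    using assms y by (simp add: ennreal_mult)
  also have "\<dots> \<le> ennreal (m * y powr (m - 1)) * (\<integral>\<^sup>+ s. ennreal (h s) \<partial>N)"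
    by (intro mult_left_mono le) auto
  also have "\<dots> = (\<integral>\<^sup>+ s. ennreal (m * y powr (m - 1) * h s) \<partial>N)"
    using assms(5) nonneg
    by (subst nn_integral_cmult[symmetric]) (auto intro!: nn_integral_cong simp: ennreal_mult)
  also have "\<dots> \<le> (\<integral>\<^sup>+ s. ennreal (h s powr m) + ennreal ((m - 1) * y powr m) \<partial>N)"
    using y nonneg assms(5) powr_tangent_le[of y _ m]
    by (intro nn_integral_mono) (auto simp flip: ennreal_plus)
  also have "\<dots> = ennreal J + ennreal ((m - 1) * y powr m) * emeasure N (space N)"
    by (subst nn_integral_add) (auto simp: J)
  also have "\<dots> \<le> ennreal J + ennreal ((m - 1) * y powr m) * ennreal c"
    by (intro add_left_mono mult_left_mono mass) auto
  also have "\<dots> = ennreal (J + (m - 1) * y powr m * c)"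
    using J \<open>0 < c\<close> \<open>1 \<le> m\<close> by (simp add: ennreal_plus ennreal_mult)
  finally have "m * y powr (m - 1) * x \<le> J + (m - 1) * y powr m * c"
    using J \<open>0 < c\<close> \<open>1 \<le> m\<close> by (subst (asm) ennreal_le_iff) auto
  moreover have "y powr m * c = y powr (m - 1) * x"
    using x \<open>0 < c\<close> by (simp add: powr_diff y_def)
  then have "(m - 1) * y powr m * c = (m - 1) * (y powr (m - 1) * x)"
    by (simp add: mult.assoc)
  ultimately have "y powr (m - 1) * x \<le> J"
    by (simp add: algebra_simps)
  moreover have "x powr m = c powr (m - 1) * (y powr (m - 1) * x)"
    using x \<open>0 < c\<close> by (simp add: y_def powr_divide powr_diff)
  ultimately have "x powr m \<le> c powr (m - 1) * J"
    by (simp add: mult_left_mono)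
  then show ?thesis
    by (simp add: J ennreal_mult flip: ennreal_mult)
qed

lemma nn_integral_interval_powr_Jensen:
  fixes h :: "real \<Rightarrow> real"
  assumes [measurable]: "h \<in> borel_measurable borel"
    and nonneg: "\<And>s. 0 \<le> h s" and "0 \<le> t" "1 \<le> m" "0 \<le> x"
    and le: "ennreal x \<le> (\<integral>\<^sup>+ s\<in>{0..t}. ennreal (h s) \<partial>lborel)"
  shows "ennreal (x powr m) \<le> ennreal (t powr (m - 1)) * (\<integral>\<^sup>+ s\<in>{0..t}. ennreal (h s powr m) \<partial>lborel)"
proof (cases "t = 0")
  case True
  \<comment> \<open>Over the null set \<open>{0}\<close> the integral is 0, which forces
    \<open>x = 0\<close>. The general lemma asks for a positive \<open>c\<close>.\<close>
  have "AE s in lborel. s \<noteq> (0::real)"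
    using AE_lborel_singleton[of "0::real"] by simp
  then have "(\<integral>\<^sup>+ s\<in>{0..t}. ennreal (h s) \<partial>lborel) = 0"
    using True by (subst nn_integral_0_iff_AE) (auto simp: indicator_def)
  with le \<open>0 \<le> x\<close> show ?thesis by simp
next
  case False
  with \<open>0 \<le> t\<close> have t: "t > 0" by simp
  have "ennreal (x powr m) \<le> ennreal (t powr (m - 1)) *
      (\<integral>\<^sup>+ s. ennreal (h s powr m) \<partial>restrict_space lborel {0..t})"
    using assms t le
    by (intro nn_integral_powr_Jensen)
      (auto simp: emeasure_restrict_space space_restrict_space nn_integral_restrict_space
        intro!: measurable_restrict_space1)
  then show ?thesis by (simp add: nn_integral_restrict_space)
qed

text \<open>The crude bound \<open>N\<close> is fed back into the inequality: \<open>K\<close> times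
  the integral of \<open>R * exp (2 * K * s)\<close> is
  \<open>R / 2 * (exp (2 * K * t) - 1)\<close>, so each pass halves the part of the constant that
  stems from \<open>N\<close>, and in the limit only \<open>2 * A\<close> is left. The doubled rate
  in the exponent pays for the halving. The argument asks for measurability and a bound known
  beforehand, not for continuity of \<phi>.\<close>

lemma bounded_Gronwall:
  fixes \<phi> :: "real \<Rightarrow> ennreal" and A K N T :: real
  assumes [measurable]: "\<phi> \<in> borel_measurable borel"
    and "0 \<le> A" "0 \<le> K" "0 \<le> N"
    and bound: "\<And>t. 0 \<le> t \<Longrightarrow> t \<le> T \<Longrightarrow> \<phi> t \<le> ennreal N"
    and le: "\<And>t. 0 \<le> t \<Longrightarrow> t \<le> T \<Longrightarrow> \<phi> t \<le> ennreal A + ennreal K * (\<integral>\<^sup>+ s\<in>{0..t}. \<phi> s \<partial>lborel)"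
    and t: "0 \<le> t" "t \<le> T"
  shows "\<phi> t \<le> ennreal (2 * A * exp (2 * K * t))"
proof -
  have step: "\<phi> t \<le> ennreal ((2 * A + N / 2 ^ n) * exp (2 * K * t))" if "0 \<le> t" "t \<le> T" for t n
    using that
  proof (induction n arbitrary: t)
    case 0
    have "N * 1 \<le> N * exp (2 * K * t)"
      using 0 assms by (intro mult_left_mono) auto
    also have "\<dots> \<le> (2 * A + N) * exp (2 * K * t)"
      using assms by (intro mult_right_mono) auto
    finally show ?case
      using bound[OF 0] by (auto intro: order_trans simp: ennreal_leI)
  next
    case (Suc n)
    define R where "R = 2 * A + N / 2 ^ n"
    have R: "0 \<le> R" using assms by (simp add: R_def)
    have FTC: "(\<integral>\<^sup>+ s. ennreal (2 * K * R * exp (2 * K * s)) * indicator {0..t} s \<partial>lborel)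
        = ennreal (R * exp (2 * K * t) - R * exp (2 * K * 0))"
    proof (rule nn_integral_FTC_Icc)
      show "((\<lambda>s. R * exp (2 * K * s)) has_real_derivative 2 * K * R * exp (2 * K * x)) (at x)" for x
        by (auto intro!: derivative_eq_intros)
    qed (use R \<open>0 \<le> K\<close> Suc in auto)
    have "ennreal K * (\<integral>\<^sup>+ s\<in>{0..t}. \<phi> s \<partial>lborel)
        \<le> ennreal K * (\<integral>\<^sup>+ s\<in>{0..t}. ennreal (R * exp (2 * K * s)) \<partial>lborel)"
      using Suc by (intro mult_left_mono nn_integral_mono) (auto simp: indicator_def R_def)
    also have "\<dots> = (\<integral>\<^sup>+ s. ennreal (K * (R * exp (2 * K * s))) * indicator {0..t} s \<partial>lborel)"
      using R \<open>0 \<le> K\<close> by (subst nn_integral_cmult[symmetric])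
        (auto intro!: nn_integral_cong simp: ennreal_mult mult.assoc)
    also have "\<dots> = (\<integral>\<^sup>+ s. ennreal (1/2) * (ennreal (2 * K * R * exp (2 * K * s)) * indicator {0..t} s) \<partial>lborel)"
      unfolding mult.assoc[symmetric] by (subst ennreal_mult'[symmetric]) (simp_all add: mult.assoc)
    also have "\<dots> = ennreal (1/2) * ennreal (R * exp (2 * K * t) - R * exp (2 * K * 0))"
      by (subst nn_integral_cmult) (auto simp: FTC)
    also have "\<dots> = ennreal (R / 2 * (exp (2 * K * t) - 1))"
      using R by (subst ennreal_mult'[symmetric]) (auto simp: algebra_simps)
    finally have "\<phi> t \<le> ennreal A + ennreal (R / 2 * (exp (2 * K * t) - 1))"
      using le[OF Suc.prems] by (meson add_left_mono order_trans)
    also have "\<dots> = ennreal (A + R / 2 * (exp (2 * K * t) - 1))"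
      using R Suc.prems assms by (intro ennreal_plus[symmetric]) auto
    also have "\<dots> \<le> ennreal ((2 * A + N / 2 ^ Suc n) * exp (2 * K * t))"
    proof (intro ennreal_leI)
      define q E where "q = N / 2 ^ n" and "E = exp (2 * K * t)"
      have "0 \<le> q" "0 \<le> A * E"
        using assms by (auto simp: q_def E_def)
      then have "A + (2 * A + q) / 2 * (E - 1) \<le> (2 * A + q / 2) * E"
        by (simp add: field_simps)
      then show "A + R / 2 * (exp (2 * K * t) - 1) \<le> (2 * A + N / 2 ^ Suc n) * exp (2 * K * t)"
        by (simp add: R_def q_def E_def mult.commute)
    qed
    finally show ?case .
  qed
  have "(\<lambda>n. (2 * A + N * (1/2) ^ n) * exp (2 * K * t)) \<longlonglongrightarrow> (2 * A + N * 0) * exp (2 * K * t)"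
    by (intro tendsto_intros LIMSEQ_power_zero) auto
  then have "(\<lambda>n. ennreal ((2 * A + N / 2 ^ n) * exp (2 * K * t))) \<longlonglongrightarrow> ennreal (2 * A * exp (2 * K * t))"
    by (intro tendsto_ennrealI) (simp add: power_divide)
  then show ?thesis
    by (rule LIMSEQ_le_const) (use step[OF t] in auto)
qed

section \<open>Laplace transforms and fractional moments\<close>

text \<open>For \<open>a = \<alpha> / 2\<close> the bound below plays the role of an \<open>\<alpha>\<close>-stable tail for \<open>sqrt Q\<close>. Unlike
  moments, it is subadditive in \<open>Q\<close> with no independence required.\<close>

definition Laplace_bound :: "'a measure \<Rightarrow> real \<Rightarrow> real \<Rightarrow> ('a \<Rightarrow> real) \<Rightarrow> bool" where
  "Laplace_bound M a c Q \<longleftrightarrow>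
     Q \<in> borel_measurable M \<and> (\<forall>\<omega>\<in>space M. 0 \<le> Q \<omega>) \<and> 0 \<le> c \<and>
     (\<forall>u>0. (\<integral>\<^sup>+ \<omega>. ennreal (1 - exp (- u * Q \<omega>)) \<partial>M) \<le> ennreal (c * u powr a))"

text \<open>Only the part \<open>s \<ge> 1 / q\<close> of the integral is kept. There
  \<open>1 - exp (- s * q)\<close> is at least \<open>1 - exp (-1)\<close>, and the tail of
  \<open>s powr (- 1 - r)\<close> integrates to \<open>q powr r / r\<close>.\<close>

lemma powr_le_Laplace_integral:
  fixes q r :: real
  assumes "0 \<le> q" "0 < r"
  shows "ennreal (q powr r) \<le> ennreal (r / (1 - exp (-1))) *
    (\<integral>\<^sup>+ s\<in>{0..}. ennreal ((1 - exp (- s * q)) * s powr (- 1 - r)) \<partial>lborel)"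
proof (cases "q = 0")
  case True
  then show ?thesis by simp
next
  case False
  with assms have q: "q > 0" by simp
  have e: "exp (-1) < (1::real)" by simp
  have I: "(\<integral>\<^sup>+ s. ennreal (s powr (- 1 - r)) * indicator {1 / q..} s \<partial>lborel) = ennreal (q powr r / r)"
  proof -
    have "((\<lambda>s. s powr (- 1 - r)) has_integral - ((1 / q) powr (- 1 - r + 1)) / (- 1 - r + 1)) {1 / q..}"
      using q assms by (intro has_integral_powr_to_inf) auto
    from nn_integral_has_integral_lebesgue'[OF _ this] show ?thesis
      using q by (simp add: powr_divide powr_minus_divide)
  qed
  have "ennreal (q powr r) = ennreal (r / (1 - exp (-1))) * (ennreal (1 - exp (-1)) * ennreal (q powr r / r))"
    using e assms by (simp flip: ennreal_mult)
  also have "ennreal (1 - exp (-1)) * ennreal (q powr r / r) =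
     (\<integral>\<^sup>+ s. ennreal (1 - exp (-1)) * (ennreal (s powr (- 1 - r)) * indicator {1 / q..} s) \<partial>lborel)"
    by (subst nn_integral_cmult) (auto simp: I)
  also have "\<dots> \<le> (\<integral>\<^sup>+ s\<in>{0..}. ennreal ((1 - exp (- s * q)) * s powr (- 1 - r)) \<partial>lborel)"
  proof (intro nn_integral_mono)
    fix s :: real
    show "ennreal (1 - exp (- 1)) * (ennreal (s powr (- 1 - r)) * indicator {1 / q..} s)
      \<le> ennreal ((1 - exp (- s * q)) * s powr (- 1 - r)) * indicator {0..} s"
    proof (cases "s \<ge> 1 / q")
      case True
      then have "1 \<le> s * q" using q by (simp add: field_simps)
      then have "exp (- s * q) \<le> exp (- 1)" by simp
      moreover have "0 \<le> s" using True q by (meson divide_nonneg_nonneg less_imp_le order_trans zero_le_one)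
      ultimately show ?thesis using True e
        by (simp add: ennreal_mult[symmetric] ennreal_leI mult_right_mono)
    qed simp
  qed
  finally show ?thesis by (simp add: mult_left_mono)
qed

text \<open>Integrating the preceding inequality over \<open>M\<close> leaves a time integral of the
  Laplace expression, which is at most \<open>min 1 (c * s powr a)\<close>. The second bound makes
  the integral converge at 0 because \<open>r < a\<close>, the first one at infinity because
  \<open>0 < r\<close>. By scaling both parts are multiples of
  \<open>c powr (r / a)\<close>.\<close>

lemma Laplace_bound_moment:
  assumes "prob_space M" "Laplace_bound M a c Q" and r: "0 < r" "r < a"
  shows "(\<integral>\<^sup>+ \<omega>. ennreal (Q \<omega> powr r) \<partial>M)
    \<le> ennreal (r / (1 - exp (-1)) * (1 / (a - r) + 1 / r) * c powr (r / a))"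
proof -
  interpret prob_space M by fact
  interpret pair_sigma_finite M lborel ..
  have [measurable]: "Q \<in> borel_measurable M" and Q: "\<And>\<omega>. \<omega> \<in> space M \<Longrightarrow> 0 \<le> Q \<omega>" and c: "0 \<le> c"
    and b: "\<And>u. 0 < u \<Longrightarrow> (\<integral>\<^sup>+ \<omega>. ennreal (1 - exp (- u * Q \<omega>)) \<partial>M) \<le> ennreal (c * u powr a)"
    using assms(2) by (auto simp: Laplace_bound_def)
  have b1: "(\<integral>\<^sup>+ \<omega>. ennreal (1 - exp (- u * Q \<omega>)) \<partial>M) \<le> 1" if "0 < u" for u
  proof -
    have "(\<integral>\<^sup>+ \<omega>. ennreal (1 - exp (- u * Q \<omega>)) \<partial>M) \<le> (\<integral>\<^sup>+ \<omega>. 1 \<partial>M)"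
      using that Q by (intro nn_integral_mono) simp
    then show ?thesis by (simp add: emeasure_space_1)
  qed
  define C where "C = r / (1 - exp (-1::real))"
  have C: "C \<ge> 0" using r by (simp add: C_def)
  \<comment> \<open>The time at which the two bounds \<open>1\<close> and
    \<open>c * s powr a\<close> cross.\<close>
  define s0 where "s0 = c powr (- 1 / a)"
  have I1: "(\<integral>\<^sup>+ s. ennreal (s powr (a - 1 - r)) * indicator {0..s0} s \<partial>lborel) = ennreal (s0 powr (a - r) / (a - r))"
  proof -
    have "((\<lambda>s. s powr (a - 1 - r)) has_integral (s0 powr (a - 1 - r + 1) / (a - 1 - r + 1))) {0..s0}"
      using r by (intro has_integral_powr_from_0) (auto simp: s0_def)
    from nn_integral_has_integral_lebesgue'[OF _ this] show ?thesis
      by simp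
  qed
  have "(\<integral>\<^sup>+ \<omega>. ennreal (Q \<omega> powr r) \<partial>M) \<le> (\<integral>\<^sup>+ \<omega>. ennreal C *
    (\<integral>\<^sup>+ s\<in>{0..}. ennreal ((1 - exp (- s * Q \<omega>)) * s powr (- 1 - r)) \<partial>lborel) \<partial>M)"
    using Q r unfolding C_def by (intro nn_integral_mono powr_le_Laplace_integral) auto
  also have "\<dots> = ennreal C *
    (\<integral>\<^sup>+ \<omega>. \<integral>\<^sup>+ s. ennreal ((1 - exp (- s * Q \<omega>)) * s powr (- 1 - r)) * indicator {0..} s \<partial>lborel \<partial>M)"
    by (intro nn_integral_cmult) measurable
  also have "(\<integral>\<^sup>+ \<omega>. \<integral>\<^sup>+ s. ennreal ((1 - exp (- s * Q \<omega>)) * s powr (- 1 - r)) * indicator {0..} s \<partial>lborel \<partial>M)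
    = (\<integral>\<^sup>+ s. \<integral>\<^sup>+ \<omega>. ennreal ((1 - exp (- s * Q \<omega>)) * s powr (- 1 - r)) * indicator {0..} s \<partial>M \<partial>lborel)"
    by (rule Fubini'[symmetric]) measurable
  also have "\<dots> \<le> (\<integral>\<^sup>+ s. ennreal (min 1 (c * s powr a)) * (ennreal (s powr (- 1 - r)) * indicator {0..} s) \<partial>lborel)"
  proof (intro nn_integral_mono)
    fix s :: real
    show "(\<integral>\<^sup>+ \<omega>. ennreal ((1 - exp (- s * Q \<omega>)) * s powr (- 1 - r)) * indicator {0..} s \<partial>M)
       \<le> ennreal (min 1 (c * s powr a)) * (ennreal (s powr (- 1 - r)) * indicator {0..} s)"
    proof (cases "s > 0")
      case True
      have "(\<integral>\<^sup>+ \<omega>. ennreal ((1 - exp (- s * Q \<omega>)) * s powr (- 1 - r)) * indicator {0..} s \<partial>M)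
        = (\<integral>\<^sup>+ \<omega>. ennreal (1 - exp (- s * Q \<omega>)) * ennreal (s powr (- 1 - r)) \<partial>M)"
        using True Q by (intro nn_integral_cong) (auto simp: ennreal_mult'')
      also have "\<dots> = (\<integral>\<^sup>+ \<omega>. ennreal (1 - exp (- s * Q \<omega>)) \<partial>M) * ennreal (s powr (- 1 - r))"
        by (rule nn_integral_multc) measurable
      also have "\<dots> \<le> ennreal (min 1 (c * s powr a)) * ennreal (s powr (- 1 - r))"
        using b[OF True] b1[OF True] by (intro mult_right_mono) (auto simp: min_def)
      finally show ?thesis using True by simp
    next
      case False
      then show ?thesis by (cases "s = 0") auto
    qed
  qed
  also have "\<dots> \<le> ennreal ((1 / (a - r) + 1 / r) * c powr (r / a))"
  proof (cases "c = 0")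
    case True
    then show ?thesis by simp
  next
    case False
    with c have c: "c > 0" by simp
    then have s0: "s0 > 0" by (simp add: s0_def)
    have I2: "(\<integral>\<^sup>+ s. ennreal (s powr (- 1 - r)) * indicator {s0..} s \<partial>lborel) = ennreal (s0 powr (- r) / r)"
    proof -
      have "((\<lambda>s. s powr (- 1 - r)) has_integral - (s0 powr (- 1 - r + 1)) / (- 1 - r + 1)) {s0..}"
        using r s0 by (intro has_integral_powr_to_inf) auto
      from nn_integral_has_integral_lebesgue'[OF _ this] show ?thesis
        by simp
    qed
    have "(\<integral>\<^sup>+ s. ennreal (min 1 (c * s powr a)) * (ennreal (s powr (- 1 - r)) * indicator {0..} s) \<partial>lborel)
      \<le> (\<integral>\<^sup>+ s. ennreal c * (ennreal (s powr (a - 1 - r)) * indicator {0..s0} s)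
           + ennreal (s powr (- 1 - r)) * indicator {s0..} s \<partial>lborel)"
    proof (intro nn_integral_mono)
      fix s :: real
      consider "s \<le> 0" | "0 < s" "s \<le> s0" | "s > s0" by linarith
      then show "ennreal (min 1 (c * s powr a)) * (ennreal (s powr (- 1 - r)) * indicator {0..} s)
        \<le> ennreal c * (ennreal (s powr (a - 1 - r)) * indicator {0..s0} s)
           + ennreal (s powr (- 1 - r)) * indicator {s0..} s"
      proof cases
        case 1
        then show ?thesis by (cases "s = 0") auto
      next
        case 2
        have "min 1 (c * s powr a) * s powr (- 1 - r) \<le> (c * s powr a) * s powr (- 1 - r)"
          by (intro mult_right_mono) auto
        also have "\<dots> = c * s powr (a - 1 - r)"
          by (simp flip: powr_add) (simp add: algebra_simps)
        finally have "ennreal (min 1 (c * s powr a) * s powr (- 1 - r)) \<le> ennreal (c * s powr (a - 1 - r))"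
          by (rule ennreal_leI)
        with 2 c show ?thesis
          by (simp add: ennreal_mult add_increasing2)
      next
        case 3
        have "min 1 (c * s powr a) * s powr (- 1 - r) \<le> 1 * s powr (- 1 - r)"
          by (intro mult_right_mono) auto
        then have "ennreal (min 1 (c * s powr a) * s powr (- 1 - r)) \<le> ennreal (s powr (- 1 - r))"
          by (simp add: ennreal_leI)
        with 3 c s0 show ?thesis
          by (simp add: ennreal_mult add_increasing2)
      qed
    qed
    also have "\<dots> = ennreal c * ennreal (s0 powr (a - r) / (a - r)) + ennreal (s0 powr (- r) / r)"
      by (subst nn_integral_add) (auto simp: nn_integral_cmult I1 I2)
    also have "\<dots> = ennreal (c * (s0 powr (a - r) / (a - r)) + s0 powr (- r) / r)"
      using c r by (simp add: ennreal_plus flip: ennreal_mult)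
    also have "c * (s0 powr (a - r) / (a - r)) + s0 powr (- r) / r = (1 / (a - r) + 1 / r) * c powr (r / a)"
    proof -
      have "c * s0 powr (a - r) = c powr (1 + (- 1 / a) * (a - r))"
        using c by (simp add: s0_def powr_powr powr_mult_base)
      also have "1 + (- 1 / a) * (a - r) = r / a"
        using r by (simp add: field_simps)
      finally have "c * s0 powr (a - r) = c powr (r / a)" .
      moreover have "s0 powr (- r) = c powr (r / a)"
        by (simp add: s0_def powr_powr)
      ultimately show ?thesis by (simp add: algebra_simps add_divide_distrib)
    qed
    finally show ?thesis .
  qed
  finally have "(\<integral>\<^sup>+ \<omega>. ennreal (Q \<omega> powr r) \<partial>M)
    \<le> ennreal C * ennreal ((1 / (a - r) + 1 / r) * c powr (r / a))"
    by (simp add: mult_left_mono)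
  then show ?thesis
    using C r unfolding C_def[symmetric] by (simp add: ennreal_mult[symmetric] mult.assoc)
qed

text \<open>For two summands, with \<open>x\<close> and \<open>y\<close> the exponentials,
  \<open>1 - x * y \<le> (1 - x) + (1 - y)\<close> is the same as
  \<open>0 \<le> (1 - x) * (1 - y)\<close>. Being pointwise, the inequality survives integration
  whatever the joint law.\<close>

lemma one_minus_exp_sum_le:
  fixes q :: "'i \<Rightarrow> real"
  assumes "finite K" "\<And>k. k \<in> K \<Longrightarrow> 0 \<le> q k" "0 \<le> u"
  shows "1 - exp (- u * (\<Sum>k\<in>K. q k)) \<le> (\<Sum>k\<in>K. 1 - exp (- u * q k))"
  using assms
proof (induction K rule: finite_induct)
  case (insert k K)
  define x y where "x = exp (- u * q k)" and "y = exp (- u * (\<Sum>k\<in>K. q k))"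
  have "x \<le> 1" "y \<le> 1"
    using insert by (auto simp: x_def y_def sum_nonneg)
  then have "0 \<le> (1 - x) * (1 - y)" by simp
  moreover have "exp (- u * (\<Sum>k\<in>insert k K. q k)) = x * y"
    using insert by (simp add: x_def y_def algebra_simps exp_add exp_diff exp_minus field_simps)
  ultimately show ?case
    using insert by (simp add: x_def y_def algebra_simps)
qed simp

lemma Laplace_bound_sum:
  assumes "finite K" "\<And>k. k \<in> K \<Longrightarrow> Laplace_bound M a (c k) (Q k)"
  shows "Laplace_bound M a (\<Sum>k\<in>K. c k) (\<lambda>\<omega>. \<Sum>k\<in>K. Q k \<omega>)"
  unfolding Laplace_bound_def
proof (intro conjI ballI allI impI)
  show "(\<lambda>\<omega>. \<Sum>k\<in>K. Q k \<omega>) \<in> borel_measurable M"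
    using assms by (auto simp: Laplace_bound_def intro!: borel_measurable_sum)
  show "0 \<le> (\<Sum>k\<in>K. Q k \<omega>)" if "\<omega> \<in> space M" for \<omega>
    using that assms by (auto simp: Laplace_bound_def intro!: sum_nonneg)
  show "0 \<le> (\<Sum>k\<in>K. c k)"
    using assms by (auto simp: Laplace_bound_def intro!: sum_nonneg)
  fix u :: real
  assume u: "0 < u"
  have "(\<integral>\<^sup>+ \<omega>. ennreal (1 - exp (- u * (\<Sum>k\<in>K. Q k \<omega>))) \<partial>M)
      \<le> (\<integral>\<^sup>+ \<omega>. (\<Sum>k\<in>K. ennreal (1 - exp (- u * Q k \<omega>))) \<partial>M)"
  proof (intro nn_integral_mono)
    fix \<omega> assume "\<omega> \<in> space M"
    then have "0 \<le> Q k \<omega>" if "k \<in> K" for k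
      using that assms by (auto simp: Laplace_bound_def)
    with assms u have "ennreal (1 - exp (- u * (\<Sum>k\<in>K. Q k \<omega>))) \<le> ennreal (\<Sum>k\<in>K. 1 - exp (- u * Q k \<omega>))"
      by (intro ennreal_leI one_minus_exp_sum_le) auto
    also have "\<dots> = (\<Sum>k\<in>K. ennreal (1 - exp (- u * Q k \<omega>)))"
      using \<open>\<And>k. k \<in> K \<Longrightarrow> 0 \<le> Q k \<omega>\<close> u by (intro sum_ennreal[symmetric]) auto
    finally show "ennreal (1 - exp (- u * (\<Sum>k\<in>K. Q k \<omega>))) \<le> (\<Sum>k\<in>K. ennreal (1 - exp (- u * Q k \<omega>)))" .
  qed
  also have "\<dots> = (\<Sum>k\<in>K. \<integral>\<^sup>+ \<omega>. ennreal (1 - exp (- u * Q k \<omega>)) \<partial>M)"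
  proof (intro nn_integral_sum)
    fix k assume "k \<in> K"
    then have [measurable]: "Q k \<in> borel_measurable M"
      using assms by (auto simp: Laplace_bound_def)
    show "(\<lambda>\<omega>. ennreal (1 - exp (- u * Q k \<omega>))) \<in> borel_measurable M"
      by measurable
  qed
  also have "\<dots> \<le> (\<Sum>k\<in>K. ennreal (c k * u powr a))"
    using assms u by (intro sum_mono) (auto simp: Laplace_bound_def)
  also have "\<dots> = ennreal ((\<Sum>k\<in>K. c k) * u powr a)"
    using assms by (subst sum_ennreal) (auto simp: Laplace_bound_def sum_distrib_right)
  finally show "(\<integral>\<^sup>+ \<omega>. ennreal (1 - exp (- u * (\<Sum>k\<in>K. Q k \<omega>))) \<partial>M) \<le> ennreal ((\<Sum>k\<in>K. c k) * u powr a)" .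
qed

lemma Laplace_bound_scale:
  assumes "Laplace_bound M a c Q" "0 < b"
  shows "Laplace_bound M a (b powr a * c) (\<lambda>\<omega>. b * Q \<omega>)"
  unfolding Laplace_bound_def
proof (intro conjI ballI allI impI)
  show "(\<lambda>\<omega>. b * Q \<omega>) \<in> borel_measurable M"
    using assms by (auto simp: Laplace_bound_def)
  show "0 \<le> b * Q \<omega>" if "\<omega> \<in> space M" for \<omega>
    using that assms by (auto simp: Laplace_bound_def)
  show "0 \<le> b powr a * c"
    using assms by (auto simp: Laplace_bound_def)
  fix u :: real
  assume u: "0 < u"
  then have "(\<integral>\<^sup>+ \<omega>. ennreal (1 - exp (- (u * b) * Q \<omega>)) \<partial>M) \<le> ennreal (c * (u * b) powr a)"
    using assms unfolding Laplace_bound_def by (metis mult_pos_pos)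
  also have "c * (u * b) powr a = b powr a * c * u powr a"
    using u assms by (simp add: powr_mult)
  finally show "(\<integral>\<^sup>+ \<omega>. ennreal (1 - exp (- u * (b * Q \<omega>))) \<partial>M) \<le> ennreal (b powr a * c * u powr a)"
    by (simp add: mult.assoc)
qed

text \<open>Fatou's lemma for the bounded integrands \<open>1 - exp (- u * Q n)\<close>. It carries
  a bound from approximating sums to a stochastic integral that is known only as an almost sure
  limit.\<close>

lemma Laplace_bound_limit:
  assumes "\<And>n. Laplace_bound M a (c n) (Q n)" "c \<longlonglongrightarrow> c'"
    and [measurable]: "Q' \<in> borel_measurable M" and nonneg: "\<And>\<omega>. \<omega> \<in> space M \<Longrightarrow> 0 \<le> Q' \<omega>"
    and lim: "AE \<omega> in M. (\<lambda>n. Q n \<omega>) \<longlonglongrightarrow> Q' \<omega>"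
  shows "Laplace_bound M a c' Q'"
  unfolding Laplace_bound_def
proof (intro conjI ballI allI impI)
  have [measurable]: "\<And>n. Q n \<in> borel_measurable M"
    using assms(1) by (auto simp: Laplace_bound_def)
  show "0 \<le> c'"
    using assms(1) by (intro LIMSEQ_le_const[OF assms(2)]) (auto simp: Laplace_bound_def)
  fix u :: real
  assume u: "0 < u"
  have "(\<integral>\<^sup>+ \<omega>. ennreal (1 - exp (- u * Q' \<omega>)) \<partial>M)
      = (\<integral>\<^sup>+ \<omega>. liminf (\<lambda>n. ennreal (1 - exp (- u * Q n \<omega>))) \<partial>M)"
    using lim
  proof (intro nn_integral_cong_AE, eventually_elim)
    case (elim \<omega>)
    then have "(\<lambda>n. ennreal (1 - exp (- u * Q n \<omega>))) \<longlonglongrightarrow> ennreal (1 - exp (- u * Q' \<omega>))"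
      by (intro tendsto_intros)
    then show ?case
      by (intro lim_imp_Liminf[symmetric]) auto
  qed
  also have "\<dots> \<le> liminf (\<lambda>n. \<integral>\<^sup>+ \<omega>. ennreal (1 - exp (- u * Q n \<omega>)) \<partial>M)"
    by (intro nn_integral_liminf) measurable
  also have "\<dots> \<le> liminf (\<lambda>n. ennreal (c n * u powr a))"
    using assms(1) u by (intro Liminf_mono) (auto simp: Laplace_bound_def)
  also have "\<dots> = ennreal (c' * u powr a)"
    by (intro lim_imp_Liminf tendsto_intros assms(2)) auto
  finally show "(\<integral>\<^sup>+ \<omega>. ennreal (1 - exp (- u * Q' \<omega>)) \<partial>M) \<le> ennreal (c' * u powr a)" .
qed (use nonneg in auto)

lemma Laplace_bound_mono:
  assumes "Laplace_bound M a c Q" "c \<le> c'"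
  shows "Laplace_bound M a c' Q"
  using assms unfolding Laplace_bound_def
  by (auto intro!: order_trans[OF _ ennreal_leI[OF mult_right_mono[OF assms(2)]]])

text \<open>The integrand is at most \<open>1 + g\<^sup>2\<close>, whose expectation is 2.\<close>

lemma std_normal_absolute_moment_le:
  assumes "0 < \<alpha>" "\<alpha> \<le> 2"
  shows "integrable std_normal_distribution (\<lambda>g. \<bar>g\<bar> powr \<alpha>)"
    and "(\<integral>g. \<bar>g\<bar> powr \<alpha> \<partial>std_normal_distribution) \<le> 2"
proof -
  interpret N: real_distribution std_normal_distribution by (rule real_dist_normal_dist)
  have le: "\<bar>g\<bar> powr \<alpha> \<le> 1 + g\<^sup>2" for g :: real
  proof (cases "\<bar>g\<bar> \<le> 1")
    case True
    then have "\<bar>g\<bar> powr \<alpha> \<le> 1" using assms by (simp add: powr_le1)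
    then show ?thesis by (smt (verit) zero_le_power2)
  next
    case False
    then have "\<bar>g\<bar> powr \<alpha> \<le> \<bar>g\<bar> powr 2" using assms by (intro powr_mono) auto
    also have "\<dots> = g\<^sup>2" using False by (simp add: powr_numeral)
    finally show ?thesis by simp
  qed
  have int2: "integrable std_normal_distribution (\<lambda>g. 1 + g\<^sup>2)"
    by (intro Bochner_Integration.integrable_add integrable_std_normal_distribution_moment) simp
  show int: "integrable std_normal_distribution (\<lambda>g. \<bar>g\<bar> powr \<alpha>)"
    using le by (intro Bochner_Integration.integrable_bound[OF int2]) auto
  have "(\<integral>g. \<bar>g\<bar> powr \<alpha> \<partial>std_normal_distribution) \<le> (\<integral>g. 1 + g\<^sup>2 \<partial>std_normal_distribution)"
    by (intro integral_mono int int2 le)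
  also have "\<dots> = 2"
    using std_normal_distribution_even_moments[of 1] N.prob_space
    by (subst Bochner_Integration.integral_add) auto
  finally show "(\<integral>g. \<bar>g\<bar> powr \<alpha> \<partial>std_normal_distribution) \<le> 2" .
qed

text \<open>With a standard normal \<open>g\<close>, the identity \<open>exp (- u x\<^sup>2) = E exp (i sqrt (2 u) x g)\<close>
  expresses the Laplace transform of \<open>X\<^sup>2\<close> by the characteristic function of \<open>X\<close>.\<close>

lemma stable_Laplace_bound:
  assumes "prob_space M" and [measurable]: "X \<in> borel_measurable M" and \<alpha>: "0 < \<alpha>" "\<alpha> \<le> 2" and c: "0 \<le> c"
    and char: "\<And>h. char (distr M borel X) h = complex_of_real (exp (- c * \<bar>h\<bar> powr \<alpha>))"
  shows "Laplace_bound M (\<alpha> / 2) (4 * c) (\<lambda>\<omega>. (X \<omega>)\<^sup>2)"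
  unfolding Laplace_bound_def
proof (intro conjI ballI allI impI)
  fix u :: real
  assume u: "0 < u"
  let ?N = std_normal_distribution
  interpret prob_space M by fact
  interpret N: real_distribution ?N by (rule real_dist_normal_dist)
  interpret P: pair_prob_space M ?N ..
  define v where "v = sqrt (2 * u)"
  have v: "v > 0" "v\<^sup>2 = 2 * u" using u by (auto simp: v_def)
  have 1: "(\<integral>g. iexp (v * X \<omega> * g) \<partial>?N) = complex_of_real (exp (- u * (X \<omega>)\<^sup>2))" for \<omega>
    using fun_cong[OF char_std_normal_distribution, of "v * X \<omega>"] v
    by (simp add: char_def power_mult_distrib)
  have 2: "(\<integral>\<omega>. iexp (v * X \<omega> * g) \<partial>M) = complex_of_real (exp (- c * \<bar>v * g\<bar> powr \<alpha>))" for g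
    using char[of "v * g"] by (simp add: char_def integral_distr algebra_simps)
  have int: "integrable (M \<Otimes>\<^sub>M ?N) (\<lambda>(\<omega>, g). iexp (v * X \<omega> * g))"
    by (intro P.P.integrable_const_bound[where B=1]) auto
  have "complex_of_real (\<integral>\<omega>. exp (- u * (X \<omega>)\<^sup>2) \<partial>M) = (\<integral>\<omega>. (\<integral>g. iexp (v * X \<omega> * g) \<partial>?N) \<partial>M)"
    by (simp only: 1 integral_complex_of_real)
  also have "\<dots> = (\<integral>g. (\<integral>\<omega>. iexp (v * X \<omega> * g) \<partial>M) \<partial>?N)"
    by (rule P.Fubini_integral[OF int, symmetric])
  also have "\<dots> = complex_of_real (\<integral>g. exp (- c * \<bar>v * g\<bar> powr \<alpha>) \<partial>?N)"
    by (simp only: 2 integral_complex_of_real)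
  finally have eq: "(\<integral>\<omega>. exp (- u * (X \<omega>)\<^sup>2) \<partial>M) = (\<integral>g. exp (- c * \<bar>v * g\<bar> powr \<alpha>) \<partial>?N)"
    by (simp only: of_real_eq_iff)
  have int_exp: "integrable M (\<lambda>\<omega>. exp (- u * (X \<omega>)\<^sup>2))"
    using u by (intro integrable_const_bound[where B=1]) auto
  note mom = std_normal_absolute_moment_le[OF \<alpha>]
  \<comment> \<open>The inequality \<open>exp (- z) \<ge> 1 - z\<close> replaces the exponential by
    the absolute moment of order \<alpha> of \<open>g\<close>, which is at most 2. The other factor
    2 in \<open>4 * c\<close> bounds \<open>2 powr (\<alpha> / 2)\<close>.\<close>
  have "1 - c * v powr \<alpha> * 2 \<le> 1 - c * v powr \<alpha> * (\<integral>g. \<bar>g\<bar> powr \<alpha> \<partial>?N)"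
    using mom c by (intro diff_left_mono mult_left_mono) auto
  also have "\<dots> = (\<integral>g. 1 - c * v powr \<alpha> * \<bar>g\<bar> powr \<alpha> \<partial>?N)"
    using mom N.prob_space by (subst Bochner_Integration.integral_diff) auto
  also have "\<dots> \<le> (\<integral>g. exp (- c * \<bar>v * g\<bar> powr \<alpha>) \<partial>?N)"
  proof (intro integral_mono)
    show "integrable ?N (\<lambda>g. 1 - c * v powr \<alpha> * \<bar>g\<bar> powr \<alpha>)"
      using mom by auto
    show "integrable ?N (\<lambda>g. exp (- c * \<bar>v * g\<bar> powr \<alpha>))"
      using c by (intro N.integrable_const_bound[where B=1]) auto
    show "1 - c * v powr \<alpha> * \<bar>g\<bar> powr \<alpha> \<le> exp (- c * \<bar>v * g\<bar> powr \<alpha>)" for g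
      using exp_ge_add_one_self[of "- c * \<bar>v * g\<bar> powr \<alpha>"] v by (simp add: abs_mult powr_mult)
  qed
  finally have "1 - (\<integral>\<omega>. exp (- u * (X \<omega>)\<^sup>2) \<partial>M) \<le> 2 * c * v powr \<alpha>"
    using eq by simp
  also have "v powr \<alpha> = (2 * u) powr (\<alpha> / 2)"
    using u by (simp add: v_def powr_half_sqrt[symmetric] powr_powr)
  also have "\<dots> \<le> 2 * u powr (\<alpha> / 2)"
    using u \<alpha> powr_mono[of "\<alpha>/2" 1 "2::real"] by (simp add: powr_mult)
  finally have "1 - (\<integral>\<omega>. exp (- u * (X \<omega>)\<^sup>2) \<partial>M) \<le> 4 * c * u powr (\<alpha> / 2)"
    using c by (simp add: mult_left_mono)
  moreover have "(\<integral>\<^sup>+ \<omega>. ennreal (1 - exp (- u * (X \<omega>)\<^sup>2)) \<partial>M) = ennreal (\<integral>\<omega>. 1 - exp (- u * (X \<omega>)\<^sup>2) \<partial>M)"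
    using u int_exp by (intro nn_integral_eq_integral) auto
  moreover have "(\<integral>\<omega>. 1 - exp (- u * (X \<omega>)\<^sup>2) \<partial>M) = 1 - (\<integral>\<omega>. exp (- u * (X \<omega>)\<^sup>2) \<partial>M)"
    using int_exp prob_space by (subst Bochner_Integration.integral_diff) auto
  ultimately show "(\<integral>\<^sup>+ \<omega>. ennreal (1 - exp (- u * (X \<omega>)\<^sup>2)) \<partial>M) \<le> ennreal (4 * c * u powr (\<alpha> / 2))"
    by (simp add: ennreal_leI)
qed (use c in auto)

section \<open>Random orthonormal series\<close>

definition orthonormal :: "(nat \<Rightarrow> 'h::real_inner) \<Rightarrow> bool" where
  "orthonormal e \<longleftrightarrow> (\<forall>i j. e i \<bullet> e j = (if i = j then 1 else 0))"

lemma norm_sum_orthonormal: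
  assumes "orthonormal e" "finite K"
  shows "(norm (\<Sum>k\<in>K. x k *\<^sub>R e k))\<^sup>2 = (\<Sum>k\<in>K. (x k)\<^sup>2)"
proof -
  have o: "e i \<bullet> e j = (if i = j then 1 else 0)" for i j
    using assms(1) by (simp only: orthonormal_def)
  have "(norm (\<Sum>k\<in>K. x k *\<^sub>R e k))\<^sup>2 = (\<Sum>i\<in>K. \<Sum>j\<in>K. x i * (x j * (e j \<bullet> e i)))"
    by (simp add: power2_norm_eq_inner inner_sum_left inner_sum_right sum_distrib_left)
  also have "\<dots> = (\<Sum>i\<in>K. \<Sum>j\<in>K. if i = j then (x i)\<^sup>2 else 0)"
    by (intro sum.cong refl) (simp add: o power2_eq_square)
  also have "\<dots> = (\<Sum>k\<in>K. (x k)\<^sup>2)"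
    using assms(2) by (simp add: sum.delta)
  finally show ?thesis .
qed

lemma summable_orthonormal:
  fixes e :: "nat \<Rightarrow> 'h::{real_inner, banach}"
  assumes "orthonormal e" "summable (\<lambda>k. (x k)\<^sup>2)"
  shows "summable (\<lambda>k. x k *\<^sub>R e k)"
  unfolding summable_Cauchy
proof (intro allI impI)
  fix \<epsilon> :: real
  assume "0 < \<epsilon>"
  then have "0 < \<epsilon>\<^sup>2" by simp
  with assms(2) obtain N where N: "\<And>m n. m \<ge> N \<Longrightarrow> norm (\<Sum>k=m..<n. (x k)\<^sup>2) < \<epsilon>\<^sup>2"
    unfolding summable_Cauchy by meson
  show "\<exists>N. \<forall>m\<ge>N. \<forall>n. norm (\<Sum>k=m..<n. x k *\<^sub>R e k) < \<epsilon>"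
  proof (intro exI allI impI)
    fix m n assume "N \<le> m"
    then have "(norm (\<Sum>k=m..<n. x k *\<^sub>R e k))\<^sup>2 < \<epsilon>\<^sup>2"
      using N[of m n] assms(1) by (simp add: norm_sum_orthonormal sum_nonneg)
    then show "norm (\<Sum>k=m..<n. x k *\<^sub>R e k) < \<epsilon>"
      by (rule power2_less_imp_less) (use \<open>0 < \<epsilon>\<close> in simp)
  qed
qed

text \<open>A finite expectation of the series makes it finite almost surely. Applied to distances
  of consecutive approximations it gives almost sure convergence, applied to indicators it is the
  Borel-Cantelli lemma.\<close>

lemma AE_summable_nn_integral:
  fixes g :: "nat \<Rightarrow> 'a \<Rightarrow> real"
  assumes [measurable]: "\<And>n. g n \<in> borel_measurable M" and nonneg: "\<And>n \<omega>. 0 \<le> g n \<omega>"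
    and le: "\<And>n. (\<integral>\<^sup>+ \<omega>. ennreal (g n \<omega>) \<partial>M) \<le> ennreal (c n)" and c: "\<And>n. 0 \<le> c n" "summable c"
  shows "AE \<omega> in M. summable (\<lambda>n. g n \<omega>)"
proof -
  have "(\<integral>\<^sup>+ \<omega>. (\<Sum>n. ennreal (g n \<omega>)) \<partial>M) = (\<Sum>n. \<integral>\<^sup>+ \<omega>. ennreal (g n \<omega>) \<partial>M)"
    by (intro nn_integral_suminf) measurable
  also have "\<dots> \<le> (\<Sum>n. ennreal (c n))"
    by (intro suminf_le le summableI)
  also have "\<dots> < \<infinity>"
    using c by (simp add: suminf_ennreal2)
  finally have "AE \<omega> in M. (\<Sum>n. ennreal (g n \<omega>)) \<noteq> \<infinity>"
    by (intro nn_integral_noteq_infinite) auto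
  then show ?thesis
    by eventually_elim (use nonneg in \<open>auto intro: summable_suminf_not_top\<close>)
qed

text \<open>The constant of \<open>Laplace_bound_moment\<close> for \<open>a = \<alpha> / 2\<close>
  and \<open>r = m / 2\<close>: the Laplace bounds concern squares, so all orders are
  halved.\<close>

definition stable_moment_const :: "real \<Rightarrow> real \<Rightarrow> real" where
  "stable_moment_const \<alpha> m = (m / 2) / (1 - exp (-1)) * (1 / (\<alpha> / 2 - m / 2) + 1 / (m / 2))"

lemma stable_moment_const_nonneg: "0 < m \<Longrightarrow> m < \<alpha> \<Longrightarrow> 0 \<le> stable_moment_const \<alpha> m"
  by (auto simp: stable_moment_const_def intro!: mult_nonneg_nonneg divide_nonneg_nonneg add_nonneg_nonneg)

text \<open>The partial sums \<open>Q n\<close> of the squares increase and share the Laplace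
  constant \<open>suminf c\<close>, so monotone convergence bounds the moment of order
  \<open>m / 2\<close> of their supremum. Finiteness of the supremum gives summability, and by
  Pythagoras it dominates the squared norm of the series.\<close>

lemma orthonormal_series_moment:
  fixes e :: "nat \<Rightarrow> 'h::{real_inner, banach, second_countable_topology}"
  assumes M: "prob_space M" and e: "orthonormal e"
    and [measurable]: "\<And>k. X k \<in> borel_measurable M"
    and LB: "\<And>k. Laplace_bound M (\<alpha> / 2) (c k) (\<lambda>\<omega>. (X k \<omega>)\<^sup>2)"
    and c: "summable c" and m: "0 < m" "m < \<alpha>"
  shows orthonormal_series_AE_summable: "AE \<omega> in M. summable (\<lambda>k. X k \<omega> *\<^sub>R e k)"
    and "(\<integral>\<^sup>+ \<omega>. ennreal (norm (\<Sum>k. X k \<omega> *\<^sub>R e k) powr m) \<partial>M)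
      \<le> ennreal (stable_moment_const \<alpha> m * suminf c powr (m / \<alpha>))"
proof -
  define Q where "Q n \<omega> = (\<Sum>k<n. (X k \<omega>)\<^sup>2)" for n \<omega>
  define b where "b = stable_moment_const \<alpha> m * suminf c powr (m / \<alpha>)"
  have Q0: "0 \<le> Q n \<omega>" for n \<omega> by (simp add: Q_def sum_nonneg)
  have [measurable]: "Q n \<in> borel_measurable M" for n
    unfolding Q_def by measurable
  have c0: "0 \<le> c k" for k using LB[of k] by (simp add: Laplace_bound_def)
  have Qmono: "Q n \<omega> \<le> Q n' \<omega>" if "n \<le> n'" for n n' \<omega>
    unfolding Q_def using that by (intro sum_mono2) auto
  have "Laplace_bound M (\<alpha> / 2) (suminf c) (Q n)" for n
  proof (rule Laplace_bound_mono)
    show "Laplace_bound M (\<alpha> / 2) (\<Sum>k<n. c k) (Q n)"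
      unfolding Q_def using LB by (intro Laplace_bound_sum) auto
    show "(\<Sum>k<n. c k) \<le> suminf c"
      using c c0 by (intro sum_le_suminf) auto
  qed
  from Laplace_bound_moment[OF M this, of "m / 2"] m
  have "(\<integral>\<^sup>+ \<omega>. ennreal (Q n \<omega> powr (m / 2)) \<partial>M) \<le> ennreal b" for n
    by (simp add: b_def stable_moment_const_def)
  moreover have "incseq (\<lambda>n \<omega>. ennreal (Q n \<omega> powr (m / 2)))"
    using m Q0 Qmono by (auto simp: incseq_def le_fun_def intro!: ennreal_leI powr_mono2)
  ultimately have le: "(\<integral>\<^sup>+ \<omega>. (SUP n. ennreal (Q n \<omega> powr (m / 2))) \<partial>M) \<le> ennreal b"
    by (subst nn_integral_monotone_convergence_SUP) (auto intro: SUP_least)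
  then have "(\<integral>\<^sup>+ \<omega>. (SUP n. ennreal (Q n \<omega> powr (m / 2))) \<partial>M) \<noteq> \<infinity>"
    by (auto simp: top_unique)
  then have "AE \<omega> in M. (SUP n. ennreal (Q n \<omega> powr (m / 2))) \<noteq> \<infinity>"
    by (intro nn_integral_noteq_infinite) auto
  then show AE: "AE \<omega> in M. summable (\<lambda>k. X k \<omega> *\<^sub>R e k)"
  proof eventually_elim
    case (elim \<omega>)
    then obtain B where B: "(SUP n. ennreal (Q n \<omega> powr (m / 2))) = ennreal B" "0 \<le> B"
      by (cases "SUP n. ennreal (Q n \<omega> powr (m / 2))") auto
    have "Q n \<omega> \<le> B powr (2 / m)" for n
    proof -
      have "ennreal (Q n \<omega> powr (m / 2)) \<le> ennreal B"
        unfolding B(1)[symmetric] by (intro SUP_upper) auto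
      then have "Q n \<omega> powr (m / 2) \<le> B"
        using B(2) by (simp add: ennreal_le_iff)
      then have "(Q n \<omega> powr (m / 2)) powr (2 / m) \<le> B powr (2 / m)"
        using m by (intro powr_mono2) auto
      then show ?thesis
        using m Q0[of n \<omega>] by (simp add: powr_powr)
    qed
    then have "summable (\<lambda>k. (X k \<omega>)\<^sup>2)"
      by (intro summableI_nonneg_bounded) (auto simp: Q_def)
    then show ?case by (rule summable_orthonormal[OF e])
  qed
  have "AE \<omega> in M. ennreal (norm (\<Sum>k. X k \<omega> *\<^sub>R e k) powr m) \<le> (SUP n. ennreal (Q n \<omega> powr (m / 2)))"
    using AE
  proof eventually_elim
    case (elim \<omega>)
    have eq: "norm (\<Sum>k<n. X k \<omega> *\<^sub>R e k) powr m = Q n \<omega> powr (m / 2)" for n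
    proof -
      have "norm (\<Sum>k<n. X k \<omega> *\<^sub>R e k) = sqrt (Q n \<omega>)"
        by (rule real_sqrt_unique[symmetric]) (simp_all add: Q_def norm_sum_orthonormal[OF e])
      then show ?thesis
        using Q0[of n \<omega>] by (simp add: powr_half_sqrt[symmetric] powr_powr)
    qed
    have "(\<lambda>n. ennreal (norm (\<Sum>k<n. X k \<omega> *\<^sub>R e k) powr m)) \<longlonglongrightarrow> ennreal (norm (\<Sum>k. X k \<omega> *\<^sub>R e k) powr m)"
      using m by (intro tendsto_ennrealI tendsto_powr' tendsto_norm summable_LIMSEQ[OF elim] tendsto_const) auto
    then show ?case
      unfolding eq by (rule LIMSEQ_le_const2) (auto intro!: exI[of _ 0] SUP_upper)
  qed
  then have "(\<integral>\<^sup>+ \<omega>. ennreal (norm (\<Sum>k. X k \<omega> *\<^sub>R e k) powr m) \<partial>M)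
      \<le> (\<integral>\<^sup>+ \<omega>. (SUP n. ennreal (Q n \<omega> powr (m / 2))) \<partial>M)"
    by (rule nn_integral_mono_AE)
  also note le
  finally show "(\<integral>\<^sup>+ \<omega>. ennreal (norm (\<Sum>k. X k \<omega> *\<^sub>R e k) powr m) \<partial>M)
      \<le> ennreal (stable_moment_const \<alpha> m * suminf c powr (m / \<alpha>))"
    by (simp add: b_def)
qed

section \<open>Predictable modifications\<close>

lemma space_predictable_algebra:
  assumes "time_filtration M F"
  shows "space (predictable_algebra M F) = {0..} \<times> space M"
  unfolding predictable_algebra_def by (rule space_measure_of_conv)

lemma predictable_generators:
  assumes "time_filtration M F"
  shows "({{0} \<times> E | E. E \<in> sets (F 0)} \<union>
     {{s<..t} \<times> E | s t E. 0 \<le> s \<and> s \<le> t \<and> E \<in> sets (F s)}) \<subseteq> Pow ({0..} \<times> space M)"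
proof -
  have sub: "E \<subseteq> space M" if "E \<in> sets (F s)" "0 \<le> s" for E s
  proof -
    have "space (F s) = space M"
      using that assms by (simp add: time_filtration_def subalgebra_def)
    with sets.sets_into_space[OF that(1)] show ?thesis by simp
  qed
  show ?thesis
  proof (rule subsetI)
    fix G assume "G \<in> {{0} \<times> E | E. E \<in> sets (F 0)} \<union>
      {{s<..t} \<times> E | s t E. 0 \<le> s \<and> s \<le> t \<and> E \<in> sets (F s)}"
    then consider E where "G = {0} \<times> E" "E \<in> sets (F 0)"
      | s t E where "G = {s<..t} \<times> E" "0 \<le> s" "E \<in> sets (F s)" by blast
    then show "G \<in> Pow ({0..} \<times> space M)"
      by cases (use sub in \<open>auto dest: sub\<close>)
  qed
qed

lemma sets_predictable_algebra:
  assumes "time_filtration M F"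
  shows "E \<in> sets (F 0) \<Longrightarrow> {0} \<times> E \<in> sets (predictable_algebra M F)"
    and "0 \<le> s \<Longrightarrow> s \<le> t \<Longrightarrow> E \<in> sets (F s) \<Longrightarrow> {s<..t} \<times> E \<in> sets (predictable_algebra M F)"
  unfolding predictable_algebra_def sets_measure_of[OF predictable_generators[OF assms]]
  by (rule sigma_sets.Basic, rule UnI1, blast) (rule sigma_sets.Basic, rule UnI2, blast)

text \<open>A generator \<open>{s<..t} \<times> E\<close> has an empty preimage unless
  \<open>\<rho>\<close> exceeds \<open>s\<close> somewhere. Hence the events of \<open>F s\<close>
  must lie in \<open>N\<close> only for those \<open>s\<close>, and stopping \<open>\<rho>\<close>
  at a time \<open>t\<close> gives measurability with respect to \<open>F t\<close>.\<close>

lemma measurable_time_change_predictable: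
  fixes \<rho> :: "real \<Rightarrow> real"
  assumes F: "time_filtration M F" and "space N = space M" and [measurable]: "\<rho> \<in> borel_measurable borel"
    and "\<And>r. 0 \<le> \<rho> r" and F0: "sets (F 0) \<subseteq> sets N"
    and sub: "\<And>s r. 0 \<le> s \<Longrightarrow> s < \<rho> r \<Longrightarrow> sets (F s) \<subseteq> sets N"
  shows "(\<lambda>(r, \<omega>). (\<rho> r, \<omega>)) \<in> measurable (borel \<Otimes>\<^sub>M N) (predictable_algebra M F)"
  unfolding predictable_algebra_def
proof (rule measurable_measure_of[OF predictable_generators[OF F]])
  show "(\<lambda>(r, \<omega>). (\<rho> r, \<omega>)) \<in> space (borel \<Otimes>\<^sub>M N) \<rightarrow> {0..} \<times> space M"
    using assms(2,4) by (auto simp: space_pair_measure)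
  fix G assume G: "G \<in> {{0} \<times> E | E. E \<in> sets (F 0)} \<union>
     {{s<..t} \<times> E | s t E. 0 \<le> s \<and> s \<le> t \<and> E \<in> sets (F s)}"
  have vimage: "(\<lambda>(r, \<omega>). (\<rho> r, \<omega>)) -` (J \<times> E) \<inter> space (borel \<Otimes>\<^sub>M N) = (\<rho> -` J) \<times> (E \<inter> space N)" for J E
    by (auto simp: space_pair_measure)
  have \<rho>: "\<rho> -` J \<in> sets borel" if "J \<in> sets borel" for J
    using measurable_sets[OF \<open>\<rho> \<in> borel_measurable borel\<close> that] by simp
  from G consider E where "G = {0} \<times> E" "E \<in> sets (F 0)"
    | s t E where "G = {s<..t} \<times> E" "0 \<le> s" "E \<in> sets (F s)" by blast
  then show "(\<lambda>(r, \<omega>). (\<rho> r, \<omega>)) -` G \<inter> space (borel \<Otimes>\<^sub>M N) \<in> sets (borel \<Otimes>\<^sub>M N)"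
  proof cases
    case 1
    then show ?thesis using F0 unfolding 1(1) vimage by (intro pair_measureI \<rho>) auto
  next
    case 2
    show ?thesis
    proof (cases "\<exists>r. s < \<rho> r")
      case True
      with sub 2 have "E \<in> sets N" by blast
      then show ?thesis unfolding 2(1) vimage by (intro pair_measureI \<rho>) auto
    next
      case False
      then have "\<rho> -` {s<..t} = {}" by auto
      then show ?thesis unfolding 2(1) vimage by simp
    qed
  qed
qed

text \<open>Clamping expresses progressive measurability while keeping the whole real line as time
  set, so that integrals over \<open>lborel\<close> and Fubini's theorem apply directly.\<close>

lemma measurable_clamp_predictable:
  assumes "time_filtration M F" "0 \<le> t"
  shows "(\<lambda>(r, \<omega>). (max 0 (min r t), \<omega>)) \<in> measurable (borel \<Otimes>\<^sub>M F t) (predictable_algebra M F)"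
proof (rule measurable_time_change_predictable[OF assms(1)])
  show "sets (F s) \<subseteq> sets (F t)" if "0 \<le> s" "s < max 0 (min r t)" for s r
    using assms that by (auto simp: time_filtration_def)
  show "space (F t) = space M" "sets (F 0) \<subseteq> sets (F t)"
    using assms by (auto simp: time_filtration_def subalgebra_def)
qed auto

lemma measurable_pos_predictable:
  assumes "time_filtration M F"
  shows "(\<lambda>(r, \<omega>). (max 0 r, \<omega>)) \<in> measurable (borel \<Otimes>\<^sub>M M) (predictable_algebra M F)"
  using assms
  by (intro measurable_time_change_predictable) (auto simp: time_filtration_def subalgebra_def)

lemma predictable_measurable_clamp:
  assumes "time_filtration M F" "predictable_process M F X" "0 \<le> t"
  shows "(\<lambda>(r, \<omega>). X (max 0 (min r t)) \<omega>) \<in> borel_measurable (borel \<Otimes>\<^sub>M F t)"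
  using measurable_compose[OF measurable_clamp_predictable[OF assms(1,3)] assms(2)[unfolded predictable_process_def]]
  by (simp add: case_prod_beta')

lemma predictable_measurable_pos:
  assumes "time_filtration M F" "predictable_process M F X"
  shows "(\<lambda>(r, \<omega>). X (max 0 r) \<omega>) \<in> borel_measurable (borel \<Otimes>\<^sub>M M)"
  using measurable_compose[OF measurable_pos_predictable[OF assms(1)] assms(2)[unfolded predictable_process_def]]
  by (simp add: case_prod_beta')

lemma predictable_imp_adapted:
  assumes "time_filtration M F" "predictable_process M F X"
  shows "adapted_process F X"
  unfolding adapted_process_def
proof (intro allI impI)
  fix t :: real
  assume t: "0 \<le> t"
  have "(\<lambda>\<omega>. (t, \<omega>)) \<in> measurable (F t) (borel \<Otimes>\<^sub>M F t)"
    by measurable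
  from measurable_compose[OF this predictable_measurable_clamp[OF assms t]] t
  show "X t \<in> borel_measurable (F t)" by simp
qed

lemma filtration_measurable:
  assumes "time_filtration M F" "0 \<le> t" "f \<in> borel_measurable (F t)"
  shows "f \<in> borel_measurable M"
  using assms measurable_from_subalg[of M "F t"] by (auto simp: time_filtration_def)

definition Lp_uniformly_continuous ::
    "'w measure \<Rightarrow> real \<Rightarrow> (real \<Rightarrow> 'w \<Rightarrow> 'h::real_normed_vector) \<Rightarrow> bool" where
  "Lp_uniformly_continuous M p X \<longleftrightarrow> (\<forall>T>0. \<forall>\<epsilon>>0. \<exists>\<delta>>0. \<forall>s\<in>{0..T}. \<forall>t\<in>{0..T}. \<bar>s - t\<bar> < \<delta> \<longrightarrow>
     (\<integral>\<^sup>+ \<omega>. ennreal (norm (X s \<omega> - X t \<omega>) powr p) \<partial>M) \<le> ennreal \<epsilon>)"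

text \<open>On each cell the process is frozen at its value at the left end point, which is known
  when the cell begins; preimages are therefore countable unions of generators. The ceiling minus 1,
  rather than the floor, matches generators that are open on the left and closed on the
  right.\<close>

lemma predictable_left_step_process:
  fixes X :: "real \<Rightarrow> 'w \<Rightarrow> 'h::real_normed_vector"
  assumes F: "time_filtration M F" and X: "adapted_process F X" and d: "0 < d"
  shows "predictable_process M F (\<lambda>t \<omega>. if t \<le> 0 then X 0 \<omega> else X (d * of_int (\<lceil>t / d\<rceil> - 1)) \<omega>)"
  unfolding predictable_process_def
proof (rule measurableI)
  fix B :: "'h set"
  assume B: "B \<in> sets borel"
  have X0: "X t -` B \<inter> space M \<in> sets (F t)" if "0 \<le> t" for t
  proof -
    have "space (F t) = space M"
      using F that by (simp add: time_filtration_def subalgebra_def)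
    moreover have "X t \<in> borel_measurable (F t)"
      using X that by (simp add: adapted_process_def)
    ultimately show ?thesis
      using measurable_sets[of "X t" "F t" borel B] B by simp
  qed
  have cell: "\<lceil>t / d\<rceil> - 1 = int j \<longleftrightarrow> t \<in> {real j * d<..(real j + 1) * d}" for t j
    using d by (auto simp: ceiling_eq_iff field_simps)
  have "(\<lambda>(t, \<omega>). if t \<le> 0 then X 0 \<omega> else X (d * of_int (\<lceil>t / d\<rceil> - 1)) \<omega>) -` B \<inter> space (predictable_algebra M F)
    = ({0} \<times> (X 0 -` B \<inter> space M)) \<union>
      (\<Union>j. {real j * d<..(real j + 1) * d} \<times> (X (real j * d) -` B \<inter> space M))"
    (is "?L = ?R")
  proof (intro set_eqI iffI)
    fix z assume z: "z \<in> ?L"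
    then obtain t \<omega> where z_eq: "z = (t, \<omega>)" "0 \<le> t" "\<omega> \<in> space M"
      by (auto simp: space_predictable_algebra[OF F])
    show "z \<in> ?R"
    proof (cases "t = 0")
      case True
      with z z_eq show ?thesis by auto
    next
      case False
      with z_eq have t: "0 < t" by simp
      define j where "j = nat (\<lceil>t / d\<rceil> - 1)"
      have "\<lceil>t / d\<rceil> \<ge> 1" using t d by simp
      then have j: "\<lceil>t / d\<rceil> - 1 = int j" by (simp add: j_def)
      then have "t \<in> {real j * d<..(real j + 1) * d}" using cell by blast
      moreover have "X (real j * d) \<omega> \<in> B"
        using z t j by (simp add: z_eq mult.commute)
      ultimately show ?thesis using z_eq by auto
    qed
  next
    fix z assume z: "z \<in> ?R"
    then consider \<omega> where "z = (0, \<omega>)" "\<omega> \<in> space M" "X 0 \<omega> \<in> B"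
      | t \<omega> j where "z = (t, \<omega>)" "t \<in> {real j * d<..(real j + 1) * d}" "\<omega> \<in> space M" "X (real j * d) \<omega> \<in> B"
      by blast
    then show "z \<in> ?L"
    proof cases
      case 1
      then show ?thesis by (simp add: space_predictable_algebra[OF F])
    next
      case 2
      from 2(2) cell have "\<lceil>t / d\<rceil> - 1 = int j" by blast
      moreover have "0 \<le> real j * d" using d by simp
      then have "0 < t" using 2(2) by auto
      ultimately show ?thesis using 2 by (simp add: space_predictable_algebra[OF F] mult.commute)
    qed
  qed
  also have "?R \<in> sets (predictable_algebra M F)"
    using d by (intro sets.Un sets.countable_UN sets_predictable_algebra[OF F] X0) (auto intro!: sets_predictable_algebra[OF F] X0 simp: field_simps)
  finally show "(\<lambda>(t, \<omega>). if t \<le> 0 then X 0 \<omega> else X (d * of_int (\<lceil>t / d\<rceil> - 1)) \<omega>) -` B \<inter> space (predictable_algebra M F)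
    \<in> sets (predictable_algebra M F)" .
qed simp

text \<open>The modulus in L^p supplies step sizes for which the left step processes converge almost
  surely at each fixed time. Their pointwise \<open>lim\<close> is predictable whether or not the
  limit exists everywhere, so no null set has to be removed from a filtration that need not be
  complete.\<close>

lemma predictable_modification:
  fixes X :: "real \<Rightarrow> 'w \<Rightarrow> 'h::{banach, second_countable_topology}"
  assumes F: "time_filtration M F" and X: "adapted_process F X"
    and cont: "Lp_uniformly_continuous M p X" and p: "0 < p"
  shows "\<exists>Y. predictable_process M F Y \<and> (\<forall>t\<ge>0. AE \<omega> in M. Y t \<omega> = X t \<omega>)"
proof -
  have Xm[measurable]: "X t \<in> borel_measurable M" if "0 \<le> t" for t
    using X that by (intro filtration_measurable[OF F]) (auto simp: adapted_process_def)
  have "\<forall>n. \<exists>\<delta>>0. \<forall>s\<in>{0..real (Suc n)}. \<forall>t\<in>{0..real (Suc n)}. \<bar>s - t\<bar> < \<delta> \<longrightarrow>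
     (\<integral>\<^sup>+ \<omega>. ennreal (norm (X s \<omega> - X t \<omega>) powr p) \<partial>M) \<le> ennreal ((1/2)^n)"
  proof
    fix n
    have "0 < real (Suc n)" "0 < (1/2::real)^n" by auto
    then show "\<exists>\<delta>>0. \<forall>s\<in>{0..real (Suc n)}. \<forall>t\<in>{0..real (Suc n)}. \<bar>s - t\<bar> < \<delta> \<longrightarrow>
      (\<integral>\<^sup>+ \<omega>. ennreal (norm (X s \<omega> - X t \<omega>) powr p) \<partial>M) \<le> ennreal ((1/2)^n)"
      using cont unfolding Lp_uniformly_continuous_def by blast
  qed
  from choice[OF this]
  obtain \<delta> where \<delta>: "\<And>n. \<delta> n > 0"
    "\<And>n s t. s \<in> {0..real (Suc n)} \<Longrightarrow> t \<in> {0..real (Suc n)} \<Longrightarrow> \<bar>s - t\<bar> < \<delta> n \<Longrightarrow>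
     (\<integral>\<^sup>+ \<omega>. ennreal (norm (X s \<omega> - X t \<omega>) powr p) \<partial>M) \<le> ennreal ((1/2)^n)"
    by blast
  \<comment> \<open>The step is half of \<open>\<delta> n\<close>: the lag behind \<open>t\<close>
    can equal a full step and has to stay strictly below \<open>\<delta> n\<close>.\<close>
  define \<eta> where "\<eta> n t = (if t \<le> 0 then 0 else \<delta> n / 2 * of_int (\<lceil>t / (\<delta> n / 2)\<rceil> - 1))" for n t
  have \<eta>: "0 \<le> \<eta> n t" "\<eta> n t \<le> t" "\<bar>\<eta> n t - t\<bar> < \<delta> n" if "0 \<le> t" for n t
  proof -
    define d where "d = \<delta> n / 2"
    have d: "d > 0" "\<delta> n = 2 * d" using \<delta>(1)[of n] by (auto simp: d_def)
    have "0 \<le> \<eta> n t \<and> \<eta> n t \<le> t \<and> \<bar>\<eta> n t - t\<bar> < \<delta> n"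
    proof (cases "t = 0")
      case True
      then show ?thesis using d by (simp add: \<eta>_def)
    next
      case False
      with that have t: "t > 0" by simp
      define z :: real where "z = of_int (\<lceil>t / d\<rceil> - 1)"
      have "\<lceil>t / d\<rceil> \<ge> 1" using t d by simp
      then have "0 \<le> z" by (simp add: z_def)
      moreover have "z < t / d" "t / d \<le> z + 1"
        unfolding z_def by linarith+
      then have "d * z < t" "t \<le> d * z + d" using d by (auto simp: field_simps)
      moreover have "\<eta> n t = d * z" using t by (simp add: \<eta>_def d_def z_def)
      ultimately show ?thesis using d by auto
    qed
    then show "0 \<le> \<eta> n t" "\<eta> n t \<le> t" "\<bar>\<eta> n t - t\<bar> < \<delta> n" by auto
  qed
  define Y where "Y t \<omega> = lim (\<lambda>n. X (\<eta> n t) \<omega>)" for t \<omega>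
  have pred: "predictable_process M F (\<lambda>t. X (\<eta> n t))" for n
  proof -
    have eq: "(\<lambda>t. X (\<eta> n t)) = (\<lambda>t \<omega>. if t \<le> 0 then X 0 \<omega> else X (\<delta> n / 2 * of_int (\<lceil>t / (\<delta> n / 2)\<rceil> - 1)) \<omega>)"
      by (auto simp: \<eta>_def fun_eq_iff)
    show ?thesis
      unfolding eq using \<delta>(1)[of n] by (intro predictable_left_step_process[OF F X]) simp
  qed
  have "predictable_process M F Y"
    unfolding predictable_process_def Y_def case_prod_beta'
    by (rule borel_measurable_lim_metric) (use pred in \<open>simp add: predictable_process_def case_prod_beta'\<close>)
  moreover have "AE \<omega> in M. Y t \<omega> = X t \<omega>" if t: "0 \<le> t" for t
  proof -
    \<comment> \<open>The estimate with index \<open>n\<close> holds on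
      \<open>{0..real (Suc n)}\<close> only; dropping the first \<open>n0\<close> terms brings
      \<open>t\<close> into range.\<close>
    obtain n0 :: nat where n0: "t \<le> real n0" using real_arch_simple by blast
    have "AE \<omega> in M. summable (\<lambda>n. norm (X (\<eta> (n + n0) t) \<omega> - X t \<omega>) powr p)"
    proof (rule AE_summable_nn_integral)
      show "(\<lambda>\<omega>. norm (X (\<eta> (n + n0) t) \<omega> - X t \<omega>) powr p) \<in> borel_measurable M" for n
        using Xm[OF t] Xm[OF \<eta>(1)[OF t]] by measurable
      show "(\<integral>\<^sup>+ \<omega>. ennreal (norm (X (\<eta> (n + n0) t) \<omega> - X t \<omega>) powr p) \<partial>M) \<le> ennreal ((1/2) ^ (n + n0))" for n
        using \<eta>[OF t, of "n + n0"] n0 t by (intro \<delta>(2)) auto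
      show "summable (\<lambda>n. (1/2) ^ (n + n0) :: real)"
        by (intro summable_ignore_initial_segment summable_geometric) auto
    qed auto
    then show ?thesis
    proof eventually_elim
      case (elim \<omega>)
      then have "(\<lambda>n. norm (X (\<eta> (n + n0) t) \<omega> - X t \<omega>) powr p) \<longlonglongrightarrow> 0"
        by (rule summable_LIMSEQ_zero)
      from tendsto_powr'[OF this tendsto_const[of "1 / p"]] p
      have "(\<lambda>n. norm (X (\<eta> (n + n0) t) \<omega> - X t \<omega>)) \<longlonglongrightarrow> 0"
        by (simp add: powr_powr)
      then have "(\<lambda>n. X (\<eta> (n + n0) t) \<omega> - X t \<omega>) \<longlonglongrightarrow> 0"
        by (rule tendsto_norm_zero_cancel)
      then have "(\<lambda>n. X (\<eta> (n + n0) t) \<omega>) \<longlonglongrightarrow> X t \<omega>"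
        by (rule LIM_zero_cancel)
      then have "(\<lambda>n. X (\<eta> n t) \<omega>) \<longlonglongrightarrow> X t \<omega>"
        by (rule LIMSEQ_offset)
      then show ?case unfolding Y_def by (rule limI)
    qed
  qed
  ultimately show ?thesis by blast
qed

section \<open>Linear combinations of stable increments\<close>

lemma Laplace_bound_abs_moment:
  assumes "prob_space M" "Laplace_bound M (\<alpha> / 2) c (\<lambda>\<omega>. (X \<omega>)\<^sup>2)" "0 < m" "m < \<alpha>"
  shows "(\<integral>\<^sup>+ \<omega>. ennreal (\<bar>X \<omega>\<bar> powr m) \<partial>M) \<le> ennreal (stable_moment_const \<alpha> m * c powr (m / \<alpha>))"
proof -
  have "(X \<omega>)\<^sup>2 powr (m / 2) = \<bar>X \<omega>\<bar> powr m" for \<omega>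
  proof -
    have "(X \<omega>)\<^sup>2 powr (m / 2) = ((X \<omega>)\<^sup>2 powr (1 / 2)) powr m"
      by (subst powr_powr) simp
    then show ?thesis by (simp add: powr_half_sqrt)
  qed
  with Laplace_bound_moment[OF assms(1,2), of "m / 2"] assms show ?thesis
    by (simp add: stable_moment_const_def)
qed

text \<open>Independent increments multiply the characteristic functions, so the combination is
  again symmetric \<alpha>-stable, with the Riemann sum of
  \<open>\<bar>a i\<bar> powr \<alpha>\<close> as its scale. The estimates for stochastic integrals
  come from this bound by a choice of the coefficients.\<close>

lemma symmetric_stable_increments_Laplace_bound:
  assumes M: "prob_space M" and L: "symmetric_stable_process M \<alpha> L" and \<alpha>: "0 < \<alpha>" "\<alpha> \<le> 2"
    and \<tau>: "0 \<le> \<tau> 0" "\<And>i. i < n \<Longrightarrow> \<tau> i \<le> \<tau> (Suc i)"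
  shows "Laplace_bound M (\<alpha> / 2) (4 * (\<Sum>i<n. \<bar>a i\<bar> powr \<alpha> * (\<tau> (Suc i) - \<tau> i)))
    (\<lambda>\<omega>. (\<Sum>i<n. a i * (L (\<tau> (Suc i)) \<omega> - L (\<tau> i) \<omega>))\<^sup>2)"
proof (rule stable_Laplace_bound[OF M _ \<alpha>])
  interpret prob_space M by fact
  have \<tau>0: "0 \<le> \<tau> i" if "i \<le> n" for i
    using that
  proof (induction i)
    case (Suc i)
    then show ?case using \<tau>(2)[of i] by auto
  qed (use \<tau> in simp)
  have Lm: "L s \<in> borel_measurable M" if "0 \<le> s" for s
    using L that by (simp add: symmetric_stable_process_def)
  show "(\<lambda>\<omega>. \<Sum>i<n. a i * (L (\<tau> (Suc i)) \<omega> - L (\<tau> i) \<omega>)) \<in> borel_measurable M"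
    by (intro borel_measurable_sum borel_measurable_times borel_measurable_diff borel_measurable_const Lm \<tau>0) auto
  show "0 \<le> (\<Sum>i<n. \<bar>a i\<bar> powr \<alpha> * (\<tau> (Suc i) - \<tau> i))"
    using \<tau> by (intro sum_nonneg mult_nonneg_nonneg) auto
  fix h
  have "indep_vars (\<lambda>_. borel) (\<lambda>i \<omega>. L (\<tau> (Suc i)) \<omega> - L (\<tau> i) \<omega>) {..<n}"
    using L \<tau> unfolding symmetric_stable_process_def by blast
  then have ind: "indep_vars (\<lambda>_. borel) (\<lambda>i \<omega>. a i * (L (\<tau> (Suc i)) \<omega> - L (\<tau> i) \<omega>)) {..<n}"
    by (rule indep_vars_compose2) auto
  have char: "char (distr M borel (\<lambda>\<omega>. a i * (L (\<tau> (Suc i)) \<omega> - L (\<tau> i) \<omega>))) h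
    = complex_of_real (exp (- (\<bar>a i\<bar> powr \<alpha> * (\<tau> (Suc i) - \<tau> i)) * \<bar>h\<bar> powr \<alpha>))" if "i < n" for i
  proof -
    have m: "(\<lambda>\<omega>. L (\<tau> (Suc i)) \<omega> - L (\<tau> i) \<omega>) \<in> borel_measurable M"
      using that by (intro borel_measurable_diff Lm \<tau>0) auto
    define d where "d = \<tau> (Suc i) - \<tau> i"
    have d: "0 \<le> d" "\<tau> i + d = \<tau> (Suc i)" using \<tau>(2)[OF that] by (auto simp: d_def)
    have "char (distr M borel (\<lambda>\<omega>. a i * (L (\<tau> (Suc i)) \<omega> - L (\<tau> i) \<omega>))) h
      = char (law M (\<lambda>\<omega>. L (\<tau> (Suc i)) \<omega> - L (\<tau> i) \<omega>)) (h * a i)"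
      using m by (simp add: char_def law_def integral_distr mult.assoc)
    also have "law M (\<lambda>\<omega>. L (\<tau> (Suc i)) \<omega> - L (\<tau> i) \<omega>) = law M (L d)"
      using L \<tau>0[of i] that d unfolding symmetric_stable_process_def by (metis less_imp_le)
    also have "char (law M (L d)) (h * a i) = complex_of_real (exp (- d * \<bar>h * a i\<bar> powr \<alpha>))"
      using L d(1) unfolding symmetric_stable_process_def by blast
    also have "- d * \<bar>h * a i\<bar> powr \<alpha> = - (\<bar>a i\<bar> powr \<alpha> * d) * \<bar>h\<bar> powr \<alpha>"
      by (simp add: abs_mult powr_mult)
    finally show ?thesis by (simp add: d_def)
  qed
  have "char (distr M borel (\<lambda>\<omega>. \<Sum>i<n. a i * (L (\<tau> (Suc i)) \<omega> - L (\<tau> i) \<omega>))) h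
    = (\<Prod>i<n. complex_of_real (exp (- (\<bar>a i\<bar> powr \<alpha> * (\<tau> (Suc i) - \<tau> i)) * \<bar>h\<bar> powr \<alpha>)))"
    unfolding char_distr_sum[OF ind] by (intro prod.cong refl char) simp
  also have "\<dots> = complex_of_real (exp (\<Sum>i<n. - (\<bar>a i\<bar> powr \<alpha> * (\<tau> (Suc i) - \<tau> i)) * \<bar>h\<bar> powr \<alpha>))"
    by (simp add: exp_sum)
  also have "(\<Sum>i<n. - (\<bar>a i\<bar> powr \<alpha> * (\<tau> (Suc i) - \<tau> i)) * \<bar>h\<bar> powr \<alpha>)
    = - (\<Sum>i<n. \<bar>a i\<bar> powr \<alpha> * (\<tau> (Suc i) - \<tau> i)) * \<bar>h\<bar> powr \<alpha>"
    by (simp add: sum_distrib_right sum_negf)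
  finally show "char (distr M borel (\<lambda>\<omega>. \<Sum>i<n. a i * (L (\<tau> (Suc i)) \<omega> - L (\<tau> i) \<omega>))) h
    = complex_of_real (exp (- (\<Sum>i<n. \<bar>a i\<bar> powr \<alpha> * (\<tau> (Suc i) - \<tau> i)) * \<bar>h\<bar> powr \<alpha>))" .
qed

section \<open>Existence of the stochastic integral\<close>

definition partition_upto :: "real \<Rightarrow> real \<Rightarrow> nat \<Rightarrow> (nat \<Rightarrow> real) \<Rightarrow> bool" where
  "partition_upto \<delta> t n \<tau> \<longleftrightarrow> \<tau> 0 = 0 \<and> \<tau> n = t \<and> (\<forall>i<n. \<tau> i \<le> \<tau> (Suc i) \<and> \<tau> (Suc i) - \<tau> i < \<delta>)"

definition left_sum :: "(real \<Rightarrow> real) \<Rightarrow> (real \<Rightarrow> 'w \<Rightarrow> real) \<Rightarrow> nat \<Rightarrow> (nat \<Rightarrow> real) \<Rightarrow> 'w \<Rightarrow> real" where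
  "left_sum f L n \<tau> \<omega> = (\<Sum>i<n. f (\<tau> i) * (L (\<tau> (Suc i)) \<omega> - L (\<tau> i) \<omega>))"

lemma partition_upto_mono:
  assumes "partition_upto \<delta> t n \<tau>" "i \<le> j" "j \<le> n"
  shows "\<tau> i \<le> \<tau> j"
  using assms(2,3)
proof (induction j rule: dec_induct)
  case (step j)
  then have "\<tau> j \<le> \<tau> (Suc j)" using assms(1) by (simp add: partition_upto_def)
  with step show ?case by simp
qed simp

lemma partition_upto_range:
  assumes "partition_upto \<delta> t n \<tau>" "i \<le> n"
  shows "0 \<le> \<tau> i" "\<tau> i \<le> t"
  using partition_upto_mono[OF assms(1), of 0 i] partition_upto_mono[OF assms(1), of i n] assms
  by (auto simp: partition_upto_def)

lemma uniform_partition_upto: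
  assumes "0 \<le> t" "0 < N" "t / real N < \<delta>"
  shows "partition_upto \<delta> t N (\<lambda>i. t * real i / real N)"
  using assms by (auto simp: partition_upto_def field_simps)

text \<open>The sum runs over all cells of \<open>U\<close>, with weight 0 outside \<open>a\<close>
  and \<open>b\<close>. The index set does not depend on \<open>a\<close> and \<open>b\<close>,
  which permits an exchange of sums when a whole partition is refined.\<close>

lemma telescope_sorted_list:
  fixes g :: "real \<Rightarrow> real"
  assumes "finite U" "a \<in> U" "b \<in> U" "a \<le> b"
  defines "\<rho> \<equiv> sorted_list_of_set U"
  shows "g b - g a = (\<Sum>k<card U - 1. of_bool (a \<le> \<rho> ! k \<and> \<rho> ! k < b) * (g (\<rho> ! Suc k) - g (\<rho> ! k)))"
proof -
  have len: "length \<rho> = card U" and set: "set \<rho> = U" and sd: "sorted_wrt (<) \<rho>"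
    using assms by (auto simp: \<rho>_def)
  from assms set obtain p q where p: "p < card U" "\<rho> ! p = a" and q: "q < card U" "\<rho> ! q = b"
    by (metis in_set_conv_nth len)
  have less: "\<rho> ! i < \<rho> ! j \<longleftrightarrow> i < j" if "i < card U" "j < card U" for i j
    using sd that len sorted_wrt_nth_less[OF sd, of i j] sorted_wrt_nth_less[OF sd, of j i]
    by (metis less_asym less_irrefl linorder_neqE_nat)
  have "p \<le> q" using less[of q p] p q assms(4) by (simp add: not_less[symmetric])
  have eq: "a \<le> \<rho> ! k \<and> \<rho> ! k < b \<longleftrightarrow> p \<le> k \<and> k < q" if "k < card U - 1" for k
  proof -
    have "k < card U" using that by simp
    then show ?thesis using less[of k p] less[of k q] p q by (auto simp: not_less[symmetric])
  qed
  have "(\<Sum>k<card U - 1. of_bool (a \<le> \<rho> ! k \<and> \<rho> ! k < b) * (g (\<rho> ! Suc k) - g (\<rho> ! k)))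
    = (\<Sum>k<card U - 1. if k \<in> {p..<q} then g (\<rho> ! Suc k) - g (\<rho> ! k) else 0)"
    by (intro sum.cong refl) (simp add: eq)
  also have "\<dots> = (\<Sum>k\<in>{..<card U - 1} \<inter> {p..<q}. g (\<rho> ! Suc k) - g (\<rho> ! k))"
    by (rule sum.inter_restrict[symmetric]) simp
  also have "{..<card U - 1} \<inter> {p..<q} = {p..<q}" using q by auto
  also have "(\<Sum>k\<in>{p..<q}. g (\<rho> ! Suc k) - g (\<rho> ! k)) = g (\<rho> ! q) - g (\<rho> ! p)"
    using \<open>p \<le> q\<close> by (rule sum_Suc_diff')
  finally show ?thesis using p q by simp
qed

text \<open>The coefficient of a cell of \<open>U\<close> is the step function of \<tau> at its left
  end point. Left sums over two partitions become comparable once both are written over the union of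
  their points.\<close>

lemma left_sum_refine:
  assumes \<tau>: "partition_upto \<delta> t n \<tau>" and U: "finite U" "\<tau> ` {..n} \<subseteq> U"
  defines "\<rho> \<equiv> sorted_list_of_set U"
  shows "left_sum f L n \<tau> \<omega> = (\<Sum>k<card U - 1.
    (\<Sum>i<n. f (\<tau> i) * of_bool (\<tau> i \<le> \<rho> ! k \<and> \<rho> ! k < \<tau> (Suc i))) * (L (\<rho> ! Suc k) \<omega> - L (\<rho> ! k) \<omega>))"
proof -
  have "left_sum f L n \<tau> \<omega> = (\<Sum>i<n. f (\<tau> i) * (\<Sum>k<card U - 1.
    of_bool (\<tau> i \<le> \<rho> ! k \<and> \<rho> ! k < \<tau> (Suc i)) * (L (\<rho> ! Suc k) \<omega> - L (\<rho> ! k) \<omega>)))"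
    unfolding left_sum_def
  proof (intro sum.cong refl arg_cong2[where f=times])
    fix i assume i: "i \<in> {..<n}"
    show "L (\<tau> (Suc i)) \<omega> - L (\<tau> i) \<omega> = (\<Sum>k<card U - 1.
      of_bool (\<tau> i \<le> \<rho> ! k \<and> \<rho> ! k < \<tau> (Suc i)) * (L (\<rho> ! Suc k) \<omega> - L (\<rho> ! k) \<omega>))"
      unfolding \<rho>_def
    proof (rule telescope_sorted_list[OF U(1), where g="\<lambda>s. L s \<omega>"])
      show "\<tau> i \<in> U" "\<tau> (Suc i) \<in> U" "\<tau> i \<le> \<tau> (Suc i)"
        using i U(2) \<tau> by (auto simp: partition_upto_def)
    qed
  qed
  also have "\<dots> = (\<Sum>i<n. \<Sum>k<card U - 1. f (\<tau> i) *
    of_bool (\<tau> i \<le> \<rho> ! k \<and> \<rho> ! k < \<tau> (Suc i)) * (L (\<rho> ! Suc k) \<omega> - L (\<rho> ! k) \<omega>))"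
    by (simp only: sum_distrib_left mult.assoc)
  also have "\<dots> = (\<Sum>k<card U - 1. \<Sum>i<n. f (\<tau> i) *
    of_bool (\<tau> i \<le> \<rho> ! k \<and> \<rho> ! k < \<tau> (Suc i)) * (L (\<rho> ! Suc k) \<omega> - L (\<rho> ! k) \<omega>))"
    by (rule sum.swap)
  finally show ?thesis by (simp only: sum_distrib_right)
qed

text \<open>The indicators of the cells telescope to 1 at \<open>s\<close>. This selects the cell
  containing \<open>s\<close> without locating it and allows repeated points in the
  partition.\<close>

lemma step_function_approx:
  fixes f :: "real \<Rightarrow> real"
  assumes \<tau>: "partition_upto \<delta> t n \<tau>" and s: "0 \<le> s" "s < t"
    and f: "\<And>u v. u \<in> {0..t} \<Longrightarrow> v \<in> {0..t} \<Longrightarrow> \<bar>u - v\<bar> < \<delta> \<Longrightarrow> \<bar>f u - f v\<bar> \<le> \<eta>"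
  shows "\<bar>(\<Sum>i<n. f (\<tau> i) * of_bool (\<tau> i \<le> s \<and> s < \<tau> (Suc i))) - f s\<bar> \<le> \<eta>"
proof -
  let ?b = "\<lambda>i. of_bool (\<tau> i \<le> s \<and> s < \<tau> (Suc i)) :: real"
  have "(\<Sum>i<n. ?b i) = (\<Sum>i<n. of_bool (\<tau> i \<le> s) - of_bool (\<tau> (Suc i) \<le> s))"
    using \<tau> by (intro sum.cong refl) (fastforce simp: partition_upto_def of_bool_def)
  also have "\<dots> = of_bool (\<tau> 0 \<le> s) - of_bool (\<tau> n \<le> s)"
    by (rule sum_lessThan_telescope')
  also have "\<dots> = 1" using \<tau> s by (simp add: partition_upto_def)
  finally have one: "(\<Sum>i<n. ?b i) = 1" .
  have "(\<Sum>i<n. f (\<tau> i) * ?b i) - f s = (\<Sum>i<n. (f (\<tau> i) - f s) * ?b i)"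
    by (simp add: left_diff_distrib sum_subtractf one flip: sum_distrib_left)
  also have "\<bar>\<dots>\<bar> \<le> (\<Sum>i<n. \<bar>(f (\<tau> i) - f s) * ?b i\<bar>)" by (rule sum_abs)
  also have "\<dots> \<le> (\<Sum>i<n. \<eta> * ?b i)"
  proof (intro sum_mono)
    fix i assume i: "i \<in> {..<n}"
    show "\<bar>(f (\<tau> i) - f s) * ?b i\<bar> \<le> \<eta> * ?b i"
    proof (cases "\<tau> i \<le> s \<and> s < \<tau> (Suc i)")
      case True
      then have "\<bar>\<tau> i - s\<bar> < \<delta>" using \<tau> i by (fastforce simp: partition_upto_def)
      with f[of "\<tau> i" s] True partition_upto_range[OF \<tau>, of i] i s show ?thesis by auto
    next
      case False
      then show ?thesis by (simp only: of_bool_eq_0_iff) simp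
    qed
  qed
  also have "\<dots> = \<eta>" by (simp add: one flip: sum_distrib_left)
  finally show ?thesis .
qed

text \<open>On the common refinement both step functions are within \<eta> of \<open>f\<close>, so
  the difference has coefficients of size at most \<open>2 * \<eta>\<close> over a total length of
  at most \<open>t\<close>.\<close>

lemma left_sum_diff_Laplace_bound:
  assumes M: "prob_space M" and L: "symmetric_stable_process M \<alpha> L" and \<alpha>: "0 < \<alpha>" "\<alpha> \<le> 2"
    and \<tau>: "partition_upto \<delta> t n \<tau>" and \<sigma>: "partition_upto \<delta> t m \<sigma>"
    and f: "\<And>u v. u \<in> {0..t} \<Longrightarrow> v \<in> {0..t} \<Longrightarrow> \<bar>u - v\<bar> < \<delta> \<Longrightarrow> \<bar>f u - f v\<bar> \<le> \<eta>"
    and \<eta>: "0 \<le> \<eta>"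
  shows "Laplace_bound M (\<alpha> / 2) (4 * ((2 * \<eta>) powr \<alpha> * t))
    (\<lambda>\<omega>. (left_sum f L n \<tau> \<omega> - left_sum f L m \<sigma> \<omega>)\<^sup>2)"
proof -
  define U where "U = \<tau> ` {..n} \<union> \<sigma> ` {..m}"
  define \<rho> where "\<rho> = sorted_list_of_set U"
  have U: "finite U" "\<tau> ` {..n} \<subseteq> U" "\<sigma> ` {..m} \<subseteq> U" "U \<noteq> {}" by (auto simp: U_def)
  have len: "length \<rho> = card U" and set: "set \<rho> = U" and sd: "sorted_wrt (<) \<rho>"
    using U by (auto simp: \<rho>_def)
  have card: "card U > 0" using U by (simp add: card_gt_0_iff)
  have U0t: "U \<subseteq> {0..t}"
    using partition_upto_range[OF \<tau>] partition_upto_range[OF \<sigma>] by (auto simp: U_def)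
  have \<rho>U: "\<rho> ! k \<in> {0..t}" if "k < card U" for k
  proof -
    have "\<rho> ! k \<in> set \<rho>" using that len by simp
    then show ?thesis unfolding set using U0t by (rule subsetD[rotated])
  qed
  have \<rho>_less: "\<rho> ! k < \<rho> ! Suc k" if "k < card U - 1" for k
    using sorted_wrt_nth_less[OF sd, of k "Suc k"] that len by simp
  define \<phi> where "\<phi> s = (\<Sum>i<n. f (\<tau> i) * of_bool (\<tau> i \<le> s \<and> s < \<tau> (Suc i)))" for s
  define \<psi> where "\<psi> s = (\<Sum>i<m. f (\<sigma> i) * of_bool (\<sigma> i \<le> s \<and> s < \<sigma> (Suc i)))" for s
  define a where "a k = \<phi> (\<rho> ! k) - \<psi> (\<rho> ! k)" for k
  have eq: "left_sum f L n \<tau> \<omega> - left_sum f L m \<sigma> \<omega> = (\<Sum>k<card U - 1. a k * (L (\<rho> ! Suc k) \<omega> - L (\<rho> ! k) \<omega>))" for \<omega>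
    unfolding left_sum_refine[OF \<tau> U(1,2)] left_sum_refine[OF \<sigma> U(1,3)]
    by (simp add: a_def \<phi>_def \<psi>_def \<rho>_def left_diff_distrib sum_subtractf)
  have a: "\<bar>a k\<bar> \<le> 2 * \<eta>" if k: "k < card U - 1" for k
  proof -
    have s: "0 \<le> \<rho> ! k" "\<rho> ! k < t"
      using \<rho>U[of k] \<rho>U[of "Suc k"] \<rho>_less[OF k] less_diff_conv[of k "card U" 1] k by auto
    have "\<bar>\<phi> (\<rho> ! k) - f (\<rho> ! k)\<bar> \<le> \<eta>"
      unfolding \<phi>_def using f by (rule step_function_approx[OF \<tau> s])
    moreover have "\<bar>\<psi> (\<rho> ! k) - f (\<rho> ! k)\<bar> \<le> \<eta>"
      unfolding \<psi>_def using f by (rule step_function_approx[OF \<sigma> s])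
    ultimately show ?thesis by (simp add: a_def)
  qed
  have "Laplace_bound M (\<alpha> / 2) (4 * (\<Sum>k<card U - 1. \<bar>a k\<bar> powr \<alpha> * (\<rho> ! Suc k - \<rho> ! k)))
    (\<lambda>\<omega>. (\<Sum>k<card U - 1. a k * (L (\<rho> ! Suc k) \<omega> - L (\<rho> ! k) \<omega>))\<^sup>2)"
    using \<rho>U[OF card] \<rho>_less
    by (intro symmetric_stable_increments_Laplace_bound[OF M L \<alpha>, where \<tau>="\<lambda>k. \<rho> ! k"]) (auto intro: less_imp_le)
  moreover have "(\<Sum>k<card U - 1. \<bar>a k\<bar> powr \<alpha> * (\<rho> ! Suc k - \<rho> ! k)) \<le> (2 * \<eta>) powr \<alpha> * t"
  proof -
    have "(\<Sum>k<card U - 1. \<bar>a k\<bar> powr \<alpha> * (\<rho> ! Suc k - \<rho> ! k))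
      \<le> (\<Sum>k<card U - 1. (2 * \<eta>) powr \<alpha> * (\<rho> ! Suc k - \<rho> ! k))"
      using a \<rho>_less \<alpha> by (intro sum_mono mult_right_mono powr_mono2) (auto intro: less_imp_le)
    also have "\<dots> = (2 * \<eta>) powr \<alpha> * (\<rho> ! (card U - 1) - \<rho> ! 0)"
      by (simp add: sum_lessThan_telescope[of "\<lambda>k. \<rho> ! k"] flip: sum_distrib_left)
    also have "\<dots> \<le> (2 * \<eta>) powr \<alpha> * t"
      using \<rho>U[of 0] \<rho>U[of "card U - 1"] card by (intro mult_left_mono) auto
    finally show ?thesis .
  qed
  ultimately show ?thesis
    unfolding eq by (rule Laplace_bound_mono[OF _ mult_left_mono]) simp
qed

text \<open>As \<open>f\<close> is uniformly continuous and \<open>1 < \<alpha>\<close>, the left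
  sums are Cauchy in L^1 when the mesh tends to 0. The integral is the pointwise limit along one
  sequence of uniform partitions, hence measurable for \<open>G\<close>; the Cauchy property
  compares every other fine partition with that sequence.\<close>

lemma stochastic_integral_exists:
  assumes M: "prob_space M" and L: "symmetric_stable_process M \<alpha> L" and \<alpha>: "1 < \<alpha>" "\<alpha> \<le> 2"
    and f: "continuous_on {0..t} f" and t: "0 \<le> t"
    and G: "subalgebra M G" and LG: "\<And>s. 0 \<le> s \<Longrightarrow> s \<le> t \<Longrightarrow> L s \<in> borel_measurable G"
  shows "\<exists>I\<in>borel_measurable G. has_stochastic_integral M f L t I"
proof -
  interpret prob_space M by fact
  define K where "K = stable_moment_const \<alpha> 1"
  have K: "0 \<le> K" unfolding K_def using \<alpha> by (intro stable_moment_const_nonneg) auto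
  have LSG: "left_sum f L n \<tau> \<in> borel_measurable G" if "partition_upto \<delta> t n \<tau>" for \<delta> n \<tau>
    unfolding left_sum_def
    using partition_upto_range[OF that]
    by (intro borel_measurable_sum borel_measurable_times borel_measurable_diff borel_measurable_const LG) auto
  have LSM: "left_sum f L n \<tau> \<in> borel_measurable M" if "partition_upto \<delta> t n \<tau>" for \<delta> n \<tau>
    using measurable_from_subalg[OF G LSG[OF that]] .
  have cauchy: "\<exists>\<delta>>0. \<forall>n \<tau> m \<sigma>. partition_upto \<delta> t n \<tau> \<longrightarrow> partition_upto \<delta> t m \<sigma> \<longrightarrow>
      (\<integral>\<^sup>+ \<omega>. ennreal \<bar>left_sum f L n \<tau> \<omega> - left_sum f L m \<sigma> \<omega>\<bar> \<partial>M) \<le> ennreal \<epsilon>" if \<epsilon>: "0 < \<epsilon>" for \<epsilon>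
  proof -
    have "((\<lambda>\<eta>. K * (4 * ((2 * \<eta>) powr \<alpha> * t)) powr (1 / \<alpha>)) \<longlongrightarrow> K * (4 * ((2 * 0) powr \<alpha> * t)) powr (1 / \<alpha>)) (at_right 0)"
      using \<alpha> t by (intro tendsto_mult tendsto_const tendsto_powr' tendsto_ident_at)
        (auto simp: eventually_at_filter intro!: always_eventually mult_nonneg_nonneg)
    then have "((\<lambda>\<eta>. K * (4 * ((2 * \<eta>) powr \<alpha> * t)) powr (1 / \<alpha>)) \<longlongrightarrow> 0) (at_right 0)"
      by simp
    then have "eventually (\<lambda>\<eta>. K * (4 * ((2 * \<eta>) powr \<alpha> * t)) powr (1 / \<alpha>) < \<epsilon>) (at_right 0)"
      using \<epsilon> by (rule order_tendstoD)
    moreover have "eventually (\<lambda>\<eta>. 0 < \<eta>) (at_right (0::real))"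
      by (rule eventually_at_right_less)
    ultimately obtain \<eta> where \<eta>: "0 < \<eta>" "K * (4 * ((2 * \<eta>) powr \<alpha> * t)) powr (1 / \<alpha>) < \<epsilon>"
      using eventually_happens[OF eventually_conj] trivial_limit_at_right_real by blast
    have "uniformly_continuous_on {0..t} f"
      using f by (rule compact_uniformly_continuous) simp
    then obtain \<delta> where \<delta>: "0 < \<delta>" "\<And>u v. u \<in> {0..t} \<Longrightarrow> v \<in> {0..t} \<Longrightarrow> \<bar>u - v\<bar> < \<delta> \<Longrightarrow> \<bar>f u - f v\<bar> < \<eta>"
      using \<eta>(1) unfolding uniformly_continuous_on_def dist_real_def by (metis abs_minus_commute)
    show ?thesis
    proof (intro exI[of _ \<delta>] conjI allI impI \<delta>(1))
      fix n \<tau> m \<sigma> assume \<tau>: "partition_upto \<delta> t n \<tau>" and \<sigma>: "partition_upto \<delta> t m \<sigma>"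
      have "Laplace_bound M (\<alpha> / 2) (4 * ((2 * \<eta>) powr \<alpha> * t)) (\<lambda>\<omega>. (left_sum f L n \<tau> \<omega> - left_sum f L m \<sigma> \<omega>)\<^sup>2)"
        using \<delta>(2) \<eta>(1) \<alpha>
        by (intro left_sum_diff_Laplace_bound[OF M L _ _ \<tau> \<sigma>]) (auto intro: less_imp_le)
      from Laplace_bound_abs_moment[OF M this, of 1] \<alpha>
      have "(\<integral>\<^sup>+ \<omega>. ennreal \<bar>left_sum f L n \<tau> \<omega> - left_sum f L m \<sigma> \<omega>\<bar> \<partial>M) \<le> ennreal (K * (4 * ((2 * \<eta>) powr \<alpha> * t)) powr (1 / \<alpha>))"
        by (simp add: K_def)
      also have "\<dots> \<le> ennreal \<epsilon>" using \<eta>(2) by (intro ennreal_leI) simp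
      finally show "(\<integral>\<^sup>+ \<omega>. ennreal \<bar>left_sum f L n \<tau> \<omega> - left_sum f L m \<sigma> \<omega>\<bar> \<partial>M) \<le> ennreal \<epsilon>" .
    qed
  qed
  have "\<forall>j. \<exists>\<delta>>0. \<forall>n \<tau> m \<sigma>. partition_upto \<delta> t n \<tau> \<longrightarrow> partition_upto \<delta> t m \<sigma> \<longrightarrow>
      (\<integral>\<^sup>+ \<omega>. ennreal \<bar>left_sum f L n \<tau> \<omega> - left_sum f L m \<sigma> \<omega>\<bar> \<partial>M) \<le> ennreal ((1/2)^j)"
    by (intro allI cauchy) simp
  from choice[OF this] obtain \<delta> where \<delta>: "\<And>j. \<delta> j > 0"
    "\<And>j n \<tau> m \<sigma>. partition_upto (\<delta> j) t n \<tau> \<Longrightarrow> partition_upto (\<delta> j) t m \<sigma> \<Longrightarrow>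
      (\<integral>\<^sup>+ \<omega>. ennreal \<bar>left_sum f L n \<tau> \<omega> - left_sum f L m \<sigma> \<omega>\<bar> \<partial>M) \<le> ennreal ((1/2)^j)"
    by blast
  \<comment> \<open>The j-th partition is fine enough for all levels up to \<open>j\<close>, so that
    the tail of the sequence can be compared at any given level.\<close>
  have "\<forall>j. \<exists>N>0. \<forall>i\<le>j. t / real N < \<delta> i"
  proof
    fix j
    obtain \<mu> where \<mu>: "0 < \<mu>" "\<And>i. i \<le> j \<Longrightarrow> \<mu> \<le> \<delta> i"
    proof
      show "0 < Min (\<delta> ` {..j})" using \<delta>(1) by (subst Min_gr_iff) auto
      show "Min (\<delta> ` {..j}) \<le> \<delta> i" if "i \<le> j" for i using that by (intro Min_le) auto
    qed
    obtain N where N: "real N > t / \<mu>" using reals_Archimedean2 by blast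
    moreover have "0 \<le> t / \<mu>" using t \<mu> by simp
    ultimately have "0 < N" by linarith
    moreover from N \<mu> this have "t / real N < \<mu>" by (simp add: field_simps)
    ultimately show "\<exists>N>0. \<forall>i\<le>j. t / real N < \<delta> i"
      using \<mu>(2) by (meson less_le_trans)
  qed
  from choice[OF this] obtain N where N: "\<And>j. N j > 0" "\<And>i j. i \<le> j \<Longrightarrow> t / real (N j) < \<delta> i"
    by blast
  define \<tau> where "\<tau> j i = t * real i / real (N j)" for j i
  have \<tau>: "partition_upto (\<delta> i) t (N j) (\<tau> j)" if "i \<le> j" for i j
    unfolding \<tau>_def using N that t by (intro uniform_partition_upto) auto
  define X where "X j = left_sum f L (N j) (\<tau> j)" for j
  have XG: "X j \<in> borel_measurable G" for j unfolding X_def by (rule LSG[OF \<tau>[of 0 j]]) simp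
  have [measurable]: "X j \<in> borel_measurable M" for j unfolding X_def by (rule LSM[OF \<tau>[of 0 j]]) simp
  define I where "I \<omega> = lim (\<lambda>j. X j \<omega>)" for \<omega>
  have IG: "I \<in> borel_measurable G" unfolding I_def by (rule borel_measurable_lim_metric[OF XG])
  have [measurable]: "I \<in> borel_measurable M" using measurable_from_subalg[OF G IG] .
  have "AE \<omega> in M. summable (\<lambda>j. \<bar>X (Suc j) \<omega> - X j \<omega>\<bar>)"
  proof (rule AE_summable_nn_integral)
    show "(\<integral>\<^sup>+ \<omega>. ennreal \<bar>X (Suc j) \<omega> - X j \<omega>\<bar> \<partial>M) \<le> ennreal ((1/2)^j)" for j
      unfolding X_def by (intro \<delta>(2) \<tau>) auto
  qed (auto intro!: summable_geometric)
  then have lim: "AE \<omega> in M. (\<lambda>j. X j \<omega>) \<longlonglongrightarrow> I \<omega>"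
  proof eventually_elim
    case (elim \<omega>)
    then have "summable (\<lambda>j. X (Suc j) \<omega> - X j \<omega>)" by (rule summable_rabs_cancel)
    then have "convergent (\<lambda>j. \<Sum>i<j. X (Suc i) \<omega> - X i \<omega>)" by (simp add: summable_iff_convergent)
    then have "convergent (\<lambda>j. X j \<omega> - X 0 \<omega>)" by (simp only: sum_lessThan_telescope[of "\<lambda>i. X i \<omega>"])
    then have "convergent (\<lambda>j. X j \<omega>)"
      using convergent_diff_const_right_iff by blast
    then show ?case unfolding I_def by (simp add: convergent_LIMSEQ_iff)
  qed
  have "has_stochastic_integral M f L t I"
    unfolding has_stochastic_integral_def
  proof (intro conjI allI impI)
    fix \<epsilon> :: real assume \<epsilon>: "0 < \<epsilon>"
    \<comment> \<open>Markov's inequality divides the L^1 distance by \<epsilon>, and the quotient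
      has to be below \<epsilon>.\<close>
    then obtain j where j: "(1/2)^j < \<epsilon> * \<epsilon>"
      using real_arch_pow_inv[of "\<epsilon> * \<epsilon>" "1/2"] by auto
    show "\<exists>\<delta>>0. \<forall>n \<tau>. \<tau> 0 = 0 \<and> \<tau> n = t \<and> (\<forall>i<n. \<tau> i \<le> \<tau> (Suc i) \<and> \<tau> (Suc i) - \<tau> i < \<delta>) \<longrightarrow>
        measure M {\<omega> \<in> space M. \<bar>(\<Sum>i<n. f (\<tau> i) * (L (\<tau> (Suc i)) \<omega> - L (\<tau> i) \<omega>)) - I \<omega>\<bar> \<ge> \<epsilon>} < \<epsilon>"
    proof (intro exI[of _ "\<delta> j"] conjI allI impI \<delta>(1))
      fix n \<sigma> assume "\<sigma> 0 = 0 \<and> \<sigma> n = t \<and> (\<forall>i<n. \<sigma> i \<le> \<sigma> (Suc i) \<and> \<sigma> (Suc i) - \<sigma> i < \<delta> j)"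
      then have \<sigma>: "partition_upto (\<delta> j) t n \<sigma>" by (simp add: partition_upto_def)
      note [measurable] = LSM[OF \<sigma>]
      have "(\<integral>\<^sup>+ \<omega>. ennreal \<bar>left_sum f L n \<sigma> \<omega> - I \<omega>\<bar> \<partial>M)
        = (\<integral>\<^sup>+ \<omega>. liminf (\<lambda>i. ennreal \<bar>left_sum f L n \<sigma> \<omega> - X i \<omega>\<bar>) \<partial>M)"
        using lim
      proof (intro nn_integral_cong_AE, eventually_elim)
        case (elim \<omega>)
        then have "(\<lambda>i. ennreal \<bar>left_sum f L n \<sigma> \<omega> - X i \<omega>\<bar>) \<longlonglongrightarrow> ennreal \<bar>left_sum f L n \<sigma> \<omega> - I \<omega>\<bar>"
          by (intro tendsto_intros)
        then show ?case by (intro lim_imp_Liminf[symmetric]) auto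
      qed
      also have "\<dots> \<le> liminf (\<lambda>i. \<integral>\<^sup>+ \<omega>. ennreal \<bar>left_sum f L n \<sigma> \<omega> - X i \<omega>\<bar> \<partial>M)"
        by (intro nn_integral_liminf) measurable
      also have "\<dots> \<le> liminf (\<lambda>i. ennreal ((1/2)^j))"
        by (intro Liminf_mono eventually_sequentiallyI[of j]) (auto simp: X_def intro!: \<delta>(2) \<sigma> \<tau>)
      also have "\<dots> = ennreal ((1/2)^j)" by (simp add: Liminf_const)
      finally have E: "(\<integral>\<^sup>+ \<omega>. ennreal \<bar>left_sum f L n \<sigma> \<omega> - I \<omega>\<bar> \<partial>M) \<le> ennreal ((1/2)^j)" .
      have int: "integrable M (\<lambda>\<omega>. \<bar>left_sum f L n \<sigma> \<omega> - I \<omega>\<bar>)"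
        by (rule integrableI_bounded) (use E in \<open>auto intro: le_less_trans\<close>)
      have "(\<integral>\<omega>. \<bar>left_sum f L n \<sigma> \<omega> - I \<omega>\<bar> \<partial>M) \<le> (1/2)^j"
        using E nn_integral_eq_integral[OF int] by (simp add: ennreal_le_iff)
      moreover have "measure M {\<omega> \<in> space M. \<epsilon> \<le> \<bar>left_sum f L n \<sigma> \<omega> - I \<omega>\<bar>} \<le> (\<integral>\<omega>. \<bar>left_sum f L n \<sigma> \<omega> - I \<omega>\<bar> \<partial>M) / \<epsilon>"
        by (rule integral_Markov_inequality_measure[OF int, of "{}"]) (use \<epsilon> in auto)
      moreover have "(1/2)^j / \<epsilon> < \<epsilon>" using j \<epsilon> by (simp add: field_simps)
      ultimately have "measure M {\<omega> \<in> space M. \<epsilon> \<le> \<bar>left_sum f L n \<sigma> \<omega> - I \<omega>\<bar>} < \<epsilon>"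
        using divide_right_mono[of _ "(1/2)^j" \<epsilon>] \<epsilon> by (smt (verit))
      then show "measure M {\<omega> \<in> space M. \<bar>(\<Sum>i<n. f (\<sigma> i) * (L (\<sigma> (Suc i)) \<omega> - L (\<sigma> i) \<omega>)) - I \<omega>\<bar> \<ge> \<epsilon>} < \<epsilon>"
        by (simp add: left_sum_def)
    qed
  qed measurable
  with IG show ?thesis by blast
qed

section \<open>The stochastic convolution\<close>

text \<open>Borel-Cantelli: the indicators of the exceptional events are almost surely summable,
  hence eventually 0.\<close>

lemma AE_tendsto_of_prob_bounds:
  fixes X :: "nat \<Rightarrow> 'a \<Rightarrow> real"
  assumes M: "prob_space M" and [measurable]: "\<And>j. X j \<in> borel_measurable M" "I \<in> borel_measurable M"
    and le: "\<And>j. measure M {\<omega> \<in> space M. \<bar>X j \<omega> - I \<omega>\<bar> \<ge> (1/2)^j} \<le> (1/2::real)^j"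
  shows "AE \<omega> in M. (\<lambda>j. X j \<omega>) \<longlonglongrightarrow> I \<omega>"
proof -
  interpret prob_space M by fact
  define E where "E j = {\<omega> \<in> space M. \<bar>X j \<omega> - I \<omega>\<bar> \<ge> (1/2)^j}" for j
  have [measurable]: "E j \<in> sets M" for j unfolding E_def by measurable
  have "AE \<omega> in M. summable (\<lambda>j. indicator (E j) \<omega> :: real)"
  proof (rule AE_summable_nn_integral)
    show "(\<integral>\<^sup>+ \<omega>. ennreal (indicator (E j) \<omega>) \<partial>M) \<le> ennreal ((1/2)^j)" for j
      using le[of j] by (simp add: ennreal_indicator emeasure_eq_measure E_def)
    show "summable (\<lambda>j. (1/2)^j :: real)" by (intro summable_geometric) auto
  qed auto
  moreover have "AE \<omega> in M. \<omega> \<in> space M" by (rule AE_space)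
  ultimately show ?thesis
  proof eventually_elim
    case (elim \<omega>)
    have "(\<lambda>j. indicator (E j) \<omega> :: real) \<longlonglongrightarrow> 0" using elim(1) by (rule summable_LIMSEQ_zero)
    then have "eventually (\<lambda>j. indicator (E j) \<omega> < (1::real)) sequentially"
      by (rule order_tendstoD) simp
    then have "eventually (\<lambda>j. \<bar>X j \<omega> - I \<omega>\<bar> \<le> (1/2)^j) sequentially"
      by eventually_elim (use elim in \<open>auto simp: E_def indicator_def split: if_splits\<close>)
    moreover have "(\<lambda>j. (1/2::real)^j) \<longlonglongrightarrow> 0" by (rule LIMSEQ_power_zero) simp
    ultimately have "(\<lambda>j. X j \<omega> - I \<omega>) \<longlonglongrightarrow> 0"
      using Lim_null_comparison[of "\<lambda>j. X j \<omega> - I \<omega>" "\<lambda>j. (1/2)^j" sequentially] by simp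
    then show ?case by (rule LIM_zero_cancel)
  qed
qed

lemma has_stochastic_integral_prob_bound:
  assumes "has_stochastic_integral M f L t I" "0 < \<epsilon>"
  shows "\<exists>\<delta>>0. \<forall>n \<tau>. partition_upto \<delta> t n \<tau> \<longrightarrow>
    measure M {\<omega> \<in> space M. \<bar>left_sum f L n \<tau> \<omega> - I \<omega>\<bar> \<ge> \<epsilon>} < \<epsilon>"
  using assms unfolding has_stochastic_integral_def partition_upto_def left_sum_def by blast

text \<open>The integrand increases in time, so its left sum stays below the integral. On a single
  cell this is \<open>x \<le> exp x - 1\<close>, and the right sides telescope.\<close>

lemma exponential_left_sum_le:
  fixes l b :: real
  assumes "\<And>i. i < n \<Longrightarrow> \<tau> i \<le> \<tau> (Suc i)" "0 \<le> l"
  shows "l * (\<Sum>i<n. exp (- l * (b - \<tau> i)) * (\<tau> (Suc i) - \<tau> i))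
    \<le> exp (- l * (b - \<tau> n)) - exp (- l * (b - \<tau> 0))"
proof -
  have "l * (\<Sum>i<n. exp (- l * (b - \<tau> i)) * (\<tau> (Suc i) - \<tau> i))
    = (\<Sum>i<n. exp (- l * (b - \<tau> i)) * (l * (\<tau> (Suc i) - \<tau> i)))"
    unfolding sum_distrib_left by (intro sum.cong refl mult.left_commute)
  also have "\<dots> \<le> (\<Sum>i<n. exp (- l * (b - \<tau> (Suc i))) - exp (- l * (b - \<tau> i)))"
  proof (intro sum_mono)
    fix i
    have "exp (- l * (b - \<tau> i)) * (l * (\<tau> (Suc i) - \<tau> i)) \<le> exp (- l * (b - \<tau> i)) * (exp (l * (\<tau> (Suc i) - \<tau> i)) - 1)"
    proof (rule mult_left_mono)
      show "l * (\<tau> (Suc i) - \<tau> i) \<le> exp (l * (\<tau> (Suc i) - \<tau> i)) - 1"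
        using exp_ge_add_one_self[of "l * (\<tau> (Suc i) - \<tau> i)"] by linarith
    qed simp
    also have "\<dots> = exp (- l * (b - \<tau> (Suc i))) - exp (- l * (b - \<tau> i))"
      by (simp add: right_diff_distrib mult_exp_exp)
    finally show "exp (- l * (b - \<tau> i)) * (l * (\<tau> (Suc i) - \<tau> i)) \<le> exp (- l * (b - \<tau> (Suc i))) - exp (- l * (b - \<tau> i))" .
  qed
  also have "\<dots> = exp (- l * (b - \<tau> n)) - exp (- l * (b - \<tau> 0))"
    by (rule sum_lessThan_telescope)
  finally show ?thesis .
qed

lemma sum_lessThan_add:
  fixes f :: "nat \<Rightarrow> 'a::comm_monoid_add"
  shows "(\<Sum>i<m + n. f i) = (\<Sum>i<m. f i) + (\<Sum>i<n. f (m + i))"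
  by (induction n) (simp_all add: add.assoc)

text \<open>On a partition of \<open>{0..t}\<close> through \<open>s\<close>, the difference of the left sums of the two integrals
  is a single linear combination of increments. The bound controls the modulus of continuity of the
  convolution; for \<open>s = t\<close> it says that the integral is unique, and for \<open>s = 0\<close> it bounds its size.\<close>

lemma exponential_integral_diff_Laplace_bound:
  assumes M: "prob_space M" and L: "symmetric_stable_process M \<alpha> L" and \<alpha>: "1 < \<alpha>" "\<alpha> \<le> 2"
    and st: "0 \<le> s" "s \<le> t" and l: "0 < l"
    and I: "has_stochastic_integral M (\<lambda>u. exp (- l * (s - u))) L s I"
    and J: "has_stochastic_integral M (\<lambda>u. exp (- l * (t - u))) L t J"
  shows "Laplace_bound M (\<alpha> / 2) (8 * (1 - exp (- l * (t - s))) / l) (\<lambda>\<omega>. (J \<omega> - I \<omega>)\<^sup>2)"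
proof -
  interpret prob_space M by fact
  have IJm[measurable]: "I \<in> borel_measurable M" "J \<in> borel_measurable M"
    using I J by (auto simp: has_stochastic_integral_def)
  have Lm: "L r \<in> borel_measurable M" if "0 \<le> r" for r
    using L that by (simp add: symmetric_stable_process_def)
  \<comment> \<open>\<open>N\<close> cells on \<open>{0..s}\<close> followed by \<open>N\<close>
    cells on \<open>{s..t}\<close>. For \<open>s = 0\<close> or \<open>s = t\<close> one half
    consists of repeated points, which a partition may have.\<close>
  define \<tau> where "\<tau> N i = (if i \<le> N then s * real i / real N else s + (t - s) * (real i - real N) / real N)" for N i :: nat
  have \<tau>_add: "\<tau> N (N + i) = s + (t - s) * real i / real N" if "0 < N" for N i
    using that by (cases "i = 0") (auto simp: \<tau>_def)
  have \<tau>_mono: "\<tau> N i \<le> \<tau> N (Suc i)" and \<tau>_mesh: "\<tau> N (Suc i) - \<tau> N i \<le> t / real N" if "0 < N" for N i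
  proof -
    have "\<tau> N i \<le> \<tau> N (Suc i) \<and> \<tau> N (Suc i) - \<tau> N i \<le> t / real N"
    proof (cases "i < N")
      case True
      then show ?thesis using st that by (simp add: \<tau>_def field_simps)
    next
      case False
      then obtain k where "i = N + k" by (metis add_diff_inverse_nat)
      then have "\<tau> N (Suc i) - \<tau> N i = (t - s) / real N"
        using \<tau>_add[OF that, of k] \<tau>_add[OF that, of "Suc k"] that by (simp add: field_simps)
      moreover have "0 \<le> (t - s) / real N" "(t - s) / real N \<le> t / real N"
        using st by (auto intro: divide_right_mono)
      ultimately show ?thesis by simp
    qed
    then show "\<tau> N i \<le> \<tau> N (Suc i)" "\<tau> N (Suc i) - \<tau> N i \<le> t / real N" by auto
  qed
  have \<tau>0: "\<tau> N 0 = 0" "\<tau> N N = s" "\<tau> N (N + N) = t" if "0 < N" for N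
    using that \<tau>_add[OF that, of N] by (auto simp: \<tau>_def)
  have part: "partition_upto \<delta> s N (\<tau> N)" "partition_upto \<delta> t (N + N) (\<tau> N)"
    if "0 < N" "t / real N < \<delta>" for N \<delta>
    using that \<tau>0[OF that(1)] \<tau>_mono[OF that(1)] \<tau>_mesh[OF that(1)]
    by (auto simp: partition_upto_def intro: le_less_trans)
  define f where "f u = exp (- l * (s - u))" for u
  define g where "g u = exp (- l * (t - u))" for u
  define q where "q = exp (- l * (t - s))"
  have q: "0 < q" "q \<le> 1" using st l by (auto simp: q_def)
  have gq: "g u = q * f u" for u
    by (simp add: g_def f_def q_def mult_exp_exp) (simp add: algebra_simps)
  have "\<forall>j. \<exists>N>0.
    measure M {\<omega> \<in> space M. \<bar>left_sum f L N (\<tau> N) \<omega> - I \<omega>\<bar> \<ge> (1/2)^j} \<le> (1/2)^j \<and>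
    measure M {\<omega> \<in> space M. \<bar>left_sum g L (N + N) (\<tau> N) \<omega> - J \<omega>\<bar> \<ge> (1/2)^j} \<le> (1/2)^j"
  proof
    fix j :: nat
    have e: "0 < (1/2::real)^j" by simp
    obtain \<delta> where \<delta>: "\<delta> > 0" "\<And>n \<tau>. partition_upto \<delta> s n \<tau> \<Longrightarrow>
      measure M {\<omega> \<in> space M. \<bar>left_sum f L n \<tau> \<omega> - I \<omega>\<bar> \<ge> (1/2)^j} < (1/2)^j"
      using has_stochastic_integral_prob_bound[OF I e] unfolding f_def by blast
    obtain \<delta>' where \<delta>': "\<delta>' > 0" "\<And>n \<tau>. partition_upto \<delta>' t n \<tau> \<Longrightarrow>
      measure M {\<omega> \<in> space M. \<bar>left_sum g L n \<tau> \<omega> - J \<omega>\<bar> \<ge> (1/2)^j} < (1/2)^j"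
      using has_stochastic_integral_prob_bound[OF J e] unfolding g_def by blast
    define \<mu> where "\<mu> = min \<delta> \<delta>'"
    have \<mu>: "0 < \<mu>" "\<mu> \<le> \<delta>" "\<mu> \<le> \<delta>'" using \<delta> \<delta>' by (auto simp: \<mu>_def)
    obtain N where N: "real N > t / \<mu>" using reals_Archimedean2 by blast
    moreover have "0 \<le> t / \<mu>" using st \<mu> by simp
    ultimately have N0: "0 < N" by linarith
    from N \<mu> this have "t / real N < \<mu>" by (simp add: field_simps)
    then have "t / real N < \<delta>" "t / real N < \<delta>'" using \<mu> by auto
    then show "\<exists>N>0. measure M {\<omega> \<in> space M. \<bar>left_sum f L N (\<tau> N) \<omega> - I \<omega>\<bar> \<ge> (1/2)^j} \<le> (1/2)^j \<and>
      measure M {\<omega> \<in> space M. \<bar>left_sum g L (N + N) (\<tau> N) \<omega> - J \<omega>\<bar> \<ge> (1/2)^j} \<le> (1/2)^j"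
      using N0 \<delta>(2)[OF part(1)[OF N0]] \<delta>'(2)[OF part(2)[OF N0]]
      by (intro exI[of _ N] conjI) (auto intro: less_imp_le)
  qed
  from choice[OF this] obtain N where N: "\<And>j. N j > 0"
    "\<And>j. measure M {\<omega> \<in> space M. \<bar>left_sum f L (N j) (\<tau> (N j)) \<omega> - I \<omega>\<bar> \<ge> (1/2)^j} \<le> (1/2)^j"
    "\<And>j. measure M {\<omega> \<in> space M. \<bar>left_sum g L (N j + N j) (\<tau> (N j)) \<omega> - J \<omega>\<bar> \<ge> (1/2)^j} \<le> (1/2)^j"
    by blast
  define X where "X j = left_sum f L (N j) (\<tau> (N j))" for j
  define Y where "Y j = left_sum g L (N j + N j) (\<tau> (N j))" for j
  have \<tau>nn: "0 \<le> \<tau> (N j) i" for i j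
    using N(1)[of j] \<tau>0(1)[OF N(1)] \<tau>_mono[OF N(1)] lift_Suc_mono_le[of "\<tau> (N j)" 0 i] by (metis le0)
  have XYm: "X j \<in> borel_measurable M" "Y j \<in> borel_measurable M" for j
    unfolding X_def Y_def left_sum_def using \<tau>nn
    by (auto intro!: borel_measurable_sum borel_measurable_times borel_measurable_diff Lm)
  have "AE \<omega> in M. (\<lambda>j. X j \<omega>) \<longlonglongrightarrow> I \<omega>"
    by (rule AE_tendsto_of_prob_bounds[OF M XYm(1) IJm(1)]) (use N in \<open>simp add: X_def\<close>)
  moreover have "AE \<omega> in M. (\<lambda>j. Y j \<omega>) \<longlonglongrightarrow> J \<omega>"
    by (rule AE_tendsto_of_prob_bounds[OF M XYm(2) IJm(2)]) (use N in \<open>simp add: Y_def\<close>)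
  ultimately have lim: "AE \<omega> in M. (\<lambda>j. (Y j \<omega> - X j \<omega>)\<^sup>2) \<longlonglongrightarrow> (J \<omega> - I \<omega>)\<^sup>2"
    by eventually_elim (intro tendsto_intros)
  have LB: "Laplace_bound M (\<alpha> / 2) (8 * (1 - q) / l) (\<lambda>\<omega>. (Y j \<omega> - X j \<omega>)\<^sup>2)" for j
  proof -
    define K where "K = N j"
    have K: "K > 0" using N by (simp add: K_def)
    note mono = \<tau>_mono[OF K]
    \<comment> \<open>Before \<open>s\<close> the coefficient is
      \<open>g - f = - ((1 - q) * f)\<close>, after \<open>s\<close> it is \<open>g\<close>: the old
      noise is damped by the factor \<open>q\<close>, and new noise is added.\<close>
    define b where "b i = (if i < K then g (\<tau> K i) - f (\<tau> K i) else g (\<tau> K i))" for i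
    have "Y j \<omega> - X j \<omega> = (\<Sum>i<K + K. b i * (L (\<tau> K (Suc i)) \<omega> - L (\<tau> K i) \<omega>))" for \<omega>
      unfolding X_def Y_def left_sum_def K_def[symmetric] b_def
      by (simp add: sum_lessThan_add sum_subtractf left_diff_distrib)
    moreover have "Laplace_bound M (\<alpha> / 2) (4 * (\<Sum>i<K + K. \<bar>b i\<bar> powr \<alpha> * (\<tau> K (Suc i) - \<tau> K i)))
      (\<lambda>\<omega>. (\<Sum>i<K + K. b i * (L (\<tau> K (Suc i)) \<omega> - L (\<tau> K i) \<omega>))\<^sup>2)"
      using \<alpha> \<tau>0(1)[OF K] mono by (intro symmetric_stable_increments_Laplace_bound[OF M L]) auto
    moreover have "4 * (\<Sum>i<K + K. \<bar>b i\<bar> powr \<alpha> * (\<tau> K (Suc i) - \<tau> K i)) \<le> 8 * (1 - q) / l"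
    proof -
      have small: "x powr \<alpha> \<le> x" if "0 \<le> x" "x \<le> 1" for x :: real
        using powr_mono'[of 1 \<alpha> x] that \<alpha> by simp
      have \<tau>s: "\<tau> K i \<le> s" if "i \<le> K" for i
        using lift_Suc_mono_le[of "\<tau> K" i K, OF mono that] \<tau>0(2)[OF K] by simp
      have \<tau>t: "\<tau> K i \<le> t" if "i \<le> K + K" for i
        using lift_Suc_mono_le[of "\<tau> K" i "K + K", OF mono that] \<tau>0(3)[OF K] by simp
      have "(\<Sum>i<K + K. \<bar>b i\<bar> powr \<alpha> * (\<tau> K (Suc i) - \<tau> K i))
        \<le> (\<Sum>i<K + K. (if i < K then (1 - q) * f (\<tau> K i) else g (\<tau> K i)) * (\<tau> K (Suc i) - \<tau> K i))"
      proof (intro sum_mono mult_right_mono)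
        fix i assume i: "i \<in> {..<K + K}"
        show "\<bar>b i\<bar> powr \<alpha> \<le> (if i < K then (1 - q) * f (\<tau> K i) else g (\<tau> K i))"
        proof (cases "i < K")
          case True
          have "b i = - ((1 - q) * f (\<tau> K i))"
            using True by (simp add: b_def gq algebra_simps)
          then have "\<bar>b i\<bar> = (1 - q) * f (\<tau> K i)"
            using q by (simp add: abs_mult f_def)
          moreover have "f (\<tau> K i) \<le> 1"
            using \<tau>s[of i] True l by (simp add: f_def)
          then have "(1 - q) * f (\<tau> K i) \<le> 1 * 1" using q by (intro mult_mono) (auto simp: f_def)
          ultimately show ?thesis using small[of "(1 - q) * f (\<tau> K i)"] True q by (simp add: f_def)
        next
          case False
          have "g (\<tau> K i) \<le> 1" using \<tau>t[of i] i l by (simp add: g_def)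
          then show ?thesis using small[of "g (\<tau> K i)"] False by (simp add: b_def g_def)
        qed
        show "0 \<le> \<tau> K (Suc i) - \<tau> K i" using mono[of i] by simp
      qed
      also have "\<dots> = (1 - q) * (\<Sum>i<K. f (\<tau> K i) * (\<tau> K (Suc i) - \<tau> K i))
        + (\<Sum>i<K. g (\<tau> K (K + i)) * (\<tau> K (Suc (K + i)) - \<tau> K (K + i)))"
        by (simp add: sum_lessThan_add sum_distrib_left mult.assoc)
      finally have "l * (\<Sum>i<K + K. \<bar>b i\<bar> powr \<alpha> * (\<tau> K (Suc i) - \<tau> K i))
        \<le> l * ((1 - q) * (\<Sum>i<K. f (\<tau> K i) * (\<tau> K (Suc i) - \<tau> K i))
        + (\<Sum>i<K. g (\<tau> K (K + i)) * (\<tau> K (Suc (K + i)) - \<tau> K (K + i))))"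
        using l by (intro mult_left_mono) auto
      also have "\<dots> = (1 - q) * (l * (\<Sum>i<K. f (\<tau> K i) * (\<tau> K (Suc i) - \<tau> K i)))
        + l * (\<Sum>i<K. g (\<tau> K (K + i)) * (\<tau> K (Suc (K + i)) - \<tau> K (K + i)))"
        by (simp add: algebra_simps)
      \<comment> \<open>Each half contributes at most \<open>1 - q\<close>; together with the factor
        4 of the Laplace bound this is the constant 8.\<close>
      also have "\<dots> \<le> (1 - q) * 1 + (1 - q)"
      proof (intro add_mono mult_left_mono)
        have "l * (\<Sum>i<K. f (\<tau> K i) * (\<tau> K (Suc i) - \<tau> K i)) \<le> exp (- l * (s - \<tau> K K)) - exp (- l * (s - \<tau> K 0))"
          unfolding f_def using mono l by (intro exponential_left_sum_le) auto
        also have "\<dots> \<le> 1" using \<tau>0(2)[OF K] by simp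
        finally show "l * (\<Sum>i<K. f (\<tau> K i) * (\<tau> K (Suc i) - \<tau> K i)) \<le> 1" .
        have "l * (\<Sum>i<K. g (\<tau> K (K + i)) * (\<tau> K (Suc (K + i)) - \<tau> K (K + i)))
          \<le> exp (- l * (t - \<tau> K (K + K))) - exp (- l * (t - \<tau> K (K + 0)))"
          using exponential_left_sum_le[of K "\<lambda>i. \<tau> K (K + i)" l t] mono l by (simp add: g_def)
        also have "\<dots> = 1 - q" using \<tau>0[OF K] by (simp add: q_def)
        finally show "l * (\<Sum>i<K. g (\<tau> K (K + i)) * (\<tau> K (Suc (K + i)) - \<tau> K (K + i))) \<le> 1 - q" .
      qed (use q in auto)
      finally show ?thesis using l by (simp add: field_simps)
    qed
    ultimately show ?thesis by (simp add: Laplace_bound_mono)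
  qed
  have "Laplace_bound M (\<alpha> / 2) (8 * (1 - q) / l) (\<lambda>\<omega>. (J \<omega> - I \<omega>)\<^sup>2)"
    by (rule Laplace_bound_limit[OF LB tendsto_const _ _ lim]) auto
  then show ?thesis by (simp add: q_def)
qed

section \<open>Moments and continuity in time of the convolution\<close>

locale stable_noise = prob_space M for M :: "'w measure" +
  fixes F :: "real \<Rightarrow> 'w measure"
    and e :: "nat \<Rightarrow> 'h::{real_inner,banach,second_countable_topology}"
    and lam bet :: "nat \<Rightarrow> real"
    and L :: "nat \<Rightarrow> real \<Rightarrow> 'w \<Rightarrow> real"
    and \<alpha> :: real
  assumes filtration: "time_filtration M F"
    and ortho: "orthonormal e"
    and \<alpha>: "1 < \<alpha>" "\<alpha> < 2"
    and bet_pos: "\<And>k. 0 < bet k"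
    and stable: "\<And>k. symmetric_stable_process M \<alpha> (L k)"
    and adapted: "\<And>k. adapted_process F (L k)"
    and lam_pos: "\<And>k. 0 < lam k"
    and summable_bet_lam: "summable (\<lambda>k. bet k powr \<alpha> / lam k)"
begin

text \<open>The Laplace constant of the k-th coordinate of an increment of the convolution over a
  time lag \<open>d\<close>. The sum over \<open>k\<close> plays the role of a modulus of
  continuity.\<close>

definition conv_term :: "real \<Rightarrow> nat \<Rightarrow> real" where
  "conv_term d k = bet k powr \<alpha> * (8 * (1 - exp (- lam k * d)) / lam k)"

definition conv_modulus :: "real \<Rightarrow> real" where
  "conv_modulus d = (\<Sum>k. conv_term d k)"

lemma conv_term_bounds:
  assumes "0 \<le> d"
  shows "0 \<le> conv_term d k" "conv_term d k \<le> 8 * (bet k powr \<alpha> / lam k)"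
proof -
  have "0 \<le> 1 - exp (- lam k * d)" "1 - exp (- lam k * d) \<le> 1"
    using assms lam_pos[of k] by auto
  then show "0 \<le> conv_term d k"
    using lam_pos[of k] by (auto simp: conv_term_def intro!: mult_nonneg_nonneg divide_nonneg_nonneg)
  have "bet k powr \<alpha> * (8 * (1 - exp (- lam k * d)) / lam k) \<le> bet k powr \<alpha> * (8 * 1 / lam k)"
    using \<open>1 - exp (- lam k * d) \<le> 1\<close> lam_pos[of k]
    by (intro mult_left_mono divide_right_mono) auto
  then show "conv_term d k \<le> 8 * (bet k powr \<alpha> / lam k)"
    by (simp add: conv_term_def)
qed

lemma summable_conv_term: "0 \<le> d \<Longrightarrow> summable (conv_term d)"
  using conv_term_bounds
  by (intro summable_comparison_test[OF _ summable_mult[OF summable_bet_lam, of 8]]) auto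

lemma conv_modulus_nonneg: "0 \<le> d \<Longrightarrow> 0 \<le> conv_modulus d"
  unfolding conv_modulus_def using conv_term_bounds by (intro suminf_nonneg summable_conv_term) auto

lemma conv_modulus_0: "conv_modulus 0 = 0"
  by (simp add: conv_modulus_def conv_term_def)

lemma conv_modulus_le: "0 \<le> d \<Longrightarrow> conv_modulus d \<le> 8 * (\<Sum>k. bet k powr \<alpha> / lam k)"
  unfolding conv_modulus_def suminf_mult[OF summable_bet_lam, symmetric] using conv_term_bounds
  by (intro suminf_le summable_conv_term summable_mult[OF summable_bet_lam]) auto

text \<open>Each term is continuous in \<open>d\<close>, but not equally so, since
  \<open>lam\<close> is unbounded. The majorant \<open>8 * (bet k powr \<alpha> / lam k)\<close>
  does not depend on \<open>d\<close> and makes the series converge uniformly.\<close>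

lemma conv_modulus_tendsto: "(conv_modulus \<longlongrightarrow> 0) (at_right 0)"
proof -
  have lam0: "lam k \<noteq> 0" for k using lam_pos[of k] by simp
  have "uniform_limit {0..} (\<lambda>n d. \<Sum>k<n. conv_term d k) conv_modulus sequentially"
    unfolding conv_modulus_def
    by (rule Weierstrass_m_test[OF _ summable_mult[OF summable_bet_lam, of 8]])
      (use conv_term_bounds in auto)
  then have "continuous_on {0..} conv_modulus"
    by (rule uniform_limit_theorem[rotated])
      (auto intro!: always_eventually continuous_intros simp: conv_term_def lam0)
  then have "(conv_modulus \<longlongrightarrow> conv_modulus 0) (at 0 within {0..})"
    by (simp add: continuous_on_def)
  then show ?thesis
    unfolding conv_modulus_0 by (rule tendsto_within_subset) auto
qed

lemma stochastic_convolution_diff_moment: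
  assumes st: "0 \<le> s" "s \<le> t" and m: "0 < m" "m < \<alpha>"
    and Z: "is_stochastic_convolution M e lam bet L s Z"
    and Z': "is_stochastic_convolution M e lam bet L t Z'"
  shows "(\<integral>\<^sup>+ \<omega>. ennreal (norm (Z' \<omega> - Z \<omega>) powr m) \<partial>M)
    \<le> ennreal (stable_moment_const \<alpha> m * conv_modulus (t - s) powr (m / \<alpha>))"
proof -
  from Z obtain I where I: "\<And>k. has_stochastic_integral M (\<lambda>u. exp (- lam k * (s - u))) (L k) s (I k)"
    and IZ: "AE \<omega> in M. (\<lambda>k. (bet k * I k \<omega>) *\<^sub>R e k) sums Z \<omega>"
    by (auto simp: is_stochastic_convolution_def)
  from Z' obtain J where J: "\<And>k. has_stochastic_integral M (\<lambda>u. exp (- lam k * (t - u))) (L k) t (J k)"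
    and JZ: "AE \<omega> in M. (\<lambda>k. (bet k * J k \<omega>) *\<^sub>R e k) sums Z' \<omega>"
    by (auto simp: is_stochastic_convolution_def)
  have [measurable]: "I k \<in> borel_measurable M" "J k \<in> borel_measurable M" for k
    using I J by (auto simp: has_stochastic_integral_def)
  define X where "X k \<omega> = bet k * (J k \<omega> - I k \<omega>)" for k \<omega>
  have LB: "Laplace_bound M (\<alpha> / 2) (conv_term (t - s) k) (\<lambda>\<omega>. (X k \<omega>)\<^sup>2)" for k
  proof -
    have "Laplace_bound M (\<alpha> / 2) (8 * (1 - exp (- lam k * (t - s))) / lam k) (\<lambda>\<omega>. (J k \<omega> - I k \<omega>)\<^sup>2)"
      using \<alpha> by (intro exponential_integral_diff_Laplace_bound[OF prob_space_axioms stable _ _ st lam_pos I J]) auto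
    \<comment> \<open>The bound is for squares, so the factor is \<open>(bet k)\<^sup>2\<close>; its
      power \<open>\<alpha> / 2\<close> is the \<open>bet k powr \<alpha>\<close> of the summability
      hypothesis.\<close>
    from Laplace_bound_scale[OF this, of "(bet k)\<^sup>2"] bet_pos[of k]
    have "Laplace_bound M (\<alpha> / 2) ((bet k)\<^sup>2 powr (\<alpha> / 2) * (8 * (1 - exp (- lam k * (t - s))) / lam k))
      (\<lambda>\<omega>. (bet k)\<^sup>2 * (J k \<omega> - I k \<omega>)\<^sup>2)" by simp
    moreover have "(bet k)\<^sup>2 powr (\<alpha> / 2) = bet k powr \<alpha>"
      using bet_pos[of k] by (simp add: powr_powr flip: powr_numeral)
    ultimately show ?thesis by (simp add: conv_term_def X_def power_mult_distrib)
  qed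
  have [measurable]: "X k \<in> borel_measurable M" for k unfolding X_def by measurable
  have "(\<integral>\<^sup>+ \<omega>. ennreal (norm (\<Sum>k. X k \<omega> *\<^sub>R e k) powr m) \<partial>M)
      \<le> ennreal (stable_moment_const \<alpha> m * suminf (conv_term (t - s)) powr (m / \<alpha>))"
    using st m by (intro orthonormal_series_moment prob_space_axioms ortho LB summable_conv_term) auto
  moreover have "AE \<omega> in M. ennreal (norm (Z' \<omega> - Z \<omega>) powr m) = ennreal (norm (\<Sum>k. X k \<omega> *\<^sub>R e k) powr m)"
    using JZ IZ
  proof eventually_elim
    case (elim \<omega>)
    from sums_diff[OF elim] have "(\<lambda>k. X k \<omega> *\<^sub>R e k) sums (Z' \<omega> - Z \<omega>)"
      by (simp add: X_def right_diff_distrib scaleR_left_diff_distrib)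
    then show ?case by (simp add: sums_iff)
  qed
  then have "(\<integral>\<^sup>+ \<omega>. ennreal (norm (Z' \<omega> - Z \<omega>) powr m) \<partial>M)
    = (\<integral>\<^sup>+ \<omega>. ennreal (norm (\<Sum>k. X k \<omega> *\<^sub>R e k) powr m) \<partial>M)"
    by (rule nn_integral_cong_AE)
  ultimately show ?thesis by (simp add: conv_modulus_def[abs_def])
qed

text \<open>A partition of \<open>{0..0}\<close> is constant, so every sum vanishes. With this
  starting value the size of the convolution at time \<open>t\<close> is its increment over the lag
  \<open>t\<close>.\<close>

lemma has_stochastic_integral_0:
  "has_stochastic_integral M (\<lambda>s. exp (- lam k * (0 - s))) (L k) 0 (\<lambda>_. 0)"
  unfolding has_stochastic_integral_def
proof (intro conjI allI impI)
  fix \<epsilon> :: real assume \<epsilon>: "0 < \<epsilon>"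
  show "\<exists>\<delta>>0. \<forall>n \<tau>. \<tau> 0 = 0 \<and> \<tau> n = 0 \<and> (\<forall>i<n. \<tau> i \<le> \<tau> (Suc i) \<and> \<tau> (Suc i) - \<tau> i < \<delta>) \<longrightarrow>
    measure M {\<omega> \<in> space M. \<bar>(\<Sum>i<n. exp (- lam k * (0 - \<tau> i)) * (L k (\<tau> (Suc i)) \<omega> - L k (\<tau> i) \<omega>)) - 0\<bar> \<ge> \<epsilon>} < \<epsilon>"
  proof (intro exI[of _ 1] conjI allI impI)
    fix n and \<tau> :: "nat \<Rightarrow> real"
    assume "\<tau> 0 = 0 \<and> \<tau> n = 0 \<and> (\<forall>i<n. \<tau> i \<le> \<tau> (Suc i) \<and> \<tau> (Suc i) - \<tau> i < 1)"
    then have \<tau>: "partition_upto 1 0 n \<tau>" by (simp add: partition_upto_def)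
    have "\<tau> i = 0" if "i \<le> n" for i using partition_upto_range[OF \<tau> that] by simp
    then have "(\<Sum>i<n. exp (- lam k * (0 - \<tau> i)) * (L k (\<tau> (Suc i)) \<omega> - L k (\<tau> i) \<omega>)) = 0" for \<omega>
      by (intro sum.neutral) auto
    then show "measure M {\<omega> \<in> space M. \<bar>(\<Sum>i<n. exp (- lam k * (0 - \<tau> i)) * (L k (\<tau> (Suc i)) \<omega> - L k (\<tau> i) \<omega>)) - 0\<bar> \<ge> \<epsilon>} < \<epsilon>"
      using \<epsilon> by (simp add: not_le[symmetric])
  qed simp
qed simp

lemma stochastic_convolution_0: "is_stochastic_convolution M e lam bet L 0 (\<lambda>_. 0)"
  unfolding is_stochastic_convolution_def
  by (intro exI[of _ "\<lambda>_ _. 0"] conjI allI has_stochastic_integral_0) simp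

lemma stochastic_convolution_moment:
  assumes "0 \<le> t" "0 < m" "m < \<alpha>" "is_stochastic_convolution M e lam bet L t Z"
  shows "(\<integral>\<^sup>+ \<omega>. ennreal (norm (Z \<omega>) powr m) \<partial>M)
    \<le> ennreal (stable_moment_const \<alpha> m * (8 * (\<Sum>k. bet k powr \<alpha> / lam k)) powr (m / \<alpha>))"
proof -
  have "(\<integral>\<^sup>+ \<omega>. ennreal (norm (Z \<omega> - 0) powr m) \<partial>M)
    \<le> ennreal (stable_moment_const \<alpha> m * conv_modulus (t - 0) powr (m / \<alpha>))"
    using assms by (intro stochastic_convolution_diff_moment[OF _ _ _ _ stochastic_convolution_0]) auto
  also have "\<dots> \<le> ennreal (stable_moment_const \<alpha> m * (8 * (\<Sum>k. bet k powr \<alpha> / lam k)) powr (m / \<alpha>))"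
    using assms \<alpha>
    by (intro ennreal_leI mult_left_mono powr_mono2 conv_modulus_le conv_modulus_nonneg stable_moment_const_nonneg) auto
  finally show ?thesis by simp
qed

text \<open>Two versions at the same time form an increment over the lag 0, where the modulus
  vanishes.\<close>

lemma stochastic_convolution_unique:
  assumes "0 \<le> t" "is_stochastic_convolution M e lam bet L t Z" "is_stochastic_convolution M e lam bet L t Z'"
    and [measurable]: "Z \<in> borel_measurable M" "Z' \<in> borel_measurable M"
  shows "AE \<omega> in M. Z' \<omega> = Z \<omega>"
proof -
  have "(\<integral>\<^sup>+ \<omega>. ennreal (norm (Z' \<omega> - Z \<omega>) powr 1) \<partial>M) = 0"
    using stochastic_convolution_diff_moment[OF assms(1) order_refl _ _ assms(2,3), of 1] \<alpha>
    by (simp add: conv_modulus_0)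
  then show ?thesis
    by (subst (asm) nn_integral_0_iff_AE) auto
qed

text \<open>The filtration is not assumed to be complete, so adaptedness could not be restored on
  null sets afterwards. The integrals are taken measurable for \<open>F t\<close> from the start,
  and \<open>lim\<close> preserves this also where the series diverges.\<close>

lemma stochastic_convolution_exists:
  assumes t: "0 \<le> t"
  shows "\<exists>Z\<in>borel_measurable (F t). is_stochastic_convolution M e lam bet L t Z"
proof -
  have sub: "subalgebra M (F t)" using filtration t by (simp add: time_filtration_def)
  have "\<exists>I\<in>borel_measurable (F t). has_stochastic_integral M (\<lambda>u. exp (- lam k * (t - u))) (L k) t I" for k
  proof (rule stochastic_integral_exists[OF prob_space_axioms stable \<alpha>(1) _ _ t sub])
    show "continuous_on {0..t} (\<lambda>u. exp (- lam k * (t - u)))" by (intro continuous_intros)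
    fix s assume s: "0 \<le> s" "s \<le> t"
    then have "L k s \<in> borel_measurable (F s)" using adapted[of k] by (simp add: adapted_process_def)
    moreover have "space (F s) = space (F t)" "sets (F s) \<subseteq> sets (F t)"
      using filtration s by (auto simp: time_filtration_def subalgebra_def)
    ultimately show "L k s \<in> borel_measurable (F t)"
      by (intro measurable_from_subalg[of "F t" "F s"]) (auto simp: subalgebra_def)
  qed (use \<alpha> in simp)
  then obtain I where IG: "\<And>k. I k \<in> borel_measurable (F t)"
    and I: "\<And>k. has_stochastic_integral M (\<lambda>u. exp (- lam k * (t - u))) (L k) t (I k)"
    by metis
  define Z where "Z \<omega> = lim (\<lambda>n. \<Sum>k<n. (bet k * I k \<omega>) *\<^sub>R e k)" for \<omega>
  have Z: "Z \<in> borel_measurable (F t)"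
    unfolding Z_def using IG by (intro borel_measurable_lim_metric borel_measurable_sum) auto
  have [measurable]: "I k \<in> borel_measurable M" for k
    using I by (auto simp: has_stochastic_integral_def)
  have LB: "Laplace_bound M (\<alpha> / 2) (conv_term t k) (\<lambda>\<omega>. (bet k * I k \<omega>)\<^sup>2)" for k
  proof -
    have "Laplace_bound M (\<alpha> / 2) (8 * (1 - exp (- lam k * (t - 0))) / lam k) (\<lambda>\<omega>. (I k \<omega> - 0)\<^sup>2)"
      using \<alpha> t by (intro exponential_integral_diff_Laplace_bound[OF prob_space_axioms stable _ _ _ _ lam_pos has_stochastic_integral_0 I]) auto
    from Laplace_bound_scale[OF this, of "(bet k)\<^sup>2"] bet_pos[of k]
    have "Laplace_bound M (\<alpha> / 2) ((bet k)\<^sup>2 powr (\<alpha> / 2) * (8 * (1 - exp (- lam k * t)) / lam k))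
      (\<lambda>\<omega>. (bet k)\<^sup>2 * (I k \<omega>)\<^sup>2)" by simp
    moreover have "(bet k)\<^sup>2 powr (\<alpha> / 2) = bet k powr \<alpha>"
      using bet_pos[of k] by (simp add: powr_powr flip: powr_numeral)
    ultimately show ?thesis by (simp add: conv_term_def power_mult_distrib)
  qed
  have "AE \<omega> in M. summable (\<lambda>k. (bet k * I k \<omega>) *\<^sub>R e k)"
    using t \<alpha> by (intro orthonormal_series_AE_summable[OF prob_space_axioms ortho _ LB summable_conv_term, of 1]) auto
  then have "AE \<omega> in M. (\<lambda>k. (bet k * I k \<omega>) *\<^sub>R e k) sums Z \<omega>"
    by eventually_elim (auto simp: Z_def sums_def summable_iff_convergent convergent_LIMSEQ_iff)
  with I Z show ?thesis unfolding is_stochastic_convolution_def by blast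
qed

end

section \<open>The semigroup\<close>

text \<open>Baire's theorem. Strong continuity at 0 bounds each orbit on a time interval that
  depends on the vector, so the interval and the bound both vary with \<open>n\<close> in the closed
  sets \<open>C n\<close>. These cover the space; one of them contains a ball, and linearity spreads
  its bound to all vectors.\<close>

lemma C0_semigroup_locally_bounded:
  fixes S :: "real \<Rightarrow> 'h::{real_normed_vector, banach} \<Rightarrow> 'h"
  assumes S: "C0_semigroup S"
  shows "\<exists>K\<ge>1. \<exists>\<delta>>0. \<forall>t\<in>{0..\<delta>}. \<forall>x. norm (S t x) \<le> K * norm x"
proof -
  define C where "C n = (\<Inter>t\<in>{0..1 / real (Suc n)}. {x. norm (S t x) \<le> real n})" for n
  have lin: "bounded_linear (S t)" if "0 \<le> t" for t
    using S that by (simp add: C0_semigroup_def)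
  have C_closed: "closed (C n)" for n
    unfolding C_def
    by (intro closed_INT ballI closed_Collect_le continuous_on_norm continuous_on_const
        linear_continuous_on lin) auto
  have "\<exists>n. x \<in> C n" for x
  proof -
    have "((\<lambda>t. norm (S t x)) \<longlongrightarrow> norm x) (at_right 0)"
      using S by (intro tendsto_norm) (simp add: C0_semigroup_def)
    then have "eventually (\<lambda>t. norm (S t x) < norm x + 1) (at_right 0)"
      by (rule order_tendstoD) simp
    then obtain d where d: "0 < d" "\<And>t. 0 < t \<Longrightarrow> t < d \<Longrightarrow> norm (S t x) < norm x + 1"
      unfolding eventually_at_right_field by blast
    obtain n :: nat where n: "real n > norm x + 1 + 1 / d" using reals_Archimedean2 by blast
    have "1 / d < real (Suc n)" using n norm_ge_zero[of x] unfolding of_nat_Suc by linarith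
    then have nd: "1 / real (Suc n) < d" using d(1) by (simp add: field_simps)
    have "norm x + 1 \<le> real n" using n d(1) by (smt (verit) divide_pos_pos)
    have "norm (S t x) \<le> real n" if "0 \<le> t" "t \<le> 1 / real (Suc n)" for t
    proof (cases "t = 0")
      case True
      then have "S t x = x" using S by (simp add: C0_semigroup_def)
      then show ?thesis using \<open>norm x + 1 \<le> real n\<close> by simp
    next
      case False
      then have "norm (S t x) < norm x + 1" using that nd by (intro d(2)) auto
      then show ?thesis using \<open>norm x + 1 \<le> real n\<close> by simp
    qed
    then have "x \<in> C n" by (auto simp: C_def)
    then show ?thesis by blast
  qed
  then have "(\<Union>n. C n) = UNIV" by auto
  then have "interior (\<Union>(range C)) \<noteq> {}" by simp
  then have "\<not> (\<forall>n. interior (C n) = {})"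
    using Met_TC.metric_Baire_category_alt[of "range C"] C_closed complete_UNIV by auto
  then obtain n x0 where "x0 \<in> interior (C n)" by blast
  then obtain r where r: "0 < r" "cball x0 r \<subseteq> C n"
    by (meson interior_subset mem_interior_cball subset_trans)
  show ?thesis
  proof (rule exI[of _ "max 1 (2 * real n / r)"], rule conjI[rotated],
      rule exI[of _ "1 / real (Suc n)"], intro conjI ballI allI)
    fix t x assume t: "t \<in> {0..1 / real (Suc n)}"
    interpret bounded_linear "S t" using t by (intro lin) auto
    show "norm (S t x) \<le> max 1 (2 * real n / r) * norm x"
    proof (cases "x = 0")
      case False
      define v where "v = (r / norm x) *\<^sub>R x"
      have "norm v = r" using False r by (simp add: v_def)
      then have "x0 + v \<in> C n" "x0 \<in> C n" using r by (auto intro!: subsetD[OF r(2)] simp: dist_norm)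
      then have "norm (S t (x0 + v)) \<le> real n" "norm (S t x0) \<le> real n"
        using t by (auto simp: C_def)
      moreover have "S t v = S t (x0 + v) - S t x0" by (simp add: add)
      ultimately have "norm (S t v) \<le> 2 * real n"
        using norm_triangle_ineq4[of "S t (x0 + v)" "S t x0"] by simp
      moreover have "norm (S t v) = r / norm x * norm (S t x)"
        using r by (simp add: v_def scaleR)
      ultimately have "norm (S t x) \<le> 2 * real n / r * norm x"
        using False r by (simp add: field_simps)
      also have "\<dots> \<le> max 1 (2 * real n / r) * norm x" by (intro mult_right_mono) auto
      finally show ?thesis .
    qed (simp add: zero)
  qed auto
qed

lemma C0_semigroup_bounded_on_interval:
  fixes S :: "real \<Rightarrow> 'h::{real_normed_vector, banach} \<Rightarrow> 'h"
  assumes S: "C0_semigroup S"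
  shows "\<exists>K\<ge>0. \<forall>t\<in>{0..T}. \<forall>x. norm (S t x) \<le> K * norm x"
proof -
  obtain K \<delta> where K: "1 \<le> K" "0 < \<delta>" "\<And>t x. t \<in> {0..\<delta>} \<Longrightarrow> norm (S t x) \<le> K * norm x"
    using C0_semigroup_locally_bounded[OF S] by blast
  have *: "norm (S t x) \<le> K ^ Suc n * norm x" if "0 \<le> t" "t \<le> real (Suc n) * \<delta>" for n t x
    using that
  proof (induction n arbitrary: t)
    case 0
    then show ?case using K(3)[of t x] by simp
  next
    case (Suc n)
    show ?case
    proof (cases "t \<le> \<delta>")
      case True
      have "norm (S t x) \<le> K * norm x" using Suc True by (intro K) auto
      also have "\<dots> \<le> K ^ Suc (Suc n) * norm x"
        using K(1) by (intro mult_right_mono self_le_power) auto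
      finally show ?thesis .
    next
      case False
      have "S (\<delta> + (t - \<delta>)) x = S \<delta> (S (t - \<delta>) x)"
        using S False K(2) unfolding C0_semigroup_def by (metis diff_ge_0_iff_ge less_imp_le not_le)
      then have "norm (S t x) \<le> K * norm (S (t - \<delta>) x)" using K(3)[of \<delta>] K(2) by simp
      also have "\<dots> \<le> K * (K ^ Suc n * norm x)"
        using Suc False K(1) by (intro mult_left_mono Suc.IH) (auto simp: algebra_simps)
      finally show ?thesis by (simp add: mult.assoc)
    qed
  qed
  obtain n where n: "real n > T / \<delta>" using reals_Archimedean2 by blast
  have "norm (S t x) \<le> K ^ Suc n * norm x" if t: "t \<in> {0..T}" for t x
  proof (rule *)
    have "T \<le> real n * \<delta>" using n K(2) by (simp add: field_simps)
    also have "\<dots> \<le> real (Suc n) * \<delta>" using K(2) by (intro mult_right_mono) auto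
    finally show "t \<le> real (Suc n) * \<delta>" using t by simp
  qed (use t in auto)
  then show ?thesis using K(1) by (intro exI[of _ "K ^ Suc n"]) auto
qed

text \<open>Euler's scheme with step \<open>t / n\<close>: each step commits an error \<open>o(t / n)\<close>, which the powers of
  the semigroup amplify at most by a constant.\<close>

lemma C0_semigroup_eigenvector:
  fixes S :: "real \<Rightarrow> 'h::{real_normed_vector, banach} \<Rightarrow> 'h"
  assumes S: "C0_semigroup S" and t: "0 \<le> t" and l: "0 \<le> l"
    and gen: "((\<lambda>h. (1 / h) *\<^sub>R (S h v - v)) \<longlongrightarrow> - l *\<^sub>R v) (at_right 0)"
  shows "S t v = exp (- l * t) *\<^sub>R v"
proof (cases "t = 0")
  case True
  then show ?thesis using S by (simp add: C0_semigroup_def)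
next
  case False
  with t have t: "0 < t" by simp
  obtain K where K: "0 \<le> K" "\<And>s x. s \<in> {0..t} \<Longrightarrow> norm (S s x) \<le> K * norm x"
    using C0_semigroup_bounded_on_interval[OF S, of t] by blast
  define \<epsilon> where "\<epsilon> h = norm (S h v - exp (- l * h) *\<^sub>R v)" for h
  have "((\<lambda>h. exp (- l * h)) has_real_derivative - l) (at 0)"
    by (auto intro!: derivative_eq_intros)
  then have "((\<lambda>h. (exp (- l * h) - 1) / h) \<longlongrightarrow> - l) (at_right 0)"
    by (auto simp: has_field_derivative_iff intro: tendsto_within_subset)
  from tendsto_diff[OF gen tendsto_scaleR[OF this tendsto_const[of v]]]
  have "((\<lambda>h. (1 / h) *\<^sub>R (S h v - v) - ((exp (- l * h) - 1) / h) *\<^sub>R v) \<longlongrightarrow> 0) (at_right 0)" by simp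
  then have "((\<lambda>h. norm ((1 / h) *\<^sub>R (S h v - v) - ((exp (- l * h) - 1) / h) *\<^sub>R v)) \<longlongrightarrow> 0) (at_right 0)"
    by (rule tendsto_norm_zero)
  moreover have "eventually (\<lambda>h. norm ((1 / h) *\<^sub>R (S h v - v) - ((exp (- l * h) - 1) / h) *\<^sub>R v) = \<epsilon> h / h) (at_right 0)"
    using eventually_at_right_less[of 0]
  proof eventually_elim
    case (elim h)
    have "(1 / h) *\<^sub>R (S h v - v) - ((exp (- l * h) - 1) / h) *\<^sub>R v = (1 / h) *\<^sub>R (S h v - exp (- l * h) *\<^sub>R v)"
      by (simp add: algebra_simps divide_inverse)
    then show ?case using elim by (simp add: \<epsilon>_def)
  qed
  ultimately have lim: "((\<lambda>h. \<epsilon> h / h) \<longlongrightarrow> 0) (at_right 0)"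
    by (rule Lim_transform_eventually)
  have err: "norm (S (real m * h) v - exp (- l * (real m * h)) *\<^sub>R v) \<le> real m * (K * \<epsilon> h)"
    if "0 < h" "real m * h \<le> t" for m h
    using that(2)
  proof (induction m)
    case 0
    then show ?case using S by (simp add: C0_semigroup_def)
  next
    case (Suc m)
    define q where "q = exp (- l * h)"
    have q: "0 \<le> q" "q \<le> 1" using that l by (auto simp: q_def)
    have mh: "real m * h \<le> t" "0 \<le> real m * h" using Suc.prems that by (auto simp: algebra_simps)
    interpret bounded_linear "S (real m * h)" using S mh by (simp add: C0_semigroup_def)
    have "S (real m * h + h) v = S (real m * h) (S h v)"
      using S mh that by (simp add: C0_semigroup_def)
    then have "S (real (Suc m) * h) v = S (real m * h) (S h v)" by (simp add: algebra_simps)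
    moreover have "exp (- l * (real (Suc m) * h)) = q * exp (- l * (real m * h))"
      by (simp add: q_def mult_exp_exp algebra_simps)
    ultimately have "S (real (Suc m) * h) v - exp (- l * (real (Suc m) * h)) *\<^sub>R v
      = S (real m * h) (S h v - q *\<^sub>R v) + q *\<^sub>R (S (real m * h) v - exp (- l * (real m * h)) *\<^sub>R v)"
      by (simp add: diff scaleR scaleR_diff_right)
    also have "norm \<dots> \<le> K * \<epsilon> h + q * (real m * (K * \<epsilon> h))"
      using K(2)[of "real m * h" "S h v - q *\<^sub>R v"] Suc.IH mh q
      by (intro norm_triangle_le add_mono) (auto simp: \<epsilon>_def q_def intro!: mult_left_mono)
    also have "\<dots> \<le> K * \<epsilon> h + 1 * (real m * (K * \<epsilon> h))"
      using q K(1) by (intro add_left_mono mult_right_mono) (auto simp: \<epsilon>_def)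
    finally show ?case by (simp add: algebra_simps)
  qed
  have le: "norm (S t v - exp (- l * t) *\<^sub>R v) \<le> K * t * (\<epsilon> (t / real n) / (t / real n))" if "n > 0" for n :: nat
    using err[of "t / real n" n] t that by (simp add: field_simps)
  have "filterlim (\<lambda>n. t / real n) (at_right 0) sequentially"
    unfolding filterlim_at
  proof (intro conjI)
    show "((\<lambda>n. t / real n) \<longlongrightarrow> 0) sequentially" by (intro tendsto_divide_0 tendsto_const) (auto intro: filterlim_real_sequentially filterlim_at_top_imp_at_infinity)
    show "\<forall>\<^sub>F n in sequentially. t / real n \<in> {0<..} \<and> t / real n \<noteq> 0"
      using t by (intro eventually_sequentiallyI[of 1]) auto
  qed
  from tendsto_mult[OF tendsto_const[of "K * t"] filterlim_compose[OF lim this]]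
  have "(\<lambda>n. K * t * (\<epsilon> (t / real n) / (t / real n))) \<longlonglongrightarrow> 0" by simp
  then have "norm (S t v - exp (- l * t) *\<^sub>R v) \<le> 0"
    by (rule tendsto_lowerbound) (use le t in \<open>auto intro!: eventually_sequentiallyI[of 1]\<close>)
  then show ?thesis by simp
qed

text \<open>On the span of the basis \<open>S t\<close> shrinks each coefficient, so Pythagoras
  gives the bound, and continuity of \<open>S t\<close> carries it to the closure.\<close>

lemma diagonal_semigroup_contraction:
  fixes S :: "real \<Rightarrow> 'h::{real_inner, banach} \<Rightarrow> 'h"
  assumes S: "C0_semigroup S" and e: "complete_orthonormal_basis e" and t: "0 \<le> t" and lam: "\<And>k. 0 \<le> lam k"
    and eig: "\<And>k. S t (e k) = exp (- lam k * t) *\<^sub>R e k"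
  shows "norm (S t x) \<le> norm x"
proof -
  have ortho: "orthonormal e" using e by (simp add: complete_orthonormal_basis_def orthonormal_def)
  interpret bounded_linear "S t" using S t by (simp add: C0_semigroup_def)
  have "inj e"
    using ortho unfolding orthonormal_def inj_def by (metis zero_neq_one)
  have "span (range e) \<subseteq> {x. norm (S t x) \<le> norm x}"
  proof
    fix x assume "x \<in> span (range e)"
    then obtain E r where x: "x = (\<Sum>a\<in>E. r a *\<^sub>R a)" and E: "finite E" "E \<subseteq> range e"
      by (auto simp: span_explicit)
    define K where "K = e -` E"
    have K: "finite K" "E = e ` K"
      using E \<open>inj e\<close> by (auto simp: K_def intro: finite_vimageI)
    have x: "x = (\<Sum>k\<in>K. r (e k) *\<^sub>R e k)"
      unfolding x K(2) using \<open>inj e\<close> by (subst sum.reindex) (auto intro: inj_on_subset)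
    have "S t x = (\<Sum>k\<in>K. (r (e k) * exp (- lam k * t)) *\<^sub>R e k)"
      unfolding x by (simp add: sum scaleR eig)
    then have "(norm (S t x))\<^sup>2 = (\<Sum>k\<in>K. (r (e k) * exp (- lam k * t))\<^sup>2)"
      using norm_sum_orthonormal[OF ortho K(1)] by simp
    also have "\<dots> \<le> (\<Sum>k\<in>K. (r (e k))\<^sup>2)"
    proof (intro sum_mono)
      fix k
      have "(exp (- lam k * t))\<^sup>2 \<le> 1\<^sup>2" using t lam[of k] by (intro power_mono) auto
      then show "(r (e k) * exp (- lam k * t))\<^sup>2 \<le> (r (e k))\<^sup>2"
        by (simp add: power_mult_distrib mult_left_le)
    qed
    also have "\<dots> = (norm x)\<^sup>2" unfolding x by (simp only: norm_sum_orthonormal[OF ortho K(1)])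
    finally show "x \<in> {x. norm (S t x) \<le> norm x}" by (simp add: power2_le_iff_abs_le)
  qed
  moreover have "closed {x. norm (S t x) \<le> norm x}"
    by (intro closed_Collect_le continuous_intros continuous_on)
  ultimately have "closure (span (range e)) \<subseteq> {x. norm (S t x) \<le> norm x}"
    by (rule closure_minimal)
  then show ?thesis using e by (auto simp: complete_orthonormal_basis_def)
qed

section \<open>Contraction semigroups and the drift integral\<close>

locale contraction_semigroup =
  fixes S :: "real \<Rightarrow> 'h::{real_inner, banach, second_countable_topology} \<Rightarrow> 'h"
  assumes C0: "C0_semigroup S" and contr: "\<And>t x. 0 \<le> t \<Longrightarrow> norm (S t x) \<le> norm x"
begin

lemma S_linear: "0 \<le> t \<Longrightarrow> bounded_linear (S t)"
  and S_0: "S 0 x = x"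
  and S_add: "0 \<le> s \<Longrightarrow> 0 \<le> t \<Longrightarrow> S (s + t) x = S s (S t x)"
  and S_right_0: "((\<lambda>t. S t x) \<longlongrightarrow> x) (at_right 0)"
  using C0 by (auto simp: C0_semigroup_def)

lemma S_diff: "0 \<le> t \<Longrightarrow> S t (x - y) = S t x - S t y"
  using S_linear bounded_linear.axioms(1) linear_diff by blast

text \<open>Taking the smaller time out as a factor and using that it contracts reduces continuity
  at every time to continuity at 0.\<close>

lemma S_time_diff:
  assumes "0 \<le> s" "0 \<le> t"
  shows "norm (S s x - S t x) \<le> norm (S \<bar>s - t\<bar> x - x)"
proof -
  have *: "norm (S t x - S s x) \<le> norm (S (t - s) x - x)" if "0 \<le> s" "s \<le> t" for s t
  proof -
    have "S t x - S s x = S s (S (t - s) x - x)"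
      using that S_add[of s "t - s" x] by (simp add: S_diff)
    then show ?thesis using contr[of s] that by simp
  qed
  show ?thesis
    using *[of s t] *[of t s] assms by (cases "s \<le> t") (auto simp: norm_minus_commute)
qed

lemma S_modulus_tendsto: "((\<lambda>t. norm (S \<bar>t\<bar> x - x)) \<longlongrightarrow> 0) (at 0)"
proof -
  have "((\<lambda>t. norm (S t x - x)) \<longlongrightarrow> 0) (at_right 0)"
    using S_right_0 by (intro tendsto_norm_zero LIM_zero)
  moreover have "filterlim (\<lambda>t::real. \<bar>t\<bar>) (at_right 0) (at 0)"
    unfolding filterlim_at by (auto simp: eventually_at_filter intro!: tendsto_rabs_zero)
  ultimately show ?thesis by (rule filterlim_compose)
qed

text \<open>Contractivity upgrades separate continuity in time and space to joint continuity, hence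
  to Borel measurability in the pair. The \<open>max 0\<close> makes the map total, so that it
  composes with arbitrary measurable functions.\<close>

lemma continuous_S_clamped: "continuous_on UNIV (\<lambda>(t, x). S (max 0 t) x)"
proof -
  have "((\<lambda>z. S (max 0 (fst z)) (snd z)) \<longlongrightarrow> S (max 0 t) x) (at (t, x))" for t x
  proof (rule Lim_transform)
    show "((\<lambda>z. S (max 0 t) x) \<longlongrightarrow> S (max 0 t) x) (at (t, x))" by (rule tendsto_const)
    have cont: "isCont (\<lambda>h. norm (S \<bar>h\<bar> x - x)) 0"
      using S_modulus_tendsto by (simp add: isCont_def S_0)
    have "((\<lambda>z. max 0 (fst z) - max 0 t) \<longlongrightarrow> max 0 t - max 0 t) (at (t, x))"
      by (intro tendsto_intros tendsto_fst[of _ "(t, x)", simplified]) 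
    then have "((\<lambda>z. max 0 (fst z) - max 0 t) \<longlongrightarrow> 0) (at (t, x))" by simp
    from isCont_tendsto_compose[OF cont this]
    have 1: "((\<lambda>z. norm (S \<bar>max 0 (fst z) - max 0 t\<bar> x - x)) \<longlongrightarrow> 0) (at (t, x))"
      by (simp add: S_0)
    have 2: "((\<lambda>z. norm (snd z - x)) \<longlongrightarrow> 0) (at (t, x))"
      by (intro tendsto_norm_zero LIM_zero tendsto_snd[of _ "(t, x)", simplified] tendsto_ident_at)
    show "((\<lambda>z. S (max 0 (fst z)) (snd z) - S (max 0 t) x) \<longlongrightarrow> 0) (at (t, x))"
    proof (rule Lim_null_comparison[OF always_eventually])
      show "((\<lambda>z. norm (S \<bar>max 0 (fst z) - max 0 t\<bar> x - x) + norm (snd z - x)) \<longlongrightarrow> 0) (at (t, x))"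
        using tendsto_add[OF 1 2] by simp
      show "\<forall>z. norm (S (max 0 (fst z)) (snd z) - S (max 0 t) x)
        \<le> norm (S \<bar>max 0 (fst z) - max 0 t\<bar> x - x) + norm (snd z - x)"
      proof
        fix z :: "real \<times> 'h"
        have "S (max 0 t) x - S (max 0 (fst z)) (snd z)
          = (S (max 0 t) x - S (max 0 (fst z)) x) + S (max 0 (fst z)) (x - snd z)"
          by (simp add: S_diff)
        also have "norm \<dots> \<le> norm (S \<bar>max 0 t - max 0 (fst z)\<bar> x - x) + norm (x - snd z)"
          by (intro norm_triangle_le add_mono S_time_diff contr) auto
        finally show "norm (S (max 0 (fst z)) (snd z) - S (max 0 t) x)
          \<le> norm (S \<bar>max 0 (fst z) - max 0 t\<bar> x - x) + norm (snd z - x)"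
          by (simp add: norm_minus_commute abs_minus_commute)
      qed
    qed
  qed
  then show ?thesis
    by (auto simp: continuous_on_def case_prod_beta')
qed

lemma measurable_S[measurable (raw)]:
  assumes [measurable]: "f \<in> borel_measurable N" "g \<in> borel_measurable N"
  shows "(\<lambda>z. S (max 0 (f z)) (g z)) \<in> borel_measurable N"
proof -
  have "(\<lambda>(t, x). S (max 0 t) x) \<in> borel_measurable borel"
    by (rule borel_measurable_continuous_onI[OF continuous_S_clamped])
  then have "(\<lambda>(t, x). S (max 0 t) x) \<in> borel_measurable (borel \<Otimes>\<^sub>M borel)"
    by (simp add: borel_prod)
  from measurable_compose[OF measurable_Pair[OF assms] this] show ?thesis by simp
qed

definition drift_conv :: "(real \<Rightarrow> 'h) \<Rightarrow> real \<Rightarrow> 'h" where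
  "drift_conv b t = (LINT s:{0..t}|lborel. S (t - s) (b s))"

lemma set_integrable_S:
  assumes b: "set_integrable lborel {0..t} b"
  shows "set_integrable lborel {0..t} (\<lambda>s. S (t - s) (b s))"
  unfolding set_integrable_def
proof (rule Bochner_Integration.integrable_bound)
  show int: "integrable lborel (\<lambda>s. indicator {0..t} s *\<^sub>R b s)"
    using b by (simp add: set_integrable_def)
  have [measurable]: "(\<lambda>s. indicator {0..t} s *\<^sub>R b s) \<in> borel_measurable borel"
    using borel_measurable_integrable[OF int] by simp
  have "(\<lambda>s. indicator {0..t} s *\<^sub>R S (t - s) (b s))
    = (\<lambda>s. indicator {0..t} s *\<^sub>R S (max 0 (t - s)) (indicator {0..t} s *\<^sub>R b s))"
    by (auto simp: fun_eq_iff indicator_def)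
  also have "\<dots> \<in> borel_measurable lborel" by measurable
  finally show "(\<lambda>s. indicator {0..t} s *\<^sub>R S (t - s) (b s)) \<in> borel_measurable lborel" .
  show "AE s in lborel. norm (indicator {0..t} s *\<^sub>R S (t - s) (b s)) \<le> norm (indicator {0..t} s *\<^sub>R b s)"
    by (auto simp: indicator_def contr)
qed

lemma norm_drift_conv_le:
  assumes b: "set_integrable lborel {0..t} b"
  shows "ennreal (norm (drift_conv b t)) \<le> (\<integral>\<^sup>+ s\<in>{0..t}. ennreal (norm (b s)) \<partial>lborel)"
proof -
  have "ennreal (norm (drift_conv b t)) \<le> (\<integral>\<^sup>+ s. ennreal (norm (indicator {0..t} s *\<^sub>R S (t - s) (b s))) \<partial>lborel)"
    unfolding drift_conv_def set_lebesgue_integral_def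
    using set_integrable_S[OF b] unfolding set_integrable_def by (rule integral_norm_bound_ennreal)
  also have "\<dots> \<le> (\<integral>\<^sup>+ s\<in>{0..t}. ennreal (norm (b s)) \<partial>lborel)"
    by (intro nn_integral_mono) (auto simp: indicator_def contr ennreal_leI)
  finally show ?thesis .
qed

lemma drift_conv_diff:
  assumes "set_integrable lborel {0..t} b" "set_integrable lborel {0..t} b'"
  shows "drift_conv b t - drift_conv b' t = drift_conv (\<lambda>s. b s - b' s) t"
proof -
  have "drift_conv b t - drift_conv b' t = (LINT s:{0..t}|lborel. S (t - s) (b s) - S (t - s) (b' s))"
    unfolding drift_conv_def using assms by (intro set_integral_diff(2)[symmetric] set_integrable_S)
  also have "\<dots> = drift_conv (\<lambda>s. b s - b' s) t"
    unfolding drift_conv_def by (intro set_lebesgue_integral_cong) (auto simp: S_diff)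
  finally show ?thesis .
qed

text \<open>Dominated convergence with majorant \<open>norm (b0 s)\<close>. For fixed
  \<open>s\<close> the integrand is continuous in the upper limit except at \<open>s = t\<close>,
  where the indicator jumps; this is one point of measure zero.\<close>

lemma continuous_on_drift_conv:
  assumes b: "set_integrable lborel {0..T} b"
  shows "continuous_on {0..T} (drift_conv b)"
  unfolding continuous_on_sequentially comp_def
proof (intro ballI allI impI)
  fix r :: "nat \<Rightarrow> real" and t
  assume t: "t \<in> {0..T}" and r: "(\<forall>n. r n \<in> {0..T}) \<and> r \<longlonglongrightarrow> t"
  define b0 where "b0 s = indicator {0..T} s *\<^sub>R b s" for s
  have int: "integrable lborel b0" using b unfolding set_integrable_def b0_def .
  have [measurable]: "b0 \<in> borel_measurable borel"
    using borel_measurable_integrable[OF int] by simp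
  have eq: "drift_conv b u = (\<integral>s. indicator {0..u} s *\<^sub>R S (max 0 (u - s)) (b0 s) \<partial>lborel)" if "u \<in> {0..T}" for u
    unfolding drift_conv_def set_lebesgue_integral_def b0_def using that
    by (intro Bochner_Integration.integral_cong) (auto simp: indicator_def)
  have "(\<lambda>n. \<integral>s. indicator {0..r n} s *\<^sub>R S (max 0 (r n - s)) (b0 s) \<partial>lborel)
    \<longlonglongrightarrow> (\<integral>s. indicator {0..t} s *\<^sub>R S (max 0 (t - s)) (b0 s) \<partial>lborel)"
  proof (rule integral_dominated_convergence)
    show "integrable lborel (\<lambda>s. norm (b0 s))" using int by simp
    have "AE s in lborel. s \<noteq> t" by (rule AE_lborel_singleton)
    then show "AE s in lborel. (\<lambda>n. indicator {0..r n} s *\<^sub>R S (max 0 (r n - s)) (b0 s))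
      \<longlonglongrightarrow> indicator {0..t} s *\<^sub>R S (max 0 (t - s)) (b0 s)"
    proof eventually_elim
      case (elim s)
      have "(\<lambda>n. (r n - s, b0 s)) \<longlonglongrightarrow> (t - s, b0 s)" using r by (intro tendsto_intros) auto
      from continuous_on_tendsto_compose[OF continuous_S_clamped this]
      have "(\<lambda>n. S (max 0 (r n - s)) (b0 s)) \<longlonglongrightarrow> S (max 0 (t - s)) (b0 s)" by simp
      moreover have "(\<lambda>n. indicator {0..r n} s :: real) \<longlonglongrightarrow> indicator {0..t} s"
      proof (rule tendsto_eventually)
        consider "s < 0" | "0 \<le> s" "s < t" | "t < s" using elim by linarith
        then show "eventually (\<lambda>n. indicator {0..r n} s = (indicator {0..t} s :: real)) sequentially"
        proof cases
          case 2
          then have "eventually (\<lambda>n. s < r n) sequentially" using r by (auto intro: order_tendstoD)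
          then show ?thesis by eventually_elim (use 2 in \<open>auto simp: indicator_def\<close>)
        next
          case 3
          then have "eventually (\<lambda>n. r n < s) sequentially" using r by (auto intro: order_tendstoD)
          then show ?thesis by eventually_elim (use 3 in \<open>auto simp: indicator_def\<close>)
        qed (auto simp: indicator_def)
      qed
      ultimately show ?case by (intro tendsto_scaleR)
    qed
    show "AE s in lborel. norm (indicator {0..r n} s *\<^sub>R S (max 0 (r n - s)) (b0 s)) \<le> norm (b0 s)" for n
      by (auto simp: indicator_def contr)
  qed measurable
  then show "(\<lambda>n. drift_conv b (r n)) \<longlonglongrightarrow> drift_conv b t"
    using eq t r by simp
qed

end

section \<open>Moments and the Lipschitz drift\<close>

locale mckean_vlasov = stable_noise M F e lam bet L \<alpha> + contraction_semigroup S
  for M :: "'w measure" and F :: "real \<Rightarrow> 'w measure"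
    and e :: "nat \<Rightarrow> 'h::{real_inner,banach,second_countable_topology}"
    and lam bet :: "nat \<Rightarrow> real" and L :: "nat \<Rightarrow> real \<Rightarrow> 'w \<Rightarrow> real"
    and \<alpha> :: real and S :: "real \<Rightarrow> 'h \<Rightarrow> 'h" +
  fixes B :: "'h \<Rightarrow> 'h measure \<Rightarrow> 'h" and p C :: real
  assumes p: "1 \<le> p" "p < \<alpha>" and C: "0 < C"
    and lip: "\<And>x y \<mu> \<nu>. \<mu> \<in> moment_probs p \<Longrightarrow> \<nu> \<in> moment_probs p \<Longrightarrow>
      norm (B x \<mu> - B y \<nu>) \<le> C * (norm (x - y) + wasserstein p \<mu> \<nu>)"
begin

definition moment :: "real \<Rightarrow> ('w \<Rightarrow> 'h) \<Rightarrow> ennreal" where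
  "moment m X = (\<integral>\<^sup>+ \<omega>. ennreal (norm (X \<omega>) powr m) \<partial>M)"

text \<open>An infinite moment becomes 0 under \<open>enn2real\<close>. The distance is therefore
  meaningful only together with finiteness of the moment of the difference.\<close>

definition Lp_dist :: "('w \<Rightarrow> 'h) \<Rightarrow> ('w \<Rightarrow> 'h) \<Rightarrow> real" where
  "Lp_dist X Y = enn2real (moment p (\<lambda>\<omega>. X \<omega> - Y \<omega>)) powr (1 / p)"

definition drift :: "(real \<Rightarrow> 'w \<Rightarrow> 'h) \<Rightarrow> 'w \<Rightarrow> real \<Rightarrow> 'h" where
  "drift X \<omega> s = B (X s \<omega>) (law M (X s))"

lemma moment_zero: "moment m (\<lambda>_. 0) = 0"
  by (simp add: moment_def)

lemma moment_cong_AE: "AE \<omega> in M. X \<omega> = Y \<omega> \<Longrightarrow> moment m X = moment m Y"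
  unfolding moment_def by (intro nn_integral_cong_AE) auto

lemma moment_mono_AE: "0 \<le> m \<Longrightarrow> AE \<omega> in M. norm (X \<omega>) \<le> norm (Y \<omega>) \<Longrightarrow> moment m X \<le> moment m Y"
  unfolding moment_def by (intro nn_integral_mono_AE) (auto intro!: ennreal_leI powr_mono2)

lemma moment_minus_commute: "moment m (\<lambda>\<omega>. X \<omega> - Y \<omega>) = moment m (\<lambda>\<omega>. Y \<omega> - X \<omega>)"
  by (simp add: moment_def norm_minus_commute)

text \<open>The factor \<open>2 powr m\<close> replaces the roots in Minkowski's inequality. All
  estimates then remain linear in the m-th moments, which is the form that Gronwall's inequality
  takes.\<close>

lemma moment_add:
  assumes [measurable]: "X \<in> borel_measurable M" "Y \<in> borel_measurable M" and m: "0 \<le> m"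
  shows "moment m (\<lambda>\<omega>. X \<omega> + Y \<omega>) \<le> ennreal (2 powr m) * (moment m X + moment m Y)"
proof -
  have "moment m (\<lambda>\<omega>. X \<omega> + Y \<omega>)
    \<le> (\<integral>\<^sup>+ \<omega>. ennreal (2 powr m) * (ennreal (norm (X \<omega>) powr m) + ennreal (norm (Y \<omega>) powr m)) \<partial>M)"
    unfolding moment_def
  proof (intro nn_integral_mono)
    fix \<omega>
    have "norm (X \<omega> + Y \<omega>) powr m \<le> (norm (X \<omega>) + norm (Y \<omega>)) powr m"
      using m by (intro powr_mono2 norm_triangle_ineq) auto
    also have "\<dots> \<le> 2 powr m * (norm (X \<omega>) powr m + norm (Y \<omega>) powr m)"
      using m by (intro powr_sum_le) auto
    finally show "ennreal (norm (X \<omega> + Y \<omega>) powr m)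
      \<le> ennreal (2 powr m) * (ennreal (norm (X \<omega>) powr m) + ennreal (norm (Y \<omega>) powr m))"
      by (simp add: ennreal_leI flip: ennreal_mult ennreal_plus)
  qed
  also have "\<dots> = ennreal (2 powr m) * (moment m X + moment m Y)"
    unfolding moment_def by (subst nn_integral_cmult) (auto simp: nn_integral_add)
  finally show ?thesis .
qed

lemma moment_triangle:
  assumes [measurable]: "X \<in> borel_measurable M" "Y \<in> borel_measurable M" "W \<in> borel_measurable M" and m: "0 \<le> m"
  shows "moment m (\<lambda>\<omega>. X \<omega> - W \<omega>) \<le> ennreal (2 powr m) * (moment m (\<lambda>\<omega>. X \<omega> - Y \<omega>) + moment m (\<lambda>\<omega>. Y \<omega> - W \<omega>))"
  using moment_add[of "\<lambda>\<omega>. X \<omega> - Y \<omega>" "\<lambda>\<omega>. Y \<omega> - W \<omega>" m] m by simp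

lemma moment_0_iff:
  assumes [measurable]: "X \<in> borel_measurable M"
  shows "moment m X = 0 \<longleftrightarrow> (AE \<omega> in M. X \<omega> = 0)"
  unfolding moment_def by (subst nn_integral_0_iff_AE) auto

lemma moment_finite_mono:
  assumes "p \<le> m" "moment m X < \<infinity>" and [measurable]: "X \<in> borel_measurable M"
  shows "moment p X < \<infinity>"
proof -
  have "moment p X \<le> (\<integral>\<^sup>+ \<omega>. 1 + ennreal (norm (X \<omega>) powr m) \<partial>M)"
    unfolding moment_def
  proof (intro nn_integral_mono)
    fix \<omega>
    have "norm (X \<omega>) powr p \<le> 1 + (norm (X \<omega>) powr p) powr (m / p)"
      using assms p by (intro le_one_plus_powr) auto
    then have "norm (X \<omega>) powr p \<le> 1 + norm (X \<omega>) powr m"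
      using p by (simp add: powr_powr)
    then have "ennreal (norm (X \<omega>) powr p) \<le> ennreal (1 + norm (X \<omega>) powr m)"
      by (rule ennreal_leI)
    then show "ennreal (norm (X \<omega>) powr p) \<le> 1 + ennreal (norm (X \<omega>) powr m)"
      by (simp add: ennreal_plus)
  qed
  also have "\<dots> = 1 + moment m X"
    by (subst nn_integral_add) (auto simp: moment_def emeasure_space_1)
  also have "\<dots> < \<infinity>" using assms(2) by simp
  finally show ?thesis .
qed

lemma law_moment_probs_iff:
  assumes [measurable]: "X \<in> borel_measurable M"
  shows "law M X \<in> moment_probs p \<longleftrightarrow> moment p X < \<infinity>"
proof -
  have "prob_space (law M X)" unfolding law_def by (rule prob_space_distr) measurable
  then show ?thesis
    by (simp add: moment_probs_def borel_probs_def law_def nn_integral_distr moment_def)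
qed

text \<open>The joint law of \<open>X\<close> and \<open>Y\<close> is one of the couplings.
  Finiteness is needed because \<open>enn2real\<close> is monotone only below infinity.\<close>

lemma wasserstein_le_Lp_dist:
  assumes [measurable]: "X \<in> borel_measurable M" "Y \<in> borel_measurable M"
    and fin: "moment p (\<lambda>\<omega>. X \<omega> - Y \<omega>) < \<infinity>"
  shows "wasserstein p (law M X) (law M Y) \<le> Lp_dist X Y"
proof -
  define \<pi> where "\<pi> = distr M (borel \<Otimes>\<^sub>M borel) (\<lambda>\<omega>. (X \<omega>, Y \<omega>))"
  have "\<pi> \<in> couplings (law M X) (law M Y)"
    unfolding couplings_def \<pi>_def law_def
    by (auto intro!: prob_space_distr simp: distr_distr comp_def)
  moreover have "(\<integral>\<^sup>+ z. ennreal (norm (fst z - snd z) powr p) \<partial>\<pi>) = moment p (\<lambda>\<omega>. X \<omega> - Y \<omega>)"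
    unfolding \<pi>_def moment_def by (subst nn_integral_distr) auto
  ultimately have "(INF \<pi>\<in>couplings (law M X) (law M Y). \<integral>\<^sup>+ z. ennreal (norm (fst z - snd z) powr p) \<partial>\<pi>)
    \<le> moment p (\<lambda>\<omega>. X \<omega> - Y \<omega>)"
    by (metis (no_types, lifting) INF_lower)
  then show ?thesis
    unfolding wasserstein_def Lp_dist_def using fin p
    by (intro powr_mono2 enn2real_mono) auto
qed

lemma moment_diff_finite:
  assumes [measurable]: "X \<in> borel_measurable M" "Y \<in> borel_measurable M"
    and "moment m X < \<infinity>" "moment m Y < \<infinity>" "0 \<le> m"
  shows "moment m (\<lambda>\<omega>. X \<omega> - Y \<omega>) < \<infinity>"
proof -
  have "moment m (\<lambda>\<omega>. X \<omega> - Y \<omega>) \<le> ennreal (2 powr m) * (moment m X + moment m Y)"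
    using moment_add[of X "\<lambda>\<omega>. - Y \<omega>" m] assms by (simp add: moment_def)
  also have "\<dots> < \<infinity>" using assms by (simp add: ennreal_mult_less_top)
  finally show ?thesis .
qed

lemma drift_lipschitz:
  assumes [measurable]: "X \<in> borel_measurable M" "Y \<in> borel_measurable M"
    and "moment p X < \<infinity>" "moment p Y < \<infinity>"
  shows "norm (B x (law M X) - B y (law M Y)) \<le> C * (norm (x - y) + Lp_dist X Y)"
proof -
  have "norm (B x (law M X) - B y (law M Y)) \<le> C * (norm (x - y) + wasserstein p (law M X) (law M Y))"
    using assms by (intro lip) (auto simp: law_moment_probs_iff)
  also have "\<dots> \<le> C * (norm (x - y) + Lp_dist X Y)"
    using C p assms by (intro mult_left_mono add_left_mono wasserstein_le_Lp_dist moment_diff_finite) auto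
  finally show ?thesis .
qed

text \<open>Jensen's inequality for \<open>M\<close>, applied to the p-th power with exponent
  \<open>m / p\<close>, shows that the m-th power of \<open>Lp_dist X Y\<close> is at most the m-th
  moment of the difference. The law term thus costs no more than the pathwise term, whence the
  leading factor 2.\<close>

lemma lipschitz_moment:
  assumes [measurable]: "X \<in> borel_measurable M" "Y \<in> borel_measurable M"
    and fin: "moment p (\<lambda>\<omega>. X \<omega> - Y \<omega>) < \<infinity>" and m: "p \<le> m"
  shows "(\<integral>\<^sup>+ \<omega>. ennreal ((C * (norm (X \<omega> - Y \<omega>) + Lp_dist X Y)) powr m) \<partial>M)
    \<le> ennreal (2 * (2 * C) powr m) * moment m (\<lambda>\<omega>. X \<omega> - Y \<omega>)"
proof -
  define d where "d \<omega> = norm (X \<omega> - Y \<omega>)" for \<omega>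
  have [measurable]: "d \<in> borel_measurable M" unfolding d_def by measurable
  define w where "w = Lp_dist X Y"
  define x where "x = enn2real (moment p (\<lambda>\<omega>. X \<omega> - Y \<omega>))"
  have d0: "0 \<le> d \<omega>" for \<omega> by (simp add: d_def)
  have w0: "0 \<le> w" by (simp add: w_def Lp_dist_def)
  have Ed: "moment m' (\<lambda>\<omega>. X \<omega> - Y \<omega>) = (\<integral>\<^sup>+ \<omega>. ennreal (d \<omega> powr m') \<partial>M)" for m'
    by (simp add: moment_def d_def)
  have x: "ennreal x = (\<integral>\<^sup>+ \<omega>. ennreal (d \<omega> powr p) \<partial>M)"
    using fin by (simp add: x_def flip: Ed)
  have "ennreal (x powr (m / p)) \<le> ennreal (1 powr (m / p - 1)) * (\<integral>\<^sup>+ \<omega>. ennreal ((d \<omega> powr p) powr (m / p)) \<partial>M)"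
    using p m x by (intro nn_integral_powr_Jensen) (auto simp: emeasure_space_1 x_def)
  also have "\<dots> = moment m (\<lambda>\<omega>. X \<omega> - Y \<omega>)"
    using p by (simp add: powr_powr Ed)
  also have "x powr (m / p) = w powr m"
    using p by (simp add: w_def Lp_dist_def x_def powr_powr)
  finally have wm: "ennreal (w powr m) \<le> moment m (\<lambda>\<omega>. X \<omega> - Y \<omega>)" .
  have "(\<integral>\<^sup>+ \<omega>. ennreal ((C * (d \<omega> + w)) powr m) \<partial>M)
    \<le> (\<integral>\<^sup>+ \<omega>. ennreal ((2 * C) powr m) * (ennreal (d \<omega> powr m) + ennreal (w powr m)) \<partial>M)"
  proof (intro nn_integral_mono)
    fix \<omega>
    have "(C * (d \<omega> + w)) powr m = C powr m * (d \<omega> + w) powr m"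
      using C d0[of \<omega>] w0 by (simp add: powr_mult)
    also have "\<dots> \<le> C powr m * (2 powr m * (d \<omega> powr m + w powr m))"
      using m p d0 w0 by (intro mult_left_mono powr_sum_le) auto
    also have "\<dots> = (2 * C) powr m * (d \<omega> powr m + w powr m)"
      using C by (simp add: powr_mult)
    finally show "ennreal ((C * (d \<omega> + w)) powr m) \<le> ennreal ((2 * C) powr m) * (ennreal (d \<omega> powr m) + ennreal (w powr m))"
      by (simp add: ennreal_leI flip: ennreal_mult ennreal_plus)
  qed
  also have "\<dots> = ennreal ((2 * C) powr m) * (moment m (\<lambda>\<omega>. X \<omega> - Y \<omega>) + ennreal (w powr m))"
    unfolding Ed by (subst nn_integral_cmult) (auto simp: nn_integral_add emeasure_space_1)
  also have "\<dots> \<le> ennreal ((2 * C) powr m) * (moment m (\<lambda>\<omega>. X \<omega> - Y \<omega>) + moment m (\<lambda>\<omega>. X \<omega> - Y \<omega>))"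
    by (intro mult_left_mono add_left_mono wm) auto
  also have "\<dots> = ennreal (2 * (2 * C) powr m) * moment m (\<lambda>\<omega>. X \<omega> - Y \<omega>)"
    by (simp add: ennreal_mult mult_2[symmetric] ac_simps)
  finally show ?thesis by (simp add: d_def w_def)
qed

text \<open>Jensen's inequality in time along each path, followed by an exchange of time and
  expectation. The integral of \<open>h\<close> may be infinite on some paths; \<open>g\<close>
  stands for the norm of a drift integral or a truncated value of the time integral.\<close>

lemma integrated_Jensen:
  assumes h[measurable]: "(\<lambda>(s, \<omega>). h s \<omega>) \<in> borel_measurable (borel \<Otimes>\<^sub>M M)"
    and h0: "\<And>s \<omega>. 0 \<le> h s \<omega>" and t: "0 \<le> t" and m: "1 \<le> m" and g: "\<And>\<omega>. 0 \<le> g \<omega>"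
    and le: "AE \<omega> in M. ennreal (g \<omega>) \<le> (\<integral>\<^sup>+ s\<in>{0..t}. ennreal (h s \<omega>) \<partial>lborel)"
  shows "(\<integral>\<^sup>+ \<omega>. ennreal (g \<omega> powr m) \<partial>M) \<le> ennreal (t powr (m - 1)) * (\<integral>\<^sup>+ s\<in>{0..t}. (\<integral>\<^sup>+ \<omega>. ennreal (h s \<omega> powr m) \<partial>M) \<partial>lborel)"
proof -
  interpret P: pair_sigma_finite lborel M ..
  have "(\<integral>\<^sup>+ \<omega>. ennreal (g \<omega> powr m) \<partial>M) \<le> (\<integral>\<^sup>+ \<omega>. ennreal (t powr (m - 1)) * (\<integral>\<^sup>+ s\<in>{0..t}. ennreal (h s \<omega> powr m) \<partial>lborel) \<partial>M)"
  proof (rule nn_integral_mono_AE)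
    have "AE \<omega> in M. \<omega> \<in> space M" by (rule AE_space)
    with le show "AE \<omega> in M. ennreal (g \<omega> powr m)
      \<le> ennreal (t powr (m - 1)) * (\<integral>\<^sup>+ s\<in>{0..t}. ennreal (h s \<omega> powr m) \<partial>lborel)"
    proof eventually_elim
      case (elim \<omega>)
      then have "(\<lambda>s. h s \<omega>) \<in> borel_measurable borel" by measurable
      then show ?case
        using elim h0 t m g by (intro nn_integral_interval_powr_Jensen) auto
    qed
  qed
  also have "\<dots> = ennreal (t powr (m - 1)) * (\<integral>\<^sup>+ \<omega>. (\<integral>\<^sup>+ s. ennreal (h s \<omega> powr m) * indicator {0..t} s \<partial>lborel) \<partial>M)"
    by (intro nn_integral_cmult) measurable
  also have "(\<integral>\<^sup>+ \<omega>. (\<integral>\<^sup>+ s. ennreal (h s \<omega> powr m) * indicator {0..t} s \<partial>lborel) \<partial>M)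
    = (\<integral>\<^sup>+ s. (\<integral>\<^sup>+ \<omega>. ennreal (h s \<omega> powr m) * indicator {0..t} s \<partial>M) \<partial>lborel)"
    by (rule P.Fubini') measurable
  also have "\<dots> = (\<integral>\<^sup>+ s\<in>{0..t}. (\<integral>\<^sup>+ \<omega>. ennreal (h s \<omega> powr m) \<partial>M) \<partial>lborel)"
  proof (intro nn_integral_cong nn_integral_multc)
    fix s :: real
    show "(\<lambda>\<omega>. ennreal (h s \<omega> powr m)) \<in> borel_measurable M" by measurable
  qed
  finally show ?thesis .
qed

definition Lp_process :: "(real \<Rightarrow> 'w \<Rightarrow> 'h) \<Rightarrow> bool" where
  "Lp_process X \<longleftrightarrow> predictable_process M F X \<and> (\<forall>t\<ge>0. moment p (X t) < \<infinity>)"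

lemma Lp_process_measurable:
  assumes "Lp_process X"
  shows "(\<lambda>(s, \<omega>). X (max 0 s) \<omega>) \<in> borel_measurable (borel \<Otimes>\<^sub>M M)"
    and "0 \<le> t \<Longrightarrow> X t \<in> borel_measurable (F t)"
    and "0 \<le> t \<Longrightarrow> X t \<in> borel_measurable M"
    and "0 \<le> t \<Longrightarrow> moment p (X t) < \<infinity>"
proof -
  have X: "predictable_process M F X" using assms by (simp add: Lp_process_def)
  show "(\<lambda>(s, \<omega>). X (max 0 s) \<omega>) \<in> borel_measurable (borel \<Otimes>\<^sub>M M)"
    by (rule predictable_measurable_pos[OF filtration X])
  show "0 \<le> t \<Longrightarrow> X t \<in> borel_measurable (F t)"
    using predictable_imp_adapted[OF filtration X] by (simp add: adapted_process_def)
  then show "0 \<le> t \<Longrightarrow> X t \<in> borel_measurable M"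
    using filtration_measurable[OF filtration] by blast
  show "0 \<le> t \<Longrightarrow> moment p (X t) < \<infinity>" using assms by (simp add: Lp_process_def)
qed

lemma Lp_process_0: "Lp_process (\<lambda>_ _. 0)"
  unfolding Lp_process_def predictable_process_def
  by (auto simp: moment_def case_prod_beta')

lemma measurable_moment_diff:
  assumes "Lp_process X" "Lp_process Y"
  shows "(\<lambda>s. moment m (\<lambda>\<omega>. X (max 0 s) \<omega> - Y (max 0 s) \<omega>)) \<in> borel_measurable borel"
proof -
  note [measurable] = Lp_process_measurable(1)[OF assms(1)] Lp_process_measurable(1)[OF assms(2)]
  show ?thesis unfolding moment_def by measurable
qed

lemma measurable_lipschitz_bound:
  assumes "Lp_process X" "Lp_process Y"
  shows "(\<lambda>(s, \<omega>). C * (norm (X (max 0 s) \<omega> - Y (max 0 s) \<omega>) + Lp_dist (X (max 0 s)) (Y (max 0 s))))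
    \<in> borel_measurable (borel \<Otimes>\<^sub>M M)"
proof -
  note [measurable] = Lp_process_measurable(1)[OF assms(1)] Lp_process_measurable(1)[OF assms(2)]
    measurable_moment_diff[OF assms]
  show ?thesis unfolding Lp_dist_def by measurable
qed

text \<open>The drifts are compared through the Lipschitz majorant \<open>h\<close>, which is
  jointly measurable. For the drift itself this is known only if the laws vary continuously, and
  that is not assumed of an \<open>Lp_process\<close>.\<close>

lemma drift_conv_diff_moment:
  assumes X: "Lp_process X" and Y: "Lp_process Y" and t: "0 \<le> t" and m: "p \<le> m"
    and "AE \<omega> in M. set_integrable lborel {0..t} (drift X \<omega>)"
    and "AE \<omega> in M. set_integrable lborel {0..t} (drift Y \<omega>)"
  shows "moment m (\<lambda>\<omega>. drift_conv (drift X \<omega>) t - drift_conv (drift Y \<omega>) t)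
    \<le> ennreal (t powr (m - 1) * (2 * (2 * C) powr m)) * (\<integral>\<^sup>+ s\<in>{0..t}. moment m (\<lambda>\<omega>. X s \<omega> - Y s \<omega>) \<partial>lborel)"
proof -
  note Xm = Lp_process_measurable[OF X] and Ym = Lp_process_measurable[OF Y]
  note [measurable] = measurable_moment_diff[OF X Y]
  define h where "h s \<omega> = C * (norm (X (max 0 s) \<omega> - Y (max 0 s) \<omega>) + Lp_dist (X (max 0 s)) (Y (max 0 s)))" for s \<omega>
  have "moment m (\<lambda>\<omega>. drift_conv (drift X \<omega>) t - drift_conv (drift Y \<omega>) t)
    \<le> ennreal (t powr (m - 1)) * (\<integral>\<^sup>+ s\<in>{0..t}. (\<integral>\<^sup>+ \<omega>. ennreal (h s \<omega> powr m) \<partial>M) \<partial>lborel)"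
    unfolding moment_def
  proof (rule integrated_Jensen)
    show "(\<lambda>(s, \<omega>). h s \<omega>) \<in> borel_measurable (borel \<Otimes>\<^sub>M M)"
      unfolding h_def by (rule measurable_lipschitz_bound[OF X Y])
    show "0 \<le> h s \<omega>" for s \<omega> using C by (simp add: h_def Lp_dist_def)
    show "AE \<omega> in M. ennreal (norm (drift_conv (drift X \<omega>) t - drift_conv (drift Y \<omega>) t))
      \<le> (\<integral>\<^sup>+ s\<in>{0..t}. ennreal (h s \<omega>) \<partial>lborel)"
      using assms(5,6)
    proof eventually_elim
      case (elim \<omega>)
      have "ennreal (norm (drift_conv (drift X \<omega>) t - drift_conv (drift Y \<omega>) t))
        \<le> (\<integral>\<^sup>+ s\<in>{0..t}. ennreal (norm (drift X \<omega> s - drift Y \<omega> s)) \<partial>lborel)"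
        unfolding drift_conv_diff[OF elim]
        by (rule norm_drift_conv_le) (rule set_integral_diff(1)[OF elim])
      also have "\<dots> \<le> (\<integral>\<^sup>+ s\<in>{0..t}. ennreal (h s \<omega>) \<partial>lborel)"
        using drift_lipschitz Xm Ym
        by (intro nn_integral_mono) (auto simp: indicator_def h_def drift_def intro!: ennreal_leI)
      finally show ?case .
    qed
  qed (use t m p in auto)
  also have "\<dots> \<le> ennreal (t powr (m - 1)) *
    (\<integral>\<^sup>+ s. ennreal (2 * (2 * C) powr m) * (moment m (\<lambda>\<omega>. X s \<omega> - Y s \<omega>) * indicator {0..t} s) \<partial>lborel)"
  proof (intro mult_left_mono nn_integral_mono)
    fix s :: real
    show "(\<integral>\<^sup>+ \<omega>. ennreal (h s \<omega> powr m) \<partial>M) * indicator {0..t} s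
      \<le> ennreal (2 * (2 * C) powr m) * (moment m (\<lambda>\<omega>. X s \<omega> - Y s \<omega>) * indicator {0..t} s)"
      using lipschitz_moment[of "X s" "Y s" m] Xm(3,4)[of s] Ym(3,4)[of s] m p moment_diff_finite[of "X s" "Y s" p]
      by (auto simp: indicator_def h_def)
  qed auto
  also have "(\<integral>\<^sup>+ s. ennreal (2 * (2 * C) powr m) * (moment m (\<lambda>\<omega>. X s \<omega> - Y s \<omega>) * indicator {0..t} s) \<partial>lborel)
    = (\<integral>\<^sup>+ s. ennreal (2 * (2 * C) powr m) * (moment m (\<lambda>\<omega>. X (max 0 s) \<omega> - Y (max 0 s) \<omega>) * indicator {0..t} s) \<partial>lborel)"
    by (intro nn_integral_cong) (auto simp: indicator_def)
  also have "\<dots> = ennreal (2 * (2 * C) powr m) * (\<integral>\<^sup>+ s\<in>{0..t}. moment m (\<lambda>\<omega>. X (max 0 s) \<omega> - Y (max 0 s) \<omega>) \<partial>lborel)"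
    by (intro nn_integral_cmult) measurable
  also have "(\<integral>\<^sup>+ s\<in>{0..t}. moment m (\<lambda>\<omega>. X (max 0 s) \<omega> - Y (max 0 s) \<omega>) \<partial>lborel)
    = (\<integral>\<^sup>+ s\<in>{0..t}. moment m (\<lambda>\<omega>. X s \<omega> - Y s \<omega>) \<partial>lborel)"
    by (intro nn_integral_cong) (auto simp: indicator_def)
  finally show ?thesis
    by (simp add: ennreal_mult mult.assoc)
qed

section \<open>Linear growth of the drift\<close>

definition drift_0 :: real where
  "drift_0 = norm (B 0 (law M (\<lambda>_. 0)))"

text \<open>The Lipschitz bound relative to the zero process. The \<open>- 0\<close> and the
  constant function are kept so that the lemmas on differences apply with
  \<open>Lp_process_0\<close> as the second process.\<close>

definition drift_bound :: "(real \<Rightarrow> 'w \<Rightarrow> 'h) \<Rightarrow> real \<Rightarrow> 'w \<Rightarrow> real" where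
  "drift_bound X s \<omega> = drift_0 + C * (norm (X (max 0 s) \<omega> - 0) + Lp_dist (X (max 0 s)) (\<lambda>_. 0))"

lemma drift_bound_nonneg: "0 \<le> drift_bound X s \<omega>"
  using C by (simp add: drift_bound_def drift_0_def Lp_dist_def)

lemma measurable_drift_bound:
  assumes "Lp_process X"
  shows "(\<lambda>(s, \<omega>). drift_bound X s \<omega>) \<in> borel_measurable (borel \<Otimes>\<^sub>M M)"
proof -
  note [measurable] = measurable_lipschitz_bound[OF assms Lp_process_0]
  have "(\<lambda>z. drift_0 + (case z of (s, \<omega>) \<Rightarrow>
      C * (norm (X (max 0 s) \<omega> - 0) + Lp_dist (X (max 0 s)) (\<lambda>_. 0)))) \<in> borel_measurable (borel \<Otimes>\<^sub>M M)"
    by measurable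
  then show ?thesis by (simp add: drift_bound_def case_prod_beta')
qed

lemma norm_drift_le:
  assumes "Lp_process X" "0 \<le> s"
  shows "norm (drift X \<omega> s) \<le> drift_bound X s \<omega>"
proof -
  have "norm (drift X \<omega> s - B 0 (law M (\<lambda>_. 0))) \<le> C * (norm (X s \<omega> - 0) + Lp_dist (X s) (\<lambda>_. 0))"
    unfolding drift_def using Lp_process_measurable(3,4)[OF assms]
    by (intro drift_lipschitz) (auto simp: moment_zero)
  then show ?thesis
    using norm_triangle_sub[of "drift X \<omega> s" "B 0 (law M (\<lambda>_. 0))"] assms(2)
    by (simp add: drift_bound_def drift_0_def)
qed

lemma drift_bound_moment:
  assumes X: "Lp_process X" and s: "0 \<le> s" and m: "p \<le> m"
  shows "(\<integral>\<^sup>+ \<omega>. ennreal (drift_bound X s \<omega> powr m) \<partial>M)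
    \<le> ennreal (2 powr m * drift_0 powr m) + ennreal (2 powr m * (2 * (2 * C) powr m)) * moment m (X s)"
proof -
  note Xm = Lp_process_measurable[OF X]
  note [measurable] = Xm(3)[OF s]
  define k where "k \<omega> = C * (norm (X s \<omega> - 0) + Lp_dist (X s) (\<lambda>_. 0))" for \<omega>
  have [measurable]: "k \<in> borel_measurable M" unfolding k_def by measurable
  have k0: "0 \<le> k \<omega>" for \<omega> using C by (simp add: k_def Lp_dist_def)
  have d0: "0 \<le> drift_0" by (simp add: drift_0_def)
  have "(\<integral>\<^sup>+ \<omega>. ennreal (drift_bound X s \<omega> powr m) \<partial>M)
    \<le> (\<integral>\<^sup>+ \<omega>. ennreal (2 powr m * drift_0 powr m) + ennreal (2 powr m) * ennreal (k \<omega> powr m) \<partial>M)"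
  proof (intro nn_integral_mono)
    fix \<omega>
    have "(drift_0 + k \<omega>) powr m \<le> 2 powr m * (drift_0 powr m + k \<omega> powr m)"
      using k0 d0 m p by (intro powr_sum_le) auto
    then have "ennreal ((drift_0 + k \<omega>) powr m) \<le> ennreal (2 powr m * drift_0 powr m + 2 powr m * k \<omega> powr m)"
      by (intro ennreal_leI) (simp add: algebra_simps)
    then show "ennreal (drift_bound X s \<omega> powr m) \<le> ennreal (2 powr m * drift_0 powr m) + ennreal (2 powr m) * ennreal (k \<omega> powr m)"
      using s by (simp add: ennreal_plus ennreal_mult drift_bound_def k_def)
  qed
  also have "\<dots> = ennreal (2 powr m * drift_0 powr m) + ennreal (2 powr m) * (\<integral>\<^sup>+ \<omega>. ennreal (k \<omega> powr m) \<partial>M)"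
    by (subst nn_integral_add) (auto simp: nn_integral_cmult emeasure_space_1)
  also have "\<dots> \<le> ennreal (2 powr m * drift_0 powr m) + ennreal (2 powr m) * (ennreal (2 * (2 * C) powr m) * moment m (\<lambda>\<omega>. X s \<omega> - 0))"
    using lipschitz_moment[of "X s" "\<lambda>_. 0" m] Xm(3,4)[OF s] m
    by (intro add_left_mono mult_left_mono) (auto simp: k_def)
  finally show ?thesis by (simp add: ennreal_mult mult.assoc)
qed

lemma measurable_moment:
  assumes "Lp_process X"
  shows "(\<lambda>s. moment m (X (max 0 s))) \<in> borel_measurable borel"
  using measurable_moment_diff[OF assms Lp_process_0] by simp

lemma integrated_drift_bound_moment:
  assumes X: "Lp_process X" and t: "0 \<le> t" and m: "p \<le> m" and g: "\<And>\<omega>. 0 \<le> g \<omega>"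
    and le: "AE \<omega> in M. ennreal (g \<omega>) \<le> (\<integral>\<^sup>+ s\<in>{0..t}. ennreal (drift_bound X s \<omega>) \<partial>lborel)"
  shows "(\<integral>\<^sup>+ \<omega>. ennreal (g \<omega> powr m) \<partial>M)
    \<le> ennreal (t powr (m - 1)) * (ennreal (2 powr m * drift_0 powr m * t)
      + ennreal (2 powr m * (2 * (2 * C) powr m)) * (\<integral>\<^sup>+ s\<in>{0..t}. moment m (X s) \<partial>lborel))"
proof -
  note [measurable] = measurable_moment[OF X]
  have "(\<integral>\<^sup>+ \<omega>. ennreal (g \<omega> powr m) \<partial>M)
    \<le> ennreal (t powr (m - 1)) * (\<integral>\<^sup>+ s\<in>{0..t}. (\<integral>\<^sup>+ \<omega>. ennreal (drift_bound X s \<omega> powr m) \<partial>M) \<partial>lborel)"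
    using p m by (intro integrated_Jensen measurable_drift_bound X drift_bound_nonneg t g le) auto
  also have "(\<integral>\<^sup>+ s\<in>{0..t}. (\<integral>\<^sup>+ \<omega>. ennreal (drift_bound X s \<omega> powr m) \<partial>M) \<partial>lborel)
    \<le> (\<integral>\<^sup>+ s. ennreal (2 powr m * drift_0 powr m) * indicator {0..t} s +
        ennreal (2 powr m * (2 * (2 * C) powr m)) * (moment m (X (max 0 s)) * indicator {0..t} s) \<partial>lborel)"
    using drift_bound_moment[OF X _ m] by (intro nn_integral_mono) (auto simp: indicator_def)
  also have "\<dots> = ennreal (2 powr m * drift_0 powr m * t)
      + ennreal (2 powr m * (2 * (2 * C) powr m)) * (\<integral>\<^sup>+ s\<in>{0..t}. moment m (X (max 0 s)) \<partial>lborel)"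
    using t
    by (subst nn_integral_add) (auto simp: nn_integral_cmult nn_integral_cmult_indicator ennreal_mult)
  also have "(\<integral>\<^sup>+ s\<in>{0..t}. moment m (X (max 0 s)) \<partial>lborel) = (\<integral>\<^sup>+ s\<in>{0..t}. moment m (X s) \<partial>lborel)"
    by (intro nn_integral_cong) (auto simp: indicator_def)
  finally show ?thesis by (simp add: mult_left_mono)
qed

lemma norm_drift_conv_le_bound:
  assumes "Lp_process X" "set_integrable lborel {0..t} (drift X \<omega>)"
  shows "ennreal (norm (drift_conv (drift X \<omega>) t)) \<le> (\<integral>\<^sup>+ s\<in>{0..t}. ennreal (drift_bound X s \<omega>) \<partial>lborel)"
proof -
  have "ennreal (norm (drift_conv (drift X \<omega>) t)) \<le> (\<integral>\<^sup>+ s\<in>{0..t}. ennreal (norm (drift X \<omega> s)) \<partial>lborel)"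
    by (rule norm_drift_conv_le[OF assms(2)])
  also have "\<dots> \<le> (\<integral>\<^sup>+ s\<in>{0..t}. ennreal (drift_bound X s \<omega>) \<partial>lborel)"
    using norm_drift_le[OF assms(1)] by (intro nn_integral_mono) (auto simp: indicator_def intro!: ennreal_leI)
  finally show ?thesis .
qed

end

section \<open>Picard iteration\<close>

lemma le_enn2realI: "ennreal x \<le> y \<Longrightarrow> y < \<infinity> \<Longrightarrow> x \<le> enn2real y"
  by (cases y) (auto simp: ennreal_le_iff2 split: if_splits)

context mckean_vlasov
begin

lemma Lp_uniformly_continuous_iff_moment:
  "Lp_uniformly_continuous M p X \<longleftrightarrow> (\<forall>T>0. \<forall>\<epsilon>>0. \<exists>\<delta>>0. \<forall>s\<in>{0..T}. \<forall>t\<in>{0..T}. \<bar>s - t\<bar> < \<delta> \<longrightarrow>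
    moment p (\<lambda>\<omega>. X s \<omega> - X t \<omega>) \<le> ennreal \<epsilon>)"
  by (simp only: Lp_uniformly_continuous_def moment_def)

lemma Lp_uniformly_continuousD:
  assumes X: "Lp_uniformly_continuous M p X" and "0 < T" "0 < \<epsilon>"
  shows "\<exists>\<delta>>0. \<forall>s\<in>{0..T}. \<forall>t\<in>{0..T}. \<bar>s - t\<bar> < \<delta> \<longrightarrow>
    moment p (\<lambda>\<omega>. X s \<omega> - X t \<omega>) \<le> ennreal \<epsilon>"
  using X[unfolded Lp_uniformly_continuous_iff_moment] assms(2,3) by simp

lemma Lp_uniformly_continuousI:
  assumes "\<And>T \<epsilon>. 0 < T \<Longrightarrow> 0 < \<epsilon> \<Longrightarrow> \<exists>\<delta>>0. \<forall>s\<in>{0..T}. \<forall>t\<in>{0..T}. \<bar>s - t\<bar> < \<delta> \<longrightarrow>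
    moment p (\<lambda>\<omega>. X s \<omega> - X t \<omega>) \<le> ennreal \<epsilon>"
  shows "Lp_uniformly_continuous M p X"
  unfolding Lp_uniformly_continuous_iff_moment by (intro allI impI assms)

text \<open>A failure would give times \<open>u n\<close> and \<open>v n\<close> with vanishing
  distance along which the moment stays large, against dominated convergence and uniform continuity
  of each path. Only countably many times occur, so a domination whose null set depends on the time
  is enough.\<close>

lemma Lp_uniformly_continuous_paths:
  fixes Y :: "real \<Rightarrow> 'w \<Rightarrow> 'h"
  assumes Y: "\<And>t. 0 \<le> t \<Longrightarrow> Y t \<in> borel_measurable M"
    and paths: "\<And>T. 0 < T \<Longrightarrow> AE \<omega> in M. continuous_on {0..T} (\<lambda>t. Y t \<omega>)"
    and dom: "\<And>T. 0 < T \<Longrightarrow> \<exists>R\<in>borel_measurable M. (\<forall>\<omega>. 0 \<le> R \<omega>) \<and> (\<integral>\<^sup>+ \<omega>. ennreal (R \<omega> powr p) \<partial>M) < \<infinity> \<and>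
      (\<forall>t\<in>{0..T}. AE \<omega> in M. norm (Y t \<omega>) \<le> R \<omega>)"
  shows "Lp_uniformly_continuous M p Y"
proof (rule ccontr)
  assume "\<not> Lp_uniformly_continuous M p Y"
  then obtain T \<epsilon> where T: "0 < T" "0 < \<epsilon>" and "\<not> (\<exists>\<delta>>0. \<forall>s\<in>{0..T}. \<forall>t\<in>{0..T}. \<bar>s - t\<bar> < \<delta> \<longrightarrow>
    moment p (\<lambda>\<omega>. Y s \<omega> - Y t \<omega>) \<le> ennreal \<epsilon>)"
    using Lp_uniformly_continuousI[of Y] by blast
  then have no: "\<exists>s\<in>{0..T}. \<exists>t\<in>{0..T}. \<bar>s - t\<bar> < \<delta> \<and>
    \<not> moment p (\<lambda>\<omega>. Y s \<omega> - Y t \<omega>) \<le> ennreal \<epsilon>" if "0 < \<delta>" for \<delta>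
    using that by blast
  have "\<forall>n. \<exists>z. fst z \<in> {0..T} \<and> snd z \<in> {0..T} \<and> \<bar>fst z - snd z\<bar> < 1 / real (Suc n) \<and>
    \<not> moment p (\<lambda>\<omega>. Y (fst z) \<omega> - Y (snd z) \<omega>) \<le> ennreal \<epsilon>"
  proof
    fix n
    have "0 < 1 / real (Suc n)" by simp
    from no[OF this] obtain s t where "s \<in> {0..T}" "t \<in> {0..T}" "\<bar>s - t\<bar> < 1 / real (Suc n)"
      "\<not> moment p (\<lambda>\<omega>. Y s \<omega> - Y t \<omega>) \<le> ennreal \<epsilon>" by blast
    then show "\<exists>z. fst z \<in> {0..T} \<and> snd z \<in> {0..T} \<and> \<bar>fst z - snd z\<bar> < 1 / real (Suc n) \<and>
      \<not> moment p (\<lambda>\<omega>. Y (fst z) \<omega> - Y (snd z) \<omega>) \<le> ennreal \<epsilon>"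
      by (intro exI[of _ "(s, t)"]) simp
  qed
  from choice[OF this] obtain z where z: "\<And>n. fst (z n) \<in> {0..T}" "\<And>n. snd (z n) \<in> {0..T}"
    "\<And>n. \<bar>fst (z n) - snd (z n)\<bar> < 1 / real (Suc n)"
    "\<And>n. \<not> moment p (\<lambda>\<omega>. Y (fst (z n)) \<omega> - Y (snd (z n)) \<omega>) \<le> ennreal \<epsilon>"
    by blast
  define u where "u n = fst (z n)" for n
  define v where "v n = snd (z n)" for n
  have uv: "u n \<in> {0..T}" "v n \<in> {0..T}" "\<bar>u n - v n\<bar> < 1 / real (Suc n)" for n
    using z by (auto simp: u_def v_def)
  obtain R where [measurable]: "R \<in> borel_measurable M" and R0: "\<And>\<omega>. 0 \<le> R \<omega>"
    and Rp: "(\<integral>\<^sup>+ \<omega>. ennreal (R \<omega> powr p) \<partial>M) < \<infinity>" and R: "\<And>t. t \<in> {0..T} \<Longrightarrow> AE \<omega> in M. norm (Y t \<omega>) \<le> R \<omega>"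
    using dom[OF T(1)] by blast
  have [measurable]: "Y (u n) \<in> borel_measurable M" "Y (v n) \<in> borel_measurable M" for n
    using uv by (auto intro: Y)
  have "(\<lambda>n. \<integral>\<^sup>+ \<omega>. ennreal (norm (Y (u n) \<omega> - Y (v n) \<omega>) powr p) \<partial>M) \<longlonglongrightarrow> (\<integral>\<^sup>+ \<omega>. 0 \<partial>M)"
  proof (rule nn_integral_dominated_convergence)
    show "AE \<omega> in M. ennreal (norm (Y (u n) \<omega> - Y (v n) \<omega>) powr p) \<le> ennreal (2 powr p) * ennreal (R \<omega> powr p)" for n
      using R[OF uv(1)[of n]] R[OF uv(2)[of n]]
    proof eventually_elim
      case (elim \<omega>)
      then have "norm (Y (u n) \<omega> - Y (v n) \<omega>) \<le> 2 * R \<omega>"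
        using norm_triangle_ineq4[of "Y (u n) \<omega>" "Y (v n) \<omega>"] by simp
      then have "norm (Y (u n) \<omega> - Y (v n) \<omega>) powr p \<le> (2 * R \<omega>) powr p"
        using p by (intro powr_mono2) auto
      also have "\<dots> = 2 powr p * R \<omega> powr p" using R0 by (simp add: powr_mult)
      finally show ?case by (simp add: ennreal_leI flip: ennreal_mult)
    qed
    show "(\<integral>\<^sup>+ \<omega>. ennreal (2 powr p) * ennreal (R \<omega> powr p) \<partial>M) < \<infinity>"
      using Rp by (subst nn_integral_cmult) (auto simp: ennreal_mult_less_top)
    show "AE \<omega> in M. (\<lambda>n. ennreal (norm (Y (u n) \<omega> - Y (v n) \<omega>) powr p)) \<longlonglongrightarrow> 0"
      using paths[OF T(1)]
    proof eventually_elim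
      case (elim \<omega>)
      then have "uniformly_continuous_on {0..T} (\<lambda>t. Y t \<omega>)"
        by (rule compact_uniformly_continuous) simp
      moreover have "(\<lambda>n. dist (u n) (v n)) \<longlonglongrightarrow> 0"
      proof (rule tendsto_sandwich[of "\<lambda>_. 0" _ _ "\<lambda>n. 1 / real (Suc n)"])
        show "(\<lambda>n. 1 / real (Suc n)) \<longlonglongrightarrow> 0" by (rule LIMSEQ_Suc[OF lim_1_over_n])
        show "\<forall>\<^sub>F n in sequentially. dist (u n) (v n) \<le> 1 / real (Suc n)"
          by (intro always_eventually allI less_imp_le) (use uv(3) in \<open>simp add: dist_real_def\<close>)
      qed auto
      ultimately have "(\<lambda>n. dist (Y (u n) \<omega>) (Y (v n) \<omega>)) \<longlonglongrightarrow> 0"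
        using uv unfolding uniformly_continuous_on_sequentially by blast
      from tendsto_powr'[OF this tendsto_const[of p]] p
      have "(\<lambda>n. norm (Y (u n) \<omega> - Y (v n) \<omega>) powr p) \<longlonglongrightarrow> 0" by (simp add: dist_norm)
      from tendsto_ennrealI[OF this] show ?case by simp
    qed
  qed measurable
  then have "(\<lambda>n. moment p (\<lambda>\<omega>. Y (u n) \<omega> - Y (v n) \<omega>)) \<longlonglongrightarrow> 0" by (simp add: moment_def)
  then have "eventually (\<lambda>n. moment p (\<lambda>\<omega>. Y (u n) \<omega> - Y (v n) \<omega>) < ennreal \<epsilon>) sequentially"
    using T(2) by (intro order_tendstoD) auto
  then obtain n where "moment p (\<lambda>\<omega>. Y (u n) \<omega> - Y (v n) \<omega>) < ennreal \<epsilon>"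
    by (auto simp: eventually_sequentially)
  with z(4)[of n] show False by (simp add: u_def v_def less_imp_le)
qed

lemma Lp_uniformly_continuous_add:
  fixes X Y :: "real \<Rightarrow> 'w \<Rightarrow> 'h"
  assumes X: "Lp_uniformly_continuous M p X" and Y: "Lp_uniformly_continuous M p Y"
    and [measurable]: "\<And>t. 0 \<le> t \<Longrightarrow> X t \<in> borel_measurable M" "\<And>t. 0 \<le> t \<Longrightarrow> Y t \<in> borel_measurable M"
  shows "Lp_uniformly_continuous M p (\<lambda>t \<omega>. X t \<omega> + Y t \<omega>)"
proof (rule Lp_uniformly_continuousI)
  fix T \<epsilon> :: real assume T: "0 < T" "0 < \<epsilon>"
  define \<eta> where "\<eta> = \<epsilon> / (2 * 2 powr p)"
  have \<eta>: "0 < \<eta>" using T by (simp add: \<eta>_def)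
  obtain \<delta>1 where \<delta>1: "0 < \<delta>1" "\<And>s t. s \<in> {0..T} \<Longrightarrow> t \<in> {0..T} \<Longrightarrow> \<bar>s - t\<bar> < \<delta>1 \<Longrightarrow>
    moment p (\<lambda>\<omega>. X s \<omega> - X t \<omega>) \<le> ennreal \<eta>"
    using Lp_uniformly_continuousD[OF X T(1) \<eta>] by blast
  obtain \<delta>2 where \<delta>2: "0 < \<delta>2" "\<And>s t. s \<in> {0..T} \<Longrightarrow> t \<in> {0..T} \<Longrightarrow> \<bar>s - t\<bar> < \<delta>2 \<Longrightarrow>
    moment p (\<lambda>\<omega>. Y s \<omega> - Y t \<omega>) \<le> ennreal \<eta>"
    using Lp_uniformly_continuousD[OF Y T(1) \<eta>] by blast
  show "\<exists>\<delta>>0. \<forall>s\<in>{0..T}. \<forall>t\<in>{0..T}. \<bar>s - t\<bar> < \<delta> \<longrightarrow>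
    moment p (\<lambda>\<omega>. (X s \<omega> + Y s \<omega>) - (X t \<omega> + Y t \<omega>)) \<le> ennreal \<epsilon>"
  proof (intro exI[of _ "min \<delta>1 \<delta>2"] conjI ballI impI)
    fix s t assume st: "s \<in> {0..T}" "t \<in> {0..T}" "\<bar>s - t\<bar> < min \<delta>1 \<delta>2"
    have "moment p (\<lambda>\<omega>. (X s \<omega> + Y s \<omega>) - (X t \<omega> + Y t \<omega>)) = moment p (\<lambda>\<omega>. (X s \<omega> - X t \<omega>) + (Y s \<omega> - Y t \<omega>))"
      by (simp add: algebra_simps)
    also have "\<dots> \<le> ennreal (2 powr p) * (moment p (\<lambda>\<omega>. X s \<omega> - X t \<omega>) + moment p (\<lambda>\<omega>. Y s \<omega> - Y t \<omega>))"
      using st p by (intro moment_add) auto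
    also have "\<dots> \<le> ennreal (2 powr p) * (ennreal \<eta> + ennreal \<eta>)"
      using st by (intro mult_left_mono add_mono \<delta>1 \<delta>2) auto
    also have "\<dots> = ennreal \<epsilon>"
      using \<eta> by (simp add: \<eta>_def flip: ennreal_plus ennreal_mult)
    finally show "moment p (\<lambda>\<omega>. (X s \<omega> + Y s \<omega>) - (X t \<omega> + Y t \<omega>)) \<le> ennreal \<epsilon>" .
  qed (use \<delta>1 \<delta>2 in auto)
qed

text \<open>The class on which the Picard iteration runs. Continuity in L^p makes the laws vary
  continuously and so the drift measurable; the bound on compact intervals makes the drift
  integrable.\<close>

definition good_process :: "(real \<Rightarrow> 'w \<Rightarrow> 'h) \<Rightarrow> bool" where
  "good_process X \<longleftrightarrow> Lp_process X \<and> Lp_uniformly_continuous M p X \<and>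
     (\<forall>T. \<exists>N\<ge>0. \<forall>t\<in>{0..T}. moment p (X t) \<le> ennreal N)"

text \<open>The conditions on moments involve the process only at fixed times, up to null sets, and
  pass to any modification. Predictability is what has to be arranged.\<close>

lemma good_modification:
  assumes Y: "\<And>t. 0 \<le> t \<Longrightarrow> Y t \<in> borel_measurable (F t)" and cont: "Lp_uniformly_continuous M p Y"
    and bound: "\<And>T. \<exists>N\<ge>0. \<forall>t\<in>{0..T}. moment p (Y t) \<le> ennreal N"
  shows "\<exists>X. good_process X \<and> (\<forall>t\<ge>0. AE \<omega> in M. X t \<omega> = Y t \<omega>)"
proof -
  obtain X where X: "predictable_process M F X" "\<And>t. 0 \<le> t \<Longrightarrow> AE \<omega> in M. X t \<omega> = Y t \<omega>"
    using predictable_modification[OF filtration _ cont] Y p by (auto simp: adapted_process_def)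
  have m: "moment p (X t) = moment p (Y t)" if "0 \<le> t" for t
    using X(2)[OF that] by (rule moment_cong_AE)
  have md: "moment p (\<lambda>\<omega>. X s \<omega> - X t \<omega>) = moment p (\<lambda>\<omega>. Y s \<omega> - Y t \<omega>)" if "0 \<le> s" "0 \<le> t" for s t
  proof (rule moment_cong_AE)
    show "AE \<omega> in M. X s \<omega> - X t \<omega> = Y s \<omega> - Y t \<omega>"
      using X(2)[OF that(1)] X(2)[OF that(2)] by eventually_elim simp
  qed
  have "good_process X"
    unfolding good_process_def Lp_process_def
  proof (intro conjI allI impI X(1))
    fix t :: real assume t: "0 \<le> t"
    then obtain N where "moment p (Y t) \<le> ennreal N"
      using bound[of t] by (meson atLeastAtMost_iff order_refl)
    also have "\<dots> < \<infinity>" by simp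
    finally show "moment p (X t) < \<infinity>" by (simp add: m t)
  next
    show "Lp_uniformly_continuous M p X"
    proof (rule Lp_uniformly_continuousI)
      fix T \<epsilon> :: real assume T: "0 < T" "0 < \<epsilon>"
      obtain \<delta> where "0 < \<delta>" "\<And>s t. s \<in> {0..T} \<Longrightarrow> t \<in> {0..T} \<Longrightarrow> \<bar>s - t\<bar> < \<delta> \<Longrightarrow>
        moment p (\<lambda>\<omega>. Y s \<omega> - Y t \<omega>) \<le> ennreal \<epsilon>"
        using Lp_uniformly_continuousD[OF cont T] by blast
      then show "\<exists>\<delta>>0. \<forall>s\<in>{0..T}. \<forall>t\<in>{0..T}. \<bar>s - t\<bar> < \<delta> \<longrightarrow> moment p (\<lambda>\<omega>. X s \<omega> - X t \<omega>) \<le> ennreal \<epsilon>"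
        by (intro exI[of _ \<delta>]) (auto simp: md)
    qed
  next
    fix T show "\<exists>N\<ge>0. \<forall>t\<in>{0..T}. moment p (X t) \<le> ennreal N"
      using bound[of T] by (auto simp: m)
  qed
  with X(2) show ?thesis by blast
qed

lemma Lp_dist_tendsto:
  assumes cont: "Lp_uniformly_continuous M p X"
  shows "((\<lambda>r. Lp_dist (X (max 0 r)) (X (max 0 s))) \<longlongrightarrow> 0) (at s)"
proof (rule tendstoI)
  fix \<epsilon> :: real assume \<epsilon>: "0 < \<epsilon>"
  define \<eta> where "\<eta> = (\<epsilon> / 2) powr p"
  have \<eta>: "0 < \<eta>" using \<epsilon> by (simp add: \<eta>_def)
  have T: "0 < \<bar>s\<bar> + 1" by simp
  obtain \<delta> where \<delta>: "0 < \<delta>" "\<And>r t. r \<in> {0..\<bar>s\<bar> + 1} \<Longrightarrow> t \<in> {0..\<bar>s\<bar> + 1} \<Longrightarrow> \<bar>r - t\<bar> < \<delta> \<Longrightarrow>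
    moment p (\<lambda>\<omega>. X r \<omega> - X t \<omega>) \<le> ennreal \<eta>"
    using Lp_uniformly_continuousD[OF cont T \<eta>] by blast
  have "dist (Lp_dist (X (max 0 r)) (X (max 0 s))) 0 < \<epsilon>" if "dist r s < min \<delta> 1" for r
  proof -
    have "moment p (\<lambda>\<omega>. X (max 0 r) \<omega> - X (max 0 s) \<omega>) \<le> ennreal \<eta>"
      using that by (intro \<delta>(2)) (auto simp: dist_real_def)
    then have "enn2real (moment p (\<lambda>\<omega>. X (max 0 r) \<omega> - X (max 0 s) \<omega>)) \<le> \<eta>"
      using \<eta> by (simp add: enn2real_leI)
    then have "Lp_dist (X (max 0 r)) (X (max 0 s)) \<le> \<eta> powr (1 / p)"
      unfolding Lp_dist_def using p by (intro powr_mono2) auto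
    also have "\<dots> = \<epsilon> / 2" using \<epsilon> p by (simp add: \<eta>_def powr_powr)
    finally show ?thesis using \<epsilon> by (simp add: Lp_dist_def)
  qed
  then show "eventually (\<lambda>r. dist (Lp_dist (X (max 0 r)) (X (max 0 s))) 0 < \<epsilon>) (at s)"
    unfolding eventually_at using \<delta>(1) by (intro exI[of _ "min \<delta> 1"]) auto
qed

text \<open>The second argument of \<open>B\<close> is a measure, and measurability in it is not
  assumed. Along a curve of laws that is continuous in L^p the Lipschitz condition makes the drift
  jointly continuous in time and space, hence Borel.\<close>

lemma measurable_drift_function:
  assumes X: "Lp_process X" and cont: "Lp_uniformly_continuous M p X"
  shows "(\<lambda>(s, x). B x (law M (X (max 0 s)))) \<in> borel_measurable (borel \<Otimes>\<^sub>M borel)"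
proof -
  have "((\<lambda>z. B (snd z) (law M (X (max 0 (fst z))))) \<longlongrightarrow> B x (law M (X (max 0 s)))) (at (s, x))" for s x
  proof (rule Lim_transform)
    show "((\<lambda>z. B x (law M (X (max 0 s)))) \<longlongrightarrow> B x (law M (X (max 0 s)))) (at (s, x))" by (rule tendsto_const)
    have "isCont (\<lambda>r. Lp_dist (X (max 0 r)) (X (max 0 s))) s"
      using Lp_dist_tendsto[OF cont, of s] p by (simp add: isCont_def Lp_dist_def moment_zero)
    moreover have fst: "((\<lambda>z. fst z) \<longlongrightarrow> s) (at (s, x))" and snd: "((\<lambda>z. snd z) \<longlongrightarrow> x) (at (s, x))"
      by (auto intro!: tendsto_eq_intros)
    ultimately have 1: "((\<lambda>z. Lp_dist (X (max 0 (fst z))) (X (max 0 s))) \<longlongrightarrow> 0) (at (s, x))"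
      using isCont_tendsto_compose[of s "\<lambda>r. Lp_dist (X (max 0 r)) (X (max 0 s))" fst] p
      by (simp add: Lp_dist_def moment_zero)
    have 2: "((\<lambda>z. norm (snd z - x)) \<longlongrightarrow> 0) (at (s, x))"
      by (rule tendsto_norm_zero[OF LIM_zero[OF snd]])
    show "((\<lambda>z. B (snd z) (law M (X (max 0 (fst z)))) - B x (law M (X (max 0 s)))) \<longlongrightarrow> 0) (at (s, x))"
    proof (rule Lim_null_comparison[OF always_eventually])
      show "((\<lambda>z. C * (norm (snd z - x) + Lp_dist (X (max 0 (fst z))) (X (max 0 s)))) \<longlongrightarrow> 0) (at (s, x))"
        using tendsto_mult[OF tendsto_const[of C] tendsto_add[OF 2 1]] by simp
      show "\<forall>z. norm (B (snd z) (law M (X (max 0 (fst z)))) - B x (law M (X (max 0 s))))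
        \<le> C * (norm (snd z - x) + Lp_dist (X (max 0 (fst z))) (X (max 0 s)))"
        using Lp_process_measurable(3,4)[OF X] by (intro allI drift_lipschitz) auto
    qed
  qed
  then have "continuous_on UNIV (\<lambda>z. B (snd z) (law M (X (max 0 (fst z)))))"
    by (auto simp: continuous_on_def)
  then have "(\<lambda>z. B (snd z) (law M (X (max 0 (fst z))))) \<in> borel_measurable borel"
    by (rule borel_measurable_continuous_onI)
  then show ?thesis by (simp add: borel_prod case_prod_beta')
qed

lemma measurable_drift_clamp:
  assumes X: "Lp_process X" and cont: "Lp_uniformly_continuous M p X" and t: "0 \<le> t"
  shows "(\<lambda>(s, \<omega>). drift X \<omega> (max 0 (min s t))) \<in> borel_measurable (borel \<Otimes>\<^sub>M F t)"
proof -
  have [measurable]: "(\<lambda>(r, \<omega>). X (max 0 (min r t)) \<omega>) \<in> borel_measurable (borel \<Otimes>\<^sub>M F t)"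
    using X t by (intro predictable_measurable_clamp[OF filtration]) (auto simp: Lp_process_def)
  have "(\<lambda>z. (max 0 (min (fst z) t), (\<lambda>(r, \<omega>). X (max 0 (min r t)) \<omega>) z)) \<in> measurable (borel \<Otimes>\<^sub>M F t) (borel \<Otimes>\<^sub>M borel)"
    by measurable
  from measurable_compose[OF this measurable_drift_function[OF X cont]]
  show ?thesis by (simp add: drift_def case_prod_beta')
qed

lemma measurable_drift:
  assumes X: "Lp_process X" and cont: "Lp_uniformly_continuous M p X" and \<omega>: "\<omega> \<in> space M"
  shows "(\<lambda>s. drift X \<omega> (max 0 s)) \<in> borel_measurable borel"
proof -
  note [measurable] = Lp_process_measurable(1)[OF X]
  have "(\<lambda>s. (\<lambda>(s, \<omega>). X (max 0 s) \<omega>) (s, \<omega>)) \<in> borel_measurable borel"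
    using \<omega> by measurable
  then have [measurable]: "(\<lambda>s. X (max 0 s) \<omega>) \<in> borel_measurable borel" by simp
  have "(\<lambda>s. (s, X (max 0 s) \<omega>)) \<in> measurable borel (borel \<Otimes>\<^sub>M borel)" by measurable
  from measurable_compose[OF this measurable_drift_function[OF X cont]]
  show ?thesis by (simp add: drift_def)
qed

text \<open>Provides one random variable with finite p-th moment that dominates the drift integrals
  at all times up to \<open>T\<close>. Almost sure finiteness comes from first moments, reduced to
  p-th moments by \<open>y \<le> 1 + y powr p\<close>; this is the 1 in \<open>D\<close>.\<close>

lemma drift_bound_integral:
  assumes X: "Lp_process X" and T: "0 \<le> T" and N: "0 \<le> N" "\<forall>t\<in>{0..T}. moment p (X t) \<le> ennreal N"
  defines "R \<equiv> \<lambda>\<omega>. \<integral>\<^sup>+ s\<in>{0..T}. ennreal (drift_bound X s \<omega>) \<partial>lborel"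
  shows "R \<in> borel_measurable M"
    and "AE \<omega> in M. R \<omega> < \<infinity>"
    and "(\<integral>\<^sup>+ \<omega>. ennreal (enn2real (R \<omega>) powr p) \<partial>M) < \<infinity>"
proof -
  interpret P: pair_sigma_finite lborel M ..
  note [measurable] = measurable_drift_bound[OF X]
  show [measurable]: "R \<in> borel_measurable M" unfolding R_def by measurable
  define D where "D = 1 + (2 powr p * drift_0 powr p + 2 powr p * (2 * (2 * C) powr p) * N)"
  have D: "(\<integral>\<^sup>+ \<omega>. ennreal (drift_bound X s \<omega>) \<partial>M) \<le> ennreal D" if s: "s \<in> {0..T}" for s
  proof -
    have [measurable]: "(\<lambda>\<omega>. drift_bound X s \<omega>) \<in> borel_measurable M" by measurable
    have "(\<integral>\<^sup>+ \<omega>. ennreal (drift_bound X s \<omega>) \<partial>M) \<le> (\<integral>\<^sup>+ \<omega>. 1 + ennreal (drift_bound X s \<omega> powr p) \<partial>M)"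
    proof (intro nn_integral_mono)
      fix \<omega>
      have "drift_bound X s \<omega> \<le> 1 + drift_bound X s \<omega> powr p"
        using p by (intro le_one_plus_powr drift_bound_nonneg)
      then have "ennreal (drift_bound X s \<omega>) \<le> ennreal (1 + drift_bound X s \<omega> powr p)" by (rule ennreal_leI)
      then show "ennreal (drift_bound X s \<omega>) \<le> 1 + ennreal (drift_bound X s \<omega> powr p)" by (simp add: ennreal_plus)
    qed
    also have "\<dots> = 1 + (\<integral>\<^sup>+ \<omega>. ennreal (drift_bound X s \<omega> powr p) \<partial>M)"
      by (subst nn_integral_add) (auto simp: emeasure_space_1)
    also have "\<dots> \<le> 1 + (ennreal (2 powr p * drift_0 powr p) + ennreal (2 powr p * (2 * (2 * C) powr p)) * ennreal N)"
      using s by (intro add_left_mono order_trans[OF drift_bound_moment[OF X]] mult_left_mono N(2)[rule_format]) auto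
    also have "\<dots> = ennreal D"
      using N(1) by (simp add: D_def ennreal_plus ennreal_mult)
    finally show ?thesis .
  qed
  have "(\<integral>\<^sup>+ \<omega>. R \<omega> \<partial>M) = (\<integral>\<^sup>+ s. (\<integral>\<^sup>+ \<omega>. ennreal (drift_bound X s \<omega>) * indicator {0..T} s \<partial>M) \<partial>lborel)"
    unfolding R_def by (rule P.Fubini') measurable
  also have "\<dots> \<le> (\<integral>\<^sup>+ s. ennreal D * indicator {0..T} s \<partial>lborel)"
    using D by (intro nn_integral_mono) (auto simp: indicator_def)
  also have "\<dots> = ennreal D * ennreal T"
    using T by (subst nn_integral_cmult_indicator) auto
  also have "\<dots> < \<infinity>" by (simp add: ennreal_mult_less_top)
  finally have "(\<integral>\<^sup>+ \<omega>. R \<omega> \<partial>M) \<noteq> \<infinity>" by simp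
  then have "AE \<omega> in M. R \<omega> \<noteq> \<infinity>" by (intro nn_integral_noteq_infinite) auto
  then show fin: "AE \<omega> in M. R \<omega> < \<infinity>" by eventually_elim (simp add: less_top)
  have "(\<integral>\<^sup>+ \<omega>. ennreal (enn2real (R \<omega>) powr p) \<partial>M)
    \<le> ennreal (T powr (p - 1)) * (ennreal (2 powr p * drift_0 powr p * T)
      + ennreal (2 powr p * (2 * (2 * C) powr p)) * (\<integral>\<^sup>+ s\<in>{0..T}. moment p (X s) \<partial>lborel))"
  proof (rule integrated_drift_bound_moment[OF X T])
    show "AE \<omega> in M. ennreal (enn2real (R \<omega>)) \<le> (\<integral>\<^sup>+ s\<in>{0..T}. ennreal (drift_bound X s \<omega>) \<partial>lborel)"
      using fin by eventually_elim (simp add: R_def)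
  qed auto
  also have "\<dots> < \<infinity>"
  proof -
    have "(\<integral>\<^sup>+ s\<in>{0..T}. moment p (X s) \<partial>lborel) \<le> (\<integral>\<^sup>+ s. ennreal N * indicator {0..T} s \<partial>lborel)"
      using N by (intro nn_integral_mono) (auto simp: indicator_def)
    also have "\<dots> = ennreal N * ennreal T"
      using T by (subst nn_integral_cmult_indicator) auto
    also have "\<dots> < \<infinity>" by (simp add: ennreal_mult_less_top)
    finally show ?thesis by (simp add: ennreal_mult_less_top)
  qed
  finally show "(\<integral>\<^sup>+ \<omega>. ennreal (enn2real (R \<omega>) powr p) \<partial>M) < \<infinity>" .
qed

lemma good_processD:
  assumes "good_process X"
  shows "Lp_process X" "Lp_uniformly_continuous M p X"
    and "\<exists>N\<ge>0. \<forall>t\<in>{0..T}. moment p (X t) \<le> ennreal N"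
  using assms by (auto simp: good_process_def)

lemma good_drift_integrable:
  assumes X: "good_process X" and T: "0 \<le> T"
  shows "AE \<omega> in M. set_integrable lborel {0..T} (drift X \<omega>)"
proof -
  note X' = good_processD[OF X]
  obtain N where N: "0 \<le> N" "\<forall>t\<in>{0..T}. moment p (X t) \<le> ennreal N" using X'(3)[of T] by blast
  have "AE \<omega> in M. \<omega> \<in> space M" by (rule AE_space)
  with drift_bound_integral(2)[OF X'(1) T N] show ?thesis
  proof eventually_elim
    case (elim \<omega>)
    have eq: "indicator {0..T} s *\<^sub>R drift X \<omega> s = indicator {0..T} s *\<^sub>R drift X \<omega> (max 0 s)" for s
      by (auto simp: indicator_def)
    note [measurable] = measurable_drift[OF X'(1,2) elim(2)]
    show ?case
      unfolding set_integrable_def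
    proof (rule integrableI_bounded)
      show "(\<lambda>s. indicator {0..T} s *\<^sub>R drift X \<omega> s) \<in> borel_measurable lborel"
        unfolding eq by measurable
      have "(\<integral>\<^sup>+ s. ennreal (norm (indicator {0..T} s *\<^sub>R drift X \<omega> s)) \<partial>lborel)
        \<le> (\<integral>\<^sup>+ s\<in>{0..T}. ennreal (drift_bound X s \<omega>) \<partial>lborel)"
        using norm_drift_le[OF X'(1)] by (intro nn_integral_mono) (auto simp: indicator_def intro!: ennreal_leI)
      with elim(1) show "(\<integral>\<^sup>+ s. ennreal (norm (indicator {0..T} s *\<^sub>R drift X \<omega> s)) \<partial>lborel) < \<infinity>"
        by (rule le_less_trans[rotated])
    qed
  qed
qed

text \<open>Clamping time at \<open>t\<close> does not change the integral and makes the integrand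
  measurable for \<open>borel \<Otimes>\<^sub>M F t\<close>, so the integral is measurable for
  \<open>F t\<close>.\<close>

lemma measurable_drift_conv:
  assumes X: "good_process X" and t: "0 \<le> t"
  shows "(\<lambda>\<omega>. drift_conv (drift X \<omega>) t) \<in> borel_measurable (F t)"
proof -
  have [measurable]: "(\<lambda>(s, \<omega>). drift X \<omega> (max 0 (min s t))) \<in> borel_measurable (borel \<Otimes>\<^sub>M F t)"
    using good_processD[OF X] t by (intro measurable_drift_clamp) auto
  have "drift_conv (drift X \<omega>) t = (\<integral>s. indicator {0..t} s *\<^sub>R S (max 0 (t - s)) (drift X \<omega> (max 0 (min s t))) \<partial>lborel)" for \<omega>
    unfolding drift_conv_def set_lebesgue_integral_def
    by (intro Bochner_Integration.integral_cong) (auto simp: indicator_def)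
  moreover have "(\<lambda>\<omega>. \<integral>s. indicator {0..t} s *\<^sub>R S (max 0 (t - s)) (drift X \<omega> (max 0 (min s t))) \<partial>lborel) \<in> borel_measurable (F t)"
    by measurable
  ultimately show ?thesis by simp
qed

lemma set_integrable_Icc_subset:
  "set_integrable lborel {0..T} (f :: real \<Rightarrow> 'h) \<Longrightarrow> t \<le> T \<Longrightarrow> set_integrable lborel {0..t} f"
  by (rule set_integrable_subset) auto

lemma drift_conv_Lp_uniformly_continuous:
  assumes X: "good_process X"
  shows "Lp_uniformly_continuous M p (\<lambda>t \<omega>. drift_conv (drift X \<omega>) t)"
proof (rule Lp_uniformly_continuous_paths)
  show "(\<lambda>\<omega>. drift_conv (drift X \<omega>) t) \<in> borel_measurable M" if "0 \<le> t" for t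
    using filtration_measurable[OF filtration that measurable_drift_conv[OF X that]] .
  fix T :: real assume T: "0 < T"
  have int: "AE \<omega> in M. set_integrable lborel {0..T} (drift X \<omega>)"
    using T by (intro good_drift_integrable X) auto
  then show "AE \<omega> in M. continuous_on {0..T} (\<lambda>t. drift_conv (drift X \<omega>) t)"
    by eventually_elim (rule continuous_on_drift_conv)
  note X' = good_processD[OF X]
  obtain N where N: "0 \<le> N" "\<forall>t\<in>{0..T}. moment p (X t) \<le> ennreal N" using X'(3)[of T] by blast
  define R where "R \<omega> = (\<integral>\<^sup>+ s\<in>{0..T}. ennreal (drift_bound X s \<omega>) \<partial>lborel)" for \<omega>
  have R: "R \<in> borel_measurable M" "AE \<omega> in M. R \<omega> < \<infinity>" "(\<integral>\<^sup>+ \<omega>. ennreal (enn2real (R \<omega>) powr p) \<partial>M) < \<infinity>"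
    using drift_bound_integral[OF X'(1) _ N] T by (auto simp: R_def[abs_def])
  show "\<exists>R\<in>borel_measurable M. (\<forall>\<omega>. 0 \<le> R \<omega>) \<and> (\<integral>\<^sup>+ \<omega>. ennreal (R \<omega> powr p) \<partial>M) < \<infinity> \<and>
      (\<forall>t\<in>{0..T}. AE \<omega> in M. norm (drift_conv (drift X \<omega>) t) \<le> R \<omega>)"
  proof (intro bexI[of _ "\<lambda>\<omega>. enn2real (R \<omega>)"] conjI ballI)
    fix t assume t: "t \<in> {0..T}"
    show "AE \<omega> in M. norm (drift_conv (drift X \<omega>) t) \<le> enn2real (R \<omega>)"
      using int R(2)
    proof eventually_elim
      case (elim \<omega>)
      have "ennreal (norm (drift_conv (drift X \<omega>) t)) \<le> (\<integral>\<^sup>+ s\<in>{0..t}. ennreal (drift_bound X s \<omega>) \<partial>lborel)"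
        using elim(1) t by (intro norm_drift_conv_le_bound X'(1) set_integrable_Icc_subset[OF elim(1)]) auto
      also have "\<dots> \<le> R \<omega>" unfolding R_def using t by (intro nn_integral_mono) (auto simp: indicator_def)
      finally show ?case using elim(2) by (rule le_enn2realI)
    qed
  qed (use R in auto)
qed

lemma drift_conv_bounded:
  assumes X: "good_process X"
  shows "\<exists>N\<ge>0. \<forall>t\<in>{0..T}. moment p (\<lambda>\<omega>. drift_conv (drift X \<omega>) t) \<le> ennreal N"
proof (cases "0 \<le> T")
  case True
  note X' = good_processD[OF X]
  obtain N where N: "0 \<le> N" "\<forall>t\<in>{0..T}. moment p (X t) \<le> ennreal N" using X'(3)[of T] by blast
  define N' where "N' = enn2real (\<integral>\<^sup>+ \<omega>. ennreal (enn2real (\<integral>\<^sup>+ s\<in>{0..T}. ennreal (drift_bound X s \<omega>) \<partial>lborel) powr p) \<partial>M)"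
  note R = drift_bound_integral[OF X'(1) True N]
  have "moment p (\<lambda>\<omega>. drift_conv (drift X \<omega>) t) \<le> ennreal N'" if t: "t \<in> {0..T}" for t
  proof -
    have "AE \<omega> in M. norm (drift_conv (drift X \<omega>) t) \<le> enn2real (\<integral>\<^sup>+ s\<in>{0..T}. ennreal (drift_bound X s \<omega>) \<partial>lborel)"
      using good_drift_integrable[OF X True] R(2)
    proof eventually_elim
      case (elim \<omega>)
      have "ennreal (norm (drift_conv (drift X \<omega>) t)) \<le> (\<integral>\<^sup>+ s\<in>{0..t}. ennreal (drift_bound X s \<omega>) \<partial>lborel)"
        using t by (intro norm_drift_conv_le_bound X'(1) set_integrable_Icc_subset[OF elim(1)]) auto
      also have "\<dots> \<le> (\<integral>\<^sup>+ s\<in>{0..T}. ennreal (drift_bound X s \<omega>) \<partial>lborel)"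
        using t by (intro nn_integral_mono) (auto simp: indicator_def)
      finally show ?case using elim(2) by (rule le_enn2realI)
    qed
    then have "moment p (\<lambda>\<omega>. drift_conv (drift X \<omega>) t)
      \<le> (\<integral>\<^sup>+ \<omega>. ennreal (enn2real (\<integral>\<^sup>+ s\<in>{0..T}. ennreal (drift_bound X s \<omega>) \<partial>lborel) powr p) \<partial>M)"
      unfolding moment_def using p by (intro nn_integral_mono_AE) (auto intro!: ennreal_leI powr_mono2)
    then show ?thesis using R(3) by (simp add: N'_def)
  qed
  then show ?thesis by (intro exI[of _ N']) (auto simp: N'_def)
qed auto

end

lemma ennreal_mult_add:
  "0 \<le> k \<Longrightarrow> 0 \<le> a \<Longrightarrow> 0 \<le> b \<Longrightarrow> ennreal k * (ennreal a + ennreal b) = ennreal (k * (a + b))"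
  by (simp only: ennreal_plus ennreal_mult add_nonneg_nonneg)

context mckean_vlasov
begin

lemma semigroup_initial_paths:
  assumes "T > 0"
  shows "continuous_on {0..T} (\<lambda>t. S t x)"
proof -
  have "continuous_on {0..T} (\<lambda>t. (\<lambda>(t, x). S (max 0 t) x) (t, x))"
    by (rule continuous_on_compose2[OF continuous_S_clamped]) (auto intro!: continuous_intros)
  then show ?thesis
    by (rule continuous_on_eq) auto
qed

lemma measurable_semigroup_initial:
  assumes "\<xi> \<in> borel_measurable (F 0)" "0 \<le> t"
  shows "(\<lambda>\<omega>. S t (\<xi> \<omega>)) \<in> borel_measurable (F t)"
proof -
  have "S t \<in> borel_measurable borel"
    using S_linear[OF assms(2)] by (intro borel_measurable_continuous_onI linear_continuous_on)
  moreover have "\<xi> \<in> borel_measurable (F t)"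
  proof (rule measurable_from_subalg[OF _ assms(1)])
    have "subalgebra M (F 0)" "subalgebra M (F t)" "sets (F 0) \<subseteq> sets (F t)"
      using filtration assms(2) by (simp_all add: time_filtration_def)
    then show "subalgebra (F t) (F 0)" by (simp add: subalgebra_def)
  qed
  ultimately show ?thesis by (rule measurable_compose[rotated])
qed

lemma stochastic_convolution_version:
  "\<exists>Z. \<forall>t\<ge>0. Z t \<in> borel_measurable (F t) \<and> is_stochastic_convolution M e lam bet L t (Z t)"
proof -
  have "\<forall>t. \<exists>Z. 0 \<le> t \<longrightarrow> Z \<in> borel_measurable (F t) \<and> is_stochastic_convolution M e lam bet L t Z"
    using stochastic_convolution_exists by blast
  from choice[OF this] show ?thesis by blast
qed

lemma stochastic_convolution_Lp_uniformly_continuous: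
  assumes Z: "\<And>t. 0 \<le> t \<Longrightarrow> is_stochastic_convolution M e lam bet L t (Z t)"
  shows "Lp_uniformly_continuous M p Z"
proof (rule Lp_uniformly_continuousI)
  fix T \<epsilon> :: real assume T: "0 < T" "0 < \<epsilon>"
  define K where "K = stable_moment_const \<alpha> p"
  have "((\<lambda>d. K * conv_modulus d powr (p / \<alpha>)) \<longlongrightarrow> K * 0 powr (p / \<alpha>)) (at_right 0)"
    using p \<alpha> conv_modulus_nonneg
    by (intro tendsto_mult tendsto_const tendsto_powr'[OF conv_modulus_tendsto])
      (auto simp: eventually_at_filter intro!: always_eventually)
  then have "((\<lambda>d. K * conv_modulus d powr (p / \<alpha>)) \<longlongrightarrow> 0) (at_right 0)" by simp
  then have "eventually (\<lambda>d. K * conv_modulus d powr (p / \<alpha>) < \<epsilon>) (at_right 0)"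
    using T by (intro order_tendstoD) auto
  then obtain \<delta> where \<delta>: "0 < \<delta>" "\<And>d. 0 < d \<Longrightarrow> d < \<delta> \<Longrightarrow> K * conv_modulus d powr (p / \<alpha>) < \<epsilon>"
    unfolding eventually_at_right_field by blast
  have *: "moment p (\<lambda>\<omega>. Z t \<omega> - Z s \<omega>) \<le> ennreal \<epsilon>" if st: "0 \<le> s" "s \<le> t" "t - s < \<delta>" for s t
  proof -
    have "moment p (\<lambda>\<omega>. Z t \<omega> - Z s \<omega>) \<le> ennreal (K * conv_modulus (t - s) powr (p / \<alpha>))"
      unfolding moment_def K_def using st p by (intro stochastic_convolution_diff_moment Z) auto
    also have "\<dots> \<le> ennreal \<epsilon>"
      using st \<delta>(2)[of "t - s"] T by (cases "s = t") (auto intro!: ennreal_leI simp: conv_modulus_0)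
    finally show ?thesis .
  qed
  show "\<exists>\<delta>>0. \<forall>s\<in>{0..T}. \<forall>t\<in>{0..T}. \<bar>s - t\<bar> < \<delta> \<longrightarrow> moment p (\<lambda>\<omega>. Z s \<omega> - Z t \<omega>) \<le> ennreal \<epsilon>"
  proof (intro exI[of _ \<delta>] conjI ballI impI \<delta>(1))
    fix s t assume st: "s \<in> {0..T}" "t \<in> {0..T}" "\<bar>s - t\<bar> < \<delta>"
    show "moment p (\<lambda>\<omega>. Z s \<omega> - Z t \<omega>) \<le> ennreal \<epsilon>"
    proof (cases "s \<le> t")
      case True
      then show ?thesis using *[of s t] st by (subst moment_minus_commute) auto
    next
      case False
      then show ?thesis using *[of t s] st by auto
    qed
  qed
qed

definition convolution_bound :: "real \<Rightarrow> real" where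
  "convolution_bound m = stable_moment_const \<alpha> m * (8 * (\<Sum>k. bet k powr \<alpha> / lam k)) powr (m / \<alpha>)"

lemma convolution_bound_nonneg: "p \<le> m \<Longrightarrow> m < \<alpha> \<Longrightarrow> 0 \<le> convolution_bound m"
  unfolding convolution_bound_def using p
  by (intro mult_nonneg_nonneg stable_moment_const_nonneg) auto

lemma moment_stochastic_convolution:
  assumes "0 \<le> t" "p \<le> m" "m < \<alpha>" "is_stochastic_convolution M e lam bet L t Z"
  shows "moment m Z \<le> ennreal (convolution_bound m)"
  unfolding moment_def convolution_bound_def using assms p by (intro stochastic_convolution_moment) auto

lemma moment_semigroup_le: "0 \<le> t \<Longrightarrow> 0 \<le> m \<Longrightarrow> moment m (\<lambda>\<omega>. S t (\<xi> \<omega>)) \<le> moment m \<xi>"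
  by (intro moment_mono_AE) (auto intro!: contr)

text \<open>The part of the equation that does not depend on the solution. The version
  \<open>Z\<close> is chosen for each time separately; only V has to be regular in time.\<close>

definition mild_noise :: "('w \<Rightarrow> 'h) \<Rightarrow> (real \<Rightarrow> 'w \<Rightarrow> 'h) \<Rightarrow> bool" where
  "mild_noise \<xi> V \<longleftrightarrow> good_process V \<and> (\<forall>t\<ge>0. \<exists>Z\<in>borel_measurable M. is_stochastic_convolution M e lam bet L t Z \<and>
     (AE \<omega> in M. V t \<omega> = S t (\<xi> \<omega>) + Z \<omega>))"

lemma mild_noise_moment:
  assumes V: "mild_noise \<xi> V" and \<xi>: "\<xi> \<in> borel_measurable (F 0)" and t: "0 \<le> t" and m: "p \<le> m" "m < \<alpha>"
  shows "moment m (V t) \<le> ennreal (2 powr m) * (moment m \<xi> + ennreal (convolution_bound m))"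
proof -
  obtain Z where [measurable]: "Z \<in> borel_measurable M" and Z: "is_stochastic_convolution M e lam bet L t Z"
    and VZ: "AE \<omega> in M. V t \<omega> = S t (\<xi> \<omega>) + Z \<omega>"
    using V t by (auto simp: mild_noise_def)
  have [measurable]: "(\<lambda>\<omega>. S t (\<xi> \<omega>)) \<in> borel_measurable M"
    using filtration_measurable[OF filtration t measurable_semigroup_initial[OF \<xi> t]] .
  have "moment m (V t) = moment m (\<lambda>\<omega>. S t (\<xi> \<omega>) + Z \<omega>)" using VZ by (rule moment_cong_AE)
  also have "\<dots> \<le> ennreal (2 powr m) * (moment m (\<lambda>\<omega>. S t (\<xi> \<omega>)) + moment m Z)"
    using m p by (intro moment_add) auto
  also have "\<dots> \<le> ennreal (2 powr m) * (moment m \<xi> + ennreal (convolution_bound m))"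
    using m p t Z by (intro mult_left_mono add_mono moment_semigroup_le moment_stochastic_convolution) auto
  finally show ?thesis .
qed

lemma mild_noise_exists:
  assumes \<xi>: "\<xi> \<in> borel_measurable (F 0)" and fin: "moment p \<xi> < \<infinity>"
  shows "\<exists>V. mild_noise \<xi> V"
proof -
  obtain Z where Z: "\<And>t. 0 \<le> t \<Longrightarrow> Z t \<in> borel_measurable (F t)"
    "\<And>t. 0 \<le> t \<Longrightarrow> is_stochastic_convolution M e lam bet L t (Z t)"
    using stochastic_convolution_version by blast
  have ZM: "Z t \<in> borel_measurable M" if "0 \<le> t" for t
    using filtration_measurable[OF filtration that Z(1)[OF that]] .
  have SM: "(\<lambda>\<omega>. S t (\<xi> \<omega>)) \<in> borel_measurable M" if "0 \<le> t" for t
    using filtration_measurable[OF filtration that measurable_semigroup_initial[OF \<xi> that]] .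
  have \<xi>M[measurable]: "\<xi> \<in> borel_measurable M" using filtration_measurable[OF filtration _ \<xi>] by simp
  define Y where "Y t \<omega> = S t (\<xi> \<omega>) + Z t \<omega>" for t \<omega>
  have "\<exists>V. good_process V \<and> (\<forall>t\<ge>0. AE \<omega> in M. V t \<omega> = Y t \<omega>)"
  proof (rule good_modification)
    show "Y t \<in> borel_measurable (F t)" if "0 \<le> t" for t
      unfolding Y_def using measurable_semigroup_initial[OF \<xi> that] Z(1)[OF that] by measurable
    have "Lp_uniformly_continuous M p (\<lambda>t \<omega>. S t (\<xi> \<omega>))"
    proof (rule Lp_uniformly_continuous_paths[OF SM])
      fix T :: real assume T: "0 < T"
      show "AE \<omega> in M. continuous_on {0..T} (\<lambda>t. S t (\<xi> \<omega>))"
        using semigroup_initial_paths[OF T] by simp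
      show "\<exists>R\<in>borel_measurable M. (\<forall>\<omega>. 0 \<le> R \<omega>) \<and> (\<integral>\<^sup>+ \<omega>. ennreal (R \<omega> powr p) \<partial>M) < \<infinity> \<and>
        (\<forall>t\<in>{0..T}. AE \<omega> in M. norm (S t (\<xi> \<omega>)) \<le> R \<omega>)"
        using fin contr by (intro bexI[of _ "\<lambda>\<omega>. norm (\<xi> \<omega>)"]) (auto simp: moment_def)
    qed
    moreover have "Lp_uniformly_continuous M p Z"
      by (rule stochastic_convolution_Lp_uniformly_continuous[OF Z(2)])
    ultimately show "Lp_uniformly_continuous M p Y"
      unfolding Y_def by (rule Lp_uniformly_continuous_add[OF _ _ SM ZM])
    fix T :: real
    define N where "N = enn2real (ennreal (2 powr p) * (moment p \<xi> + ennreal (convolution_bound p)))"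
    have N: "ennreal N = ennreal (2 powr p) * (moment p \<xi> + ennreal (convolution_bound p))"
      using fin by (simp add: N_def ennreal_mult_less_top)
    show "\<exists>N\<ge>0. \<forall>t\<in>{0..T}. moment p (Y t) \<le> ennreal N"
    proof (intro exI[of _ N] conjI ballI)
      fix t assume "t \<in> {0..T}"
      then have t: "0 \<le> t" by simp
      have "moment p (Y t) \<le> ennreal (2 powr p) * (moment p (\<lambda>\<omega>. S t (\<xi> \<omega>)) + moment p (Z t))"
        unfolding Y_def using SM[OF t] ZM[OF t] p by (intro moment_add) auto
      also have "\<dots> \<le> ennreal N"
        unfolding N using p t Z by (intro mult_left_mono add_mono moment_semigroup_le moment_stochastic_convolution) auto
      finally show "moment p (Y t) \<le> ennreal N" .
    qed (simp add: N_def)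
  qed
  then obtain V where "good_process V" "\<And>t. 0 \<le> t \<Longrightarrow> AE \<omega> in M. V t \<omega> = Y t \<omega>" by blast
  then have "mild_noise \<xi> V"
    unfolding mild_noise_def Y_def using Z(2) ZM by blast
  then show ?thesis by blast
qed

text \<open>One Picard step from \<open>X\<close> to \<open>Y\<close>, with a null set that may
  depend on the time. The solutions are the fixed points \<open>solves_step V X X\<close>.\<close>

definition solves_step :: "(real \<Rightarrow> 'w \<Rightarrow> 'h) \<Rightarrow> (real \<Rightarrow> 'w \<Rightarrow> 'h) \<Rightarrow> (real \<Rightarrow> 'w \<Rightarrow> 'h) \<Rightarrow> bool" where
  "solves_step V X Y \<longleftrightarrow> (\<forall>t\<ge>0. AE \<omega> in M. Y t \<omega> = V t \<omega> + drift_conv (drift X \<omega>) t)"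

lemma Picard_step:
  assumes V: "good_process V" and X: "good_process X"
  shows "\<exists>Y. good_process Y \<and> solves_step V X Y"
proof -
  note V' = good_processD[OF V] and X' = good_processD[OF X]
  have GM: "(\<lambda>\<omega>. drift_conv (drift X \<omega>) t) \<in> borel_measurable M" if "0 \<le> t" for t
    using filtration_measurable[OF filtration that measurable_drift_conv[OF X that]] .
  have "\<exists>Y. good_process Y \<and> (\<forall>t\<ge>0. AE \<omega> in M. Y t \<omega> = V t \<omega> + drift_conv (drift X \<omega>) t)"
  proof (rule good_modification)
    show "(\<lambda>\<omega>. V t \<omega> + drift_conv (drift X \<omega>) t) \<in> borel_measurable (F t)" if "0 \<le> t" for t
      using Lp_process_measurable(2)[OF V'(1) that] measurable_drift_conv[OF X that] by measurable
    show "Lp_uniformly_continuous M p (\<lambda>t \<omega>. V t \<omega> + drift_conv (drift X \<omega>) t)"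
      by (rule Lp_uniformly_continuous_add[OF V'(2) drift_conv_Lp_uniformly_continuous[OF X] Lp_process_measurable(3)[OF V'(1)] GM])
    fix T :: real
    obtain N1 where N1: "0 \<le> N1" "\<forall>t\<in>{0..T}. moment p (V t) \<le> ennreal N1" using V'(3)[of T] by blast
    obtain N2 where N2: "0 \<le> N2" "\<forall>t\<in>{0..T}. moment p (\<lambda>\<omega>. drift_conv (drift X \<omega>) t) \<le> ennreal N2"
      using drift_conv_bounded[OF X, of T] by blast
    show "\<exists>N\<ge>0. \<forall>t\<in>{0..T}. moment p (\<lambda>\<omega>. V t \<omega> + drift_conv (drift X \<omega>) t) \<le> ennreal N"
    proof (intro exI[of _ "2 powr p * (N1 + N2)"] conjI ballI)
      fix t assume t: "t \<in> {0..T}"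
      then have "moment p (\<lambda>\<omega>. V t \<omega> + drift_conv (drift X \<omega>) t)
        \<le> ennreal (2 powr p) * (moment p (V t) + moment p (\<lambda>\<omega>. drift_conv (drift X \<omega>) t))"
        using p by (intro moment_add Lp_process_measurable(3)[OF V'(1)] GM) auto
      also have "\<dots> \<le> ennreal (2 powr p) * (ennreal N1 + ennreal N2)"
        using t N1 N2 by (intro mult_left_mono add_mono) auto
      finally show "moment p (\<lambda>\<omega>. V t \<omega> + drift_conv (drift X \<omega>) t) \<le> ennreal (2 powr p * (N1 + N2))"
        using N1 N2 by (simp add: ennreal_plus ennreal_mult)
    qed (use N1 N2 in auto)
  qed
  then show ?thesis by (simp add: solves_step_def)
qed

definition step_const :: "real \<Rightarrow> real" where
  "step_const T = T powr (p - 1) * (2 * (2 * C) powr p)"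

lemma step_const_nonneg: "0 \<le> step_const T"
  by (simp add: step_const_def)

lemma solves_step_diff_moment:
  assumes "Lp_process X" "Lp_process Y" "solves_step V X X'" "solves_step V Y Y'"
    and "\<And>t. 0 \<le> t \<Longrightarrow> AE \<omega> in M. set_integrable lborel {0..t} (drift X \<omega>)"
    and "\<And>t. 0 \<le> t \<Longrightarrow> AE \<omega> in M. set_integrable lborel {0..t} (drift Y \<omega>)"
    and t: "0 \<le> t" "t \<le> T"
  shows "moment p (\<lambda>\<omega>. X' t \<omega> - Y' t \<omega>)
    \<le> ennreal (step_const T) * (\<integral>\<^sup>+ s\<in>{0..t}. moment p (\<lambda>\<omega>. X s \<omega> - Y s \<omega>) \<partial>lborel)"
proof -
  have "AE \<omega> in M. X' t \<omega> = V t \<omega> + drift_conv (drift X \<omega>) t" "AE \<omega> in M. Y' t \<omega> = V t \<omega> + drift_conv (drift Y \<omega>) t"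
    using assms(3,4) t by (auto simp: solves_step_def)
  then have "AE \<omega> in M. X' t \<omega> - Y' t \<omega> = drift_conv (drift X \<omega>) t - drift_conv (drift Y \<omega>) t"
    by eventually_elim simp
  then have "moment p (\<lambda>\<omega>. X' t \<omega> - Y' t \<omega>) = moment p (\<lambda>\<omega>. drift_conv (drift X \<omega>) t - drift_conv (drift Y \<omega>) t)"
    by (rule moment_cong_AE)
  also have "\<dots> \<le> ennreal (t powr (p - 1) * (2 * (2 * C) powr p)) * (\<integral>\<^sup>+ s\<in>{0..t}. moment p (\<lambda>\<omega>. X s \<omega> - Y s \<omega>) \<partial>lborel)"
    using assms t by (intro drift_conv_diff_moment) auto
  also have "\<dots> \<le> ennreal (step_const T) * (\<integral>\<^sup>+ s\<in>{0..t}. moment p (\<lambda>\<omega>. X s \<omega> - Y s \<omega>) \<partial>lborel)"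
    unfolding step_const_def using t p
    by (intro mult_right_mono ennreal_leI powr_mono2) auto
  finally show ?thesis .
qed

text \<open>Instead of a complete space of processes, the iterates themselves are used: they
  converge almost surely at each fixed time, their pointwise \<open>lim\<close> is again
  predictable, and Fatou's lemma carries the geometric rate over to the limit.\<close>

lemma fixed_point_exists:
  assumes V: "good_process V"
  shows "\<exists>X. good_process X \<and> solves_step V X X"
proof -
  \<comment> \<open>A Picard step determines its result only up to modification, so a representative
    is chosen.\<close>
  define next_it where "next_it X = (SOME Y. good_process Y \<and> solves_step V X Y)" for X
  have next_it: "good_process (next_it X) \<and> solves_step V X (next_it X)" if "good_process X" for X
    unfolding next_it_def using Picard_step[OF V that] by (rule someI_ex)
  define x where "x n = (next_it ^^ n) V" for n
  have good: "good_process (x n)" for n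
    unfolding x_def by (induction n) (auto simp: V next_it)
  have step: "solves_step V (x n) (x (Suc n))" for n
    using next_it[OF good[of n]] by (simp add: x_def)
  note xL = good_processD(1)[OF good] and xint = good_drift_integrable[OF good]
  note xM = Lp_process_measurable(3)[OF xL]
  \<comment> \<open>With the weight \<open>exp (b * t)\<close> and \<open>b = 16 * K\<close>, one
    step gains the factor 1/16. This ratio leaves room for the triangle constant 4 in sums of many
    differences and for the factor \<open>2 ^ n\<close> in the passage to first moments.\<close>
  have diff_le: "\<exists>A\<ge>0. \<forall>t\<in>{0..T}. \<forall>n. moment p (\<lambda>\<omega>. x (Suc n) t \<omega> - x n t \<omega>) \<le> ennreal (A / 16 ^ n)"
    if T: "0 < T" for T
  proof -
    obtain N where N: "0 \<le> N" "\<forall>t\<in>{0..T}. moment p (x 0 t) \<le> ennreal N" using good_processD(3)[OF good] by blast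
    obtain N' where N': "0 \<le> N'" "\<forall>t\<in>{0..T}. moment p (x 1 t) \<le> ennreal N'" using good_processD(3)[OF good] by blast
    define A where "A = 2 powr p * (N + N')"
    have A: "0 \<le> A" using N N' by (simp add: A_def)
    define K where "K = step_const T + 1"
    have K: "0 < K" using step_const_nonneg[of T] by (simp add: K_def)
    define b where "b = 16 * K"
    have *: "moment p (\<lambda>\<omega>. x (Suc n) t \<omega> - x n t \<omega>) \<le> ennreal (A / 16 ^ n * exp (b * t))" if "t \<in> {0..T}" for n t
      using that
    proof (induction n arbitrary: t)
      case 0
      have "moment p (\<lambda>\<omega>. x (Suc 0) t \<omega> - x 0 t \<omega>) \<le> ennreal (2 powr p) * (moment p (x 1 t) + moment p (x 0 t))"
        using moment_add[of "x 1 t" "\<lambda>\<omega>. - x 0 t \<omega>" p] xM[of t] 0 p by (simp add: moment_def)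
      also have "\<dots> \<le> ennreal (2 powr p) * (ennreal N' + ennreal N)"
        using N N' 0 by (intro mult_left_mono add_mono) auto
      also have "\<dots> = ennreal A"
        using N N' by (simp add: A_def add.commute flip: ennreal_plus ennreal_mult)
      also have "\<dots> \<le> ennreal (A / 16 ^ 0 * exp (b * t))"
        using A 0 K mult_left_mono[of 1 "exp (b * t)" A] by (intro ennreal_leI) (auto simp: b_def)
      finally show ?case .
    next
      case (Suc n)
      then have t: "0 \<le> t" "t \<le> T" by auto
      define R where "R = A / 16 ^ n"
      have R: "0 \<le> R" using A by (simp add: R_def)
      have "moment p (\<lambda>\<omega>. x (Suc (Suc n)) t \<omega> - x (Suc n) t \<omega>)
        \<le> ennreal (step_const T) * (\<integral>\<^sup>+ s\<in>{0..t}. moment p (\<lambda>\<omega>. x (Suc n) s \<omega> - x n s \<omega>) \<partial>lborel)"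
        by (rule solves_step_diff_moment[OF xL xL step step xint xint t])
      also have "\<dots> \<le> ennreal K * (\<integral>\<^sup>+ s. ennreal (R * exp (b * s)) * indicator {0..t} s \<partial>lborel)"
      proof (rule mult_mono)
        show "(\<integral>\<^sup>+ s\<in>{0..t}. moment p (\<lambda>\<omega>. x (Suc n) s \<omega> - x n s \<omega>) \<partial>lborel)
          \<le> (\<integral>\<^sup>+ s. ennreal (R * exp (b * s)) * indicator {0..t} s \<partial>lborel)"
          using Suc.IH t by (intro nn_integral_mono) (auto simp: indicator_def R_def)
      qed (auto simp: K_def intro: ennreal_leI)
      also have "\<dots> = (\<integral>\<^sup>+ s. ennreal K * (ennreal (R * exp (b * s)) * indicator {0..t} s) \<partial>lborel)"
        by (rule nn_integral_cmult[symmetric]) measurable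
      also have "\<dots> = (\<integral>\<^sup>+ s. ennreal (K * (R * exp (b * s))) * indicator {0..t} s \<partial>lborel)"
        using K R by (intro nn_integral_cong) (simp add: ennreal_mult mult.assoc)
      also have "\<dots> = ennreal (R / 16 * exp (b * t) - R / 16 * exp (b * 0))"
      proof (rule nn_integral_FTC_Icc)
        show "((\<lambda>s. R / 16 * exp (b * s)) has_real_derivative K * (R * exp (b * u))) (at u)" for u
          by (auto intro!: derivative_eq_intros simp: b_def)
      qed (use K R t in auto)
      also have "\<dots> \<le> ennreal (A / 16 ^ Suc n * exp (b * t))"
        using R by (intro ennreal_leI) (simp add: R_def)
      finally show ?case .
    qed
    show ?thesis
    proof (intro exI[of _ "A * exp (b * T)"] conjI ballI allI)
      fix t n assume t: "t \<in> {0..T}"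
      have "A / 16 ^ n * exp (b * t) \<le> A / 16 ^ n * exp (b * T)"
        using t A K by (intro mult_left_mono) (auto simp: b_def)
      then have "ennreal (A / 16 ^ n * exp (b * t)) \<le> ennreal (A * exp (b * T) / 16 ^ n)"
        by (intro ennreal_leI) simp
      with *[OF t] show "moment p (\<lambda>\<omega>. x (Suc n) t \<omega> - x n t \<omega>) \<le> ennreal (A * exp (b * T) / 16 ^ n)"
        by (rule order_trans)
    qed (use A in auto)
  qed
  have pow4: "2 powr p \<le> 4"
  proof -
    have "2 powr p \<le> (2::real) powr 2" using p \<alpha> by (intro powr_mono) auto
    then show ?thesis by simp
  qed
  have tri: "moment p (\<lambda>\<omega>. U \<omega> - W \<omega>) \<le> 4 * (moment p (\<lambda>\<omega>. U \<omega> - Q \<omega>) + moment p (\<lambda>\<omega>. Q \<omega> - W \<omega>))"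
    if [measurable]: "U \<in> borel_measurable M" "Q \<in> borel_measurable M" "W \<in> borel_measurable M" for U Q W
  proof -
    have "moment p (\<lambda>\<omega>. U \<omega> - W \<omega>) \<le> ennreal (2 powr p) * (moment p (\<lambda>\<omega>. U \<omega> - Q \<omega>) + moment p (\<lambda>\<omega>. Q \<omega> - W \<omega>))"
      using p by (intro moment_triangle) auto
    also have "\<dots> \<le> ennreal 4 * (moment p (\<lambda>\<omega>. U \<omega> - Q \<omega>) + moment p (\<lambda>\<omega>. Q \<omega> - W \<omega>))"
      using pow4 by (intro mult_right_mono ennreal_leI) auto
    finally show ?thesis by simp
  qed
  \<comment> \<open>The constant 6 closes the induction:
    \<open>4 * (6 / 16 + 1) = 5.5\<close>.\<close>
  have far: "moment p (\<lambda>\<omega>. x (n + k) t \<omega> - x n t \<omega>) \<le> ennreal (6 * A / 16 ^ n)"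
    if A: "0 \<le> A" "\<And>n. moment p (\<lambda>\<omega>. x (Suc n) t \<omega> - x n t \<omega>) \<le> ennreal (A / 16 ^ n)" and t: "0 \<le> t" for A t n k
  proof (induction k arbitrary: n)
    case 0
    then show ?case by (simp add: moment_zero)
  next
    case (Suc k)
    have "moment p (\<lambda>\<omega>. x (n + Suc k) t \<omega> - x n t \<omega>)
      \<le> 4 * (moment p (\<lambda>\<omega>. x (n + Suc k) t \<omega> - x (Suc n) t \<omega>) + moment p (\<lambda>\<omega>. x (Suc n) t \<omega> - x n t \<omega>))"
      using t by (intro tri xM)
    also have "\<dots> \<le> ennreal 4 * (ennreal (6 * A / 16 ^ Suc n) + ennreal (A / 16 ^ n))"
      using Suc.IH[of "Suc n"] A by (simp add: add_mono mult_left_mono)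
    also have "\<dots> = ennreal (4 * (6 * A / 16 ^ Suc n + A / 16 ^ n))"
      using A by (intro ennreal_mult_add) auto
    also have "\<dots> \<le> ennreal (6 * A / 16 ^ n)"
      using A by (intro ennreal_leI) (simp add: field_simps)
    finally show ?case .
  qed
  define X where "X t \<omega> = lim (\<lambda>n. x n t \<omega>)" for t \<omega>
  have pred: "predictable_process M F X"
    unfolding predictable_process_def X_def case_prod_beta'
    by (rule borel_measurable_lim_metric)
      (use xL in \<open>simp add: Lp_process_def predictable_process_def case_prod_beta'\<close>)
  have XM: "X t \<in> borel_measurable M" if "0 \<le> t" for t
    using that predictable_imp_adapted[OF filtration pred]
    by (intro filtration_measurable[OF filtration]) (auto simp: adapted_process_def)
  have conv: "AE \<omega> in M. (\<lambda>n. x n t \<omega>) \<longlonglongrightarrow> X t \<omega>" if t: "0 \<le> t" for t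
  proof -
    obtain A where A: "0 \<le> A" "\<And>n. moment p (\<lambda>\<omega>. x (Suc n) t \<omega> - x n t \<omega>) \<le> ennreal (A / 16 ^ n)"
      using diff_le[of "t + 1"] t by auto
    have "AE \<omega> in M. summable (\<lambda>n. norm (x (Suc n) t \<omega> - x n t \<omega>))"
    proof (rule AE_summable_nn_integral)
      note [measurable] = xM[OF t]
      show "(\<lambda>\<omega>. norm (x (Suc n) t \<omega> - x n t \<omega>)) \<in> borel_measurable M" for n by measurable
      show "(\<integral>\<^sup>+ \<omega>. ennreal (norm (x (Suc n) t \<omega> - x n t \<omega>)) \<partial>M) \<le> ennreal ((1/2) ^ n + A * (1/8) ^ n)" for n
      proof -
        \<comment> \<open>Almost sure convergence needs summable distances, while the p-th moments
          only control powers. Either \<open>y\<close> is at most the summable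
          \<open>(1/2) ^ n\<close>, or \<open>2 ^ n * y > 1\<close>, and then \<open>y\<close> is at
          most \<open>2 ^ n * y powr p\<close> because \<open>p - 1\<close> lies between 0 and
          1.\<close>
        have le: "y \<le> (1/2) ^ n + 2 ^ n * y powr p" if y: "0 \<le> y" for y :: real
        proof (cases "y \<le> (1/2) ^ n")
          case True
          then show ?thesis by (simp add: add_increasing2)
        next
          case False
          then have y: "(1/2) ^ n < y" by simp
          have y0: "0 < y" using y by (rule less_trans[rotated]) simp
          have "1 \<le> 2 ^ n * y" using y by (simp add: field_simps)
          then have "1 \<le> (2 ^ n * y) powr (p - 1)" using p by (simp add: ge_one_powr_ge_zero)
          also have "\<dots> = (2 ^ n) powr (p - 1) * y powr (p - 1)" using y0 by (simp add: powr_mult)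
          also have "\<dots> \<le> (2 ^ n) powr 1 * y powr (p - 1)"
            using p \<alpha> by (intro mult_right_mono powr_mono) auto
          finally have "1 * y \<le> (2 ^ n * y powr (p - 1)) * y" using y0 by (intro mult_right_mono) auto
          also have "y powr (p - 1) * y = y powr p" using y0 by (simp add: powr_diff)
          then have "(2 ^ n * y powr (p - 1)) * y = 2 ^ n * y powr p" by (simp add: mult.assoc)
          finally show ?thesis by (simp add: add_increasing)
        qed
        have "(\<integral>\<^sup>+ \<omega>. ennreal (norm (x (Suc n) t \<omega> - x n t \<omega>)) \<partial>M)
          \<le> (\<integral>\<^sup>+ \<omega>. ennreal ((1/2) ^ n) + ennreal (2 ^ n) * ennreal (norm (x (Suc n) t \<omega> - x n t \<omega>) powr p) \<partial>M)"
        proof (intro nn_integral_mono)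
          fix \<omega>
          have "ennreal (norm (x (Suc n) t \<omega> - x n t \<omega>)) \<le> ennreal ((1/2) ^ n + 2 ^ n * norm (x (Suc n) t \<omega> - x n t \<omega>) powr p)"
            by (intro ennreal_leI le) simp
          then show "ennreal (norm (x (Suc n) t \<omega> - x n t \<omega>)) \<le> ennreal ((1/2) ^ n) + ennreal (2 ^ n) * ennreal (norm (x (Suc n) t \<omega> - x n t \<omega>) powr p)"
            by (simp only: ennreal_plus ennreal_mult zero_le_power zero_le_divide_1_iff powr_ge_zero zero_le_numeral mult_nonneg_nonneg)
        qed
        also have "\<dots> = ennreal ((1/2) ^ n) + ennreal (2 ^ n) * moment p (\<lambda>\<omega>. x (Suc n) t \<omega> - x n t \<omega>)"
          unfolding moment_def by (subst nn_integral_add) (auto simp: nn_integral_cmult emeasure_space_1)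
        also have "\<dots> \<le> ennreal ((1/2) ^ n) + ennreal (2 ^ n) * ennreal (A / 16 ^ n)"
          by (intro add_left_mono mult_left_mono A) auto
        also have "\<dots> = ennreal ((1/2) ^ n + 2 ^ n * (A / 16 ^ n))"
          using A(1) by (simp flip: ennreal_plus ennreal_mult)
        also have "(2::real) ^ n * (A / 16 ^ n) = A * (1/8) ^ n"
          by (simp add: power_divide field_simps flip: power_mult_distrib)
        finally show ?thesis .
      qed
      show "summable (\<lambda>n. (1/2) ^ n + A * (1/8) ^ n)"
        by (intro summable_add summable_mult summable_geometric) auto
    qed (use A in auto)
    then show ?thesis
    proof eventually_elim
      case (elim \<omega>)
      then have "summable (\<lambda>n. x (Suc n) t \<omega> - x n t \<omega>)" by (rule summable_norm_cancel)
      then have "convergent (\<lambda>n. \<Sum>i<n. x (Suc i) t \<omega> - x i t \<omega>)" by (simp add: summable_iff_convergent)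
      then have "convergent (\<lambda>n. x n t \<omega> - x 0 t \<omega>)" by (simp only: sum_lessThan_telescope[of "\<lambda>i. x i t \<omega>"])
      then have "convergent (\<lambda>n. x n t \<omega>)"
        using convergent_diff_const_right_iff by blast
      then show ?case unfolding X_def by (simp add: convergent_LIMSEQ_iff)
    qed
  qed
  \<comment> \<open>Fatou's lemma applied to \<open>far\<close> as \<open>k\<close> grows.\<close>
  have close: "moment p (\<lambda>\<omega>. X t \<omega> - x n t \<omega>) \<le> ennreal (6 * A / 16 ^ n)"
    if A: "0 \<le> A" "\<And>n. moment p (\<lambda>\<omega>. x (Suc n) t \<omega> - x n t \<omega>) \<le> ennreal (A / 16 ^ n)" and t: "0 \<le> t" for A t n
  proof -
    note [measurable] = xM[OF t]
    have "moment p (\<lambda>\<omega>. X t \<omega> - x n t \<omega>) = (\<integral>\<^sup>+ \<omega>. liminf (\<lambda>k. ennreal (norm (x (n + k) t \<omega> - x n t \<omega>) powr p)) \<partial>M)"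
      unfolding moment_def
    proof (rule nn_integral_cong_AE)
      show "AE \<omega> in M. ennreal (norm (X t \<omega> - x n t \<omega>) powr p) = liminf (\<lambda>k. ennreal (norm (x (n + k) t \<omega> - x n t \<omega>) powr p))"
        using conv[OF t]
      proof eventually_elim
        case (elim \<omega>)
        then have "(\<lambda>k. x (n + k) t \<omega>) \<longlonglongrightarrow> X t \<omega>"
          by (subst add.commute) (rule LIMSEQ_ignore_initial_segment)
        then have "(\<lambda>k. ennreal (norm (x (n + k) t \<omega> - x n t \<omega>) powr p)) \<longlonglongrightarrow> ennreal (norm (X t \<omega> - x n t \<omega>) powr p)"
          using p by (intro tendsto_ennrealI tendsto_powr' tendsto_norm tendsto_diff tendsto_const) auto
        then show ?case by (intro lim_imp_Liminf[symmetric]) auto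
      qed
    qed
    also have "\<dots> \<le> liminf (\<lambda>k. moment p (\<lambda>\<omega>. x (n + k) t \<omega> - x n t \<omega>))"
      unfolding moment_def by (intro nn_integral_liminf) measurable
    also have "\<dots> \<le> liminf (\<lambda>k. ennreal (6 * A / 16 ^ n))"
      by (intro Liminf_mono always_eventually allI far A t)
    also have "\<dots> = ennreal (6 * A / 16 ^ n)" by (simp add: Liminf_const)
    finally show ?thesis .
  qed
  have to0: "\<exists>n. c / 16 ^ n \<le> \<epsilon>" if "0 < \<epsilon>" for c \<epsilon> :: real
  proof -
    have "(\<lambda>n. c * (1/16) ^ n) \<longlonglongrightarrow> c * 0" by (intro tendsto_mult tendsto_const LIMSEQ_power_zero) auto
    then have "eventually (\<lambda>n. c * (1/16) ^ n < \<epsilon>) sequentially" using that by (intro order_tendstoD) auto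
    then obtain n where "c * (1/16) ^ n < \<epsilon>" by (auto simp: eventually_sequentially)
    then show ?thesis by (intro exI[of _ n]) (simp add: power_divide)
  qed
  have bound: "\<exists>N\<ge>0. \<forall>t\<in>{0..T}. moment p (X t) \<le> ennreal N" for T
  proof (cases "0 < T")
    case True
    obtain A where A: "0 \<le> A" "\<And>t n. t \<in> {0..T} \<Longrightarrow> moment p (\<lambda>\<omega>. x (Suc n) t \<omega> - x n t \<omega>) \<le> ennreal (A / 16 ^ n)"
      using diff_le[OF True] by blast
    obtain N where N: "0 \<le> N" "\<forall>t\<in>{0..T}. moment p (x 0 t) \<le> ennreal N" using good_processD(3)[OF good] by blast
    show ?thesis
    proof (intro exI[of _ "4 * (6 * A / 16 ^ 0 + N)"] conjI ballI)
      fix t assume t: "t \<in> {0..T}"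
      have "moment p (X t) \<le> 4 * (moment p (\<lambda>\<omega>. X t \<omega> - x 0 t \<omega>) + moment p (\<lambda>\<omega>. x 0 t \<omega> - 0))"
        using tri[of "X t" "x 0 t" "\<lambda>_. 0"] t XM xM by simp
      also have "\<dots> \<le> ennreal 4 * (ennreal (6 * A / 16 ^ 0) + ennreal N)"
        using close[OF A(1) A(2)[OF t], of 0] N t by (simp add: add_mono mult_left_mono)
      also have "\<dots> = ennreal (4 * (6 * A / 16 ^ 0 + N))"
        using A N by (intro ennreal_mult_add) auto
      finally show "moment p (X t) \<le> ennreal (4 * (6 * A / 16 ^ 0 + N))" .
    qed (use A N in auto)
  next
    case False
    \<comment> \<open>For \<open>T \<le> 0\<close> the interval contains at most the time 0, which
      the estimate on \<open>{0..1}\<close> covers.\<close>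
    obtain A where A: "0 \<le> A" "\<And>t n. t \<in> {0..1} \<Longrightarrow> moment p (\<lambda>\<omega>. x (Suc n) t \<omega> - x n t \<omega>) \<le> ennreal (A / 16 ^ n)"
      using diff_le[of 1] by auto
    have "moment p (X 0) \<le> 4 * (moment p (\<lambda>\<omega>. X 0 \<omega> - x 0 0 \<omega>) + moment p (\<lambda>\<omega>. x 0 0 \<omega> - 0))"
      using tri[of "X 0" "x 0 0" "\<lambda>_. 0"] XM xM by simp
    also have "\<dots> < \<infinity>"
      using close[OF A(1) A(2), of 0 0] Lp_process_measurable(4)[OF xL, of 0 0]
      by (auto simp: ennreal_mult_less_top intro: le_less_trans)
    finally have "moment p (X 0) < \<infinity>" .
    then have fin: "ennreal (enn2real (moment p (X 0))) = moment p (X 0)" by simp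
    show ?thesis
    proof (intro exI[of _ "enn2real (moment p (X 0))"] conjI ballI)
      fix t assume "t \<in> {0..T}"
      then have "t = 0" using False by auto
      then show "moment p (X t) \<le> ennreal (enn2real (moment p (X 0)))" by (simp only: fin)
    qed simp
  qed
  have XL: "Lp_process X"
    unfolding Lp_process_def
  proof (intro conjI pred allI impI)
    fix t :: real assume t: "0 \<le> t"
    then obtain N where "moment p (X t) \<le> ennreal N"
      using bound[of t] by (meson atLeastAtMost_iff order_refl)
    also have "\<dots> < \<infinity>" by simp
    finally show "moment p (X t) < \<infinity>" .
  qed
  have "Lp_uniformly_continuous M p X"
  proof (rule Lp_uniformly_continuousI)
    fix T \<epsilon> :: real assume T: "0 < T" "0 < \<epsilon>"
    obtain A where A: "0 \<le> A" "\<And>t n. t \<in> {0..T} \<Longrightarrow> moment p (\<lambda>\<omega>. x (Suc n) t \<omega> - x n t \<omega>) \<le> ennreal (A / 16 ^ n)"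
      using diff_le[OF T(1)] by blast
    \<comment> \<open>Two nested triangle inequalities with constant 4 give
      \<open>4 * (1 + 4 * 2) = 36\<close>.\<close>
    have e: "0 < \<epsilon> / 36" using T by simp
    obtain n where n: "6 * A / 16 ^ n \<le> \<epsilon> / 36" using to0[OF e] by blast
    obtain \<delta> where \<delta>: "0 < \<delta>" "\<forall>s\<in>{0..T}. \<forall>t\<in>{0..T}. \<bar>s - t\<bar> < \<delta> \<longrightarrow> moment p (\<lambda>\<omega>. x n s \<omega> - x n t \<omega>) \<le> ennreal (\<epsilon> / 36)"
      using Lp_uniformly_continuousD[OF good_processD(2)[OF good] T(1) e] by blast
    show "\<exists>\<delta>>0. \<forall>s\<in>{0..T}. \<forall>t\<in>{0..T}. \<bar>s - t\<bar> < \<delta> \<longrightarrow> moment p (\<lambda>\<omega>. X s \<omega> - X t \<omega>) \<le> ennreal \<epsilon>"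
    proof (intro exI[of _ \<delta>] conjI ballI impI \<delta>(1))
      fix s t assume st: "s \<in> {0..T}" "t \<in> {0..T}" "\<bar>s - t\<bar> < \<delta>"
      have c: "moment p (\<lambda>\<omega>. X r \<omega> - x n r \<omega>) \<le> ennreal (\<epsilon> / 36)" if "r \<in> {0..T}" for r
        using that by (intro order_trans[OF close[OF A(1) A(2)[OF that]] ennreal_leI[OF n]]) auto
      have "moment p (\<lambda>\<omega>. X s \<omega> - X t \<omega>) \<le> 4 * (moment p (\<lambda>\<omega>. X s \<omega> - x n s \<omega>) + moment p (\<lambda>\<omega>. x n s \<omega> - X t \<omega>))"
        using st by (intro tri XM xM) auto
      also have "moment p (\<lambda>\<omega>. x n s \<omega> - X t \<omega>) \<le> 4 * (moment p (\<lambda>\<omega>. x n s \<omega> - x n t \<omega>) + moment p (\<lambda>\<omega>. x n t \<omega> - X t \<omega>))"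
        using st by (intro tri XM xM) auto
      also have "moment p (\<lambda>\<omega>. x n t \<omega> - X t \<omega>) = moment p (\<lambda>\<omega>. X t \<omega> - x n t \<omega>)"
        by (rule moment_minus_commute)
      finally have "moment p (\<lambda>\<omega>. X s \<omega> - X t \<omega>) \<le> 4 * (moment p (\<lambda>\<omega>. X s \<omega> - x n s \<omega>)
        + 4 * (moment p (\<lambda>\<omega>. x n s \<omega> - x n t \<omega>) + moment p (\<lambda>\<omega>. X t \<omega> - x n t \<omega>)))"
        by (simp add: mult_left_mono add_left_mono)
      also have "\<dots> \<le> 4 * (ennreal (\<epsilon> / 36) + 4 * (ennreal (\<epsilon> / 36) + ennreal (\<epsilon> / 36)))"
        using st \<delta>(2) c by (intro mult_left_mono add_mono) auto
      also have "\<dots> = ennreal 4 * (ennreal (\<epsilon> / 36) + ennreal 4 * (ennreal (\<epsilon> / 36) + ennreal (\<epsilon> / 36)))"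
        by simp
      also have "\<dots> = ennreal \<epsilon>"
      proof -
        have "ennreal 4 * (ennreal (\<epsilon> / 36) + ennreal (\<epsilon> / 36)) = ennreal (4 * (\<epsilon> / 36 + \<epsilon> / 36))"
          using T by (intro ennreal_mult_add) auto
        moreover have "ennreal 4 * (ennreal (\<epsilon> / 36) + ennreal (4 * (\<epsilon> / 36 + \<epsilon> / 36)))
          = ennreal (4 * (\<epsilon> / 36 + 4 * (\<epsilon> / 36 + \<epsilon> / 36)))"
          using T by (intro ennreal_mult_add) auto
        ultimately show ?thesis by simp
      qed
      finally show "moment p (\<lambda>\<omega>. X s \<omega> - X t \<omega>) \<le> ennreal \<epsilon>" .
    qed
  qed
  with XL bound have X: "good_process X" by (simp add: good_process_def)
  have "solves_step V X X"
    unfolding solves_step_def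
  proof (intro allI impI)
    fix t :: real assume t: "0 \<le> t"
    define T where "T = t + 1"
    have T: "0 < T" "t \<in> {0..T}" using t by (auto simp: T_def)
    obtain A where A: "0 \<le> A" "\<And>t n. t \<in> {0..T} \<Longrightarrow> moment p (\<lambda>\<omega>. x (Suc n) t \<omega> - x n t \<omega>) \<le> ennreal (A / 16 ^ n)"
      using diff_le[OF T(1)] by blast
    \<comment> \<open>A further Picard step applied to the limit \<open>X\<close>. Both
      \<open>X\<close> and \<open>Y\<close> are close to \<open>x (Suc n)\<close>, the latter
      because a step is Lipschitz in the moments, so they agree almost surely.\<close>
    obtain Y where Y: "good_process Y" "solves_step V X Y" using Picard_step[OF V X] by blast
    have YM: "Y t \<in> borel_measurable M" using t by (rule Lp_process_measurable(3)[OF good_processD(1)[OF Y(1)]])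
    define c where "c = 4 * (6 * A + step_const T * (6 * A * T))"
    have le: "moment p (\<lambda>\<omega>. X t \<omega> - Y t \<omega>) \<le> ennreal (c / 16 ^ n)" for n
    proof -
      have "moment p (\<lambda>\<omega>. X t \<omega> - Y t \<omega>)
        \<le> 4 * (moment p (\<lambda>\<omega>. X t \<omega> - x (Suc n) t \<omega>) + moment p (\<lambda>\<omega>. x (Suc n) t \<omega> - Y t \<omega>))"
        using t by (intro tri XM xM YM)
      moreover have "moment p (\<lambda>\<omega>. X t \<omega> - x (Suc n) t \<omega>) \<le> ennreal (6 * A / 16 ^ n)"
        by (rule order_trans[OF close[OF A(1) A(2)[OF T(2)] t, of "Suc n"]])
          (use A(1) in \<open>auto intro!: ennreal_leI simp: field_simps\<close>)
      moreover have "moment p (\<lambda>\<omega>. x (Suc n) t \<omega> - Y t \<omega>) \<le> ennreal (step_const T * (6 * A / 16 ^ n * T))"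
      proof -
        have "moment p (\<lambda>\<omega>. x (Suc n) t \<omega> - Y t \<omega>)
          \<le> ennreal (step_const T) * (\<integral>\<^sup>+ s\<in>{0..t}. moment p (\<lambda>\<omega>. x n s \<omega> - X s \<omega>) \<partial>lborel)"
          using T by (intro solves_step_diff_moment[OF xL XL step Y(2) xint good_drift_integrable[OF X] t]) auto
        also have "\<dots> \<le> ennreal (step_const T) * (\<integral>\<^sup>+ s. ennreal (6 * A / 16 ^ n) * indicator {0..t} s \<partial>lborel)"
        proof (intro mult_left_mono nn_integral_mono)
          fix s :: real
          show "moment p (\<lambda>\<omega>. x n s \<omega> - X s \<omega>) * indicator {0..t} s \<le> ennreal (6 * A / 16 ^ n) * indicator {0..t} s"
          proof (cases "s \<in> {0..t}")
            case True
            then have s: "s \<in> {0..T}" "0 \<le> s" using T by auto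
            from close[OF A(1) A(2)[OF s(1)] s(2)] True show ?thesis by (subst moment_minus_commute) simp
          qed simp
        qed auto
        also have "\<dots> = ennreal (step_const T) * (ennreal (6 * A / 16 ^ n) * ennreal t)"
          using t by (subst nn_integral_cmult_indicator) auto
        also have "\<dots> \<le> ennreal (step_const T) * (ennreal (6 * A / 16 ^ n) * ennreal T)"
          using T by (intro mult_left_mono ennreal_leI) auto
        also have "\<dots> = ennreal (step_const T * (6 * A / 16 ^ n * T))"
          using A(1) T step_const_nonneg[of T]
          by (simp only: ennreal_mult mult_nonneg_nonneg divide_nonneg_nonneg zero_le_numeral zero_le_power less_imp_le)
        finally show ?thesis .
      qed
      ultimately have "moment p (\<lambda>\<omega>. X t \<omega> - Y t \<omega>)
        \<le> ennreal 4 * (ennreal (6 * A / 16 ^ n) + ennreal (step_const T * (6 * A / 16 ^ n * T)))"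
        by (simp) (meson add_mono mult_left_mono order_trans zero_le)
      also have "\<dots> = ennreal (4 * (6 * A / 16 ^ n + step_const T * (6 * A / 16 ^ n * T)))"
        using A(1) T step_const_nonneg[of T] by (intro ennreal_mult_add) auto
      also have "4 * (6 * A / 16 ^ n + step_const T * (6 * A / 16 ^ n * T)) = c / 16 ^ n"
        by (simp add: c_def field_simps)
      finally show ?thesis .
    qed
    have "moment p (\<lambda>\<omega>. X t \<omega> - Y t \<omega>) \<le> 0 + ennreal \<epsilon>" if "0 < \<epsilon>" for \<epsilon>
      using to0[OF that, of c] le by (auto intro: order_trans ennreal_leI)
    then have "moment p (\<lambda>\<omega>. X t \<omega> - Y t \<omega>) = 0"
      using ennreal_le_epsilon[of 0 "moment p (\<lambda>\<omega>. X t \<omega> - Y t \<omega>)"] by auto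
    then have "AE \<omega> in M. X t \<omega> = Y t \<omega>"
      using XM[OF t] YM by (subst (asm) moment_0_iff) auto
    moreover have "AE \<omega> in M. Y t \<omega> = V t \<omega> + drift_conv (drift X \<omega>) t"
      using Y(2) t by (simp add: solves_step_def)
    ultimately show "AE \<omega> in M. X t \<omega> = V t \<omega> + drift_conv (drift X \<omega>) t"
      by eventually_elim simp
  qed
  with X show ?thesis by blast
qed

end

section \<open>A priori bounds and uniqueness\<close>

text \<open>The \<open>Z\<close> of a mild solution is only almost surely the sum of its series, and
  on a space that need not be complete it may fail to be measurable. The uniqueness of the
  convolution is stated for measurable versions.\<close>

lemma (in stable_noise) stochastic_convolution_measurable_version:
  assumes "is_stochastic_convolution M e lam bet L t Z"
  shows "\<exists>Z'\<in>borel_measurable M. is_stochastic_convolution M e lam bet L t Z' \<and> (AE \<omega> in M. Z \<omega> = Z' \<omega>)"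
proof -
  from assms obtain I where I: "\<And>k. has_stochastic_integral M (\<lambda>s. exp (- lam k * (t - s))) (L k) t (I k)"
    and sums: "AE \<omega> in M. (\<lambda>k. (bet k * I k \<omega>) *\<^sub>R e k) sums Z \<omega>"
    by (auto simp: is_stochastic_convolution_def)
  have [measurable]: "I k \<in> borel_measurable M" for k
    using I by (simp add: has_stochastic_integral_def)
  define Z' where "Z' \<omega> = lim (\<lambda>n. \<Sum>k<n. (bet k * I k \<omega>) *\<^sub>R e k)" for \<omega>
  have "Z' \<in> borel_measurable M" unfolding Z'_def by measurable
  moreover have eq: "AE \<omega> in M. Z \<omega> = Z' \<omega>"
    using sums by eventually_elim (simp add: Z'_def sums_def limI)
  moreover have "AE \<omega> in M. (\<lambda>k. (bet k * I k \<omega>) *\<^sub>R e k) sums Z' \<omega>"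
    using sums eq by eventually_elim simp
  with I have "is_stochastic_convolution M e lam bet L t Z'"
    unfolding is_stochastic_convolution_def by blast
  ultimately show ?thesis by blast
qed

context mckean_vlasov
begin

text \<open>Versions of the convolution at a given time agree almost surely, so the same V
  represents the noise of every solution that starts from \<open>\<xi>\<close>.\<close>

lemma mild_solution_solves_step:
  assumes sol: "mild_solution M F e lam bet L S p B \<xi> X" and loc: "drift_locally_integrable M B X"
    and V: "mild_noise \<xi> V"
  shows "Lp_process X" "solves_step V X X"
    and "\<And>t. 0 \<le> t \<Longrightarrow> AE \<omega> in M. set_integrable lborel {0..t} (drift X \<omega>)"
proof -
  have pred: "predictable_process M F X" using sol by (simp add: mild_solution_def)
  have XM: "X t \<in> borel_measurable M" if "0 \<le> t" for t
    using predictable_imp_adapted[OF filtration pred] that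
    by (intro filtration_measurable[OF filtration that]) (simp add: adapted_process_def)
  show "Lp_process X"
    unfolding Lp_process_def
  proof (intro conjI pred allI impI)
    fix t :: real assume t: "0 \<le> t"
    then have "law M (X t) \<in> moment_probs p" using sol by (simp add: mild_solution_def)
    then show "moment p (X t) < \<infinity>" using law_moment_probs_iff[OF XM[OF t]] by simp
  qed
  have drift_eq: "(\<lambda>s. B (X s \<omega>) (law M (X s))) = drift X \<omega>" for \<omega>
    by (simp add: drift_def fun_eq_iff)
  show "AE \<omega> in M. set_integrable lborel {0..t} (drift X \<omega>)" if "0 \<le> t" for t
    using loc that by (simp add: drift_locally_integrable_def drift_eq)
  show "solves_step V X X"
    unfolding solves_step_def
  proof (intro allI impI)
    fix t :: real assume t: "0 \<le> t"
    obtain Z where Z: "is_stochastic_convolution M e lam bet L t Z"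
      "AE \<omega> in M. X t \<omega> = S t (\<xi> \<omega>) + drift_conv (drift X \<omega>) t + Z \<omega>"
      using sol t by (auto simp: mild_solution_def drift_conv_def drift_def)
    obtain Z1 where Z1: "Z1 \<in> borel_measurable M" "is_stochastic_convolution M e lam bet L t Z1" "AE \<omega> in M. Z \<omega> = Z1 \<omega>"
      using stochastic_convolution_measurable_version[OF Z(1)] by blast
    obtain Z2 where Z2: "Z2 \<in> borel_measurable M" "is_stochastic_convolution M e lam bet L t Z2"
      "AE \<omega> in M. V t \<omega> = S t (\<xi> \<omega>) + Z2 \<omega>"
      using V t by (auto simp: mild_noise_def)
    have "AE \<omega> in M. Z2 \<omega> = Z1 \<omega>"
      by (rule stochastic_convolution_unique[OF t Z1(2) Z2(2) Z1(1) Z2(1)])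
    with Z(2) Z1(3) Z2(3) show "AE \<omega> in M. X t \<omega> = V t \<omega> + drift_conv (drift X \<omega>) t"
      by eventually_elim (simp add: algebra_simps)
  qed
qed

lemma moment_le_add:
  assumes [measurable]: "V \<in> borel_measurable M" "c \<in> borel_measurable M" and c: "\<And>\<omega>. 0 \<le> c \<omega>" and m: "0 \<le> m"
    and le: "AE \<omega> in M. norm (Y \<omega>) \<le> norm (V \<omega>) + c \<omega>"
  shows "moment m Y \<le> ennreal (2 powr m) * (moment m V + (\<integral>\<^sup>+ \<omega>. ennreal (c \<omega> powr m) \<partial>M))"
proof -
  have "moment m Y \<le> (\<integral>\<^sup>+ \<omega>. ennreal (2 powr m) * (ennreal (norm (V \<omega>) powr m) + ennreal (c \<omega> powr m)) \<partial>M)"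
    unfolding moment_def
  proof (rule nn_integral_mono_AE)
    show "AE \<omega> in M. ennreal (norm (Y \<omega>) powr m) \<le> ennreal (2 powr m) * (ennreal (norm (V \<omega>) powr m) + ennreal (c \<omega> powr m))"
      using le
    proof eventually_elim
      case (elim \<omega>)
      have "norm (Y \<omega>) powr m \<le> (norm (V \<omega>) + c \<omega>) powr m" using elim m by (intro powr_mono2) auto
      also have "\<dots> \<le> 2 powr m * (norm (V \<omega>) powr m + c \<omega> powr m)"
        using c m by (intro powr_sum_le) auto
      finally show ?case by (simp add: ennreal_leI flip: ennreal_mult ennreal_plus)
    qed
  qed
  also have "\<dots> = ennreal (2 powr m) * (moment m V + (\<integral>\<^sup>+ \<omega>. ennreal (c \<omega> powr m) \<partial>M))"
    unfolding moment_def by (subst nn_integral_cmult) (auto simp: nn_integral_add)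
  finally show ?thesis .
qed

text \<open>Along a solution the paths of \<open>X - V\<close> are continuous, so their supremum over rational times
  is finite; this bounds \<open>X\<close> pathwise, though with no moment information.\<close>

lemma pathwise_bound:
  assumes X: "Lp_process X" and V: "Lp_process V" and sol: "solves_step V X X" and T: "0 < T"
    and int: "AE \<omega> in M. set_integrable lborel {0..T} (drift X \<omega>)"
  shows "\<exists>r\<in>borel_measurable M. (AE \<omega> in M. r \<omega> < (\<infinity>::ennreal)) \<and>
    (\<forall>t\<in>{0..T}. AE \<omega> in M. ennreal (norm (X t \<omega> - V t \<omega>)) \<le> r \<omega>)"
proof -
  define Q where "Q = \<rat> \<inter> {0..T}"
  have Q: "countable Q" unfolding Q_def using countable_rat by (rule countable_Int1)
  define r where "r \<omega> = (SUP q\<in>Q. ennreal (norm (X q \<omega> - V q \<omega>)))" for \<omega>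
  have XV: "X t \<in> borel_measurable M" "V t \<in> borel_measurable M" if "0 \<le> t" for t
    using Lp_process_measurable(3)[OF X that] Lp_process_measurable(3)[OF V that] .
  have r: "r \<in> borel_measurable M"
    unfolding r_def
  proof (rule borel_measurable_SUP[OF Q])
    fix q assume "q \<in> Q"
    then have "0 \<le> q" by (simp add: Q_def)
    note [measurable] = XV[OF this]
    show "(\<lambda>\<omega>. ennreal (norm (X q \<omega> - V q \<omega>))) \<in> borel_measurable M" by measurable
  qed
  have eqQ: "AE \<omega> in M. \<forall>q\<in>Q. X q \<omega> = V q \<omega> + drift_conv (drift X \<omega>) q"
    using sol Q by (auto simp: AE_ball_countable solves_step_def Q_def)
  have "AE \<omega> in M. r \<omega> < \<infinity>"
    using int eqQ
  proof eventually_elim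
    case (elim \<omega>)
    have "r \<omega> \<le> (\<integral>\<^sup>+ s. ennreal (norm (indicator {0..T} s *\<^sub>R drift X \<omega> s)) \<partial>lborel)"
      unfolding r_def
    proof (rule SUP_least)
      fix q assume q: "q \<in> Q"
      then have q': "q \<le> T" by (simp add: Q_def)
      have "ennreal (norm (X q \<omega> - V q \<omega>)) = ennreal (norm (drift_conv (drift X \<omega>) q))"
        using elim(2) q by simp
      also have "\<dots> \<le> (\<integral>\<^sup>+ s\<in>{0..q}. ennreal (norm (drift X \<omega> s)) \<partial>lborel)"
        by (rule norm_drift_conv_le[OF set_integrable_Icc_subset[OF elim(1) q']])
      also have "\<dots> \<le> (\<integral>\<^sup>+ s. ennreal (norm (indicator {0..T} s *\<^sub>R drift X \<omega> s)) \<partial>lborel)"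
        using q' by (intro nn_integral_mono) (auto simp: indicator_def)
      finally show "ennreal (norm (X q \<omega> - V q \<omega>)) \<le> (\<integral>\<^sup>+ s. ennreal (norm (indicator {0..T} s *\<^sub>R drift X \<omega> s)) \<partial>lborel)" .
    qed
    also have "\<dots> < \<infinity>"
      using elim(1) unfolding set_integrable_def integrable_iff_bounded by blast
    finally show ?case .
  qed
  moreover have "AE \<omega> in M. ennreal (norm (X t \<omega> - V t \<omega>)) \<le> r \<omega>" if t: "t \<in> {0..T}" for t
  proof -
    have "AE \<omega> in M. X t \<omega> = V t \<omega> + drift_conv (drift X \<omega>) t"
      using sol t by (simp add: solves_step_def)
    with int eqQ show ?thesis
    proof eventually_elim
      case (elim \<omega>)
      have cont: "continuous_on {0..T} (drift_conv (drift X \<omega>))"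
        by (rule continuous_on_drift_conv[OF elim(1)])
      show ?case
      proof (rule ennreal_le_epsilon)
        fix \<epsilon> :: real assume \<epsilon>: "0 < \<epsilon>"
        obtain \<delta> where \<delta>: "0 < \<delta>" "\<And>u. u \<in> {0..T} \<Longrightarrow> dist u t < \<delta> \<Longrightarrow>
          dist (drift_conv (drift X \<omega>) u) (drift_conv (drift X \<omega>) t) < \<epsilon>"
          using cont t \<epsilon> unfolding continuous_on_iff by blast
        \<comment> \<open>As \<open>T > 0\<close>, there is room for a rational time in
          \<open>{0..T}\<close> also when \<open>t\<close> is an end point.\<close>
        have "max 0 (t - \<delta>) < min T (t + \<delta>)" using t T \<delta>(1) by auto
        then obtain q where q: "q \<in> \<rat>" "max 0 (t - \<delta>) < q" "q < min T (t + \<delta>)"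
          using Rats_dense_in_real by blast
        then have "q \<in> Q" "q \<in> {0..T}" "dist q t < \<delta>" by (auto simp: Q_def dist_real_def)
        have "norm (X t \<omega> - V t \<omega>) = norm (drift_conv (drift X \<omega>) t)" using elim(3) by simp
        also have "\<dots> \<le> norm (drift_conv (drift X \<omega>) q) + \<epsilon>"
          using \<delta>(2)[OF \<open>q \<in> {0..T}\<close> \<open>dist q t < \<delta>\<close>] norm_triangle_sub[of "drift_conv (drift X \<omega>) t" "drift_conv (drift X \<omega>) q"]
          by (simp add: dist_norm norm_minus_commute)
        also have "norm (drift_conv (drift X \<omega>) q) = norm (X q \<omega> - V q \<omega>)" using elim(2) \<open>q \<in> Q\<close> by simp
        finally have "ennreal (norm (X t \<omega> - V t \<omega>)) \<le> ennreal (norm (X q \<omega> - V q \<omega>) + \<epsilon>)"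
          by (rule ennreal_leI)
        also have "\<dots> = ennreal (norm (X q \<omega> - V q \<omega>)) + ennreal \<epsilon>" using \<epsilon> by (simp add: ennreal_plus)
        also have "\<dots> \<le> r \<omega> + ennreal \<epsilon>"
          unfolding r_def using \<open>q \<in> Q\<close> by (intro add_right_mono SUP_upper)
        finally show "ennreal (norm (X t \<omega> - V t \<omega>)) \<le> r \<omega> + ennreal \<epsilon>" .
      qed
    qed
  qed
  ultimately show ?thesis using r by blast
qed

lemma AE_integral_norm_finite:
  assumes V: "Lp_process V" and T: "0 \<le> T" and m: "1 \<le> m"
    and N: "0 \<le> N" "\<forall>t\<in>{0..T}. moment m (V t) \<le> ennreal N"
  shows "AE \<omega> in M. (\<integral>\<^sup>+ s\<in>{0..T}. ennreal (norm (V (max 0 s) \<omega>)) \<partial>lborel) < \<infinity>"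
proof -
  interpret P: pair_sigma_finite lborel M ..
  note [measurable] = Lp_process_measurable(1)[OF V]
  have le: "(\<integral>\<^sup>+ \<omega>. ennreal (norm (V s \<omega>)) \<partial>M) \<le> ennreal (1 + N)" if s: "s \<in> {0..T}" for s
  proof -
    have s0: "0 \<le> s" using s by simp
    note [measurable] = Lp_process_measurable(3)[OF V s0]
    have "(\<integral>\<^sup>+ \<omega>. ennreal (norm (V s \<omega>)) \<partial>M) \<le> (\<integral>\<^sup>+ \<omega>. 1 + ennreal (norm (V s \<omega>) powr m) \<partial>M)"
    proof (intro nn_integral_mono)
      fix \<omega>
      have "norm (V s \<omega>) \<le> 1 + norm (V s \<omega>) powr m"
        using m by (intro le_one_plus_powr) auto
      then have "ennreal (norm (V s \<omega>)) \<le> ennreal (1 + norm (V s \<omega>) powr m)" by (rule ennreal_leI)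
      then show "ennreal (norm (V s \<omega>)) \<le> 1 + ennreal (norm (V s \<omega>) powr m)" by (simp add: ennreal_plus)
    qed
    also have "\<dots> = 1 + moment m (V s)"
      unfolding moment_def by (subst nn_integral_add) (auto simp: emeasure_space_1)
    also have "\<dots> \<le> 1 + ennreal N" using N s by (intro add_left_mono) auto
    finally show ?thesis using N by (simp add: ennreal_plus)
  qed
  have "(\<integral>\<^sup>+ \<omega>. \<integral>\<^sup>+ s. ennreal (norm (V (max 0 s) \<omega>)) * indicator {0..T} s \<partial>lborel \<partial>M)
    = (\<integral>\<^sup>+ s. \<integral>\<^sup>+ \<omega>. ennreal (norm (V (max 0 s) \<omega>)) * indicator {0..T} s \<partial>M \<partial>lborel)"
    by (rule P.Fubini') measurable
  also have "\<dots> \<le> (\<integral>\<^sup>+ s. ennreal (1 + N) * indicator {0..T} s \<partial>lborel)"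
    using le by (intro nn_integral_mono) (auto simp: indicator_def)
  also have "\<dots> = ennreal (1 + N) * ennreal T"
    using T by (subst nn_integral_cmult_indicator) auto
  also have "\<dots> < \<infinity>" by (simp add: ennreal_mult_less_top)
  finally have "(\<integral>\<^sup>+ \<omega>. \<integral>\<^sup>+ s. ennreal (norm (V (max 0 s) \<omega>)) * indicator {0..T} s \<partial>lborel \<partial>M) \<noteq> \<infinity>" by simp
  then have "AE \<omega> in M. (\<integral>\<^sup>+ s. ennreal (norm (V (max 0 s) \<omega>)) * indicator {0..T} s \<partial>lborel) \<noteq> \<infinity>"
    by (intro nn_integral_noteq_infinite) measurable
  then show ?thesis by eventually_elim (simp add: less_top)
qed

text \<open>Evaluating the Lipschitz bound on a single path \<open>\<omega>\<^sub>0\<close> on which drift and solution are integrable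
  shows that the contribution of the laws to the drift is bounded by an integrable deterministic
  function. The moments are then bounded by Gronwall's inequality on the events \<open>{r \<le> N}\<close>, with a
  constant not depending on \<open>N\<close>.\<close>

lemma a_priori_moment:
  assumes X: "Lp_process X" and V: "Lp_process V" and sol: "solves_step V X X" and T: "0 < T" and m: "p \<le> m"
    and int: "\<And>t. 0 \<le> t \<Longrightarrow> AE \<omega> in M. set_integrable lborel {0..t} (drift X \<omega>)"
    and NV: "0 \<le> NV" "\<forall>t\<in>{0..T}. moment m (V t) \<le> ennreal NV"
  shows "\<exists>K\<ge>0. \<forall>t\<in>{0..T}. moment m (X t) \<le> ennreal K"
proof -
  interpret P: pair_sigma_finite lborel M ..
  have m1: "1 \<le> m" "0 \<le> m" using m p by auto
  have intT: "AE \<omega> in M. set_integrable lborel {0..T} (drift X \<omega>)" using T by (intro int) simp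
  obtain r where r[measurable]: "r \<in> borel_measurable M" and r_fin: "AE \<omega> in M. r \<omega> < (\<infinity>::ennreal)"
    and r_le: "\<And>t. t \<in> {0..T} \<Longrightarrow> AE \<omega> in M. ennreal (norm (X t \<omega> - V t \<omega>)) \<le> r \<omega>"
    using pathwise_bound[OF X V sol T intT] by blast
  note [measurable] = Lp_process_measurable(1)[OF X] Lp_process_measurable(1)[OF V]
  have Xr: "AE \<omega> in M. ennreal (norm (X t \<omega>)) \<le> ennreal (norm (V t \<omega>)) + r \<omega>" if "t \<in> {0..T}" for t
    using r_le[OF that]
  proof eventually_elim
    case (elim \<omega>)
    have "ennreal (norm (X t \<omega>)) \<le> ennreal (norm (V t \<omega>) + norm (X t \<omega> - V t \<omega>))"
      using norm_triangle_sub[of "X t \<omega>" "V t \<omega>"] by (intro ennreal_leI) simp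
    also have "\<dots> \<le> ennreal (norm (V t \<omega>)) + r \<omega>" using elim by (simp add: ennreal_plus add_left_mono)
    finally show ?case .
  qed
  \<comment> \<open>The pathwise bound holds at each time outside a null set that may depend on the
    time. Fubini's theorem turns it into a bound at almost every time along almost every path, which
    is enough for time integrals.\<close>
  have "AE s in lborel. AE \<omega> in M. s \<in> {0..T} \<longrightarrow> ennreal (norm (X (max 0 s) \<omega>)) \<le> ennreal (norm (V (max 0 s) \<omega>)) + r \<omega>"
  proof (rule AE_I2)
    fix s :: real
    show "AE \<omega> in M. s \<in> {0..T} \<longrightarrow> ennreal (norm (X (max 0 s) \<omega>)) \<le> ennreal (norm (V (max 0 s) \<omega>)) + r \<omega>"
    proof (cases "s \<in> {0..T}")
      case True
      with Xr[OF True] show ?thesis by simp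
    next
      case False
      then show ?thesis by (intro AE_I2) blast
    qed
  qed
  then have "AE \<omega> in M. AE s in lborel. s \<in> {0..T} \<longrightarrow> ennreal (norm (X (max 0 s) \<omega>)) \<le> ennreal (norm (V (max 0 s) \<omega>)) + r \<omega>"
  proof (subst (asm) P.AE_commute)
    have cong: "sets (lborel \<Otimes>\<^sub>M M) = sets (borel \<Otimes>\<^sub>M M)"
      by (rule sets_pair_measure_cong) auto
    have [measurable]: "(\<lambda>z. X (max 0 (fst z)) (snd z)) \<in> borel_measurable (lborel \<Otimes>\<^sub>M M)"
      "(\<lambda>z. V (max 0 (fst z)) (snd z)) \<in> borel_measurable (lborel \<Otimes>\<^sub>M M)"
      using Lp_process_measurable(1)[OF X] Lp_process_measurable(1)[OF V]
      unfolding measurable_cong_sets[OF cong refl] by (simp_all add: case_prod_beta')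
    show "{z \<in> space (lborel \<Otimes>\<^sub>M M). fst z \<in> {0..T} \<longrightarrow>
      ennreal (norm (X (max 0 (fst z)) (snd z))) \<le> ennreal (norm (V (max 0 (fst z)) (snd z))) + r (snd z)}
      \<in> sets (lborel \<Otimes>\<^sub>M M)"
      by measurable
  qed
  moreover have "AE \<omega> in M. (\<integral>\<^sup>+ s\<in>{0..T}. ennreal (norm (V (max 0 s) \<omega>)) \<partial>lborel) < \<infinity>"
    using T m1 by (intro AE_integral_norm_finite[OF V _ _ NV]) auto
  moreover have "AE \<omega> in M. \<omega> \<in> space M" by (rule AE_space)
  ultimately have X_int: "AE \<omega> in M. (\<integral>\<^sup>+ s\<in>{0..T}. ennreal (norm (X (max 0 s) \<omega>)) \<partial>lborel) < \<infinity>"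
    using r_fin
  proof eventually_elim
    case (elim \<omega>)
    have [measurable]: "(\<lambda>s. V (max 0 s) \<omega>) \<in> borel_measurable borel"
      using measurable_compose[OF measurable_Pair2'[OF elim(3)] Lp_process_measurable(1)[OF V]] by simp
    have "(\<integral>\<^sup>+ s\<in>{0..T}. ennreal (norm (X (max 0 s) \<omega>)) \<partial>lborel)
      \<le> (\<integral>\<^sup>+ s. ennreal (norm (V (max 0 s) \<omega>)) * indicator {0..T} s + r \<omega> * indicator {0..T} s \<partial>lborel)"
      using elim(1) by (intro nn_integral_mono_AE) (auto simp: indicator_def)
    also have "\<dots> = (\<integral>\<^sup>+ s\<in>{0..T}. ennreal (norm (V (max 0 s) \<omega>)) \<partial>lborel) + r \<omega> * ennreal T"
      using T by (subst nn_integral_add) (auto simp: nn_integral_cmult_indicator)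
    also have "\<dots> < \<infinity>" using elim(2,4) by (simp add: ennreal_mult_less_top)
    finally show ?case .
  qed
  have "AE \<omega> in M. \<omega> \<in> space M \<and> set_integrable lborel {0..T} (drift X \<omega>) \<and>
    (\<integral>\<^sup>+ s\<in>{0..T}. ennreal (norm (X (max 0 s) \<omega>)) \<partial>lborel) < \<infinity>"
    using AE_space intT X_int by eventually_elim simp
  then obtain \<omega>0 where \<omega>0: "\<omega>0 \<in> space M" "set_integrable lborel {0..T} (drift X \<omega>0)"
    "(\<integral>\<^sup>+ s\<in>{0..T}. ennreal (norm (X (max 0 s) \<omega>0)) \<partial>lborel) < \<infinity>"
    using eventually_happens'[OF ae_filter_bot] by blast
  define a where "a s = norm (indicator {0..T} s *\<^sub>R drift X \<omega>0 s)" for s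
  define b where "b s = C * (norm (X (max 0 s) \<omega>0) * indicator {0..T} s)" for s :: real
  have [measurable]: "a \<in> borel_measurable borel"
    unfolding a_def
  proof (rule measurable_compose[OF _ borel_measurable_norm])
    show "(\<lambda>s. indicator {0..T} s *\<^sub>R drift X \<omega>0 s) \<in> borel_measurable borel"
      using borel_measurable_integrable[OF \<omega>0(2)[unfolded set_integrable_def]] by simp
  qed
  have [measurable]: "(\<lambda>s. X (max 0 s) \<omega>0) \<in> borel_measurable borel"
    using measurable_compose[OF measurable_Pair2'[OF \<omega>0(1)] Lp_process_measurable(1)[OF X]] by simp
  have [measurable]: "b \<in> borel_measurable borel" unfolding b_def by measurable
  have ab0: "0 \<le> a s" "0 \<le> b s" for s using C by (auto simp: a_def b_def)
  define G where "G = enn2real (\<integral>\<^sup>+ s. ennreal (a s + b s) \<partial>lborel)"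
  have G0: "0 \<le> G" by (simp add: G_def)
  have G: "ennreal G = (\<integral>\<^sup>+ s. ennreal (a s + b s) \<partial>lborel)"
  proof -
    have "(\<integral>\<^sup>+ s. ennreal (a s + b s) \<partial>lborel) = (\<integral>\<^sup>+ s. ennreal (a s) \<partial>lborel) + (\<integral>\<^sup>+ s. ennreal (b s) \<partial>lborel)"
      using ab0 by (subst nn_integral_add[symmetric]) (auto simp: ennreal_plus)
    moreover have "(\<integral>\<^sup>+ s. ennreal (a s) \<partial>lborel) < \<infinity>"
      using \<omega>0(2) unfolding set_integrable_def integrable_iff_bounded a_def by blast
    moreover have "(\<integral>\<^sup>+ s. ennreal (b s) \<partial>lborel) = ennreal C * (\<integral>\<^sup>+ s\<in>{0..T}. ennreal (norm (X (max 0 s) \<omega>0)) \<partial>lborel)"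
      using C by (subst nn_integral_cmult[symmetric]) (auto intro!: nn_integral_cong simp: b_def ennreal_mult indicator_def)
    then have "(\<integral>\<^sup>+ s. ennreal (b s) \<partial>lborel) < \<infinity>" using \<omega>0(3) by (simp add: ennreal_mult_less_top)
    ultimately show ?thesis by (simp add: G_def)
  qed
  \<comment> \<open>Both drifts are taken under the law at time \<open>s\<close>, so the distance of
    the laws is 0 and only the two points are compared.\<close>
  have drift_le: "norm (drift X \<omega> s) \<le> a s + b s + C * norm (X s \<omega>)" if s: "s \<in> {0..T}" for s \<omega>
  proof -
    have s0: "0 \<le> s" using s by simp
    have "norm (B (X s \<omega>) (law M (X s)) - B (X s \<omega>0) (law M (X s))) \<le> C * (norm (X s \<omega> - X s \<omega>0) + Lp_dist (X s) (X s))"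
      using Lp_process_measurable(3,4)[OF X s0] by (intro drift_lipschitz) auto
    also have "Lp_dist (X s) (X s) = 0" using p by (simp add: Lp_dist_def moment_zero)
    finally have "norm (drift X \<omega> s - drift X \<omega>0 s) \<le> C * (norm (X s \<omega> - X s \<omega>0))"
      by (simp add: drift_def)
    also have "\<dots> \<le> C * (norm (X s \<omega>) + norm (X s \<omega>0))"
      using C by (intro mult_left_mono norm_triangle_ineq4) auto
    finally show ?thesis
      using norm_triangle_sub[of "drift X \<omega> s" "drift X \<omega>0 s"] s by (simp add: a_def b_def algebra_simps)
  qed
  define A where "A = 2 powr m * (NV + 2 powr m * G powr m)"
  \<comment> \<open>One factor \<open>2 powr m\<close> splits off V, the other one splits
    \<open>G + z\<close>; \<open>T powr (m - 1)\<close> comes from Jensen's inequality in time and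
    \<open>C powr m\<close> from the Lipschitz condition. The truncation level does not
    enter.\<close>
  define K where "K = 2 powr m * (2 powr m * (T powr (m - 1) * C powr m))"
  have A0: "0 \<le> A" and K0: "0 \<le> K" using NV by (auto simp: A_def K_def)
  have trunc: "moment m (\<lambda>\<omega>. indicator {\<omega> \<in> space M. r \<omega> \<le> ennreal N} \<omega> *\<^sub>R X t \<omega>) \<le> ennreal (2 * A * exp (2 * K * T))"
    if t: "t \<in> {0..T}" for t and N :: nat
  proof -
    \<comment> \<open>Since \<open>r\<close> bounds the path on the whole of \<open>{0..T}\<close>,
      one event serves all times, and its indicator can be moved inside the time integral.\<close>
    define E where "E = {\<omega> \<in> space M. r \<omega> \<le> ennreal N}"
    have [measurable]: "E \<in> sets M" unfolding E_def by measurable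
    define XN where "XN t \<omega> = indicator E \<omega> *\<^sub>R X (max 0 t) \<omega>" for t \<omega>
    have XNm[measurable]: "(\<lambda>(s, \<omega>). XN s \<omega>) \<in> borel_measurable (borel \<Otimes>\<^sub>M M)"
      unfolding XN_def by measurable
    define \<phi> where "\<phi> t = moment m (XN t)" for t
    have [measurable]: "\<phi> \<in> borel_measurable borel" unfolding \<phi>_def moment_def by measurable
    \<comment> \<open>This bound grows with \<open>N\<close>. It provides the finiteness that
      Gronwall's inequality presupposes and disappears from the conclusion.\<close>
    have \<phi>_bounded: "\<phi> t \<le> ennreal (2 powr m * (NV + real N powr m))" if t: "t \<in> {0..T}" for t
    proof -
      have t0: "0 \<le> t" using t by simp
      have "\<phi> t \<le> ennreal (2 powr m) * (moment m (V t) + (\<integral>\<^sup>+ \<omega>. ennreal (real N powr m) \<partial>M))"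
        unfolding \<phi>_def
      proof (rule moment_le_add)
        show "AE \<omega> in M. norm (XN t \<omega>) \<le> norm (V t \<omega>) + real N"
          using Xr[OF t]
        proof eventually_elim
          case (elim \<omega>)
          show ?case
          proof (cases "\<omega> \<in> E")
            case True
            then have "ennreal (norm (X t \<omega>)) \<le> ennreal (norm (V t \<omega>)) + ennreal (real N)"
              using elim by (auto simp: E_def intro: order_trans add_left_mono)
            then have "norm (X t \<omega>) \<le> norm (V t \<omega>) + real N"
              by (simp flip: ennreal_plus)
            then show ?thesis using True t0 by (simp add: XN_def)
          qed (simp add: XN_def)
        qed
      qed (use Lp_process_measurable(3)[OF V t0] m1 in auto)
      also have "\<dots> \<le> ennreal (2 powr m) * (ennreal NV + ennreal (real N powr m))"
        using NV t by (intro mult_left_mono add_mono) (auto simp: emeasure_space_1)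
      also have "\<dots> = ennreal (2 powr m * (NV + real N powr m))"
        using NV by (intro ennreal_mult_add) auto
      finally show ?thesis .
    qed
    have \<phi>_le: "\<phi> t \<le> ennreal A + ennreal K * (\<integral>\<^sup>+ s\<in>{0..t}. \<phi> s \<partial>lborel)" if t: "t \<in> {0..T}" for t
    proof -
      have t0: "0 \<le> t" "t \<le> T" using t by auto
      define h where "h s \<omega> = C * norm (XN s \<omega>)" for s \<omega>
      have hm[measurable]: "(\<lambda>(s, \<omega>). h s \<omega>) \<in> borel_measurable (borel \<Otimes>\<^sub>M M)"
        unfolding h_def by measurable
      \<comment> \<open>Off \<open>E\<close> the integrand is 0, and on \<open>E\<close> the
        integral is almost surely finite by \<open>X_int\<close>, so \<open>enn2real\<close> loses
        nothing.\<close>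
      define z where "z \<omega> = enn2real (\<integral>\<^sup>+ s\<in>{0..t}. ennreal (h s \<omega>) \<partial>lborel)" for \<omega>
      have [measurable]: "z \<in> borel_measurable M" unfolding z_def by measurable
      have z0: "0 \<le> z \<omega>" for \<omega> by (simp add: z_def)
      have "AE \<omega> in M. X t \<omega> = V t \<omega> + drift_conv (drift X \<omega>) t"
        using sol t0 by (simp add: solves_step_def)
      with intT X_int have le: "AE \<omega> in M. norm (XN t \<omega>) \<le> norm (V t \<omega>) + (G + z \<omega>)"
      proof eventually_elim
        case (elim \<omega>)
        show ?case
        proof (cases "\<omega> \<in> E")
          case True
          have h_eq: "h s \<omega> = C * norm (X (max 0 s) \<omega>)" for s using True by (simp add: h_def XN_def)
          have hs[measurable]: "(\<lambda>s. h s \<omega>) \<in> borel_measurable borel"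
            using True measurable_compose[OF measurable_Pair2'[of \<omega> M] hm] sets.sets_into_space[OF \<open>E \<in> sets M\<close>] by auto
          have Xs[measurable]: "(\<lambda>s. X (max 0 s) \<omega>) \<in> borel_measurable borel"
            using True measurable_compose[OF measurable_Pair2'[of \<omega> M] Lp_process_measurable(1)[OF X]]
              sets.sets_into_space[OF \<open>E \<in> sets M\<close>] by auto
          have "(\<integral>\<^sup>+ s\<in>{0..t}. ennreal (h s \<omega>) \<partial>lborel)
            \<le> (\<integral>\<^sup>+ s. ennreal C * (ennreal (norm (X (max 0 s) \<omega>)) * indicator {0..T} s) \<partial>lborel)"
            using t0 C by (intro nn_integral_mono) (auto simp: h_eq indicator_def ennreal_mult)
          also have "\<dots> = ennreal C * (\<integral>\<^sup>+ s\<in>{0..T}. ennreal (norm (X (max 0 s) \<omega>)) \<partial>lborel)"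
            by (rule nn_integral_cmult) measurable
          also have "\<dots> < \<infinity>" using elim(2) by (simp add: ennreal_mult_less_top)
          finally have z: "ennreal (z \<omega>) = (\<integral>\<^sup>+ s\<in>{0..t}. ennreal (h s \<omega>) \<partial>lborel)"
            by (simp add: z_def)
          have "ennreal (norm (drift_conv (drift X \<omega>) t)) \<le> (\<integral>\<^sup>+ s\<in>{0..t}. ennreal (norm (drift X \<omega> s)) \<partial>lborel)"
            using t0 by (intro norm_drift_conv_le set_integrable_Icc_subset[OF elim(1)])
          also have "\<dots> \<le> (\<integral>\<^sup>+ s. ennreal (a s + b s) + ennreal (h s \<omega>) * indicator {0..t} s \<partial>lborel)"
          proof (intro nn_integral_mono)
            fix s :: real
            show "ennreal (norm (drift X \<omega> s)) * indicator {0..t} s \<le> ennreal (a s + b s) + ennreal (h s \<omega>) * indicator {0..t} s"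
            proof (cases "s \<in> {0..t}")
              case True
              then have "norm (drift X \<omega> s) \<le> (a s + b s) + h s \<omega>"
                using drift_le[of s \<omega>] t0 by (simp add: h_eq)
              then have "ennreal (norm (drift X \<omega> s)) \<le> ennreal ((a s + b s) + h s \<omega>)" by (rule ennreal_leI)
              also have "\<dots> = ennreal (a s + b s) + ennreal (h s \<omega>)"
                using ab0[of s] C by (intro ennreal_plus) (auto simp: h_def)
              finally show ?thesis using True by simp
            qed simp
          qed
          also have "\<dots> = ennreal G + ennreal (z \<omega>)"
            unfolding G z by (rule nn_integral_add) measurable
          also have "\<dots> = ennreal (G + z \<omega>)" using G0 z0 by (simp add: ennreal_plus)
          finally have "norm (drift_conv (drift X \<omega>) t) \<le> G + z \<omega>"
            using G0 z0[of \<omega>] by (subst (asm) ennreal_le_iff) auto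
          then show ?thesis
            using True t0 elim(3) norm_triangle_ineq[of "V t \<omega>" "drift_conv (drift X \<omega>) t"] by (simp add: XN_def)
        next
          case False
          then show ?thesis using G0 z0[of \<omega>] by (simp add: XN_def)
        qed
      qed
      have "(\<integral>\<^sup>+ \<omega>. ennreal ((G + z \<omega>) powr m) \<partial>M)
        \<le> (\<integral>\<^sup>+ \<omega>. ennreal (2 powr m) * (ennreal (G powr m) + ennreal (z \<omega> powr m)) \<partial>M)"
      proof (intro nn_integral_mono)
        fix \<omega>
        have "(G + z \<omega>) powr m \<le> 2 powr m * (G powr m + z \<omega> powr m)"
          using G0 z0 m1 by (intro powr_sum_le) auto
        then show "ennreal ((G + z \<omega>) powr m) \<le> ennreal (2 powr m) * (ennreal (G powr m) + ennreal (z \<omega> powr m))"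
          by (simp add: ennreal_leI flip: ennreal_mult ennreal_plus)
      qed
      also have "\<dots> = ennreal (2 powr m) * (ennreal (G powr m) + (\<integral>\<^sup>+ \<omega>. ennreal (z \<omega> powr m) \<partial>M))"
        by (subst nn_integral_cmult) (auto simp: nn_integral_add emeasure_space_1)
      also have "(\<integral>\<^sup>+ \<omega>. ennreal (z \<omega> powr m) \<partial>M)
        \<le> ennreal (t powr (m - 1)) * (\<integral>\<^sup>+ s\<in>{0..t}. (\<integral>\<^sup>+ \<omega>. ennreal (h s \<omega> powr m) \<partial>M) \<partial>lborel)"
      proof (rule integrated_Jensen[OF hm])
        show "AE \<omega> in M. ennreal (z \<omega>) \<le> (\<integral>\<^sup>+ s\<in>{0..t}. ennreal (h s \<omega>) \<partial>lborel)"
          unfolding z_def by (rule AE_I2) (simp add: ennreal_enn2real_if)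
      qed (use C t0 m1 z0 in \<open>auto simp: h_def\<close>)
      also have "(\<integral>\<^sup>+ s\<in>{0..t}. (\<integral>\<^sup>+ \<omega>. ennreal (h s \<omega> powr m) \<partial>M) \<partial>lborel)
        = (\<integral>\<^sup>+ s. ennreal (C powr m) * (\<phi> s * indicator {0..t} s) \<partial>lborel)"
      proof (intro nn_integral_cong)
        fix s :: real
        have [measurable]: "XN s \<in> borel_measurable M" using XNm by measurable
        have "(\<integral>\<^sup>+ \<omega>. ennreal (h s \<omega> powr m) \<partial>M) = (\<integral>\<^sup>+ \<omega>. ennreal (C powr m) * ennreal (norm (XN s \<omega>) powr m) \<partial>M)"
          using C by (intro nn_integral_cong) (simp add: h_def powr_mult ennreal_mult)
        also have "\<dots> = ennreal (C powr m) * \<phi> s"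
          unfolding \<phi>_def moment_def by (rule nn_integral_cmult) measurable
        finally show "(\<integral>\<^sup>+ \<omega>. ennreal (h s \<omega> powr m) \<partial>M) * indicator {0..t} s = ennreal (C powr m) * (\<phi> s * indicator {0..t} s)"
          by (simp add: mult.assoc)
      qed
      also have "\<dots> = ennreal (C powr m) * (\<integral>\<^sup>+ s\<in>{0..t}. \<phi> s \<partial>lborel)"
        by (rule nn_integral_cmult) measurable
      also have "ennreal (t powr (m - 1)) * (ennreal (C powr m) * (\<integral>\<^sup>+ s\<in>{0..t}. \<phi> s \<partial>lborel))
        \<le> ennreal (T powr (m - 1)) * (ennreal (C powr m) * (\<integral>\<^sup>+ s\<in>{0..t}. \<phi> s \<partial>lborel))"
        using t0 m1 by (intro mult_right_mono ennreal_leI powr_mono2) auto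
      finally have Gz: "(\<integral>\<^sup>+ \<omega>. ennreal ((G + z \<omega>) powr m) \<partial>M) \<le> ennreal (2 powr m) * (ennreal (G powr m) +
        ennreal (T powr (m - 1)) * (ennreal (C powr m) * (\<integral>\<^sup>+ s\<in>{0..t}. \<phi> s \<partial>lborel)))"
        by (simp add: mult_left_mono add_left_mono)
      have "\<phi> t \<le> ennreal (2 powr m) * (moment m (V t) + (\<integral>\<^sup>+ \<omega>. ennreal ((G + z \<omega>) powr m) \<partial>M))"
        unfolding \<phi>_def using Lp_process_measurable(3)[OF V t0(1)] G0 z0 m1 le
        by (intro moment_le_add) auto
      also have "\<dots> \<le> ennreal (2 powr m) * (ennreal NV + ennreal (2 powr m) * (ennreal (G powr m) +
        ennreal (T powr (m - 1)) * (ennreal (C powr m) * (\<integral>\<^sup>+ s\<in>{0..t}. \<phi> s \<partial>lborel))))"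
        using NV t Gz by (intro mult_left_mono add_mono) auto
      also have "\<dots> = ennreal A + ennreal K * (\<integral>\<^sup>+ s\<in>{0..t}. \<phi> s \<partial>lborel)"
        using NV(1) by (simp add: A_def K_def ennreal_mult ennreal_plus distrib_left mult.assoc add.assoc)
      finally show ?thesis .
    qed
    have "\<phi> t \<le> ennreal (2 * A * exp (2 * K * t))"
      using \<phi>_bounded \<phi>_le t NV
      by (intro bounded_Gronwall[where N="2 powr m * (NV + real N powr m)" and T=T] A0 K0) auto
    also have "\<dots> \<le> ennreal (2 * A * exp (2 * K * T))"
      using t A0 K0 by (intro ennreal_leI mult_left_mono) (auto intro: mult_left_mono)
    finally show ?thesis using t by (simp add: \<phi>_def XN_def[abs_def] E_def)
  qed
  show ?thesis
  proof (intro exI[of _ "2 * A * exp (2 * K * T)"] conjI ballI)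
    fix t assume t: "t \<in> {0..T}"
    then have t0: "0 \<le> t" by simp
    note [measurable] = Lp_process_measurable(3)[OF X t0]
    \<comment> \<open>Almost every path lies in the events from some level on, because
      \<open>r\<close> is almost surely finite. Fatou's lemma then removes the truncation, as the
      bound is the same for all levels.\<close>
    have "moment m (X t) = (\<integral>\<^sup>+ \<omega>. liminf (\<lambda>N. ennreal (norm (indicator {\<omega> \<in> space M. r \<omega> \<le> ennreal (real N)} \<omega> *\<^sub>R X t \<omega>) powr m)) \<partial>M)"
      unfolding moment_def
    proof (rule nn_integral_cong_AE)
      have "AE \<omega> in M. \<omega> \<in> space M" by (rule AE_space)
      with r_fin show "AE \<omega> in M. ennreal (norm (X t \<omega>) powr m)
        = liminf (\<lambda>N. ennreal (norm (indicator {\<omega> \<in> space M. r \<omega> \<le> ennreal (real N)} \<omega> *\<^sub>R X t \<omega>) powr m))"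
      proof eventually_elim
        case (elim \<omega>)
        obtain n0 :: nat where n0: "r \<omega> \<le> ennreal (real n0)"
        proof (cases "r \<omega>")
          case (real x)
          obtain n0 where "x \<le> real n0" using real_arch_simple by blast
          then show ?thesis using that[of n0] real by (simp add: ennreal_leI)
        qed (use elim in simp)
        have "eventually (\<lambda>N. ennreal (norm (indicator {\<omega> \<in> space M. r \<omega> \<le> ennreal (real N)} \<omega> *\<^sub>R X t \<omega>) powr m)
          = ennreal (norm (X t \<omega>) powr m)) sequentially"
          using eventually_ge_at_top[of n0]
        proof eventually_elim
          case (elim N)
          then have "ennreal (real n0) \<le> ennreal (real N)" by (intro ennreal_leI) simp
          then have "r \<omega> \<le> ennreal (real N)" using n0 by (rule order_trans[rotated])
          then show ?case using \<open>\<omega> \<in> space M\<close> by simp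
        qed
        then have "(\<lambda>N. ennreal (norm (indicator {\<omega> \<in> space M. r \<omega> \<le> ennreal (real N)} \<omega> *\<^sub>R X t \<omega>) powr m))
          \<longlonglongrightarrow> ennreal (norm (X t \<omega>) powr m)" by (rule tendsto_eventually)
        then show ?case by (intro lim_imp_Liminf[symmetric]) auto
      qed
    qed
    also have "\<dots> \<le> liminf (\<lambda>N. moment m (\<lambda>\<omega>. indicator {\<omega> \<in> space M. r \<omega> \<le> ennreal (real N)} \<omega> *\<^sub>R X t \<omega>))"
      unfolding moment_def by (intro nn_integral_liminf) measurable
    also have "\<dots> \<le> liminf (\<lambda>N. ennreal (2 * A * exp (2 * K * T)))"
      by (intro Liminf_mono always_eventually allI trunc t)
    also have "\<dots> = ennreal (2 * A * exp (2 * K * T))" by (simp add: Liminf_const)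
    finally show "moment m (X t) \<le> ennreal (2 * A * exp (2 * K * T))" .
  qed (use A0 in simp)
qed

text \<open>In the difference of two solutions V cancels, so Gronwall's inequality applies with
  \<open>A = 0\<close>. The a priori moments of both solutions give the bound it
  presupposes.\<close>

lemma solution_unique:
  assumes X: "Lp_process X" "solves_step V X X" "\<And>t. 0 \<le> t \<Longrightarrow> AE \<omega> in M. set_integrable lborel {0..t} (drift X \<omega>)"
    and Y: "Lp_process Y" "solves_step V Y Y" "\<And>t. 0 \<le> t \<Longrightarrow> AE \<omega> in M. set_integrable lborel {0..t} (drift Y \<omega>)"
    and V: "good_process V" and t: "0 \<le> t"
  shows "AE \<omega> in M. Y t \<omega> = X t \<omega>"
proof -
  define T where "T = t + 1"
  have T: "0 < T" "t \<le> T" using t by (auto simp: T_def)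
  obtain N where N: "0 \<le> N" "\<forall>t\<in>{0..T}. moment p (V t) \<le> ennreal N" using good_processD(3)[OF V] by blast
  note VL = good_processD(1)[OF V]
  obtain KX where KX: "0 \<le> KX" "\<forall>t\<in>{0..T}. moment p (X t) \<le> ennreal KX"
    using a_priori_moment[OF X(1) VL X(2) T(1) order_refl X(3) N] by blast
  obtain KY where KY: "0 \<le> KY" "\<forall>t\<in>{0..T}. moment p (Y t) \<le> ennreal KY"
    using a_priori_moment[OF Y(1) VL Y(2) T(1) order_refl Y(3) N] by blast
  define w where "w s = moment p (\<lambda>\<omega>. Y (max 0 s) \<omega> - X (max 0 s) \<omega>)" for s
  have "w t \<le> ennreal (2 * 0 * exp (2 * step_const T * t))"
  proof (rule bounded_Gronwall[where N="2 powr p * (KY + KX)" and T=T])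
    show "w \<in> borel_measurable borel" unfolding w_def by (rule measurable_moment_diff[OF Y(1) X(1)])
    show "0 \<le> step_const T" by (rule step_const_nonneg)
    fix s assume s: "0 \<le> s" "s \<le> T"
    have "moment p (\<lambda>\<omega>. Y s \<omega> - X s \<omega>) \<le> ennreal (2 powr p) * (moment p (Y s) + moment p (X s))"
      using moment_add[of "Y s" "\<lambda>\<omega>. - X s \<omega>" p] Lp_process_measurable(3)[OF X(1) s(1)]
        Lp_process_measurable(3)[OF Y(1) s(1)] p by (simp add: moment_def)
    also have "\<dots> \<le> ennreal (2 powr p) * (ennreal KY + ennreal KX)"
      using KX KY s by (intro mult_left_mono add_mono) auto
    also have "\<dots> = ennreal (2 powr p * (KY + KX))" using KX KY by (intro ennreal_mult_add) auto
    finally show "w s \<le> ennreal (2 powr p * (KY + KX))" using s by (simp add: w_def)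
    have "w s = moment p (\<lambda>\<omega>. Y s \<omega> - X s \<omega>)" using s by (simp add: w_def)
    also have "\<dots> \<le> ennreal (step_const T) * (\<integral>\<^sup>+ u\<in>{0..s}. moment p (\<lambda>\<omega>. Y u \<omega> - X u \<omega>) \<partial>lborel)"
      by (rule solves_step_diff_moment[OF Y(1) X(1) Y(2) X(2) Y(3) X(3) s])
    also have "(\<integral>\<^sup>+ u\<in>{0..s}. moment p (\<lambda>\<omega>. Y u \<omega> - X u \<omega>) \<partial>lborel) = (\<integral>\<^sup>+ u\<in>{0..s}. w u \<partial>lborel)"
      by (intro nn_integral_cong) (auto simp: indicator_def w_def)
    finally show "w s \<le> ennreal 0 + ennreal (step_const T) * (\<integral>\<^sup>+ u\<in>{0..s}. w u \<partial>lborel)" by simp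
  qed (use KX KY t T in auto)
  then have "moment p (\<lambda>\<omega>. Y t \<omega> - X t \<omega>) = 0" using t by (simp add: w_def)
  then show ?thesis
    using Lp_process_measurable(3)[OF X(1) t] Lp_process_measurable(3)[OF Y(1) t]
    by (subst (asm) moment_0_iff) auto
qed

section \<open>Moment estimate with constants independent of the solution\<close>

text \<open>The outer \<open>2 powr m\<close> splits off V, \<open>T powr (m - 1)\<close> is
  Jensen's inequality in time, and the remaining factor is the coefficient of the moment in
  \<open>drift_bound_moment\<close>.\<close>

definition growth_rate :: "real \<Rightarrow> real \<Rightarrow> real" where
  "growth_rate m T = 2 powr m * (T powr (m - 1) * (2 powr m * (2 * (2 * C) powr m)))"

definition growth_const :: "real \<Rightarrow> real \<Rightarrow> real" where
  "growth_const m T = T powr (m - 1) * (2 powr m * drift_0 powr m * T)"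

text \<open>The constant of \<open>a_priori_moment\<close> depends on the path that was picked and
  so on the solution; from it only finiteness is taken. A second application of Gronwall's
  inequality, now to the linear growth bound with the law included, gives constants that involve the
  solution through \<open>NV\<close> alone.\<close>

lemma solution_moment:
  assumes X: "Lp_process X" "solves_step V X X" and int: "\<And>t. 0 \<le> t \<Longrightarrow> AE \<omega> in M. set_integrable lborel {0..t} (drift X \<omega>)"
    and V: "Lp_process V" and T: "0 < T" and m: "p \<le> m"
    and NV: "0 \<le> NV" "\<forall>t\<in>{0..T}. moment m (V t) \<le> ennreal NV" and t: "t \<in> {0..T}"
  shows "moment m (X t) \<le> ennreal (2 * (2 powr m * (NV + growth_const m T)) * exp (2 * growth_rate m T * T))"
proof -
  have m1: "1 \<le> m" "0 \<le> m" using m p by auto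
  obtain KX where KX: "0 \<le> KX" "\<forall>t\<in>{0..T}. moment m (X t) \<le> ennreal KX"
    using a_priori_moment[OF X(1) V X(2) T m int NV] by blast
  define A where "A = 2 powr m * (NV + growth_const m T)"
  define K where "K = growth_rate m T"
  have A: "0 \<le> A" and K: "0 \<le> K" using NV(1) T by (auto simp: A_def K_def growth_const_def growth_rate_def)
  have "moment m (X (max 0 t)) \<le> ennreal (2 * A * exp (2 * K * t))"
  proof (rule bounded_Gronwall[where N=KX and T=T])
    show "(\<lambda>t. moment m (X (max 0 t))) \<in> borel_measurable borel" by (rule measurable_moment[OF X(1)])
    fix s assume s: "0 \<le> s" "s \<le> T"
    show "moment m (X (max 0 s)) \<le> ennreal KX" using KX s by simp
    note [measurable] = Lp_process_measurable(3)[OF X(1) s(1)] Lp_process_measurable(3)[OF V s(1)]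
    have AE: "AE \<omega> in M. X s \<omega> = V s \<omega> + drift_conv (drift X \<omega>) s"
      using X(2) s by (simp add: solves_step_def)
    have "AE \<omega> in M. X s \<omega> - V s \<omega> = drift_conv (drift X \<omega>) s" using AE by eventually_elim simp
    then have "moment m (\<lambda>\<omega>. X s \<omega> - V s \<omega>) = moment m (\<lambda>\<omega>. drift_conv (drift X \<omega>) s)"
      by (rule moment_cong_AE)
    also have "\<dots> \<le> ennreal (s powr (m - 1)) * (ennreal (2 powr m * drift_0 powr m * s)
      + ennreal (2 powr m * (2 * (2 * C) powr m)) * (\<integral>\<^sup>+ u\<in>{0..s}. moment m (X u) \<partial>lborel))"
      unfolding moment_def
    proof (rule integrated_drift_bound_moment[OF X(1) s(1) m, unfolded moment_def])
      show "AE \<omega> in M. ennreal (norm (drift_conv (drift X \<omega>) s)) \<le> (\<integral>\<^sup>+ u\<in>{0..s}. ennreal (drift_bound X u \<omega>) \<partial>lborel)"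
        using int[OF s(1)] by eventually_elim (rule norm_drift_conv_le_bound[OF X(1)])
    qed auto
    also have "\<dots> \<le> ennreal (T powr (m - 1)) * (ennreal (2 powr m * drift_0 powr m * T)
      + ennreal (2 powr m * (2 * (2 * C) powr m)) * (\<integral>\<^sup>+ u\<in>{0..s}. moment m (X u) \<partial>lborel))"
      using s m1 by (intro mult_mono add_mono ennreal_leI powr_mono2 mult_left_mono) auto
    finally have D: "moment m (\<lambda>\<omega>. X s \<omega> - V s \<omega>) \<le> ennreal (T powr (m - 1)) * (ennreal (2 powr m * drift_0 powr m * T)
      + ennreal (2 powr m * (2 * (2 * C) powr m)) * (\<integral>\<^sup>+ u\<in>{0..s}. moment m (X u) \<partial>lborel))" .
    have "moment m (X s) \<le> ennreal (2 powr m) * (moment m (V s) + moment m (\<lambda>\<omega>. X s \<omega> - V s \<omega>))"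
      using moment_add[of "V s" "\<lambda>\<omega>. X s \<omega> - V s \<omega>" m] m1 by simp
    also have "\<dots> \<le> ennreal (2 powr m) * (ennreal NV + ennreal (T powr (m - 1)) * (ennreal (2 powr m * drift_0 powr m * T)
      + ennreal (2 powr m * (2 * (2 * C) powr m)) * (\<integral>\<^sup>+ u\<in>{0..s}. moment m (X u) \<partial>lborel)))"
      using NV s D by (intro mult_left_mono add_mono) auto
    also have "\<dots> = ennreal A + ennreal K * (\<integral>\<^sup>+ u\<in>{0..s}. moment m (X u) \<partial>lborel)"
      using NV(1) T by (simp add: A_def K_def growth_const_def growth_rate_def ennreal_mult ennreal_plus distrib_left mult.assoc add.assoc)
    also have "(\<integral>\<^sup>+ u\<in>{0..s}. moment m (X u) \<partial>lborel) = (\<integral>\<^sup>+ u\<in>{0..s}. moment m (X (max 0 u)) \<partial>lborel)"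
      by (intro nn_integral_cong) (auto simp: indicator_def)
    finally show "moment m (X (max 0 s)) \<le> ennreal A + ennreal K * (\<integral>\<^sup>+ u\<in>{0..s}. moment m (X (max 0 u)) \<partial>lborel)"
      using s by simp
  qed (use A K KX t in auto)
  also have "\<dots> \<le> ennreal (2 * A * exp (2 * K * T))"
    using t A K by (intro ennreal_leI mult_left_mono) (auto intro: mult_left_mono)
  finally show ?thesis using t by (simp add: A_def K_def)
qed

lemma moment_finite_iff_integrable:
  assumes [measurable]: "X \<in> borel_measurable M"
  shows "moment m X < \<infinity> \<longleftrightarrow> integrable M (\<lambda>\<omega>. norm (X \<omega>) powr m)"
  unfolding moment_def integrable_iff_bounded by simp

lemma moment_eq_integral:
  assumes "integrable M (\<lambda>\<omega>. norm (X \<omega>) powr m)"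
  shows "moment m X = ennreal (\<integral>\<omega>. norm (X \<omega>) powr m \<partial>M)"
  unfolding moment_def using assms by (intro nn_integral_eq_integral) auto

theorem mild_solution_exists_unique:
  assumes \<xi>: "\<xi> \<in> borel_measurable (F 0)" and int: "integrable M (\<lambda>\<omega>. norm (\<xi> \<omega>) powr p)"
  shows "\<exists>X. mild_solution M F e lam bet L S p B \<xi> X \<and> drift_locally_integrable M B X \<and>
    (\<forall>Y. mild_solution M F e lam bet L S p B \<xi> Y \<and> drift_locally_integrable M B Y \<longrightarrow>
      (\<forall>t\<ge>0. AE \<omega> in M. Y t \<omega> = X t \<omega>))"
proof -
  have "moment p \<xi> < \<infinity>" using moment_eq_integral[OF int] by simp
  then obtain V where V: "mild_noise \<xi> V" using mild_noise_exists[OF \<xi>] by blast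
  then have Vg: "good_process V" by (simp add: mild_noise_def)
  obtain X where X: "good_process X" "solves_step V X X" using fixed_point_exists[OF Vg] by blast
  note XL = good_processD(1)[OF X(1)]
  have drift_eq: "(\<lambda>s. B (X s \<omega>) (law M (X s))) = drift X \<omega>" for \<omega>
    by (simp add: drift_def fun_eq_iff)
  have Xint: "AE \<omega> in M. set_integrable lborel {0..t} (drift X \<omega>)" if "0 \<le> t" for t
    using good_drift_integrable[OF X(1) that] .
  have loc: "drift_locally_integrable M B X"
    unfolding drift_locally_integrable_def drift_eq using Xint by simp
  have pred: "predictable_process M F X" using XL by (simp add: Lp_process_def)
  have "mild_solution M F e lam bet L S p B \<xi> X"
    unfolding mild_solution_def
  proof (intro conjI allI impI)
    show "predictable_process M F X" by (rule pred)
    show "adapted_process F X" by (rule predictable_imp_adapted[OF filtration pred])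
    fix t :: real assume t: "0 \<le> t"
    show "law M (X t) \<in> moment_probs p"
      using law_moment_probs_iff[OF Lp_process_measurable(3)[OF XL t]] Lp_process_measurable(4)[OF XL t] by simp
    show "AE \<omega> in M. set_integrable lborel {0..t} (\<lambda>s. S (t - s) (B (X s \<omega>) (law M (X s))))"
      using Xint[OF t]
    proof eventually_elim
      case (elim \<omega>)
      from set_integrable_S[OF elim] show ?case by (simp add: drift_def)
    qed
    obtain Z where Z: "is_stochastic_convolution M e lam bet L t Z" "AE \<omega> in M. V t \<omega> = S t (\<xi> \<omega>) + Z \<omega>"
      using V t by (auto simp: mild_noise_def)
    have "AE \<omega> in M. X t \<omega> = V t \<omega> + drift_conv (drift X \<omega>) t"
      using X(2) t by (simp add: solves_step_def)
    with Z(2) have "AE \<omega> in M. X t \<omega> = S t (\<xi> \<omega>) + (LINT s:{0..t}|lborel. S (t - s) (B (X s \<omega>) (law M (X s)))) + Z \<omega>"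
      by eventually_elim (simp add: drift_conv_def drift_def algebra_simps)
    with Z(1) show "\<exists>Z. is_stochastic_convolution M e lam bet L t Z \<and>
      (AE \<omega> in M. X t \<omega> = S t (\<xi> \<omega>) + (LINT s:{0..t}|lborel. S (t - s) (B (X s \<omega>) (law M (X s)))) + Z \<omega>)"
      by blast
  qed
  moreover have "AE \<omega> in M. Y t \<omega> = X t \<omega>"
    if Y: "mild_solution M F e lam bet L S p B \<xi> Y" "drift_locally_integrable M B Y" and t: "0 \<le> t" for Y t
    using mild_solution_solves_step[OF Y V] by (intro solution_unique[OF XL X(2) Xint _ _ _ Vg t])
  ultimately show ?thesis using loc by blast
qed

text \<open>\<open>K\<close> must be fixed before \<open>\<xi>\<close> and \<open>X\<close>. The
  bound on the moments of V is affine in the moment \<open>x\<close> of the initial value, hence so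
  is the bound \<open>a + b * x\<close> for the solution, with coefficients determined by the
  equation, \<open>m\<close> and \<open>T\<close>.\<close>

theorem mild_solution_moment_estimate:
  assumes m: "p \<le> m" "m < \<alpha>" and T: "0 < T"
  shows "\<exists>K>0. \<forall>\<xi> X. \<xi> \<in> borel_measurable (F 0) \<and> integrable M (\<lambda>\<omega>. norm (\<xi> \<omega>) powr m) \<and>
    mild_solution M F e lam bet L S p B \<xi> X \<and> drift_locally_integrable M B X \<longrightarrow>
    (\<forall>t\<in>{0..T}. integrable M (\<lambda>\<omega>. norm (X t \<omega>) powr m) \<and>
      (\<integral>\<omega>. norm (X t \<omega>) powr m \<partial>M) powr (1 / m) \<le> K * (1 + (\<integral>\<omega>. norm (\<xi> \<omega>) powr m \<partial>M) powr (1 / m)))"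
proof -
  have m1: "1 \<le> m" using m p by simp
  define E where "E = 2 * 2 powr m * exp (2 * growth_rate m T * T)"
  define a where "a = E * (2 powr m * convolution_bound m + growth_const m T)"
  define b where "b = E * 2 powr m"
  have g0: "0 \<le> growth_const m T" using T by (simp add: growth_const_def)
  have cb: "0 \<le> convolution_bound m" by (rule convolution_bound_nonneg[OF m])
  have ab: "0 \<le> a" "0 \<le> b" using g0 cb by (auto simp: a_def b_def E_def)
  \<comment> \<open>The root of \<open>a + b * x\<close> is split by \<open>powr_sum_le\<close> with
    exponent \<open>1 / m\<close>; the summand 1 makes \<open>K\<close> positive.\<close>
  define K where "K = 2 powr (1 / m) * (a powr (1 / m) + b powr (1 / m)) + 1"
  show ?thesis
  proof (intro exI[of _ K] conjI allI impI ballI)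
    show "0 < K" by (simp add: K_def add_nonneg_pos)
    fix \<xi> X t
    assume H: "\<xi> \<in> borel_measurable (F 0) \<and> integrable M (\<lambda>\<omega>. norm (\<xi> \<omega>) powr m) \<and>
      mild_solution M F e lam bet L S p B \<xi> X \<and> drift_locally_integrable M B X" and t: "t \<in> {0..T}"
    then have \<xi>: "\<xi> \<in> borel_measurable (F 0)" and int: "integrable M (\<lambda>\<omega>. norm (\<xi> \<omega>) powr m)" by auto
    have \<xi>M: "\<xi> \<in> borel_measurable M" using filtration_measurable[OF filtration _ \<xi>] by simp
    define x where "x = (\<integral>\<omega>. norm (\<xi> \<omega>) powr m \<partial>M)"
    have x0: "0 \<le> x" by (simp add: x_def)
    have mx: "moment m \<xi> = ennreal x" unfolding x_def by (rule moment_eq_integral[OF int])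
    have "moment p \<xi> < \<infinity>" using moment_finite_mono[OF m(1) _ \<xi>M] mx by simp
    then obtain V where V: "mild_noise \<xi> V" using mild_noise_exists[OF \<xi>] by blast
    then have VL: "Lp_process V" by (simp add: mild_noise_def good_process_def)
    define NV where "NV = 2 powr m * (x + convolution_bound m)"
    have NV: "0 \<le> NV" "\<forall>t\<in>{0..T}. moment m (V t) \<le> ennreal NV"
    proof -
      show "0 \<le> NV" using x0 cb by (simp add: NV_def)
      show "\<forall>t\<in>{0..T}. moment m (V t) \<le> ennreal NV"
      proof
        fix t assume "t \<in> {0..T}"
        then have "moment m (V t) \<le> ennreal (2 powr m) * (ennreal x + ennreal (convolution_bound m))"
          using mild_noise_moment[OF V \<xi> _ m] by (simp add: mx)
        also have "\<dots> = ennreal NV" unfolding NV_def using x0 cb by (intro ennreal_mult_add) auto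
        finally show "moment m (V t) \<le> ennreal NV" .
      qed
    qed
    have sol: "Lp_process X" "solves_step V X X" "\<And>t. 0 \<le> t \<Longrightarrow> AE \<omega> in M. set_integrable lborel {0..t} (drift X \<omega>)"
      using mild_solution_solves_step[OF _ _ V] H by auto
    have "moment m (X t) \<le> ennreal (2 * (2 powr m * (NV + growth_const m T)) * exp (2 * growth_rate m T * T))"
      by (rule solution_moment[OF sol VL T m(1) NV t])
    also have "2 * (2 powr m * (NV + growth_const m T)) * exp (2 * growth_rate m T * T) = a + b * x"
      by (simp add: a_def b_def E_def NV_def algebra_simps)
    finally have le: "moment m (X t) \<le> ennreal (a + b * x)" .
    have t0: "0 \<le> t" using t by simp
    have "moment m (X t) < \<infinity>" using le by (rule le_less_trans) simp
    then show intX: "integrable M (\<lambda>\<omega>. norm (X t \<omega>) powr m)"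
      using moment_finite_iff_integrable[OF Lp_process_measurable(3)[OF sol(1) t0]] by simp
    have "(\<integral>\<omega>. norm (X t \<omega>) powr m \<partial>M) \<le> a + b * x"
      using le[unfolded moment_eq_integral[OF intX]] ab x0 by (subst (asm) ennreal_le_iff) auto
    then have "(\<integral>\<omega>. norm (X t \<omega>) powr m \<partial>M) powr (1 / m) \<le> (a + b * x) powr (1 / m)"
      using m1 by (intro powr_mono2) auto
    also have "\<dots> \<le> 2 powr (1 / m) * (a powr (1 / m) + (b * x) powr (1 / m))"
      using ab x0 m1 by (intro powr_sum_le) auto
    also have "\<dots> = 2 powr (1 / m) * (a powr (1 / m) + b powr (1 / m) * x powr (1 / m))"
      using ab x0 by (simp add: powr_mult)
    also have "\<dots> \<le> K * (1 + x powr (1 / m))"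
    proof -
      define u v w where "u = 2 powr (1 / m) * a powr (1 / m)" and "v = 2 powr (1 / m) * b powr (1 / m)" and "w = x powr (1 / m)"
      have "0 \<le> u" "0 \<le> v" "0 \<le> w" by (auto simp: u_def v_def w_def)
      then have "u + v * w \<le> (u + v + 1) * (1 + w)"
        by (simp add: algebra_simps)
      then show ?thesis by (simp add: K_def u_def v_def w_def algebra_simps)
    qed
    finally show "(\<integral>\<omega>. norm (X t \<omega>) powr m \<partial>M) powr (1 / m) \<le> K * (1 + (\<integral>\<omega>. norm (\<xi> \<omega>) powr m \<partial>M) powr (1 / m))"
      by (simp add: x_def)
  qed
qed

end

section \<open>From the generator to the diagonal contraction semigroup\<close>

theorem theorem2p2:
  fixes M :: "'w measure"
    and F :: "real \<Rightarrow> 'w measure"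
    and e :: "nat \<Rightarrow> 'h::{real_inner,banach,second_countable_topology}"
    and lam bet :: "nat \<Rightarrow> real"
    and L :: "nat \<Rightarrow> real \<Rightarrow> 'w \<Rightarrow> real"
    and D :: "'h set"
    and A :: "'h \<Rightarrow> 'h"
    and S :: "real \<Rightarrow> 'h \<Rightarrow> 'h"
    and B :: "'h \<Rightarrow> 'h measure \<Rightarrow> 'h"
    and \<alpha> p C :: real
  assumes "prob_space M"
    and "time_filtration M F"
    and "complete_orthonormal_basis e"
    and "1 < \<alpha>" and "\<alpha> < 2"
    and "\<And>k. 0 < bet k"
    and "\<And>k. symmetric_stable_process M \<alpha> (L k)"
    and "\<And>k. adapted_process F (L k)"
    and "independent_processes M L"
    and "self_adjoint_operator D A"
    and "\<And>k. e k \<in> D"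
    and "\<And>k. A (e k) = - lam k *\<^sub>R e k"
    and "\<And>k. 0 < lam k" and "incseq lam" and "filterlim lam at_top sequentially"
    and "generates_C0_semigroup D A S"
    and "1 \<le> p" and "p < \<alpha>" and "0 < C"
    and "\<And>x y \<mu> \<nu>. \<mu> \<in> moment_probs p \<Longrightarrow> \<nu> \<in> moment_probs p \<Longrightarrow>
           norm (B x \<mu> - B y \<nu>) \<le> C * (norm (x - y) + wasserstein p \<mu> \<nu>)"
    and "summable (\<lambda>k. bet k powr \<alpha> / lam k)"
  shows "(\<forall>\<xi>. \<xi> \<in> borel_measurable (F 0) \<and> integrable M (\<lambda>\<omega>. norm (\<xi> \<omega>) powr p) \<longrightarrow>
            (\<exists>X. mild_solution M F e lam bet L S p B \<xi> X \<and> drift_locally_integrable M B X \<and>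
               (\<forall>Y. mild_solution M F e lam bet L S p B \<xi> Y \<and> drift_locally_integrable M B Y \<longrightarrow>
                  (\<forall>t\<ge>0. AE \<omega> in M. Y t \<omega> = X t \<omega>)))) \<and>
         (\<forall>m T. p \<le> m \<and> m < \<alpha> \<and> 0 < T \<longrightarrow>
            (\<exists>K>0. \<forall>\<xi> X.
               \<xi> \<in> borel_measurable (F 0) \<and> integrable M (\<lambda>\<omega>. norm (\<xi> \<omega>) powr m) \<and>
               mild_solution M F e lam bet L S p B \<xi> X \<and> drift_locally_integrable M B X \<longrightarrow>
               (\<forall>t\<in>{0..T}. integrable M (\<lambda>\<omega>. norm (X t \<omega>) powr m) \<and>
                  (\<integral>\<omega>. norm (X t \<omega>) powr m \<partial>M) powr (1 / m)
                    \<le> K * (1 + (\<integral>\<omega>. norm (\<xi> \<omega>) powr m \<partial>M) powr (1 / m)))))"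
proof -
  interpret prob_space M by fact
  have ortho: "orthonormal e"
    using assms(3) by (simp add: complete_orthonormal_basis_def orthonormal_def)
  have C0: "C0_semigroup S"
    using assms(16) by (simp add: generates_C0_semigroup_def)
  have lam: "0 \<le> lam k" for k using assms(13)[of k] by simp
  \<comment> \<open>The generator at \<open>e k\<close> is the right derivative of the orbit at 0;
    the eigenvector lemma integrates it to an exponential. Contractivity follows from the
    eigenvalues.\<close>
  have eig: "S t (e k) = exp (- lam k * t) *\<^sub>R e k" if "0 \<le> t" for t k
  proof (rule C0_semigroup_eigenvector[OF C0 that lam])
    show "((\<lambda>h. (1 / h) *\<^sub>R (S h (e k) - e k)) \<longlongrightarrow> - lam k *\<^sub>R e k) (at_right 0)"
      using assms(11)[of k] assms(12)[of k] assms(16) unfolding generates_C0_semigroup_def by blast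
  qed
  interpret mckean_vlasov M F e lam bet L \<alpha> S B p C
  proof unfold_locales
    show "norm (S t x) \<le> norm x" if "0 \<le> t" for t x
      by (rule diagonal_semigroup_contraction[OF C0 assms(3) that lam eig[OF that]])
  qed (use assms ortho C0 in auto)
  show ?thesis
    using mild_solution_exists_unique mild_solution_moment_estimate by blast
qed

end
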